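(* Let $P$ be a non-empty set of prime numbers, $G$ a pro-$P$ group, $\Omega\cong\mathbb Z_P=\prod_{p\in P}\mathbb Z_p$ with a fixed topological generator $\omega$, and $d:G\to\Omega$ a surjective continuous homomorphism. Let $\mathfrak E$ be a $G$-spectrum, put $\mathfrak K=\mathfrak K(\mathfrak E)_{\mathrm{ab}}=(\mathfrak E,\mathrm{Com}^{\mathrm t},\mathbb Z)$, and let $(C,v)$ be a Fesenko--Neukirch datum on $\mathfrak E$. Assume that $\mathfrak K$ is coherent and that $C$ satisfies the class field axiom for all $(H,U)\in\mathfrak E_{\mathrm b}$ with $H/U$ cyclic of prime order $\ell$, for every prime number $\ell$. If $\Upsilon_{(H,U)}$ is injective for all $(H,U)\in\mathfrak E_{\mathrm b}$ with $H/U$ cyclic of prime order and $f_{H|U}=1$, then the Fesenko--Neukirch morphism $\Upsilon:\pi_{\mathfrak K}\to\widehat{\mathrm H}^0_{\mathfrak E}(C)$ is already a $\mathfrak K$-class field theory.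
   Context: Abelian groups are regarded as discrete topological groups; $\mathsf{TAb}$ is the category of topological abelian groups. ${}^gH=gHg^{-1}$, $H^g=g^{-1}Hg$; $\langle h\rangle_{\mathrm c}$ is the closure of $\langle h\rangle$; $\mathrm{Com}^{\mathrm t}(H)$ is the closed commutator subgroup of $H$. RIC-functors. A RIC-domain $\mathfrak D$ consists of a non-empty set $\mathfrak D_{\mathrm b}$ with a left action $(g,x)\mapsto{}^gx$ of a group $G$ and, for each $x\in\mathfrak D_{\mathrm b}$, subsets $\mathfrak D_{\mathrm r}(x),\mathfrak D_{\mathrm i}(x)\subseteq\mathfrak D_{\mathrm b}$ such that for $\star\in\{\mathrm r,\mathrm i\}$: $x\in\mathfrak D_\star(x)$; $y\in\mathfrak D_\star(x)$ implies $\mathfrak D_\star(y)\subseteq\mathfrak D_\star(x)$; ${}^g\mathfrak D_\star(x)=\mathfrak D_\star({}^gx)$. A RIC-functor $\Phi:\mathfrak D\to\mathcal C$ consists of objects $\Phi(x)$ and morphisms $\mathrm{res}_{y,x}:\Phi(x)\to\Phi(y)$ ($y\in\mathfrak D_{\mathrm r}(x)$), $\mathrm{ind}_{x,y}:\Phi(y)\to\Phi(x)$ ($y\in\mathfrak D_{\mathrm i}(x)$), $\mathrm{con}_{g,x}:\Phi(x)\to\Phi({}^gx)$ such that $\mathrm{res}_{x,x}=\mathrm{ind}_{x,x}=\mathrm{con}_{1,x}=\mathrm{id}$; $\mathrm{res}_{z,y}\mathrm{res}_{y,x}=\mathrm{res}_{z,x}$, $\mathrm{ind}_{x,y}\mathrm{ind}_{y,z}=\mathrm{ind}_{x,z}$,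 $\mathrm{con}_{g',{}^gx}\mathrm{con}_{g,x}=\mathrm{con}_{g'g,x}$; $\mathrm{con}_{g,y}\mathrm{res}_{y,x}=\mathrm{res}_{{}^gy,{}^gx}\mathrm{con}_{g,x}$ and $\mathrm{con}_{g,x}\mathrm{ind}_{x,y}=\mathrm{ind}_{{}^gx,{}^gy}\mathrm{con}_{g,y}$. Morphisms are families $(\varphi_x)$ commuting with res, ind, con; the category is $\mathsf{Fct}(\mathfrak D,\mathcal C)$. Subgroup systems and Mackey functors. A $G$-subgroup system is a RIC-domain $\mathfrak S$ where $\mathfrak S_{\mathrm b}$ is a set of subgroups of $G$ with the conjugation action and $I\le H$ for $I\in\mathfrak S_\star(H)$; $\mathfrak S'\le\mathfrak S$ means $\mathfrak S'_{\mathrm b}\subseteq\mathfrak S_{\mathrm b}$, $\mathfrak S'_\star(H)\subseteq\mathfrak S_\star(H)$. It is arithmetic if $\mathfrak S_{\mathrm r}(H)$ and $\mathfrak S_{\mathrm i}(H)$ contain all open subgroups of $H$ for each $H\in\mathfrak S_{\mathrm b}$. It is a $G$-Mackey system if for $I\in\mathfrak S_{\mathrm r}(H)$, $J\in\mathfrak S_{\mathrm i}(H)$ the set $I\backslash H/J$ is finite, $I\cap J\in\mathfrak S_{\mathrm r}(J)$ and $I\cap J\in\mathfrak S_{\mathrm i}(I)$. A cohomological Mackey functor $C:\mathfrak M\to\mathsf{Ab}$ on a Mackey system is a RIC-functor with $\mathrm{con}_{h,H}=\mathrm{id}$ for $h\in H$, $\mathrm{res}_{I,H}\mathrm{ind}_{H,J}=\sum_{h}\mathrm{ind}_{I,I\cap{}^hJ}\,\mathrm{con}_{h,I^h\cap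 J}\,\mathrm{res}_{I^h\cap J,J}$ ($h$ over representatives of $I\backslash H/J$), and $\mathrm{ind}_{H,I}\mathrm{res}_{I,H}=[H:I]\,\mathrm{id}$ for $I\in\mathfrak M_{\mathrm r}(H)\cap\mathfrak M_{\mathrm i}(H)$. Groups $C(H)$ are written multiplicatively. Ramification. For closed subgroups $K\le H$ of $G$: $I_H=H\cap\ker d$, $f_{H|K}=[d(H):d(K)]$, $f_H=f_{G|H}$, $e_{H|K}=[I_H:I_K]$. $H$ is inertially finite if closed with $f_H<\infty$; then $d(H)=f_H\Omega$ and $d_H=\frac1{f_H}d|_H:H\to\Omega$ is surjective with kernel $I_H$. $\mathcal E^{\mathrm{ur}}(H)$ is the set of open normal subgroups $U$ of $H$ with $I_H\le U$; for $U\in\mathcal E^{\mathrm{ur}}(H)$ the Frobenius element $\varphi_{H|U}\in H/U$ is the image of any $h\in H$ with $d_H(h)=\omega$. A $G$-subgroup system is inertially finite if all members are inertially finite closed subgroups and $[H:I]<\infty$ for $I\in\mathfrak S_{\mathrm r}(H)$. Spectra. A two-dimensional $G$-subgroup system is a RIC-domain $\mathfrak E$ with $\mathfrak E_{\mathrm b}$ a set of pairs $(H,U)$ ($H$ closed subgroup of $G$, $U$ closed normal subgroup of $H$) with componentwise conjugation and $I\le H$, $V\le U$ for $(I,V)\in\mathfrak E_\star(H,U)$. $\mathfrak E^\flat_{\mathrm b}$ is the set of first components of $\mathfrak E_{\mathrm b}$, $\mathrm{Ext}(\mathfrak E,H)=\{U:(H,U)\in\mathfrak E_{\mathrm b}\}$,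 $\mathfrak E^\flat_\star(H)$ the set of first components of $\bigcup_U\mathfrak E_\star(H,U)$. $\mathfrak E$ is a $G$-spectrum if $\mathfrak E^\flat$ is a $G$-subgroup system, $(I,V)\in\mathfrak E_{\mathrm r}(H,U)$ implies $V=U$, and $[H:I]<\infty$ for $I\in\mathfrak E^\flat_{\mathrm r}(H)$. A Mackey cover of $\mathfrak E$ is a $G$-Mackey system $\mathfrak M$ with $\mathfrak E^\flat\le\mathfrak M$, $\mathrm{Ext}(\mathfrak E,H)\subseteq\mathfrak M_{\mathrm i}(H)$, and $V\in\mathfrak M_{\mathrm i}(U)$ whenever $(I,V)\in\mathfrak E_{\mathrm i}(H,U)$. Coherence. $\mathfrak K=(\mathfrak E,\mathrm{Com}^{\mathrm t},\mathbb Z)$ is coherent if $[H:U]<\infty$ for all $(H,U)\in\mathfrak E_{\mathrm b}$ and for every $H\in\mathfrak E^\flat_{\mathrm b}$: $\mathrm{Ext}(\mathfrak E,H)\subseteq\mathfrak E^\flat_{\mathrm i}(H)$; if $U\in\mathrm{Ext}(\mathfrak E,H)$ and $U_1$ is a closed normal subgroup of $H$ with $U\le U_1$, then $U_1\in\mathrm{Ext}(\mathfrak E,H)$, $U\in\mathrm{Ext}(\mathfrak E,U_1)$, $(U_1,U)\in\mathfrak E_{\mathrm i}(H,U)$ and $(H,U)\in\mathfrak E_{\mathrm i}(H,U_1)$; if $U\in\mathrm{Ext}(\mathfrak E,H)$ and $I$ is an open subgroup of $H$ with $U\le I$, then $(I,U)\in\mathfrak E_{\mathrm i}(H,U)$.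 (The remaining conditions of the general definition hold automatically for the dualizing functor $\mathbb Z$.) Valuations. For inertially finite $\mathfrak M$ let $\boldsymbol\Omega_d\in\mathsf{Fct}(\mathfrak M,\mathsf{Ab})$ be: $\boldsymbol\Omega_d(H)=\Omega$, con $=\mathrm{id}$, $\mathrm{res}_{K,H}$ = multiplication by $e_{H|K}$, $\mathrm{ind}_{H,K}$ = multiplication by $f_{H|K}$. $\mathrm{Val}_d^{\Omega,\omega}(C)$ is the set of morphisms $v:C\to\boldsymbol\Omega_d$ with $\omega\in\mathrm{im}(v_H)$ for all $H\in\mathfrak M_{\mathrm b}$. A prime element of $C(H)$ is $\pi\in C(H)$ with $v_H(\pi)=\omega$. Fesenko--Neukirch datum on $\mathfrak E$: a pair $(C,v)$ with $C:\mathfrak M\to\mathsf{Ab}$ a cohomological Mackey functor on an arithmetic and inertially finite Mackey cover $\mathfrak M$ of $\mathfrak E$ and $v\in\mathrm{Val}_d^{\Omega,\omega}(C)$ such that (1) for each $(H,U)\in\mathfrak E_{\mathrm b}$ with $U\in\mathcal E^{\mathrm{ur}}(H)$: $\mathrm{im}(v_H)/[H:U]\,\mathrm{im}(v_U)$ has order $[H:U]$ and is generated by the image of $\omega$; $\mathrm{ind}^C_{H,U}:\ker(v_U)\to\ker(v_H)$ is surjective; $|C(H)/\mathrm{ind}^C_{H,U}C(U)|\le[H:U]$; (2) for each open subgroup $U$ of a group $H\in\mathfrak E^\flat_{\mathrm b}$ and each $V\in\mathcal E^{\mathrm{ur}}(U)$ the sequence $1\to\ker(v_U)\xrightarrow{\mathrm{res}_{V,U}}\ker(v_V)\xrightarrow{\mathrm{con}_{\varphi-1,V}}\ker(v_V)\xrightarrow{\mathrm{ind}_{U,V}}\ker(v_U)\to1$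 is exact, where $\varphi=\varphi_{U|V}$ and $\mathrm{con}_{\varphi-1,V}(x)=\mathrm{con}_{\tilde\varphi,V}(x)x^{-1}$, $\tilde\varphi\in U$ representing $\varphi$. Fesenko--Neukirch morphism. $\Omega^+=\{n\omega:n\in\mathbb N_{>0}\}$, $\mathrm{mult}(n\omega)=n$; for $n=\prod_pp^{n(p)}$, $P'(n)=\prod_{p\notin P}p^{n(p)}$; $\mathrm{Frob}_H=\{h\in H:d_H(h)\in\Omega^+\}$; $\Sigma_{h,H|U}=\langle h\rangle_{\mathrm c}I_U$ (open subgroup of $H$ for $U$ open normal in $H$). $\Upsilon_{(H,U)}:(H/U)^{\mathrm{ab}}\to C(H)/\mathrm{ind}^C_{H,U}C(U)$ sends the class of $\bar h\in H/U$ to $\mathrm{ind}^C_{H,\Sigma_{h,H|U}}(\pi_h)^{P'(\mathrm{mult}(d_H(h)))}$, where $h\in\mathrm{Frob}_H$ lifts $\bar h$ and $\pi_h\in C(\Sigma_{h,H|U})$ is a prime element; this is a well-defined homomorphism independent of choices, and $\Upsilon=(\Upsilon_{(H,U)})$ is a morphism $\pi_{\mathfrak K}\to\widehat{\mathrm H}^0_{\mathfrak E}(C)$ in $\mathsf{Fct}(\mathfrak E,\mathsf{TAb})$. Here $\pi_{\mathfrak K}(H,U)=(H/U)^{\mathrm{ab}}$ with con induced by conjugation, ind by inclusion, res the group-theoretic transfer; $\widehat{\mathrm H}^0_{\mathfrak E}(C)(H,U)=C(H)/\mathrm{ind}^C_{H,U}C(U)$ with structure maps induced by $C$. Class field axiom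 for $(H,U)$: $|C(H)/\mathrm{ind}^C_{H,U}C(U)|=[H:U]$ and $\ker(\mathrm{ind}^C_{H,U})$ is generated by the elements $\mathrm{con}^C_{h,U}(x)x^{-1}$, $h\in H$, $x\in C(U)$. $\mathfrak K$-class field theory: $\Upsilon$ is an isomorphism in $\mathsf{Fct}(\mathfrak E,\mathsf{TAb})$ and, for every $H\in\mathfrak E^\flat_{\mathrm b}$ and every set $\mathcal L(H)\subseteq\{U\in\mathrm{Ext}(\mathfrak E,H):U\ge\mathrm{Com}^{\mathrm t}(H)\}$ closed under products and intersections, the map $U\mapsto\mathrm{ind}^C_{H,U}C(U)$ from $\mathcal L(H)$ to the lattice of subgroups of $C(H)$ is an injective morphism of lattices. *)

theory Defs
  imports
    "HOL-Algebra.Group_Action"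
    "HOL-Algebra.FiniteProduct"
    "HOL-Algebra.Product_Groups"
    "HOL-Algebra.Exact_Sequence"
    "HOL-Algebra.Lattice"
    "HOL-Computational_Algebra.Primes"
    "HOL-Analysis.Function_Topology"
    "HOL-Analysis.Abstract_Topological_Spaces"
begin

section \<open>Topological groups\<close>

definition top_group :: "'a monoid \<Rightarrow> 'a topology \<Rightarrow> bool" where
  "top_group A T \<longleftrightarrow> group A \<and> topspace T = carrier A \<and>
     continuous_map (prod_topology T T) T (\<lambda>(x, y). x \<otimes>\<^bsub>A\<^esub> y) \<and>
     continuous_map T T (\<lambda>x. inv\<^bsub>A\<^esub> x)"

definition top_ab_group :: "'a monoid \<Rightarrow> 'a topology \<Rightarrow> bool" where
  "top_ab_group A T \<longleftrightarrow> top_group A T \<and> comm_group A"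

definition top_hom ::
    "'a monoid \<Rightarrow> 'a topology \<Rightarrow> 'b monoid \<Rightarrow> 'b topology \<Rightarrow> ('a \<Rightarrow> 'b) set" where
  "top_hom A S B T = {f \<in> hom A B. continuous_map S T f}"

text \<open>The index is \<open>0\<close> if it is infinite; finiteness is expressed by \<open>fin_index\<close>.\<close>

definition grp_index :: "'a monoid \<Rightarrow> 'a set \<Rightarrow> 'a set \<Rightarrow> nat" where
  "grp_index A H K = card (rcosets\<^bsub>A\<lparr>carrier := H\<rparr>\<^esub> K)"

definition fin_index :: "'a monoid \<Rightarrow> 'a set \<Rightarrow> 'a set \<Rightarrow> bool" where
  "fin_index A H K \<longleftrightarrow> finite (rcosets\<^bsub>A\<lparr>carrier := H\<rparr>\<^esub> K)"

definition closed_subgroup :: "'a monoid \<Rightarrow> 'a topology \<Rightarrow> 'a set \<Rightarrow> bool" where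
  "closed_subgroup A T H \<longleftrightarrow> subgroup H A \<and> closedin T H"

definition open_subgroup_of :: "'a monoid \<Rightarrow> 'a topology \<Rightarrow> 'a set \<Rightarrow> 'a set \<Rightarrow> bool" where
  "open_subgroup_of A T I H \<longleftrightarrow> subgroup I A \<and> I \<subseteq> H \<and> openin (subtopology T H) I"

definition closed_normal_in :: "'a monoid \<Rightarrow> 'a topology \<Rightarrow> 'a set \<Rightarrow> 'a set \<Rightarrow> bool" where
  "closed_normal_in A T U H \<longleftrightarrow> U \<lhd> (A\<lparr>carrier := H\<rparr>) \<and> closedin (subtopology T H) U"

definition open_normal_in :: "'a monoid \<Rightarrow> 'a topology \<Rightarrow> 'a set \<Rightarrow> 'a set \<Rightarrow> bool" where
  "open_normal_in A T U H \<longleftrightarrow> U \<lhd> (A\<lparr>carrier := H\<rparr>) \<and> openin (subtopology T H) U"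

definition profinite_group :: "'a monoid \<Rightarrow> 'a topology \<Rightarrow> bool" where
  "profinite_group A T \<longleftrightarrow> top_group A T \<and> compact_space T \<and> Hausdorff_space T \<and>
     (\<forall>S. connectedin T S \<longrightarrow> (\<exists>a. S \<subseteq> {a}))"

definition pro_P_group :: "nat set \<Rightarrow> 'a monoid \<Rightarrow> 'a topology \<Rightarrow> bool" where
  "pro_P_group P A T \<longleftrightarrow> profinite_group A T \<and>
     (\<forall>N p. open_normal_in A T N (carrier A) \<longrightarrow> prime p \<longrightarrow>
        p dvd grp_index A (carrier A) N \<longrightarrow> p \<in> P)"

definition image_topology :: "'a topology \<Rightarrow> ('a \<Rightarrow> 'b) \<Rightarrow> 'b topology" where
  "image_topology T f =
     topology (\<lambda>V. V \<subseteq> f ` topspace T \<and> openin T {x \<in> topspace T. f x \<in> V})"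

lemma openin_image_topology:
  "openin (image_topology T f) V \<longleftrightarrow>
     V \<subseteq> f ` topspace T \<and> openin T {x \<in> topspace T. f x \<in> V}"
proof -
  have "istopology (\<lambda>V. V \<subseteq> f ` topspace T \<and> openin T {x \<in> topspace T. f x \<in> V})"
    unfolding istopology_def
  proof (rule conjI; intro allI impI)
    fix S U
    assume "S \<subseteq> f ` topspace T \<and> openin T {x \<in> topspace T. f x \<in> S}"
      "U \<subseteq> f ` topspace T \<and> openin T {x \<in> topspace T. f x \<in> U}"
    moreover have "{x \<in> topspace T. f x \<in> S \<inter> U} =
        {x \<in> topspace T. f x \<in> S} \<inter> {x \<in> topspace T. f x \<in> U}"
      by auto
    ultimately show "S \<inter> U \<subseteq> f ` topspace T \<and> openin T {x \<in> topspace T. f x \<in> S \<inter> U}"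
      by auto
  next
    fix K
    assume K: "\<forall>V\<in>K. V \<subseteq> f ` topspace T \<and> openin T {x \<in> topspace T. f x \<in> V}"
    have "{x \<in> topspace T. f x \<in> \<Union>K} = (\<Union>V\<in>K. {x \<in> topspace T. f x \<in> V})"
      by auto
    with K show "\<Union>K \<subseteq> f ` topspace T \<and> openin T {x \<in> topspace T. f x \<in> \<Union>K}"
      by auto
  qed
  then show ?thesis
    unfolding image_topology_def by simp
qed

lemma quotient_map_image_topology: "quotient_map T (image_topology T f) f"
proof -
  have "openin (image_topology T f) (f ` topspace T)"
    by (simp add: openin_image_topology cong: conj_cong)
  then have "topspace (image_topology T f) = f ` topspace T"
    by (metis openin_image_topology openin_subset openin_topspace subset_antisym)
  then show ?thesis
    unfolding quotient_map_def by (simp add: openin_image_topology)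
qed

text \<open>
  \<open>induced_map X p q\<close> is the map sending \<open>p x\<close> to \<open>q x\<close> for all \<open>x \<in> X\<close>; it is meaningful
  on \<open>p ` X\<close> if \<open>q\<close> is constant on the fibres of \<open>p\<close>.
\<close>

definition induced_map :: "'x set \<Rightarrow> ('x \<Rightarrow> 'p) \<Rightarrow> ('x \<Rightarrow> 'q) \<Rightarrow> 'p \<Rightarrow> 'q" where
  "induced_map X p q c = (THE y. \<exists>x\<in>X. p x = c \<and> q x = y)"


section \<open>The group \<open>\<int>\<^sub>P\<close>\<close>

text \<open>The \<open>p\<close>-adic integers as the inverse limit of the groups \<open>\<int>/p\<^sup>n\<close>.\<close>

definition padic_carrier :: "nat \<Rightarrow> (nat \<Rightarrow> int) set" where
  "padic_carrier p = {x \<in> (\<Pi>\<^sub>E n\<in>UNIV. carrier (integer_mod_group (p ^ n))).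
     \<forall>n. x (Suc n) mod int (p ^ n) = x n}"

definition padic_group :: "nat \<Rightarrow> (nat \<Rightarrow> int) monoid" where
  "padic_group p = (product_group UNIV (\<lambda>n. integer_mod_group (p ^ n)))
     \<lparr>carrier := padic_carrier p\<rparr>"

definition padic_topology :: "nat \<Rightarrow> (nat \<Rightarrow> int) topology" where
  "padic_topology p =
     subtopology
       (product_topology (\<lambda>n. discrete_topology (carrier (integer_mod_group (p ^ n)))) UNIV)
       (padic_carrier p)"

definition ZP_group :: "nat set \<Rightarrow> (nat \<Rightarrow> nat \<Rightarrow> int) monoid" where
  "ZP_group P = product_group P padic_group"

definition ZP_topology :: "nat set \<Rightarrow> (nat \<Rightarrow> nat \<Rightarrow> int) topology" where
  "ZP_topology P = product_topology padic_topology P"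

definition top_generator :: "'w monoid \<Rightarrow> 'w topology \<Rightarrow> 'w \<Rightarrow> bool" where
  "top_generator \<Omega> T \<omega> \<longleftrightarrow> \<omega> \<in> carrier \<Omega> \<and> T closure_of (generate \<Omega> {\<omega>}) = carrier \<Omega>"


section \<open>RIC-domains and RIC-functors\<close>

record 'x ric_dom =
  base :: "'x set"
  rdom :: "'x \<Rightarrow> 'x set"
  idom :: "'x \<Rightarrow> 'x set"

definition ric_domain :: "'g monoid \<Rightarrow> ('g \<Rightarrow> 'x \<Rightarrow> 'x) \<Rightarrow> 'x ric_dom \<Rightarrow> bool" where
  "ric_domain G act D \<longleftrightarrow>
     base D \<noteq> {} \<and> group_action G (base D) (\<lambda>g. restrict (act g) (base D)) \<and>
     (\<forall>S\<in>{rdom D, idom D}. \<forall>x\<in>base D.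
        S x \<subseteq> base D \<and> x \<in> S x \<and> (\<forall>y\<in>S x. S y \<subseteq> S x) \<and>
        (\<forall>g\<in>carrier G. act g ` S x = S (act g x)))"

text \<open>
  The subscripts are ordered as in \<open>res\<^sub>y\<^sub>,\<^sub>x : \<Phi>(x) \<rightarrow> \<Phi>(y)\<close>, \<open>ind\<^sub>x\<^sub>,\<^sub>y : \<Phi>(y) \<rightarrow> \<Phi>(x)\<close> and
  \<open>con\<^sub>g\<^sub>,\<^sub>x : \<Phi>(x) \<rightarrow> \<Phi>(\<^sup>gx)\<close>.
\<close>

record ('x, 'g, 'a) ric_fun =
  obj :: "'x \<Rightarrow> 'a monoid"
  obj_top :: "'x \<Rightarrow> 'a topology"
  res_map :: "'x \<Rightarrow> 'x \<Rightarrow> 'a \<Rightarrow> 'a"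
  ind_map :: "'x \<Rightarrow> 'x \<Rightarrow> 'a \<Rightarrow> 'a"
  con_map :: "'g \<Rightarrow> 'x \<Rightarrow> 'a \<Rightarrow> 'a"

definition obj_hom ::
    "('x, 'g, 'a) ric_fun \<Rightarrow> 'x \<Rightarrow> ('y, 'h, 'b) ric_fun \<Rightarrow> 'y \<Rightarrow> ('a \<Rightarrow> 'b) set" where
  "obj_hom \<Phi> x \<Psi> y = top_hom (obj \<Phi> x) (obj_top \<Phi> x) (obj \<Psi> y) (obj_top \<Psi> y)"

definition ric_functor ::
    "'g monoid \<Rightarrow> ('g \<Rightarrow> 'x \<Rightarrow> 'x) \<Rightarrow> 'x ric_dom \<Rightarrow> ('x, 'g, 'a) ric_fun \<Rightarrow> bool" where
  "ric_functor G act D \<Phi> \<longleftrightarrow>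
     (\<forall>x\<in>base D. top_ab_group (obj \<Phi> x) (obj_top \<Phi> x)) \<and>
     (\<forall>x\<in>base D. \<forall>y\<in>rdom D x. res_map \<Phi> y x \<in> obj_hom \<Phi> x \<Phi> y) \<and>
     (\<forall>x\<in>base D. \<forall>y\<in>idom D x. ind_map \<Phi> x y \<in> obj_hom \<Phi> y \<Phi> x) \<and>
     (\<forall>x\<in>base D. \<forall>g\<in>carrier G. con_map \<Phi> g x \<in> obj_hom \<Phi> x \<Phi> (act g x)) \<and>
     (\<forall>x\<in>base D. \<forall>a\<in>carrier (obj \<Phi> x).
        res_map \<Phi> x x a = a \<and> ind_map \<Phi> x x a = a \<and> con_map \<Phi> \<one>\<^bsub>G\<^esub> x a = a) \<and>
     (\<forall>x\<in>base D. \<forall>y\<in>rdom D x. \<forall>z\<in>rdom D y. \<forall>a\<in>carrier (obj \<Phi> x).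
        res_map \<Phi> z y (res_map \<Phi> y x a) = res_map \<Phi> z x a) \<and>
     (\<forall>x\<in>base D. \<forall>y\<in>idom D x. \<forall>z\<in>idom D y. \<forall>a\<in>carrier (obj \<Phi> z).
        ind_map \<Phi> x y (ind_map \<Phi> y z a) = ind_map \<Phi> x z a) \<and>
     (\<forall>x\<in>base D. \<forall>g\<in>carrier G. \<forall>g'\<in>carrier G. \<forall>a\<in>carrier (obj \<Phi> x).
        con_map \<Phi> g' (act g x) (con_map \<Phi> g x a) = con_map \<Phi> (g' \<otimes>\<^bsub>G\<^esub> g) x a) \<and>
     (\<forall>x\<in>base D. \<forall>y\<in>rdom D x. \<forall>g\<in>carrier G. \<forall>a\<in>carrier (obj \<Phi> x).
        con_map \<Phi> g y (res_map \<Phi> y x a) = res_map \<Phi> (act g y) (act g x) (con_map \<Phi> g x a)) \<and>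
     (\<forall>x\<in>base D. \<forall>y\<in>idom D x. \<forall>g\<in>carrier G. \<forall>a\<in>carrier (obj \<Phi> y).
        con_map \<Phi> g x (ind_map \<Phi> x y a) = ind_map \<Phi> (act g x) (act g y) (con_map \<Phi> g y a))"

text \<open>Functors to abelian groups are functors to topological abelian groups with discrete values.\<close>

definition ab_ric_functor ::
    "'g monoid \<Rightarrow> ('g \<Rightarrow> 'x \<Rightarrow> 'x) \<Rightarrow> 'x ric_dom \<Rightarrow> ('x, 'g, 'a) ric_fun \<Rightarrow> bool" where
  "ab_ric_functor G act D \<Phi> \<longleftrightarrow> ric_functor G act D \<Phi> \<and>
     (\<forall>x\<in>base D. obj_top \<Phi> x = discrete_topology (carrier (obj \<Phi> x)))"

definition ric_morphism ::
    "'g monoid \<Rightarrow> ('g \<Rightarrow> 'x \<Rightarrow> 'x) \<Rightarrow> 'x ric_dom \<Rightarrow>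
     ('x, 'g, 'a) ric_fun \<Rightarrow> ('x, 'g, 'b) ric_fun \<Rightarrow> ('x \<Rightarrow> 'a \<Rightarrow> 'b) \<Rightarrow> bool" where
  "ric_morphism G act D \<Phi> \<Psi> \<phi> \<longleftrightarrow>
     ric_functor G act D \<Phi> \<and> ric_functor G act D \<Psi> \<and>
     (\<forall>x\<in>base D. \<phi> x \<in> obj_hom \<Phi> x \<Psi> x) \<and>
     (\<forall>x\<in>base D. \<forall>y\<in>rdom D x. \<forall>a\<in>carrier (obj \<Phi> x).
        \<phi> y (res_map \<Phi> y x a) = res_map \<Psi> y x (\<phi> x a)) \<and>
     (\<forall>x\<in>base D. \<forall>y\<in>idom D x. \<forall>a\<in>carrier (obj \<Phi> y).
        \<phi> x (ind_map \<Phi> x y a) = ind_map \<Psi> x y (\<phi> y a)) \<and>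
     (\<forall>x\<in>base D. \<forall>g\<in>carrier G. \<forall>a\<in>carrier (obj \<Phi> x).
        \<phi> (act g x) (con_map \<Phi> g x a) = con_map \<Psi> g x (\<phi> x a))"

definition ric_isomorphism ::
    "'g monoid \<Rightarrow> ('g \<Rightarrow> 'x \<Rightarrow> 'x) \<Rightarrow> 'x ric_dom \<Rightarrow>
     ('x, 'g, 'a) ric_fun \<Rightarrow> ('x, 'g, 'b) ric_fun \<Rightarrow> ('x \<Rightarrow> 'a \<Rightarrow> 'b) \<Rightarrow> bool" where
  "ric_isomorphism G act D \<Phi> \<Psi> \<phi> \<longleftrightarrow>
     ric_morphism G act D \<Phi> \<Psi> \<phi> \<and>
     (\<exists>\<psi>. ric_morphism G act D \<Psi> \<Phi> \<psi> \<and>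
        (\<forall>x\<in>base D. (\<forall>a\<in>carrier (obj \<Phi> x). \<psi> x (\<phi> x a) = a) \<and>
                     (\<forall>b\<in>carrier (obj \<Psi> x). \<phi> x (\<psi> x b) = b)))"


section \<open>Subgroup systems and Mackey functors\<close>

definition conj_set :: "'g monoid \<Rightarrow> 'g \<Rightarrow> 'g set \<Rightarrow> 'g set" where
  "conj_set G g H = g <#\<^bsub>G\<^esub> H #>\<^bsub>G\<^esub> (inv\<^bsub>G\<^esub> g)"

definition subgroup_system :: "'g monoid \<Rightarrow> 'g set ric_dom \<Rightarrow> bool" where
  "subgroup_system G S \<longleftrightarrow> ric_domain G (conj_set G) S \<and>
     (\<forall>H\<in>base S. subgroup H G \<and> (\<forall>I \<in> rdom S H \<union> idom S H. I \<subseteq> H))"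

definition subsystem :: "'g set ric_dom \<Rightarrow> 'g set ric_dom \<Rightarrow> bool" where
  "subsystem S' S \<longleftrightarrow> base S' \<subseteq> base S \<and>
     (\<forall>H\<in>base S'. rdom S' H \<subseteq> rdom S H \<and> idom S' H \<subseteq> idom S H)"

definition arithmetic_system :: "'g monoid \<Rightarrow> 'g topology \<Rightarrow> 'g set ric_dom \<Rightarrow> bool" where
  "arithmetic_system G T S \<longleftrightarrow>
     (\<forall>H\<in>base S. \<forall>I. open_subgroup_of G T I H \<longrightarrow> I \<in> rdom S H \<and> I \<in> idom S H)"

definition double_coset :: "'g monoid \<Rightarrow> 'g set \<Rightarrow> 'g \<Rightarrow> 'g set \<Rightarrow> 'g set" where
  "double_coset G I h J = (I #>\<^bsub>G\<^esub> h) <#>\<^bsub>G\<^esub> J"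

definition double_cosets :: "'g monoid \<Rightarrow> 'g set \<Rightarrow> 'g set \<Rightarrow> 'g set \<Rightarrow> 'g set set" where
  "double_cosets G I H J = (\<lambda>h. double_coset G I h J) ` H"

definition mackey_system :: "'g monoid \<Rightarrow> 'g set ric_dom \<Rightarrow> bool" where
  "mackey_system G M \<longleftrightarrow> subgroup_system G M \<and>
     (\<forall>H\<in>base M. \<forall>I\<in>rdom M H. \<forall>J\<in>idom M H.
        finite (double_cosets G I H J) \<and> I \<inter> J \<in> rdom M J \<and> I \<inter> J \<in> idom M I)"

definition coh_mackey_functor ::
    "'g monoid \<Rightarrow> 'g set ric_dom \<Rightarrow> ('g set, 'g, 'a) ric_fun \<Rightarrow> bool" where
  "coh_mackey_functor G M C \<longleftrightarrow>
     ab_ric_functor G (conj_set G) M C \<and>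
     (\<forall>H\<in>base M. \<forall>h\<in>H. \<forall>a\<in>carrier (obj C H). con_map C h H a = a) \<and>
     (\<forall>H\<in>base M. \<forall>I\<in>rdom M H. \<forall>J\<in>idom M H. \<forall>R\<subseteq>H.
        bij_betw (\<lambda>h. double_coset G I h J) R (double_cosets G I H J) \<longrightarrow>
        (\<forall>a\<in>carrier (obj C J). res_map C I H (ind_map C H J a) =
           finprod (obj C I)
             (\<lambda>h. ind_map C I (I \<inter> conj_set G h J)
                (con_map C h (conj_set G (inv\<^bsub>G\<^esub> h) I \<inter> J)
                  (res_map C (conj_set G (inv\<^bsub>G\<^esub> h) I \<inter> J) J a))) R)) \<and>
     (\<forall>H\<in>base M. \<forall>I\<in>rdom M H \<inter> idom M H. \<forall>a\<in>carrier (obj C H).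
        ind_map C H I (res_map C I H a) = a [^]\<^bsub>obj C H\<^esub> grp_index G H I)"

definition norm_group :: "('g set, 'g, 'a) ric_fun \<Rightarrow> 'g set \<Rightarrow> 'g set \<Rightarrow> 'a set" where
  "norm_group C H U = ind_map C H U ` carrier (obj C U)"


section \<open>Ramification\<close>

text \<open>
  As all groups here, \<open>\<Omega>\<close> is written multiplicatively: \<open>n\<omega>\<close> becomes \<open>\<omega> [^] n\<close>.
\<close>

definition inertia :: "'g monoid \<Rightarrow> 'w monoid \<Rightarrow> ('g \<Rightarrow> 'w) \<Rightarrow> 'g set \<Rightarrow> 'g set" where
  "inertia G \<Omega> d H = H \<inter> kernel G \<Omega> d"

definition f_rel :: "'w monoid \<Rightarrow> ('g \<Rightarrow> 'w) \<Rightarrow> 'g set \<Rightarrow> 'g set \<Rightarrow> nat" where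
  "f_rel \<Omega> d H K = grp_index \<Omega> (d ` H) (d ` K)"

definition f_abs :: "'g monoid \<Rightarrow> 'w monoid \<Rightarrow> ('g \<Rightarrow> 'w) \<Rightarrow> 'g set \<Rightarrow> nat" where
  "f_abs G \<Omega> d H = f_rel \<Omega> d (carrier G) H"

definition e_rel :: "'g monoid \<Rightarrow> 'w monoid \<Rightarrow> ('g \<Rightarrow> 'w) \<Rightarrow> 'g set \<Rightarrow> 'g set \<Rightarrow> nat" where
  "e_rel G \<Omega> d H K = grp_index G (inertia G \<Omega> d H) (inertia G \<Omega> d K)"

definition inertially_finite ::
    "'g monoid \<Rightarrow> 'g topology \<Rightarrow> 'w monoid \<Rightarrow> ('g \<Rightarrow> 'w) \<Rightarrow> 'g set \<Rightarrow> bool" where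
  "inertially_finite G T \<Omega> d H \<longleftrightarrow>
     closed_subgroup G T H \<and> fin_index \<Omega> (d ` carrier G) (d ` H)"

definition inertially_finite_system ::
    "'g monoid \<Rightarrow> 'g topology \<Rightarrow> 'w monoid \<Rightarrow> ('g \<Rightarrow> 'w) \<Rightarrow> 'g set ric_dom \<Rightarrow> bool" where
  "inertially_finite_system G T \<Omega> d S \<longleftrightarrow>
     (\<forall>H\<in>base S. inertially_finite G T \<Omega> d H \<and> (\<forall>I\<in>rdom S H. fin_index G H I))"

text \<open>The map \<open>d\<^sub>H = (1/f\<^sub>H) d\<close>; division is unique since \<open>\<Omega>\<close> is torsion-free.\<close>

definition norm_deg :: "'g monoid \<Rightarrow> 'w monoid \<Rightarrow> ('g \<Rightarrow> 'w) \<Rightarrow> 'g set \<Rightarrow> 'g \<Rightarrow> 'w" where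
  "norm_deg G \<Omega> d H h = (THE w. w \<in> carrier \<Omega> \<and> w [^]\<^bsub>\<Omega>\<^esub> f_abs G \<Omega> d H = d h)"

definition unram :: "'g monoid \<Rightarrow> 'g topology \<Rightarrow> 'w monoid \<Rightarrow> ('g \<Rightarrow> 'w) \<Rightarrow> 'g set \<Rightarrow> 'g set set" where
  "unram G T \<Omega> d H = {U. open_normal_in G T U H \<and> inertia G \<Omega> d H \<subseteq> U}"

text \<open>The Frobenius element \<open>\<phi>\<^bsub>H|U\<^esub> \<in> H/U\<close>, as a coset of \<open>U\<close>.\<close>

definition frob_elt ::
    "'g monoid \<Rightarrow> 'w monoid \<Rightarrow> 'w \<Rightarrow> ('g \<Rightarrow> 'w) \<Rightarrow> 'g set \<Rightarrow> 'g set \<Rightarrow> 'g set" where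
  "frob_elt G \<Omega> \<omega> d H U = (THE c. \<exists>h\<in>H. norm_deg G \<Omega> d H h = \<omega> \<and> c = U #>\<^bsub>G\<^esub> h)"


section \<open>Spectra\<close>

definition conj_pair :: "'g monoid \<Rightarrow> 'g \<Rightarrow> 'g set \<times> 'g set \<Rightarrow> 'g set \<times> 'g set" where
  "conj_pair G g = map_prod (conj_set G g) (conj_set G g)"

definition subgroup_system_2 ::
    "'g monoid \<Rightarrow> 'g topology \<Rightarrow> ('g set \<times> 'g set) ric_dom \<Rightarrow> bool" where
  "subgroup_system_2 G T E \<longleftrightarrow> ric_domain G (conj_pair G) E \<and>
     (\<forall>(H, U)\<in>base E. closed_subgroup G T H \<and> closed_normal_in G T U H \<and>
        (\<forall>(I, V) \<in> rdom E (H, U) \<union> idom E (H, U). I \<subseteq> H \<and> V \<subseteq> U))"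

definition Ext :: "('g set \<times> 'g set) ric_dom \<Rightarrow> 'g set \<Rightarrow> 'g set set" where
  "Ext E H = {U. (H, U) \<in> base E}"

definition flat :: "('g set \<times> 'g set) ric_dom \<Rightarrow> 'g set ric_dom" where
  "flat E = \<lparr>base = fst ` base E,
             rdom = (\<lambda>H. \<Union>U\<in>Ext E H. fst ` rdom E (H, U)),
             idom = (\<lambda>H. \<Union>U\<in>Ext E H. fst ` idom E (H, U))\<rparr>"

definition spectrum :: "'g monoid \<Rightarrow> 'g topology \<Rightarrow> ('g set \<times> 'g set) ric_dom \<Rightarrow> bool" where
  "spectrum G T E \<longleftrightarrow> subgroup_system_2 G T E \<and> subgroup_system G (flat E) \<and>
     (\<forall>(H, U)\<in>base E. \<forall>(I, V)\<in>rdom E (H, U). V = U) \<and>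
     (\<forall>H\<in>base (flat E). \<forall>I\<in>rdom (flat E) H. fin_index G H I)"

definition mackey_cover ::
    "'g monoid \<Rightarrow> ('g set \<times> 'g set) ric_dom \<Rightarrow> 'g set ric_dom \<Rightarrow> bool" where
  "mackey_cover G E M \<longleftrightarrow> mackey_system G M \<and> subsystem (flat E) M \<and>
     (\<forall>H\<in>base (flat E). Ext E H \<subseteq> idom M H) \<and>
     (\<forall>(H, U)\<in>base E. \<forall>(I, V)\<in>idom E (H, U). V \<in> idom M U)"

text \<open>
  Coherence of \<open>(\<EE>, Com\<^sup>t, \<int>)\<close>: only the conditions that are not automatic for the dualizing
  functor \<open>\<int>\<close>.
\<close>

definition coherent ::
    "'g monoid \<Rightarrow> 'g topology \<Rightarrow> ('g set \<times> 'g set) ric_dom \<Rightarrow> bool" where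
  "coherent G T E \<longleftrightarrow>
     (\<forall>(H, U)\<in>base E. fin_index G H U) \<and>
     (\<forall>H\<in>base (flat E).
        Ext E H \<subseteq> idom (flat E) H \<and>
        (\<forall>U\<in>Ext E H. \<forall>U1. closed_normal_in G T U1 H \<and> U \<subseteq> U1 \<longrightarrow>
           U1 \<in> Ext E H \<and> U \<in> Ext E U1 \<and>
           (U1, U) \<in> idom E (H, U) \<and> (H, U) \<in> idom E (H, U1)) \<and>
        (\<forall>U\<in>Ext E H. \<forall>I. open_subgroup_of G T I H \<and> U \<subseteq> I \<longrightarrow> (I, U) \<in> idom E (H, U)))"


section \<open>Valuations and Fesenko--Neukirch data\<close>

definition Omega_fun ::
    "'g monoid \<Rightarrow> 'w monoid \<Rightarrow> ('g \<Rightarrow> 'w) \<Rightarrow> ('g set, 'g, 'w) ric_fun" where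
  "Omega_fun G \<Omega> d =
     \<lparr>obj = (\<lambda>H. \<Omega>),
      obj_top = (\<lambda>H. discrete_topology (carrier \<Omega>)),
      res_map = (\<lambda>K H w. w [^]\<^bsub>\<Omega>\<^esub> e_rel G \<Omega> d H K),
      ind_map = (\<lambda>H K w. w [^]\<^bsub>\<Omega>\<^esub> f_rel \<Omega> d H K),
      con_map = (\<lambda>g H w. w)\<rparr>"

definition Val ::
    "'g monoid \<Rightarrow> 'w monoid \<Rightarrow> 'w \<Rightarrow> ('g \<Rightarrow> 'w) \<Rightarrow> 'g set ric_dom \<Rightarrow>
     ('g set, 'g, 'a) ric_fun \<Rightarrow> ('g set \<Rightarrow> 'a \<Rightarrow> 'w) set" where
  "Val G \<Omega> \<omega> d M C = {v. ric_morphism G (conj_set G) M C (Omega_fun G \<Omega> d) v \<and>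
     (\<forall>H\<in>base M. \<omega> \<in> v H ` carrier (obj C H))}"

definition prime_elements ::
    "'w \<Rightarrow> ('g set, 'g, 'a) ric_fun \<Rightarrow> ('g set \<Rightarrow> 'a \<Rightarrow> 'w) \<Rightarrow> 'g set \<Rightarrow> 'a set" where
  "prime_elements \<omega> C v H = {\<pi> \<in> carrier (obj C H). v H \<pi> = \<omega>}"

definition unit_group ::
    "'w monoid \<Rightarrow> ('g set, 'g, 'a) ric_fun \<Rightarrow> ('g set \<Rightarrow> 'a \<Rightarrow> 'w) \<Rightarrow> 'g set \<Rightarrow> 'a monoid" where
  "unit_group \<Omega> C v H = (obj C H)\<lparr>carrier := kernel (obj C H) \<Omega> (v H)\<rparr>"

definition val_quotient ::
    "'g monoid \<Rightarrow> 'w monoid \<Rightarrow> ('g set, 'g, 'a) ric_fun \<Rightarrow> ('g set \<Rightarrow> 'a \<Rightarrow> 'w) \<Rightarrow>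
     'g set \<Rightarrow> 'g set \<Rightarrow> 'w set monoid" where
  "val_quotient G \<Omega> C v H U =
     \<Omega>\<lparr>carrier := v H ` carrier (obj C H)\<rparr>
       Mod ((\<lambda>w. w [^]\<^bsub>\<Omega>\<^esub> grp_index G H U) ` (v U ` carrier (obj C U)))"

definition FN_datum ::
    "'g monoid \<Rightarrow> 'g topology \<Rightarrow> 'w monoid \<Rightarrow> 'w \<Rightarrow> ('g \<Rightarrow> 'w) \<Rightarrow>
     ('g set \<times> 'g set) ric_dom \<Rightarrow> 'g set ric_dom \<Rightarrow>
     ('g set, 'g, 'a) ric_fun \<Rightarrow> ('g set \<Rightarrow> 'a \<Rightarrow> 'w) \<Rightarrow> bool" where
  "FN_datum G T \<Omega> \<omega> d E M C v \<longleftrightarrow>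
     mackey_cover G E M \<and> arithmetic_system G T M \<and> inertially_finite_system G T \<Omega> d M \<and>
     coh_mackey_functor G M C \<and> v \<in> Val G \<Omega> \<omega> d M C \<and>
     (\<forall>(H, U)\<in>base E. U \<in> unram G T \<Omega> d H \<longrightarrow>
        order (val_quotient G \<Omega> C v H U) = grp_index G H U \<and>
        carrier (val_quotient G \<Omega> C v H U) =
          generate (val_quotient G \<Omega> C v H U)
            {((\<lambda>w. w [^]\<^bsub>\<Omega>\<^esub> grp_index G H U) ` (v U ` carrier (obj C U))) #>\<^bsub>\<Omega>\<^esub> \<omega>} \<and>
        ind_map C H U ` carrier (unit_group \<Omega> C v U) = carrier (unit_group \<Omega> C v H) \<and>
        finite (carrier (obj C H Mod norm_group C H U)) \<and>
        order (obj C H Mod norm_group C H U) \<le> grp_index G H U) \<and>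
     (\<forall>H\<in>base (flat E). \<forall>U. open_subgroup_of G T U H \<longrightarrow>
        (\<forall>V\<in>unram G T \<Omega> d U. \<forall>\<phi>\<in>frob_elt G \<Omega> \<omega> d U V.
           exact_seq
             ([singleton_group \<one>\<^bsub>obj C U\<^esub>, unit_group \<Omega> C v U, unit_group \<Omega> C v V,
               unit_group \<Omega> C v V, unit_group \<Omega> C v U, singleton_group \<one>\<^bsub>obj C U\<^esub>],
              [\<lambda>x. \<one>\<^bsub>obj C U\<^esub>, ind_map C U V,
               \<lambda>x. con_map C \<phi> V x \<otimes>\<^bsub>obj C V\<^esub> inv\<^bsub>obj C V\<^esub> x, res_map C V U,
               \<lambda>x. \<one>\<^bsub>obj C U\<^esub>])))"

definition class_field_axiom ::
    "'g monoid \<Rightarrow> ('g set, 'g, 'a) ric_fun \<Rightarrow> 'g set \<Rightarrow> 'g set \<Rightarrow> bool" where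
  "class_field_axiom G C H U \<longleftrightarrow>
     order (obj C H Mod norm_group C H U) = grp_index G H U \<and>
     kernel (obj C U) (obj C H) (ind_map C H U) =
       generate (obj C U)
         {con_map C h U x \<otimes>\<^bsub>obj C U\<^esub> inv\<^bsub>obj C U\<^esub> x | h x. h \<in> H \<and> x \<in> carrier (obj C U)}"


section \<open>The functors \<open>\<pi>\<^sub>\<KK>\<close> and \<open>\<hat>\<H>\<^sup>0\<close>\<close>

definition Com_t :: "'a monoid \<Rightarrow> 'a topology \<Rightarrow> 'a set" where
  "Com_t A T = T closure_of (derived A (carrier A))"

definition ab_group :: "'a monoid \<Rightarrow> 'a topology \<Rightarrow> 'a set monoid" where
  "ab_group A T = A Mod Com_t A T"

definition ab_class :: "'a monoid \<Rightarrow> 'a topology \<Rightarrow> 'a \<Rightarrow> 'a set" where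
  "ab_class A T a = Com_t A T #>\<^bsub>A\<^esub> a"

definition ab_topology :: "'a monoid \<Rightarrow> 'a topology \<Rightarrow> 'a set topology" where
  "ab_topology A T = image_topology T (ab_class A T)"

text \<open>
  The transfer \<open>A\<^sup>a\<^sup>b \<rightarrow> B\<^sup>a\<^sup>b\<close> for a subgroup \<open>B\<close> of finite index: with \<open>\<rho>\<close> choosing representatives
  of the left cosets of \<open>B\<close>, the class of \<open>a\<close> goes to the product of the classes of
  \<open>\<rho>(a c)\<^sup>-\<^sup>1 a \<rho>(c) \<in> B\<close> over all left cosets \<open>c\<close>.
\<close>

definition transfer :: "'a monoid \<Rightarrow> 'a topology \<Rightarrow> 'a set \<Rightarrow> 'a set \<Rightarrow> 'a set" where
  "transfer A T B = induced_map (carrier A) (ab_class A T)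
     (\<lambda>a. finprod (ab_group (A\<lparr>carrier := B\<rparr>) (subtopology T B))
        (\<lambda>c. ab_class (A\<lparr>carrier := B\<rparr>) (subtopology T B)
           (inv\<^bsub>A\<^esub> (SOME x. x \<in> a <#\<^bsub>A\<^esub> c) \<otimes>\<^bsub>A\<^esub> a \<otimes>\<^bsub>A\<^esub> (SOME x. x \<in> c)))
        ((\<lambda>x. x <#\<^bsub>A\<^esub> B) ` carrier A))"

definition quot_group :: "'g monoid \<Rightarrow> 'g set \<times> 'g set \<Rightarrow> 'g set monoid" where
  "quot_group G = (\<lambda>(H, U). G\<lparr>carrier := H\<rparr> Mod U)"

definition quot_top :: "'g monoid \<Rightarrow> 'g topology \<Rightarrow> 'g set \<times> 'g set \<Rightarrow> 'g set topology" where
  "quot_top G T = (\<lambda>(H, U). image_topology (subtopology T H) (\<lambda>h. U #>\<^bsub>G\<^esub> h))"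

definition pi_class :: "'g monoid \<Rightarrow> 'g topology \<Rightarrow> 'g set \<times> 'g set \<Rightarrow> 'g \<Rightarrow> 'g set set" where
  "pi_class G T x h = ab_class (quot_group G x) (quot_top G T x) (snd x #>\<^bsub>G\<^esub> h)"

definition pi_fun ::
    "'g monoid \<Rightarrow> 'g topology \<Rightarrow> ('g set \<times> 'g set, 'g, 'g set set) ric_fun" where
  "pi_fun G T =
     \<lparr>obj = (\<lambda>x. ab_group (quot_group G x) (quot_top G T x)),
      obj_top = (\<lambda>x. ab_topology (quot_group G x) (quot_top G T x)),
      res_map = (\<lambda>y x. transfer (quot_group G x) (quot_top G T x) (carrier (quot_group G y))),
      ind_map = (\<lambda>x y. induced_map (fst y) (pi_class G T y) (pi_class G T x)),
      con_map = (\<lambda>g x. induced_map (fst x) (pi_class G T x)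
        (\<lambda>h. pi_class G T (conj_pair G g x) (g \<otimes>\<^bsub>G\<^esub> h \<otimes>\<^bsub>G\<^esub> inv\<^bsub>G\<^esub> g)))\<rparr>"

definition H0_class ::
    "('g set, 'g, 'a) ric_fun \<Rightarrow> 'g set \<times> 'g set \<Rightarrow> 'a \<Rightarrow> 'a set" where
  "H0_class C = (\<lambda>(H, U) a. norm_group C H U #>\<^bsub>obj C H\<^esub> a)"

definition H0_fun ::
    "'g monoid \<Rightarrow> ('g set, 'g, 'a) ric_fun \<Rightarrow> ('g set \<times> 'g set, 'g, 'a set) ric_fun" where
  "H0_fun G C =
     \<lparr>obj = (\<lambda>(H, U). obj C H Mod norm_group C H U),
      obj_top = (\<lambda>(H, U). discrete_topology (carrier (obj C H Mod norm_group C H U))),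
      res_map = (\<lambda>y x. induced_map (carrier (obj C (fst x))) (H0_class C x)
        (\<lambda>a. H0_class C y (res_map C (fst y) (fst x) a))),
      ind_map = (\<lambda>x y. induced_map (carrier (obj C (fst y))) (H0_class C y)
        (\<lambda>a. H0_class C x (ind_map C (fst x) (fst y) a))),
      con_map = (\<lambda>g x. induced_map (carrier (obj C (fst x))) (H0_class C x)
        (\<lambda>a. H0_class C (conj_pair G g x) (con_map C g (fst x) a)))\<rparr>"


section \<open>The Fesenko--Neukirch morphism and class field theories\<close>

definition Omega_plus :: "'w monoid \<Rightarrow> 'w \<Rightarrow> 'w set" where
  "Omega_plus \<Omega> \<omega> = {\<omega> [^]\<^bsub>\<Omega>\<^esub> n | n::nat. 0 < n}"

definition mult_Omega :: "'w monoid \<Rightarrow> 'w \<Rightarrow> 'w \<Rightarrow> nat" where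
  "mult_Omega \<Omega> \<omega> w = (THE n. 0 < n \<and> w = \<omega> [^]\<^bsub>\<Omega>\<^esub> n)"

definition P'_part :: "nat set \<Rightarrow> nat \<Rightarrow> nat" where
  "P'_part P n = (\<Prod>p \<in> prime_factors n - P. p ^ multiplicity p n)"

definition Frob :: "'g monoid \<Rightarrow> 'w monoid \<Rightarrow> 'w \<Rightarrow> ('g \<Rightarrow> 'w) \<Rightarrow> 'g set \<Rightarrow> 'g set" where
  "Frob G \<Omega> \<omega> d H = {h \<in> H. norm_deg G \<Omega> d H h \<in> Omega_plus \<Omega> \<omega>}"

definition Sigma_h ::
    "'g monoid \<Rightarrow> 'g topology \<Rightarrow> 'w monoid \<Rightarrow> ('g \<Rightarrow> 'w) \<Rightarrow> 'g set \<Rightarrow> 'g \<Rightarrow> 'g set" where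
  "Sigma_h G T \<Omega> d U h = (T closure_of generate G {h}) <#>\<^bsub>G\<^esub> inertia G \<Omega> d U"

text \<open>
  The Fesenko--Neukirch morphism sends the class of \<open>h\<close> to the class of
  \<open>ind(\<pi>)^P'(mult(d\<^sub>H(h)))\<close>, for all Frobenius lifts \<open>h\<close> and all prime elements \<open>\<pi>\<close> at the
  subgroup \<open>\<Sigma>\<^sub>h\<close>.
\<close>

definition Upsilon ::
    "nat set \<Rightarrow> 'g monoid \<Rightarrow> 'g topology \<Rightarrow> 'w monoid \<Rightarrow> 'w \<Rightarrow> ('g \<Rightarrow> 'w) \<Rightarrow>
     ('g set, 'g, 'a) ric_fun \<Rightarrow> ('g set \<Rightarrow> 'a \<Rightarrow> 'w) \<Rightarrow>
     'g set \<times> 'g set \<Rightarrow> 'g set set \<Rightarrow> 'a set" where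
  "Upsilon P G T \<Omega> \<omega> d C v = (\<lambda>(H, U).
     induced_map
       (SIGMA h : Frob G \<Omega> \<omega> d H. prime_elements \<omega> C v (Sigma_h G T \<Omega> d U h))
       (\<lambda>(h, \<pi>). pi_class G T (H, U) h)
       (\<lambda>(h, \<pi>). H0_class C (H, U)
          (ind_map C H (Sigma_h G T \<Omega> d U h) \<pi>
             [^]\<^bsub>obj C H\<^esub> P'_part P (mult_Omega \<Omega> \<omega> (norm_deg G \<Omega> d H h)))))"

definition lattice_embedding :: "'p gorder \<Rightarrow> 'q gorder \<Rightarrow> ('p \<Rightarrow> 'q) \<Rightarrow> bool" where
  "lattice_embedding X Y f \<longleftrightarrow> f \<in> carrier X \<rightarrow> carrier Y \<and> inj_on f (carrier X) \<and>
     join_pres X Y f \<and> meet_pres X Y f"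

definition class_field_theory ::
    "'g monoid \<Rightarrow> 'g topology \<Rightarrow> ('g set \<times> 'g set) ric_dom \<Rightarrow> ('g set, 'g, 'a) ric_fun \<Rightarrow>
     ('g set \<times> 'g set \<Rightarrow> 'g set set \<Rightarrow> 'a set) \<Rightarrow> bool" where
  "class_field_theory G T E C \<Upsilon> \<longleftrightarrow>
     ric_isomorphism G (conj_pair G) E (pi_fun G T) (H0_fun G C) \<Upsilon> \<and>
     (\<forall>H\<in>base (flat E). \<forall>L \<subseteq> {U \<in> Ext E H. Com_t (G\<lparr>carrier := H\<rparr>) (subtopology T H) \<subseteq> U}.
        (\<forall>U1\<in>L. \<forall>U2\<in>L. U1 <#>\<^bsub>G\<^esub> U2 \<in> L \<and> U1 \<inter> U2 \<in> L) \<longrightarrow>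
        lattice_embedding
          \<lparr>carrier = L, eq = (=), le = (\<subseteq>)\<rparr>
          \<lparr>carrier = {A. subgroup A (obj C H)}, eq = (=), le = (\<subseteq>)\<rparr>
          (norm_group C H))"

end

theory Submission
 imports Defs "HOL-Number_Theory.Cong" "HOL-Algebra.Sylow" "HOL-Algebra.Multiplicative_Group"
begin

text \<open>
 Neukirch's construction. On Frobenius lifts, \<open>h \<mapsto> ind(\<pi>\<^sub>h)\<close> (up to the \<open>P'\<close>-part of the degree) is
 multiplicative modulo norms: by the Mackey formula its restriction to a large unramified layer is a
 product of translates of \<open>\<pi>\<^sub>h\<close> under a Frobenius element \<open>\<phi>\<close>, so the defect of multiplicativity is a
 unit \<open>u\<close> for which \<open>(\<phi> - 1)u\<close> is a sum of \<open>(t\<^sub>i - 1)u\<^sub>i\<close> with \<open>t\<^sub>i\<close> in the inertia group, and the exact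
 sequence of units shows that the norm of such a \<open>u\<close> comes from \<open>U\<close>. The map \<open>\<Upsilon>\<close> commutes with
 restriction since the summands of the Mackey formula correspond to the orbits of \<open>h\<close> on \<open>H/I\<close>, along
 which the transfer telescopes.

 Bijectivity is proved by induction on \<open>[H:U]\<close>. A layer of prime index is either unramified, and then
 the valuation detects the kernel, or has \<open>f = 1\<close>, where injectivity is assumed; surjectivity follows
 by counting. For prime powers one inserts a normal subgroup of index \<open>p\<close>, the class field axiom
 making induction from it injective on norm residues; for other indices one uses Sylow subgroups and
 \<open>ind \<circ> res = [H:I]\<close>; a non-abelian \<open>H/U\<close> is replaced by its abelianization. As \<open>\<Upsilon>\<close> is then a pointwise
 bijection onto the functor \<open>\<hat>\<H>\<^sup>0\<close>, the functor laws for \<open>\<pi>\<^sub>\<KK>\<close> are transported along it.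
\<close>

text \<open>As \<open>induced_map\<close> picks values by \<open>THE\<close>, independence of
  \<open>Upsilon\<close> of the Frobenius lift and of the prime element has to be proved. Both
  follow from multiplicativity on lifts, so one computation with units carries everything. Its
  obstacle is that lifts do not commute: the inertia element \<phi>^(n1+n2) (h1 h2)^-1 of a product
  is not the product of the inertia elements \<phi>^ni hi^-1 of the factors. Conjugating the second
  lift by \<phi>^n1 repairs this and changes nothing in C(H). The exponent P'(n) compensates that
  \<Omega> sees only the P-part n_P of a degree n: the degrees of \<Sigma>_h form f_H n_P \<Omega>,
  so the Mackey formula yields a Frobenius orbit of length n_P, and the power P'(n) stretches it to
  length n, which is additive in the lifts. All groups are compared inside one pair
  \<open>dv H a\<close>, \<open>dv U a\<close> of unramified layers, with a a common multiple of the
  P-parts of the degrees that occur.\<close>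

abbreviation mult_inv :: "('a, 'b) monoid_scheme \<Rightarrow> 'a \<Rightarrow> 'a \<Rightarrow> 'a" (infixl "\<div>\<index>" 70)
 where "x \<div>\<^bsub>G\<^esub> y \<equiv> x \<otimes>\<^bsub>G\<^esub> inv\<^bsub>G\<^esub> y"

section \<open>The group \<open>\<int>\<^sub>P\<close>\<close>

lemma padic_carrier_iff:
 assumes "prime p"
 shows "x \<in> padic_carrier p \<longleftrightarrow>
  (\<forall>n. 0 \<le> x n \<and> x n < int (p ^ n) \<and> x (Suc n) mod int (p ^ n) = x n)"
 using prime_gt_0_nat[OF assms]
 by (auto simp: padic_carrier_def carrier_integer_mod_group PiE_def extensional_def Pi_def)

text \<open>Compactness is Tychonoff for finite discrete factors; \<open>padic_carrier p\<close> is
  closed in the product because each condition x(n+1) mod p^n = x(n) is the equalizer of two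
  continuous maps into a Hausdorff space.\<close>

lemma compact_Hausdorff_padic_topology:
 assumes "prime p"
 shows "compact_space (padic_topology p)" "Hausdorff_space (padic_topology p)"
proof -
 let ?D = "\<lambda>n. discrete_topology (carrier (integer_mod_group (p ^ n)))"
 let ?X = "product_topology ?D UNIV"
 have p0: "p ^ n \<noteq> 0" for n using prime_gt_0_nat[OF assms] by simp
 have comp: "compact_space ?X" using p0 by (auto simp: compact_space_product_topology compact_space_discrete_topology
    carrier_integer_mod_group)
 have haus: "Hausdorff_space ?X" by (auto simp: Hausdorff_space_product_topology)
 have cont: "continuous_map ?X (discrete_topology UNIV) (\<lambda>x. f (x n))" for n and f :: "int \<Rightarrow> int"
 proof -
  have 1: "continuous_map ?X (?D n) (\<lambda>x. x n)" by (rule continuous_map_product_projection) simp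
  have 2: "continuous_map (?D n) (discrete_topology UNIV) f" by simp
  show ?thesis using continuous_map_compose[OF 1 2] by (simp add: o_def)
 qed
 have H: "Hausdorff_space (discrete_topology (UNIV :: int set))" by simp
 have "closedin ?X {x \<in> topspace ?X. x (Suc n) mod int (p ^ n) = x n}" for n
  using closedin_continuous_maps_eq[OF H cont[of "\<lambda>z. z mod int (p ^ n)" "Suc n"]
    cont[of "\<lambda>z. z" n]] by simp
 then have "closedin ?X (\<Inter>n. {x \<in> topspace ?X. x (Suc n) mod int (p ^ n) = x n})"
  by (intro closedin_Inter) auto
 moreover have "(\<Inter>n. {x \<in> topspace ?X. x (Suc n) mod int (p ^ n) = x n}) = padic_carrier p"
  by (auto simp: padic_carrier_def)
 ultimately have "closedin ?X (padic_carrier p)" by simp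
 then show "compact_space (padic_topology p)" unfolding padic_topology_def
  by (intro compact_space_subtopology closedin_compact_space comp)
 show "Hausdorff_space (padic_topology p)"
  unfolding padic_topology_def by (rule Hausdorff_space_subtopology[OF haus])
qed

lemma compact_Hausdorff_ZP_topology:
 assumes "\<forall>p\<in>P. prime p"
 shows "compact_space (ZP_topology P)" "Hausdorff_space (ZP_topology P)" using assms compact_Hausdorff_padic_topology
 by (auto simp: ZP_topology_def compact_space_product_topology Hausdorff_space_product_topology)

lemma carrier_ZP: "carrier (ZP_group P) = (\<Pi>\<^sub>E p\<in>P. padic_carrier p)"
 by (simp add: ZP_group_def padic_group_def)

lemma ZP_mult_apply:
 "p \<in> P \<Longrightarrow> (x \<otimes>\<^bsub>ZP_group P\<^esub> y) p n = (x p n + y p n) mod int (p ^ n)"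
 by (simp add: ZP_group_def padic_group_def)

text \<open>The arithmetic of A is done in coordinates: \<open>f x p n\<close> is the residue modulo
  p^n of the p-component of x. Only the group isomorphism enters; the topology is handled
  separately.\<close>

locale ZP_iso =
 fixes P :: "nat set" and A :: "'w monoid" and f :: "'w \<Rightarrow> nat \<Rightarrow> nat \<Rightarrow> int"
 assumes primes: "\<forall>p\<in>P. prime p" and grp: "group A" and iso: "f \<in> iso A (ZP_group P)"
begin

interpretation group A by (rule grp)

lemma f_carrier: "x \<in> carrier A \<Longrightarrow> f x \<in> (\<Pi>\<^sub>E p\<in>P. padic_carrier p)"
 using iso by (auto simp: iso_def hom_def carrier_ZP)

lemma f_range:
 "x \<in> carrier A \<Longrightarrow> p \<in> P \<Longrightarrow> 0 \<le> f x p n \<and> f x p n < int (p ^ n)"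
 using f_carrier[of x] primes padic_carrier_iff[of p] by (auto simp: PiE_def Pi_def)

lemma f_compat:
 "x \<in> carrier A \<Longrightarrow> p \<in> P \<Longrightarrow> f x p (Suc n) mod int (p ^ n) = f x p n"
 using f_carrier[of x] primes padic_carrier_iff[of p] by (auto simp: PiE_def Pi_def)

lemma f_mult:
 "x \<in> carrier A \<Longrightarrow> y \<in> carrier A \<Longrightarrow> p \<in> P \<Longrightarrow>
  f (x \<otimes>\<^bsub>A\<^esub> y) p n = (f x p n + f y p n) mod int (p ^ n)"
 using iso by (auto simp: iso_def hom_mult ZP_mult_apply)

lemma f_eqI:
 assumes "x \<in> carrier A" "y \<in> carrier A" "\<And>p n. p \<in> P \<Longrightarrow> f x p n = f y p n"
 shows "x = y"
proof -
 have "f x = f y" using assms f_carrier[of x] f_carrier[of y] by (intro PiE_ext[of _ P padic_carrier]) auto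
 then show ?thesis using iso assms(1,2) by (auto simp: iso_def bij_betw_def inj_on_def)
qed

lemma f_surj:
 assumes "y \<in> (\<Pi>\<^sub>E p\<in>P. padic_carrier p)"
 obtains x where "x \<in> carrier A" "f x = y"
proof -
 have "y \<in> f ` carrier A" using iso assms by (simp add: iso_def bij_betw_def carrier_ZP)
 then show thesis using that by blast
qed

lemma commutative: "comm_group A"
proof (rule group_comm_groupI)
 fix x y assume "x \<in> carrier A" "y \<in> carrier A"
 then show "x \<otimes>\<^bsub>A\<^esub> y = y \<otimes>\<^bsub>A\<^esub> x"
  by (intro f_eqI) (auto simp: f_mult add.commute)
qed

lemma f_one: "p \<in> P \<Longrightarrow> f \<one>\<^bsub>A\<^esub> p n = 0"
proof -
 assume p: "p \<in> P"
 let ?z = "f \<one>\<^bsub>A\<^esub> p n"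
 have "?z = (?z + ?z) mod int (p ^ n)"
  using f_mult[of "\<one>\<^bsub>A\<^esub>" "\<one>\<^bsub>A\<^esub>" p n] p by simp
 then have "[?z = ?z + ?z] (mod int (p ^ n))"
  using f_range[of "\<one>\<^bsub>A\<^esub>" p n] p by (auto simp: cong_def)
 then have "[?z = 0] (mod int (p ^ n))" by (simp add: cong_iff_dvd_diff)
 then show "?z = 0" using f_range[of "\<one>\<^bsub>A\<^esub>" p n] p by (auto simp: cong_def)
qed

lemma f_pow:
 "x \<in> carrier A \<Longrightarrow> p \<in> P \<Longrightarrow> f (x [^]\<^bsub>A\<^esub> (k::nat)) p n = (int k * f x p n) mod int (p ^ n)"
proof (induction k)
 case 0
 then show ?case by (simp add: f_one)
next
 case (Suc k)
 then show ?case by (simp add: f_mult algebra_simps mod_add_left_eq mod_add_right_eq)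
qed

lemma f_compat': "x \<in> carrier A \<Longrightarrow> p \<in> P \<Longrightarrow> f x p (n + m) mod int (p ^ n) = f x p n"
proof (induction m)
 case 0
 then show ?case using f_range[of x p n] by simp
next
 case (Suc m)
 have "f x p (n + Suc m) mod int (p ^ n) = (f x p (n + Suc m) mod int (p ^ (n + m))) mod int (p ^ n)"
  by (simp add: mod_mod_cancel power_add)
 also have "\<dots> = f x p (n + m) mod int (p ^ n)" using f_compat[of x p "n + m"] Suc by simp
 finally show ?case using Suc by simp
qed

text \<open>Dividing a relation k x = 0 by p^e, the exact p-power in k, costs e digits, and the
  cofactor m is invertible modulo p^n. Hence digit n of x is computed from digit n + e.\<close>

lemma torsion_free:
 assumes x: "x \<in> carrier A" and k: "0 < (k::nat)" and eq: "x [^]\<^bsub>A\<^esub> k = \<one>\<^bsub>A\<^esub>"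
 shows "x = \<one>\<^bsub>A\<^esub>"
proof (rule f_eqI)
 fix p n assume p: "p \<in> P"
 have pp: "prime p" using primes p by auto
 define e where "e = multiplicity p k"
 obtain m where m: "k = p ^ e * m" "\<not> p dvd m"
  using multiplicity_decompose'[of k p] k pp prime_gt_1_nat[OF pp] unfolding e_def
  by (metis not_prime_unit not_gr_zero)
 have "(int k * f x p (n + e)) mod int (p ^ (n + e)) = 0" using f_pow[OF x p, of k "n + e"] eq f_one[OF p] by simp
 then have "int (p ^ (n + e)) dvd int (p ^ e) * (int m * f x p (n + e))" by (auto simp: m mult.assoc)
 then have "int (p ^ n) dvd int m * f x p (n + e)"
  using pp by (simp add: power_add mult.commute[of "int p ^ n"] prime_gt_0_nat)
 moreover have "coprime (int (p ^ n)) (int m)" using m(2) pp by (simp add: prime_imp_coprime)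
 ultimately have "int (p ^ n) dvd f x p (n + e)" using coprime_dvd_mult_right_iff by blast
 then have "f x p n = 0" using f_compat'[OF x p, of n e] by (simp add: mod_eq_0_iff_dvd)
 then show "f x p n = f \<one>\<^bsub>A\<^esub> p n" using f_one[OF p] by simp
qed (use x in auto)

text \<open>The witness is 1 in every component of Z_P: its residue modulo p is 1, while that of a
  p-th power is 0.\<close>

lemma not_divisible:
 assumes p: "p \<in> P"
 obtains x where "x \<in> carrier A" "\<And>y. y \<in> carrier A \<Longrightarrow> x \<noteq> y [^]\<^bsub>A\<^esub> p"
proof -
 have "(\<lambda>p\<in>P. \<lambda>n. 1 mod int (p ^ n)) \<in> (\<Pi>\<^sub>E p\<in>P. padic_carrier p)"
 proof (rule restrict_PiE_iff[THEN iffD2], rule ballI)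
  fix q assume "q \<in> P"
  then have "prime q" using primes by auto
  then show "(\<lambda>n. 1 mod int (q ^ n)) \<in> padic_carrier q"
   using prime_gt_0_nat[of q] by (auto simp: padic_carrier_iff mod_mod_cancel)
 qed
 then obtain x where x: "x \<in> carrier A" "f x = (\<lambda>p\<in>P. \<lambda>n. 1 mod int (p ^ n))"
  by (rule f_surj)
 have "x \<noteq> y [^]\<^bsub>A\<^esub> p" if "y \<in> carrier A" for y
 proof
  assume "x = y [^]\<^bsub>A\<^esub> p"
  then have "f x p 1 = 0" using f_pow[OF that p, of p 1] by simp
  moreover have "f x p 1 = 1" using p primes prime_gt_1_nat[of p] by (auto simp: x(2))
  ultimately show False by simp
 qed
 then show ?thesis using x(1) that by blast
qed

text \<open>For q outside P the equations q y = x modulo p^n have unique solutions. Existence gives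
  the digits of y, uniqueness makes the digits for n and n + 1 compatible.\<close>

lemma divisible:
 assumes q: "prime q" "q \<notin> P" and x: "x \<in> carrier A"
 obtains y where "y \<in> carrier A" "x = y [^]\<^bsub>A\<^esub> q"
proof -
 have cop: "coprime (int q) (int (p ^ n))" if "p \<in> P" for p n
  using that q primes by (metis coprime_int_iff coprime_power_right_iff primes_coprime)
 have ex: "\<exists>y. 0 \<le> y \<and> y < int (p ^ n) \<and> (int q * y) mod int (p ^ n) = f x p n" if p: "p \<in> P" for p n
 proof -
  obtain a where a: "[int q * a = 1] (mod int (p ^ n))" using cong_solve_coprime_int[OF cop[OF p]] by blast
  let ?y = "(a * f x p n) mod int (p ^ n)"
  have "[int q * ?y = int q * a * f x p n] (mod int (p ^ n))" by (simp add: cong_def mod_mult_right_eq mult.assoc)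
  also have "[int q * a * f x p n = 1 * f x p n] (mod int (p ^ n))" by (rule cong_mult[OF a cong_refl])
  finally have "(int q * ?y) mod int (p ^ n) = f x p n" using f_range[OF x p, of n] by (simp add: cong_def)
  moreover have "0 < int (p ^ n)" using p primes prime_gt_0_nat[of p] by auto
  ultimately show ?thesis by (intro exI[of _ ?y]) auto
 qed
 define y where "y p n = (SOME y. 0 \<le> y \<and> y < int (p ^ n) \<and> (int q * y) mod int (p ^ n) = f x p n)" for p n
 have y: "0 \<le> y p n \<and> y p n < int (p ^ n) \<and> (int q * y p n) mod int (p ^ n) = f x p n"
  if "p \<in> P" for p n unfolding y_def by (rule someI_ex[OF ex[OF that]])
 have "y p (Suc n) mod int (p ^ n) = y p n" if p: "p \<in> P" for p n
 proof -
  have "[int q * y p (Suc n) = f x p (Suc n)] (mod int (p ^ n))" using y[OF p, of "Suc n"]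
   by (metis cong_def mod_mod_cancel power_Suc2 of_nat_mult dvd_triv_left)
  also have "[f x p (Suc n) = f x p n] (mod int (p ^ n))"
   using f_compat[OF x p, of n] by (simp add: cong_def) (metis mod_mod_trivial)
  also have "[f x p n = int q * y p n] (mod int (p ^ n))" using y[OF p, of n] by (metis cong_def mod_mod_trivial)
  finally have "[y p (Suc n) = y p n] (mod int (p ^ n))" using cong_mult_lcancel[OF cop[OF p]] by blast
  then show ?thesis using y[OF p, of n] by (simp add: cong_def)
 qed
 then have "(\<lambda>p\<in>P. y p) \<in> (\<Pi>\<^sub>E p\<in>P. padic_carrier p)"
  using y primes by (auto simp: restrict_PiE_iff padic_carrier_iff)
 then obtain z where z: "z \<in> carrier A" "f z = (\<lambda>p\<in>P. y p)" by (rule f_surj)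
 have "x = z [^]\<^bsub>A\<^esub> q"
 proof (rule f_eqI)
  fix p n assume p: "p \<in> P"
  show "f x p n = f (z [^]\<^bsub>A\<^esub> q) p n" using y[OF p, of n] p by (simp add: f_pow[OF z(1) p] z(2))
 qed (use x z in auto)
 then show ?thesis using z(1) that by blast
qed

end

section \<open>Topological groups\<close>

lemma (in group) pow_normal_index:
 assumes "N \<lhd> G" "x \<in> carrier G"
 shows "x [^] card (rcosets N) \<in> N"
proof -
 interpret N: normal N G by fact
 interpret Q: group "G Mod N" by (rule N.factorgroup_is_group)
 have "(N #> x) [^]\<^bsub>G Mod N\<^esub> order (G Mod N) = \<one>\<^bsub>G Mod N\<^esub>"
  by (rule Q.pow_order_eq_1) (auto simp: carrier_FactGroup assms)
 then have "N #> (x [^] order (G Mod N)) = N" using N.FactGroup_pow[OF assms(2)] by simp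
 then have "x [^] order (G Mod N) \<in> N"
  using rcos_self[of "x [^] order (G Mod N)" N] assms N.subgroup_axioms by auto
 moreover have "order (G Mod N) = card (rcosets N)" by (simp add: order_def FactGroup_def)
 ultimately show ?thesis by simp
qed

locale topological_group = group G for G :: "'a monoid" (structure) +
 fixes T :: "'a topology"
 assumes top_group: "top_group G T"
begin

lemma topspace_carrier [simp]: "topspace T = carrier G" using top_group by (simp add: top_group_def)

lemma continuous_mult:
 assumes "continuous_map X T f" "continuous_map X T g"
 shows "continuous_map X T (\<lambda>x. f x \<otimes> g x)"
proof -
 have "continuous_map (prod_topology T T) T (\<lambda>(x, y). x \<otimes> y)"
  using top_group by (simp add: top_group_def)
 moreover have "continuous_map X (prod_topology T T) (\<lambda>x. (f x, g x))"
  using assms by (simp add: continuous_map_pairwise o_def)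
 ultimately have "continuous_map X T ((\<lambda>(x, y). x \<otimes> y) \<circ> (\<lambda>x. (f x, g x)))"
  by (intro continuous_map_compose)
 then show ?thesis by (simp add: o_def)
qed

lemma continuous_inv: "continuous_map T T (\<lambda>x. inv x)" using top_group by (simp add: top_group_def)

lemma continuous_const: "c \<in> carrier G \<Longrightarrow> continuous_map X T (\<lambda>x. c)" by simp

lemma continuous_pow: "continuous_map T T (\<lambda>x. x [^] (n::nat))"
proof (induction n)
 case 0
 then show ?case by (simp add: continuous_map_const)
next
 case (Suc n)
 then show ?case using continuous_mult[OF Suc continuous_map_id] by (simp add: id_def)
qed

lemma subgroup_closure:
 assumes "subgroup S G"
 shows "subgroup (T closure_of S) G"
proof (rule subgroupI)
 interpret S: subgroup S G by fact
 have sub: "S \<subseteq> T closure_of S" by (simp add: closure_of_subset S.subset)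
 show "T closure_of S \<subseteq> carrier G" using closure_of_subset_topspace[of T S] by simp
 show "T closure_of S \<noteq> {}" using sub S.one_closed by blast
 show "inv a \<in> T closure_of S" if "a \<in> T closure_of S" for a
 proof -
  have "inv a \<in> T closure_of ((\<lambda>x. inv x) ` S)"
   using continuous_map_image_closure_subset[OF continuous_inv, of S] that by blast
  moreover have "(\<lambda>x. inv x) ` S \<subseteq> S" by auto
  ultimately show ?thesis using closure_of_mono by blast
 qed
 show "a \<otimes> b \<in> T closure_of S" if "a \<in> T closure_of S" "b \<in> T closure_of S" for a b
 proof -
  have c: "continuous_map (prod_topology T T) T (\<lambda>(x, y). x \<otimes> y)"
   using top_group by (simp add: top_group_def)
  have "(a, b) \<in> prod_topology T T closure_of (S \<times> S)" using that by (simp add: closure_of_Times)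
  then have "a \<otimes> b \<in> T closure_of ((\<lambda>(x, y). x \<otimes> y) ` (S \<times> S))"
   using continuous_map_image_closure_subset[OF c, of "S \<times> S"] by blast
  moreover have "(\<lambda>(x, y). x \<otimes> y) ` (S \<times> S) \<subseteq> S" by auto
  ultimately show ?thesis using closure_of_mono by blast
 qed
qed

lemma openin_right_translate:
 assumes "openin T N" "g \<in> carrier G"
 shows "openin T {x \<in> carrier G. x \<div> g \<in> N}"
proof -
 have "continuous_map T T (\<lambda>x. x \<div> g)"
  using assms by (intro continuous_mult continuous_const continuous_map_id[unfolded id_def]) auto
 then show ?thesis using openin_continuous_map_preimage[OF _ assms(1), of T "\<lambda>x. x \<div> g"] by simp
qed

lemma openin_rcoset:
 assumes "openin T N" "subgroup N G" "g \<in> carrier G"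
 shows "openin T (N #> g)"
proof -
 interpret N: subgroup N G by fact
 have "N #> g = {x \<in> carrier G. x \<div> g \<in> N}"
  using assms(3) N.rcos_module[OF is_group assms(3)] N.elemrcos_carrier[OF is_group assms(3)] by blast
 then show ?thesis using openin_right_translate[OF assms(1,3)] by simp
qed

text \<open>The cosets of an open subgroup form an open partition, which has no proper subcover;
  compactness therefore bounds their number.\<close>

lemma compact_open_subgroup_finite_index:
 assumes "compact_space T" "openin T N" "subgroup N G"
 shows "finite (rcosets N)"
proof -
 interpret N: subgroup N G by fact
 have un: "\<Union>(rcosets N) = carrier G" using rcosets_part_G[OF assms(3)] .
 have "\<forall>c\<in>rcosets N. openin T c" using openin_rcoset[OF assms(2,3)] by (auto simp: RCOSETS_def)
 moreover have "compactin T (carrier G)" using assms(1) by (simp add: compact_space_def)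
 ultimately obtain F where F: "finite F" "F \<subseteq> rcosets N" "carrier G \<subseteq> \<Union>F"
  using un unfolding compactin_def by (metis order_refl)
 have "rcosets N \<subseteq> F"
 proof
  fix c assume c: "c \<in> rcosets N"
  then obtain x where x: "x \<in> c" "x \<in> carrier G" using N.rcosets_non_empty[OF c] un by blast
  then obtain e where "e \<in> F" "x \<in> e" using F(3) by blast
  moreover have "e = c"
   using rcos_disjoint[OF assms(3)] c x(1) F(2) \<open>e \<in> F\<close> \<open>x \<in> e\<close>
   by (metis disjnt_iff pairwiseD subsetD)
  ultimately show "c \<in> F" by simp
 qed
 then show ?thesis using F(1) finite_subset by blast
qed

end

text \<open>\<open>profinite_group\<close> is defined by total disconnectedness, while the later
  arguments use small open normal subgroups. A clopen neighbourhood K of 1 inside V is found first;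
  then N consists of all x whose insertion anywhere into a product does not change membership in
  K.\<close>

lemma (in topological_group) profinite_open_normal:
 assumes comp: "compact_space T" and haus: "Hausdorff_space T"
  and dis: "\<forall>S. connectedin T S \<longrightarrow> (\<exists>a. S \<subseteq> {a})"
  and V: "openin T V" "\<one> \<in> V"
 obtains N where "N \<lhd> G" "openin T N" "N \<subseteq> V"
proof -
 \<comment> \<open>In a compact Hausdorff space quasi-components are the components, hence points
   here; so a point outside V is separated from 1 by a clopen set.\<close>
 have qc: "quasi_components_of T = connected_components_of T"
  using quasi_eq_connected_components_of comp haus by blast
 have ex: "\<exists>K. openin T K \<and> closedin T K \<and> \<one> \<in> K \<and> x \<notin> K" if x: "x \<in> carrier G - V" for x
 proof (rule ccontr)
  assume neg: "\<not> ?thesis"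
  have "quasi_component_of T \<one> x" unfolding quasi_component_of using x neg by auto
  moreover have "quasi_component_of_set T \<one> \<in> connected_components_of T"
   using qc quasi_component_in_quasi_components_of[of T \<one>] by simp
  then have "connectedin T (quasi_component_of_set T \<one>)" by (rule connectedin_connected_components_of)
  then obtain a where "quasi_component_of_set T \<one> \<subseteq> {a}" using dis by blast
  moreover have "quasi_component_of T \<one> \<one>" by simp
  ultimately have "x = \<one>" by blast
  then show False using x V by blast
 qed
 define \<K> where "\<K> = {K. openin T K \<and> closedin T K \<and> \<one> \<in> K}"
 have "compactin T (carrier G - V)"
  using comp V(1) by (metis closedin_compact_space closedin_diff closedin_topspace topspace_carrier)
 moreover have "\<forall>U\<in>(\<lambda>K. carrier G - K) ` \<K>. openin T U"
  unfolding \<K>_def using openin_diff[of T "carrier G"] openin_topspace[of T] by auto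
 moreover have "carrier G - V \<subseteq> \<Union>((\<lambda>K. carrier G - K) ` \<K>)"
  using ex unfolding \<K>_def by blast
 ultimately obtain F where F: "finite F" "F \<subseteq> (\<lambda>K. carrier G - K) ` \<K>" "carrier G - V \<subseteq> \<Union>F"
  unfolding compactin_def by metis
 then obtain F' where F': "finite F'" "F' \<subseteq> \<K>" "F = (\<lambda>K. carrier G - K) ` F'"
  by (metis finite_subset_image)
 define K where "K = carrier G \<inter> \<Inter>F'"
 have Ko: "openin T K" and Kc: "closedin T K"
 proof -
  have "openin T (\<Inter>(insert (carrier G) F'))"
   using F' openin_topspace[of T] unfolding \<K>_def by (intro openin_Inter) auto
  then show "openin T K" by (simp add: K_def)
  have "closedin T (\<Inter>(insert (carrier G) F'))"
   using F' closedin_topspace[of T] unfolding \<K>_def by (intro closedin_Inter) auto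
  then show "closedin T K" by (simp add: K_def)
 qed
 have K1: "\<one> \<in> K" and KO: "K \<subseteq> V" using F' F(3) unfolding K_def \<K>_def by blast+
 have Kcar: "K \<subseteq> carrier G" unfolding K_def by blast
 \<comment> \<open>The kernel of the two-sided syntactic congruence of K: a normal subgroup for
   purely formal reasons, and contained in K because 1 lies in K (take a = b = 1).\<close>
 define N where "N = {x \<in> carrier G. \<forall>a\<in>carrier G. \<forall>b\<in>carrier G. a \<otimes> x \<otimes> b \<in> K \<longleftrightarrow> a \<otimes> b \<in> K}"
 have "subgroup N G"
 proof (rule subgroupI)
  show "N \<subseteq> carrier G" "N \<noteq> {}" unfolding N_def by auto
  show "inv x \<in> N" if x: "x \<in> N" for x unfolding N_def
  proof (safe intro!: inv_closed)
   have xc: "x \<in> carrier G" using x N_def by auto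
   fix a b assume ab: "a \<in> carrier G" "b \<in> carrier G"
   have "a \<otimes> x \<otimes> (inv x \<otimes> b) \<in> K \<longleftrightarrow> a \<otimes> (inv x \<otimes> b) \<in> K"
    using x ab xc unfolding N_def by blast
   moreover have "a \<otimes> x \<otimes> (inv x \<otimes> b) = a \<otimes> b"
    using ab xc by (metis inv_closed inv_solve_left m_assoc m_closed)
   moreover have "a \<otimes> (inv x \<otimes> b) = a \<div> x \<otimes> b" using ab xc by (simp add: m_assoc)
   ultimately show "a \<div> x \<otimes> b \<in> K \<Longrightarrow> a \<otimes> b \<in> K" "a \<otimes> b \<in> K \<Longrightarrow> a \<div> x \<otimes> b \<in> K"
    by auto
  qed (use x N_def in auto)
  show "x \<otimes> y \<in> N" if x: "x \<in> N" and y: "y \<in> N" for x y unfolding N_def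
  proof (safe)
   have xc: "x \<in> carrier G" "y \<in> carrier G" using x y N_def by auto
   then show "x \<otimes> y \<in> carrier G" by simp
   fix a b assume ab: "a \<in> carrier G" "b \<in> carrier G"
   have "a \<otimes> x \<otimes> y \<otimes> b \<in> K \<longleftrightarrow> a \<otimes> x \<otimes> b \<in> K" "a \<otimes> x \<otimes> b \<in> K \<longleftrightarrow> a \<otimes> b \<in> K"
    using x y ab xc unfolding N_def by auto
   moreover have "a \<otimes> x \<otimes> y \<otimes> b = a \<otimes> (x \<otimes> y) \<otimes> b" using ab xc by (simp add: m_assoc)
   ultimately show "a \<otimes> (x \<otimes> y) \<otimes> b \<in> K \<Longrightarrow> a \<otimes> b \<in> K" "a \<otimes> b \<in> K \<Longrightarrow> a \<otimes> (x \<otimes> y) \<otimes> b \<in> K"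
    by auto
  qed
 qed
 moreover have "g \<otimes> x \<div> g \<in> N" if g: "g \<in> carrier G" and x: "x \<in> N" for g x unfolding N_def
 proof (safe)
  have xc: "x \<in> carrier G" using x N_def by auto
  then show "g \<otimes> x \<div> g \<in> carrier G" using g by simp
  fix a b assume ab: "a \<in> carrier G" "b \<in> carrier G"
  have "a \<otimes> g \<otimes> x \<otimes> (inv g \<otimes> b) \<in> K \<longleftrightarrow> a \<otimes> g \<otimes> (inv g \<otimes> b) \<in> K"
   using x ab g unfolding N_def by blast
  moreover have "a \<otimes> g \<otimes> (inv g \<otimes> b) = a \<otimes> b"
   using ab g by (metis inv_closed inv_solve_left m_assoc m_closed)
  moreover have "a \<otimes> (g \<otimes> x \<div> g) \<otimes> b = a \<otimes> g \<otimes> x \<otimes> (inv g \<otimes> b)"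
   using ab xc g by (simp add: m_assoc)
  ultimately show "a \<otimes> (g \<otimes> x \<div> g) \<otimes> b \<in> K \<Longrightarrow> a \<otimes> b \<in> K"
    "a \<otimes> b \<in> K \<Longrightarrow> a \<otimes> (g \<otimes> x \<div> g) \<otimes> b \<in> K" by auto
 qed
 ultimately have "N \<lhd> G" by (simp add: normal_inv_iff)
 moreover have "N \<subseteq> V"
 proof
  fix x assume "x \<in> N"
  then have "\<one> \<otimes> x \<otimes> \<one> \<in> K \<longleftrightarrow> \<one> \<otimes> \<one> \<in> K" "x \<in> carrier G" unfolding N_def by blast+
  then show "x \<in> V" using K1 KO by auto
 qed
 moreover have "openin T N"
 proof -
  let ?X = "prod_topology (prod_topology T T) T"
  let ?f = "\<lambda>z. fst (fst z) \<otimes> snd z \<otimes> snd (fst z)"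
  let ?g = "\<lambda>z. fst (fst z) \<otimes> snd (fst z)"
  have p: "continuous_map ?X T (\<lambda>z. fst (fst z))" "continuous_map ?X T (\<lambda>z. snd (fst z))"
    "continuous_map ?X T (\<lambda>z. snd z)"
   using continuous_map_compose[OF continuous_map_fst continuous_map_fst, of T T T]
    continuous_map_compose[OF continuous_map_fst continuous_map_snd, of T T T]
    continuous_map_snd[of "prod_topology T T" T] by (simp_all add: o_def)
  have f: "continuous_map ?X T ?f" and g: "continuous_map ?X T ?g" by (intro continuous_mult p)+
  let ?A = "{z \<in> topspace ?X. ?f z \<in> K}" and ?B = "{z \<in> topspace ?X. ?g z \<in> K}"
  have "closedin ?X ?A" "openin ?X ?A" "closedin ?X ?B" "openin ?X ?B"
   using closedin_continuous_map_preimage[OF f Kc] openin_continuous_map_preimage[OF f Ko]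
    closedin_continuous_map_preimage[OF g Kc] openin_continuous_map_preimage[OF g Ko] by auto
  \<comment> \<open>The triples (a, b, x) witnessing that x is not in N form a closed set;
    projection along the compact factor of the pairs (a, b) is a closed map, so the complement of N
    is closed.\<close>
  then have "closedin ?X ((?A - ?B) \<union> (?B - ?A))" by (intro closedin_Un closedin_diff)
  moreover have "compact_space (prod_topology T T)" using comp by (simp add: compact_space_prod_topology)
  ultimately have "closedin T (snd ` ((?A - ?B) \<union> (?B - ?A)))"
   using closed_map_snd[of "prod_topology T T" T] unfolding closed_map_def by blast
  then have "openin T (carrier G - snd ` ((?A - ?B) \<union> (?B - ?A)))"
   using openin_diff[OF openin_topspace, of T] by simp
  moreover have "carrier G - snd ` ((?A - ?B) \<union> (?B - ?A)) = N"
  proof -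
   have "x \<in> snd ` ((?A - ?B) \<union> (?B - ?A)) \<longleftrightarrow> x \<notin> N" if x: "x \<in> carrier G" for x
   proof
    assume "x \<in> snd ` ((?A - ?B) \<union> (?B - ?A))"
    then show "x \<notin> N" unfolding N_def by force
   next
    assume "x \<notin> N"
    then obtain a b where ab: "a \<in> carrier G" "b \<in> carrier G" "(a \<otimes> x \<otimes> b \<in> K) \<noteq> (a \<otimes> b \<in> K)"
     using x unfolding N_def by blast
    then have "((a, b), x) \<in> (?A - ?B) \<union> (?B - ?A)" using x by auto
    then show "x \<in> snd ` ((?A - ?B) \<union> (?B - ?A))" by force
   qed
   then show ?thesis unfolding N_def by blast
  qed
  ultimately show ?thesis by simp
 qed
 ultimately show thesis using that by blast
qed

section \<open>The degree map of a pro-\<open>P\<close> group\<close>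

locale pro_P_degree =
 fixes P :: "nat set"
  and G :: "'g monoid" (structure) and T :: "'g topology"
  and \<Omega> :: "'w monoid" and TO :: "'w topology" and \<omega> :: 'w
  and d :: "'g \<Rightarrow> 'w"
 assumes primes: "\<forall>p\<in>P. prime p"
  and pro_P: "pro_P_group P G T"
  and top_Omega: "top_group \<Omega> TO"
  and Omega_ZP: "\<exists>\<iota>. \<iota> \<in> iso \<Omega> (ZP_group P) \<and> homeomorphic_map TO (ZP_topology P) \<iota>"
  and omega_gen: "top_generator \<Omega> TO \<omega>"
  and d_top_hom: "d \<in> top_hom G T \<Omega> TO" and d_surj: "d ` carrier G = carrier \<Omega>"
begin

abbreviation Omega_pow (infixr "\<up>" 75) where "w \<up> n \<equiv> w [^]\<^bsub>\<Omega>\<^esub> n"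
abbreviation Omega_mult (infixl "\<cdot>" 70) where "x \<cdot> y \<equiv> x \<otimes>\<^bsub>\<Omega>\<^esub> y"

lemma profinite: "profinite_group G T" using pro_P by (simp add: pro_P_group_def)

sublocale G: topological_group G T
 using profinite by (simp add: profinite_group_def top_group_def topological_group_def
   topological_group_axioms_def)

sublocale Og: topological_group \<Omega> TO
 using top_Omega by (simp add: top_group_def topological_group_def topological_group_axioms_def)

lemma compact_G: "compact_space T" and Hausdorff_G: "Hausdorff_space T"
 using profinite by (auto simp: profinite_group_def)

sublocale Og: comm_group \<Omega>
proof -
 obtain \<iota> where "\<iota> \<in> iso \<Omega> (ZP_group P)" using Omega_ZP by blast
 then interpret ZP_iso P \<Omega> \<iota> by unfold_locales (use primes Og.is_group in auto)
 show "comm_group \<Omega>" by (rule commutative)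
qed

lemma Omega_torsion_free: "x \<in> carrier \<Omega> \<Longrightarrow> 0 < (k::nat) \<Longrightarrow> x \<up> k = \<one>\<^bsub>\<Omega>\<^esub> \<Longrightarrow> x = \<one>\<^bsub>\<Omega>\<^esub>"
 and Omega_not_divisible: "p \<in> P \<Longrightarrow> \<exists>x\<in>carrier \<Omega>. \<forall>y\<in>carrier \<Omega>. x \<noteq> y \<up> p"
 and Omega_divisible: "prime q \<Longrightarrow> q \<notin> P \<Longrightarrow> x \<in> carrier \<Omega> \<Longrightarrow> \<exists>y\<in>carrier \<Omega>. x = y \<up> q"
proof -
 obtain \<iota> where "\<iota> \<in> iso \<Omega> (ZP_group P)" using Omega_ZP by blast
 then interpret ZP_iso P \<Omega> \<iota> by unfold_locales (use primes Og.is_group in auto)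
 show "x \<in> carrier \<Omega> \<Longrightarrow> 0 < (k::nat) \<Longrightarrow> x \<up> k = \<one>\<^bsub>\<Omega>\<^esub> \<Longrightarrow> x = \<one>\<^bsub>\<Omega>\<^esub>"
  by (rule torsion_free)
 show "p \<in> P \<Longrightarrow> \<exists>x\<in>carrier \<Omega>. \<forall>y\<in>carrier \<Omega>. x \<noteq> y \<up> p"
  by (metis not_divisible)
 show "prime q \<Longrightarrow> q \<notin> P \<Longrightarrow> x \<in> carrier \<Omega> \<Longrightarrow> \<exists>y\<in>carrier \<Omega>. x = y \<up> q"
  by (metis divisible)
qed

lemma compact_Omega: "compact_space TO" and Hausdorff_Omega: "Hausdorff_space TO"
proof -
 obtain \<iota> where "homeomorphic_map TO (ZP_topology P) \<iota>" using Omega_ZP by blast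
 then have "TO homeomorphic_space ZP_topology P" by (rule homeomorphic_map_imp_homeomorphic_space)
 then show "compact_space TO" "Hausdorff_space TO"
  using compact_Hausdorff_ZP_topology[OF primes] homeomorphic_compact_space
   homeomorphic_Hausdorff_space by blast+
qed

lemma omega_carrier [simp]: "\<omega> \<in> carrier \<Omega>"
 and omega_closure: "TO closure_of (generate \<Omega> {\<omega>}) = carrier \<Omega>"
 using omega_gen by (auto simp: top_generator_def)

lemma d_hom: "d \<in> hom G \<Omega>" and d_continuous: "continuous_map T TO d"
 using d_top_hom by (auto simp: top_hom_def)

sublocale d: group_hom G \<Omega> d using d_hom by (simp add: group_hom_def group_hom_axioms_def)

section \<open>The subgroups n\<Omega> and the powers of \<omega> in them\<close>

definition Om :: "nat \<Rightarrow> 'w set" where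
 "Om n = (\<lambda>w. w \<up> n) ` carrier \<Omega>"

text \<open>Indices of open normal subgroups of G are of this kind. On such n the map
  \<open>Om\<close> is injective, while a general n enters only through its P-part.\<close>

definition Pnum :: "nat \<Rightarrow> bool" where
 "Pnum n \<longleftrightarrow> 0 < n \<and> (\<forall>p. prime p \<longrightarrow> p dvd n \<longrightarrow> p \<in> P)"

lemma Pnum_pos: "Pnum n \<Longrightarrow> 0 < n" by (simp add: Pnum_def)

lemma Pnum_mult: "Pnum m \<Longrightarrow> Pnum n \<Longrightarrow> Pnum (m * n)"
 by (auto simp: Pnum_def prime_dvd_mult_iff)

lemma Pnum_dvd: "Pnum m \<Longrightarrow> n dvd m \<Longrightarrow> Pnum n"
 by (auto simp: Pnum_def intro: dvd_trans dest: dvd_pos_nat)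

lemma Pnum_1 [simp]: "Pnum 1" "Pnum (Suc 0)" by (auto simp: Pnum_def)

lemma Om_subset: "Om n \<subseteq> carrier \<Omega>" by (auto simp: Om_def)

lemma Om_subgroup: "subgroup (Om n) \<Omega>"
proof (rule Og.subgroupI)
 show "Om n \<noteq> {}" by (auto simp: Om_def)
 show "inv\<^bsub>\<Omega>\<^esub> a \<in> Om n" if a: "a \<in> Om n" for a
 proof -
  obtain w where "w \<in> carrier \<Omega>" "a = w \<up> n" using a by (auto simp: Om_def)
  then show ?thesis using Og.nat_pow_inv[of w n] by (auto simp: Om_def intro!: image_eqI[of _ _ "inv\<^bsub>\<Omega>\<^esub> w"])
 qed
 show "a \<cdot> b \<in> Om n" if ab: "a \<in> Om n" "b \<in> Om n" for a b
 proof -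
  obtain x y where "x \<in> carrier \<Omega>" "a = x \<up> n" "y \<in> carrier \<Omega>" "b = y \<up> n"
   using ab by (auto simp: Om_def)
  then show ?thesis using Og.nat_pow_distrib[of x y n]
   by (auto simp: Om_def intro!: image_eqI[of _ _ "x \<cdot> y"])
 qed
qed (rule Om_subset)

lemma Om_1 [simp]: "Om 1 = carrier \<Omega>" "Om (Suc 0) = carrier \<Omega>" by (force simp: Om_def image_iff)+

lemma Om_dvd: "m dvd n \<Longrightarrow> Om n \<subseteq> Om m"
proof
 fix x assume "m dvd n" "x \<in> Om n"
 then obtain k w where "n = m * k" "w \<in> carrier \<Omega>" "x = w \<up> n" by (auto simp: Om_def dvd_def)
 then have "x = (w \<up> k) \<up> m" by (simp add: Og.nat_pow_pow mult.commute)
 then show "x \<in> Om m" using \<open>w \<in> carrier \<Omega>\<close> by (auto simp: Om_def)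
qed

lemma pow_in_Om: "w \<in> carrier \<Omega> \<Longrightarrow> m dvd n \<Longrightarrow> w \<up> n \<in> Om m"
 using Om_dvd[of m n] by (auto simp: Om_def)

lemma Omega_pow_inj:
 assumes "x \<in> carrier \<Omega>" "y \<in> carrier \<Omega>" "0 < (k::nat)" "x \<up> k = y \<up> k"
 shows "x = y"
proof -
 have "(x \<cdot> inv\<^bsub>\<Omega>\<^esub> y) \<up> k = \<one>\<^bsub>\<Omega>\<^esub>"
  using assms by (simp add: Og.nat_pow_distrib Og.nat_pow_inv)
 then have "x \<cdot> inv\<^bsub>\<Omega>\<^esub> y = \<one>\<^bsub>\<Omega>\<^esub>"
  using assms Omega_torsion_free by simp
 then show ?thesis using assms Og.inv_equality Og.inv_inv by fastforce
qed

lemma Om_compact: "compactin TO ((\<lambda>z. w \<cdot> z) ` Om n)" if "w \<in> carrier \<Omega>"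
proof -
 have "continuous_map TO TO (\<lambda>z. w \<cdot> z \<up> (n::nat))"
  by (intro Og.continuous_mult Og.continuous_const Og.continuous_pow that)
 then have "compactin TO ((\<lambda>z. w \<cdot> z \<up> n) ` carrier \<Omega>)"
  using compact_Omega image_compactin unfolding compact_space_def by fastforce
 then show ?thesis by (simp add: Om_def image_image)
qed

lemma Om_coset_closed: "closedin TO ((\<lambda>z. w \<cdot> z) ` Om n)" if "w \<in> carrier \<Omega>"
 using Om_compact[OF that] Hausdorff_Omega compactin_imp_closedin by blast

lemma Om_closed: "closedin TO (Om n)"
proof -
 have "(\<lambda>z. \<one>\<^bsub>\<Omega>\<^esub> \<cdot> z) ` Om n = Om n" using Om_subset by force
 then show ?thesis using Om_coset_closed[of "\<one>\<^bsub>\<Omega>\<^esub>" n] by simp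
qed

text \<open>Division with remainder by n in \<Omega>: the finitely many cosets of n\<Omega> through
  powers of \<omega> are closed, being compact images, and cover the dense subgroup generated by
  \<omega>.\<close>

lemma omega_split:
 assumes w: "w \<in> carrier \<Omega>" and n: "0 < (n::nat)"
 obtains j :: nat and z where "j < n" "z \<in> carrier \<Omega>" "w = \<omega> \<up> j \<cdot> z \<up> n"
proof -
 let ?Z = "\<Union>j\<in>{..<n}. (\<lambda>z. \<omega> \<up> j \<cdot> z) ` Om n"
 have "closedin TO ?Z" by (intro closedin_Union) (auto intro: Om_coset_closed)
 moreover have "generate \<Omega> {\<omega>} \<subseteq> ?Z"
 proof
  fix x assume "x \<in> generate \<Omega> {\<omega>}"
  then obtain k :: int where k: "x = \<omega> \<up> k" using Og.generate_pow[of \<omega>] by auto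
  define j where "j = nat (k mod int n)"
  have j: "j < n" "k = int j + (k div int n) * int n" using n by (auto simp: j_def nat_less_iff)
  have "x = \<omega> \<up> (int j) \<cdot> \<omega> \<up> ((k div int n) * int n)"
   using k j(2) by (metis Og.int_pow_mult omega_carrier)
  also have "\<omega> \<up> ((k div int n) * int n) = (\<omega> \<up> (k div int n)) \<up> n"
   by (metis Og.int_pow_pow int_pow_int omega_carrier)
  finally have "x = \<omega> \<up> j \<cdot> (\<omega> \<up> (k div int n)) \<up> n" by (simp add: int_pow_int)
  moreover have "(\<omega> \<up> (k div int n)) \<up> n \<in> Om n" by (auto simp: Om_def)
  ultimately show "x \<in> ?Z" using j(1) by blast
 qed
 ultimately have "carrier \<Omega> \<subseteq> ?Z" using closure_of_minimal omega_closure by metis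
 then show thesis using w that by (auto simp: Om_def)
qed

text \<open>Otherwise the closed subgroup p\<Omega> would contain the topological generator and be
  everything, against \<open>Omega_not_divisible\<close>.\<close>

lemma omega_not_in_Om:
 assumes "p \<in> P" shows "\<omega> \<notin> Om p"
proof
 assume "\<omega> \<in> Om p"
 then have "generate \<Omega> {\<omega>} \<subseteq> Om p" using Og.generate_subgroup_incl[OF _ Om_subgroup] by simp
 then have "carrier \<Omega> \<subseteq> Om p" using closure_of_minimal[OF _ Om_closed] omega_closure by metis
 then show False using Omega_not_divisible[OF assms] by (auto simp: Om_def)
qed

text \<open>Amounts to injectivity of Z/b into \<Omega>/b\<Omega>. With g = gcd(b, j),
  torsion-freeness cancels g; a prime p dividing b/g would then make \<omega> itself a p-th
  power.\<close>

lemma omega_int_in_Om: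
 assumes b: "Pnum b" and j: "\<omega> \<up> (j::int) \<in> Om b"
 shows "int b dvd j"
proof (cases "j = 0")
 case False
 define g where "g = gcd (int b) j"
 have g0: "g > 0" using b by (simp add: g_def Pnum_def)
 obtain b' j' where bj: "int b = g * b'" "j = g * j'" "coprime b' j'"
 proof -
  have "coprime (int b div g) (j div g)" using b unfolding g_def by (intro div_gcd_coprime) (auto simp: Pnum_def)
  then show thesis using that[of "int b div g" "j div g"] by (simp add: g_def)
 qed
 have b'0: "b' > 0" using b g0 bj(1) by (metis Pnum_pos of_nat_0_less_iff zero_less_mult_pos)
 obtain z where z: "z \<in> carrier \<Omega>" "\<omega> \<up> j = z \<up> b" using j by (auto simp: Om_def)
 have "(\<omega> \<up> j') \<up> (nat g) = (z \<up> b') \<up> (nat g)"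
 proof -
  have "(\<omega> \<up> j') \<up> (int (nat g)) = \<omega> \<up> j"
   using g0 bj by (simp add: Og.int_pow_pow mult.commute)
  moreover have "(z \<up> b') \<up> (int (nat g)) = z \<up> int b"
   using g0 bj(1) z(1) by (simp add: Og.int_pow_pow mult.commute)
  ultimately have "(\<omega> \<up> j') \<up> (int (nat g)) = (z \<up> b') \<up> (int (nat g))"
   using z(2) by (simp only: int_pow_int)
  then show ?thesis by (simp only: int_pow_int)
 qed
 then have eq: "\<omega> \<up> j' = z \<up> b'"
  using Omega_pow_inj[of "\<omega> \<up> j'" "z \<up> b'" "nat g"] z(1) g0 by simp
 have "b' = 1"
 proof (rule ccontr)
  assume "b' \<noteq> 1"
  then have "nat b' \<noteq> 1" using b'0 by simp
  then obtain p where p: "prime p" "p dvd nat b'" using prime_factor_nat by blast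
  have pb: "int p dvd b'" using p(2) b'0 by (metis int_dvd_int_iff int_nat_eq order_less_imp_le)
  then have "int p dvd int b" using bj(1) by simp
  then have pP: "p \<in> P" using b p(1) by (simp add: Pnum_def)
  have "coprime (int p) j'" using pb bj(3) by (metis coprime_divisors dvd_refl)
  then obtain s t where st: "s * int p + t * j' = 1" using bezout_int[of "int p" j'] by auto
  obtain c where c: "b' = int p * c" using pb by blast
  \<comment> \<open>Bezout for the coprime numbers p and j'. Both factors are p-th powers, the
    second because \<omega>^j' = z^b' and p divides b'.\<close>
  have "\<omega> = \<omega> \<up> (s * int p + t * j')" using st by simp
  also have "\<dots> = \<omega> \<up> (s * int p) \<cdot> \<omega> \<up> (j' * t)"
   by (simp add: Og.int_pow_mult mult.commute)
  also have "\<omega> \<up> (j' * t) = (z \<up> b') \<up> t" using eq by (metis Og.int_pow_pow omega_carrier)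
  also have "\<dots> = (z \<up> (c * t)) \<up> (int p)" using z(1) by (simp add: c Og.int_pow_pow ac_simps)
  also have "\<omega> \<up> (s * int p) = (\<omega> \<up> s) \<up> (int p)" by (simp add: Og.int_pow_pow)
  finally have "\<omega> = (\<omega> \<up> s \<cdot> z \<up> (c * t)) \<up> p"
   using z(1) by (simp add: int_pow_int Og.nat_pow_distrib)
  then have "\<omega> \<in> Om p" using z(1) by (force simp: Om_def)
  then show False using omega_not_in_Om[OF pP] by simp
 qed
 then show ?thesis using bj by simp
qed simp

lemma omega_in_Om:
 assumes "Pnum b" "\<omega> \<up> (j::nat) \<in> Om b"
 shows "b dvd j"
proof -
 have "\<omega> \<up> int j \<in> Om b" using assms(2) by (simp only: int_pow_int)
 then show ?thesis using omega_int_in_Om[OF assms(1)] int_dvd_int_iff by blast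
qed

text \<open>For empty P the group \<Omega> would be trivial; a prime in P excludes \<omega> = 1, and
  torsion-freeness does the rest.\<close>

lemma omega_pow_inj:
 assumes "P \<noteq> {}" "\<omega> \<up> (j::nat) = \<omega> \<up> (k::nat)"
 shows "j = k"
proof -
 have aux: "j \<le> k" if "\<omega> \<up> (j::nat) = \<omega> \<up> (k::nat)" for j k
 proof (rule ccontr)
  assume "\<not> j \<le> k"
  then have "\<omega> \<up> (j - k) \<cdot> \<omega> \<up> k = \<one>\<^bsub>\<Omega>\<^esub> \<cdot> \<omega> \<up> k"
   using that by (simp add: Og.nat_pow_mult)
  then have "\<omega> \<up> (j - k) = \<one>\<^bsub>\<Omega>\<^esub>"
   using Og.right_cancel[of "\<omega> \<up> k" "\<omega> \<up> (j - k)" "\<one>\<^bsub>\<Omega>\<^esub>"] by simp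
  then have "\<omega> = \<one>\<^bsub>\<Omega>\<^esub>" using Omega_torsion_free[of \<omega> "j - k"] \<open>\<not> j \<le> k\<close> by simp
  obtain p where "p \<in> P" using assms(1) by blast
  then show False using omega_not_in_Om[of p] subgroup.one_closed[OF Om_subgroup] \<open>\<omega> = \<one>\<^bsub>\<Omega>\<^esub>\<close> by metis
 qed
 show ?thesis using aux[of j k] aux[of k j] assms(2) by simp
qed

text \<open>Multiplication by primes outside P is surjective on \<Omega>, so a factor q composed of
  such primes leaves no trace in \<open>Om\<close>.\<close>

lemma Om_coprime:
 assumes "0 < q" "\<forall>p. prime p \<longrightarrow> p dvd q \<longrightarrow> p \<notin> P"
 shows "Om (n * q) = Om n"
proof -
 have "\<exists>y\<in>carrier \<Omega>. x = y \<up> q" if "x \<in> carrier \<Omega>" for x using assms that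
 proof (induction q arbitrary: x rule: less_induct)
  case (less q)
  show ?case
  proof (cases "q = 1")
   case True
   then show ?thesis using less.prems by auto
  next
   case False
   then obtain p where p: "prime p" "p dvd q" using prime_factor_nat by blast
   then obtain r where r: "q = p * r" by blast
   have "p \<notin> P" using p less.prems by blast
   then obtain y where y: "y \<in> carrier \<Omega>" "x = y \<up> p"
    using Omega_divisible[OF p(1)] less.prems by blast
   have "r < q" "0 < r" using less.prems(1) r prime_gt_1_nat[OF p(1)] by auto
   moreover have "\<forall>p. prime p \<longrightarrow> p dvd r \<longrightarrow> p \<notin> P" using less.prems(2) r by auto
   ultimately obtain z where "z \<in> carrier \<Omega>" "y = z \<up> r" using less.IH[of r y] y by blast
   then show ?thesis using y r by (auto simp: Og.nat_pow_pow mult.commute intro!: bexI[of _ z])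
  qed
 qed
 then have "Om q = carrier \<Omega>" using Om_subset by (force simp: Om_def)
 show ?thesis
 proof
  show "Om (n * q) \<subseteq> Om n" by (rule Om_dvd) simp
  show "Om n \<subseteq> Om (n * q)"
  proof
   fix x assume "x \<in> Om n"
   then obtain w where w: "w \<in> carrier \<Omega>" "x = w \<up> n" by (auto simp: Om_def)
   then obtain y where "y \<in> carrier \<Omega>" "w = y \<up> q"
    using \<open>Om q = carrier \<Omega>\<close> by (auto simp: Om_def)
   then show "x \<in> Om (n * q)" using w by (auto simp: Om_def Og.nat_pow_pow mult.commute)
  qed
 qed
qed

lemma closure_omega_pow: "TO closure_of (generate \<Omega> {\<omega> \<up> (c::nat)}) = Om c"
proof
 have "generate \<Omega> {\<omega> \<up> c} \<subseteq> Om c"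
  using Og.generate_subgroup_incl[OF _ Om_subgroup, of "{\<omega> \<up> c}" c] pow_in_Om[of \<omega> c c] by simp
 then show "TO closure_of (generate \<Omega> {\<omega> \<up> c}) \<subseteq> Om c"
  by (rule closure_of_minimal[OF _ Om_closed])
 have "(\<lambda>w. w \<up> c) ` (TO closure_of (generate \<Omega> {\<omega>})) \<subseteq>
   TO closure_of ((\<lambda>w. w \<up> c) ` generate \<Omega> {\<omega>})"
  by (rule continuous_map_image_closure_subset[OF Og.continuous_pow])
 moreover have "(\<lambda>w. w \<up> c) ` generate \<Omega> {\<omega>} \<subseteq> generate \<Omega> {\<omega> \<up> c}"
 proof
  fix x assume "x \<in> (\<lambda>w. w \<up> c) ` generate \<Omega> {\<omega>}"
  then obtain k :: int where "x = (\<omega> \<up> k) \<up> c" using Og.generate_pow[of \<omega>] by auto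
  then have "x = (\<omega> \<up> c) \<up> k" by (metis Og.int_pow_pow int_pow_int mult.commute omega_carrier)
  then show "x \<in> generate \<Omega> {\<omega> \<up> c}" using Og.generate_pow[of "\<omega> \<up> c"] by auto
 qed
 ultimately have "(\<lambda>w. w \<up> c) ` (TO closure_of (generate \<Omega> {\<omega>})) \<subseteq>
   TO closure_of (generate \<Omega> {\<omega> \<up> c})" by (meson closure_of_mono subset_trans)
 then
 show "Om c \<subseteq> TO closure_of (generate \<Omega> {\<omega> \<up> c})" unfolding Om_def omega_closure .
qed

text \<open>By \<open>omega_split\<close> the complement is a finite union of closed cosets.\<close>

lemma Om_open: "0 < n \<Longrightarrow> openin TO (Om n)"
proof -
 assume n: "0 < n"
 let ?J = "{j. j < n \<and> \<omega> \<up> j \<notin> Om n}"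
 interpret S: subgroup "Om n" \<Omega> by (rule Om_subgroup)
 have "carrier \<Omega> - Om n = (\<Union>j\<in>?J. (\<lambda>z. \<omega> \<up> j \<cdot> z) ` Om n)"
 proof (intro equalityI subsetI)
  fix x assume x: "x \<in> carrier \<Omega> - Om n"
  then obtain j z where j: "j < n" "z \<in> carrier \<Omega>" "x = \<omega> \<up> j \<cdot> z \<up> n"
   using omega_split[OF _ n] by blast
  have z: "z \<up> n \<in> Om n" using j by (auto simp: Om_def)
  then have "\<omega> \<up> j \<notin> Om n" using x j by auto
  then show "x \<in> (\<Union>j\<in>?J. (\<lambda>z. \<omega> \<up> j \<cdot> z) ` Om n)" using j z by blast
 next
  fix x assume "x \<in> (\<Union>j\<in>?J. (\<lambda>z. \<omega> \<up> j \<cdot> z) ` Om n)"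
  then obtain j z where j: "\<omega> \<up> (j::nat) \<notin> Om n" "z \<in> Om n" "x = \<omega> \<up> j \<cdot> z" by blast
  have zc: "z \<in> carrier \<Omega>" using j Om_subset by auto
  have "x \<notin> Om n"
  proof
   assume "x \<in> Om n"
   then have "x \<cdot> inv\<^bsub>\<Omega>\<^esub> z \<in> Om n" using j by simp
   then show False using j zc by (simp add: Og.m_assoc)
  qed
  then show "x \<in> carrier \<Omega> - Om n" using j zc by simp
 qed
 moreover have "closedin TO (\<Union>j\<in>?J. (\<lambda>z. \<omega> \<up> j \<cdot> z) ` Om n)"
  by (intro closedin_Union) (auto intro: Om_coset_closed)
 ultimately have "closedin TO (carrier \<Omega> - Om n)" by simp
 then show ?thesis using Om_subset[of n] openin_closedin[of "Om n" TO] by simp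
qed

lemma openin_d_vimage: "0 < n \<Longrightarrow> openin T {x \<in> carrier G. d x \<in> Om n}"
 using openin_continuous_map_preimage[OF d_continuous Om_open[of n]] by simp

lemma subgroup_d_vimage:
 assumes "subgroup S \<Omega>" shows "subgroup {x \<in> carrier G. d x \<in> S} G"
proof -
 interpret S: subgroup S \<Omega> by fact
 have "\<one> \<in> {x \<in> carrier G. d x \<in> S}" by simp
 then show ?thesis by (intro G.subgroupI) auto
qed

lemma open_normal_index_Pnum:
 assumes "N \<lhd> G" "openin T N"
 shows "Pnum (card (rcosets N))"
proof -
 have "finite (rcosets N)"
  using G.compact_open_subgroup_finite_index[OF compact_G assms(2)] assms(1) normal_imp_subgroup by blast
 moreover have "rcosets N \<noteq> {}" by (auto simp: RCOSETS_def)
 ultimately have "0 < card (rcosets N)" by (simp add: card_gt_0_iff)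
 moreover have "open_normal_in G T N (carrier G)"
  using assms by (simp add: open_normal_in_def) (metis G.topspace_carrier subtopology_topspace)
 then have "\<forall>p. prime p \<longrightarrow> p dvd grp_index G (carrier G) N \<longrightarrow> p \<in> P"
  using pro_P by (simp add: pro_P_group_def)
 ultimately show ?thesis by (simp add: Pnum_def grp_index_def)
qed

lemma open_normal_below:
 assumes "openin (subtopology T H) V" "\<one> \<in> V" "H \<subseteq> carrier G"
 obtains N where "N \<lhd> G" "openin T N" "N \<inter> H \<subseteq> V"
proof -
 obtain S where S: "openin T S" "V = S \<inter> H" using assms(1) by (auto simp: openin_subtopology)
 then have "\<one> \<in> S" using assms(2) by auto
 then obtain N where "N \<lhd> G" "openin T N" "N \<subseteq> S"
  using G.profinite_open_normal[OF compact_G Hausdorff_G _ S(1)] profinite by (auto simp: profinite_group_def)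
 then show thesis using that S(2) by blast
qed

text \<open>The pro-P hypothesis speaks of open normal subgroups of G only. For an arbitrary
  subgroup H it yields an exponent rather than an index, and \<open>prime_dvd_exponent\<close> turns
  the exponent into a statement on indices.\<close>

lemma open_exponent:
 assumes "openin (subtopology T H) V" "\<one> \<in> V" "subgroup H G"
 obtains k where "Pnum k" "\<And>h. h \<in> H \<Longrightarrow> h [^] k \<in> V"
proof -
 interpret H: subgroup H G by fact
 obtain N where N: "N \<lhd> G" "openin T N" "N \<inter> H \<subseteq> V"
  using open_normal_below[OF assms(1,2) H.subset] by blast
 have "h [^] card (rcosets N) \<in> V" if "h \<in> H" for h
 proof -
  have "h [^] n \<in> H" for n :: nat by (induction n) (use that in auto)
  then show ?thesis using G.pow_normal_index[OF N(1), of h] that N(3) by auto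
 qed
 then show thesis using that open_normal_index_Pnum[OF N(1,2)] by blast
qed

section \<open>Procyclic subgroups and the degree map on them\<close>

definition cyc :: "'g \<Rightarrow> 'g set" where
 "cyc h = T closure_of (generate G {h})"

lemma cyc_subgroup: "h \<in> carrier G \<Longrightarrow> subgroup (cyc h) G"
 unfolding cyc_def by (intro G.subgroup_closure G.generate_is_subgroup) simp

lemma cyc_self: "h \<in> carrier G \<Longrightarrow> h \<in> cyc h"
proof -
 assume h: "h \<in> carrier G"
 have "generate G {h} \<subseteq> cyc h"
  unfolding cyc_def using h G.generate_incl[of "{h}"] by (intro closure_of_subset) simp
 moreover have "h \<in> generate G {h}" by (rule generate.incl) simp
 ultimately show ?thesis by (rule subsetD)
qed

lemma cyc_minimal: "subgroup H G \<Longrightarrow> closedin T H \<Longrightarrow> h \<in> H \<Longrightarrow> cyc h \<subseteq> H"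
 unfolding cyc_def by (intro closure_of_minimal G.generate_subgroup_incl) auto

lemma cyc_closed: "closedin T (cyc h)" by (simp add: cyc_def)

lemma cyc_pow_subset: "h \<in> carrier G \<Longrightarrow> cyc (h [^] (k::nat)) \<subseteq> cyc h"
proof -
 assume h: "h \<in> carrier G"
 interpret S: subgroup "cyc h" G using cyc_subgroup[OF h] .
 have "h [^] k \<in> cyc h" by (induction k) (use cyc_self[OF h] in auto)
 then show ?thesis by (intro cyc_minimal cyc_subgroup cyc_closed h)
qed

text \<open>Compactness makes the image of \<open>cyc h\<close> closed, so it is the closure of the
  group generated by d(h).\<close>

lemma d_cyc:
 assumes h: "h \<in> carrier G" "d h = \<omega> \<up> (c::nat)"
 shows "d ` cyc h = Om c"
proof
 have img: "d ` generate G {h} = generate \<Omega> {d h}" using d.generate_img[of "{h}"] h by simp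
 have "d ` cyc h \<subseteq> TO closure_of (d ` generate G {h})"
  unfolding cyc_def by (rule continuous_map_image_closure_subset[OF d_continuous])
 then show "d ` cyc h \<subseteq> Om c" using img closure_omega_pow[of c] h by simp
 have "compactin T (cyc h)" using compact_G cyc_closed closedin_compact_space by blast
 then have "compactin TO (d ` cyc h)" using d_continuous image_compactin by blast
 then have cl: "closedin TO (d ` cyc h)" using Hausdorff_Omega compactin_imp_closedin by blast
 have "generate \<Omega> {d h} \<subseteq> d ` cyc h"
  unfolding img[symmetric] cyc_def using h G.generate_incl[of "{h}"] by (intro image_mono closure_of_subset) auto
 then have "TO closure_of generate \<Omega> {d h} \<subseteq> d ` cyc h" by (rule closure_of_minimal[OF _ cl])
 then show "Om c \<subseteq> d ` cyc h" using closure_omega_pow[of c] h(2) by metis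
qed

text \<open>In effect the degree map is injective on \<open>cyc h\<close>, as N is arbitrary. A
  kernel element s is approximated modulo N by a power h^j, and the approximation is taken so fine
  in degree that j is forced to be divisible by [G:N].\<close>

lemma cyc_kernel:
 assumes h: "h \<in> carrier G" "d h = \<omega> \<up> (c::nat)" "0 < c"
  and s: "s \<in> cyc h" "d s = \<one>\<^bsub>\<Omega>\<^esub>" and N: "N \<lhd> G" "openin T N"
 shows "s \<in> N"
proof -
 interpret N: normal N G by fact
 define k where "k = card (rcosets N)"
 have k: "Pnum k" unfolding k_def by (rule open_normal_index_Pnum[OF N])
 have sc: "s \<in> carrier G" using s(1) closure_of_subset_topspace[of T] by (auto simp: cyc_def)
 \<comment> \<open>With k = [G:N], the condition on degrees makes \<omega>^(cj) a ck-th power;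
   torsion-freeness and \<open>omega_int_in_Om\<close> then give that k divides j, and h^k lies in
   N.\<close>
 let ?O = "N \<inter> {x \<in> carrier G. d x \<in> Om (c * k)}"
 have "openin T ?O" using N(2) openin_d_vimage[of "c * k"] h(3) Pnum_pos[OF k] by (intro openin_Int) auto
 then have op: "openin T {x \<in> carrier G. x \<div> s \<in> ?O}" using sc by (rule G.openin_right_translate)
 have mem: "s \<in> {x \<in> carrier G. x \<div> s \<in> ?O}" using sc subgroup.one_closed[OF Om_subgroup] by simp
 have "\<And>V. s \<in> V \<and> openin T V \<Longrightarrow> \<exists>y. y \<in> generate G {h} \<and> y \<in> V"
  using s(1) unfolding cyc_def in_closure_of by simp
 from this[OF conjI[OF mem op]]
 obtain x where x: "x \<in> generate G {h}" "x \<in> carrier G" "x \<div> s \<in> N" "d (x \<div> s) \<in> Om (c * k)"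
  by blast
 obtain j :: int where j: "x = h [^] j" using x(1) G.generate_pow[OF h(1)] by auto
 have "d x \<in> Om (c * k)" using x sc s(2) by simp
 moreover have "d x = (\<omega> \<up> c) \<up> j" using j h d.hom_int_pow by simp
 ultimately obtain z where z: "z \<in> carrier \<Omega>" "(\<omega> \<up> c) \<up> j = z \<up> (c * k)"
  by (auto simp: Om_def)
 have "(\<omega> \<up> j) \<up> c = (z \<up> k) \<up> c"
 proof -
  have "(\<omega> \<up> j) \<up> (int c) = (\<omega> \<up> (int c)) \<up> j"
   by (simp add: Og.int_pow_pow mult.commute)
  moreover have "z \<up> (c * k) = (z \<up> k) \<up> c" using z(1) by (simp add: Og.nat_pow_pow mult.commute)
  ultimately show ?thesis using z(2) by (simp add: int_pow_int)
 qed
 then have "\<omega> \<up> j = z \<up> k"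
  by (rule Omega_pow_inj[OF Og.int_pow_closed[OF omega_carrier] Og.nat_pow_closed[OF z(1)] h(3)])
 then have "\<omega> \<up> j \<in> Om k" using z(1) unfolding Om_def by blast
 then have "int k dvd j" by (rule omega_int_in_Om[OF k])
 then obtain l where l: "j = int k * l" by blast
 have "h [^] k \<in> N" unfolding k_def by (rule G.pow_normal_index[OF N(1) h(1)])
 then have "(h [^] (int k)) [^] l \<in> N"
  using G.subgroup_int_pow_closed[OF N.subgroup_axioms] by (simp add: int_pow_int)
 then have "x \<in> N" using j l h(1) by (simp add: G.int_pow_pow)
 then have "inv (x \<div> s) \<otimes> x \<in> N" using x(3) by simp
 then show ?thesis using sc x(2) by (simp add: G.inv_mult_group G.m_assoc)
qed

end

section \<open>Indices\<close>

lemma rcosets_restrict: "rcosets\<^bsub>A\<lparr>carrier := H\<rparr>\<^esub> K = (\<lambda>h. K #>\<^bsub>A\<^esub> h) ` H"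
 by (auto simp: RCOSETS_def r_coset_def)

locale plain_group = group G for G :: "'a monoid" (structure)
begin

lemma rcoset_eq_iff:
 assumes "subgroup K G" "x \<in> carrier G" "y \<in> carrier G"
 shows "K #> x = K #> y \<longleftrightarrow> x \<div> y \<in> K"
proof -
 have "x \<in> K #> y \<longleftrightarrow> x \<div> y \<in> K"
  by (rule subgroup.rcos_module[OF assms(1) is_group assms(3,2)])
 moreover have "K #> x = K #> y" if "x \<in> K #> y" using repr_independence[OF that assms(3,1)] by simp
 moreover have "x \<in> K #> x" by (rule rcos_self[OF assms(2,1)])
 ultimately show ?thesis by auto
qed

lemma index_by_representatives:
 assumes K: "subgroup K G" and H: "subgroup H G"
  and g: "\<And>j. j < b \<Longrightarrow> g j \<in> H"
  and ex: "\<And>h. h \<in> H \<Longrightarrow> \<exists>j<b. h \<div> (g j) \<in> K"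
  and un: "\<And>i j. i < b \<Longrightarrow> j < b \<Longrightarrow> g j \<div> (g i) \<in> K \<Longrightarrow> i = j"
 shows "grp_index G H K = b" "fin_index G H K"
proof -
 have Hc: "\<And>h. h \<in> H \<Longrightarrow> h \<in> carrier G" using subgroup.mem_carrier[OF H] .
 have "bij_betw (\<lambda>j. K #> g j) {..<b} (rcosets\<^bsub>G\<lparr>carrier := H\<rparr>\<^esub> K)"
  unfolding bij_betw_def
 proof
  show "inj_on (\<lambda>j. K #> g j) {..<b}"
  proof (rule inj_onI)
   fix i j assume ij: "i \<in> {..<b}" "j \<in> {..<b}" "K #> g i = K #> g j"
   then have "g j \<div> (g i) \<in> K" using rcoset_eq_iff[OF K Hc[OF g[of j]] Hc[OF g[of i]]] by simp
   then show "i = j" using un ij by simp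
  qed
  show "(\<lambda>j. K #> g j) ` {..<b} = rcosets\<^bsub>G\<lparr>carrier := H\<rparr>\<^esub> K"
   unfolding rcosets_restrict
  proof (intro equalityI subsetI)
   fix x assume "x \<in> (\<lambda>h. K #> h) ` H"
   then obtain h where h: "h \<in> H" "x = K #> h" by blast
   then obtain j where j: "j < b" "h \<div> (g j) \<in> K" using ex by blast
   then have "K #> h = K #> g j" using rcoset_eq_iff[OF K Hc[OF h(1)] Hc[OF g[of j]]] by simp
   then show "x \<in> (\<lambda>j. K #> g j) ` {..<b}" using h j by blast
  qed (use g in auto)
 qed
 then show "grp_index G H K = b" "fin_index G H K"
  using bij_betw_same_card[of _ "{..<b}"] bij_betw_finite[of _ "{..<b}"]
  by (fastforce simp: grp_index_def fin_index_def)+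
qed

lemma index_self: "subgroup H G \<Longrightarrow> grp_index G H H = 1"
 by (rule index_by_representatives(1)[of H H 1 "\<lambda>_. \<one>"])
  (auto simp: subgroup.one_closed subgroup.mem_carrier)

lemma fin_index_pos:
 assumes "subgroup H G" "fin_index G H K" shows "0 < grp_index G H K"
proof -
 have "rcosets\<^bsub>G\<lparr>carrier := H\<rparr>\<^esub> K \<noteq> {}"
  using subgroup.one_closed[OF assms(1)] by (auto simp: rcosets_restrict)
 then show ?thesis using assms(2) by (simp add: grp_index_def fin_index_def card_gt_0_iff)
qed

lemma pow_restrict: "x [^]\<^bsub>G\<lparr>carrier := H\<rparr>\<^esub> (n::nat) = x [^] n" by (simp add: nat_pow_def)

lemma normal_index_pow:
 assumes "subgroup H G" "U \<lhd> G\<lparr>carrier := H\<rparr>" "h \<in> H"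
 shows "h [^] grp_index G H U \<in> U"
proof -
 interpret H: group "G\<lparr>carrier := H\<rparr>" using subgroup_imp_group[OF assms(1)] .
 show ?thesis using H.pow_normal_index[OF assms(2)] assms(3) by (simp add: grp_index_def pow_restrict)
qed

lemma inv_restrict: "subgroup H G \<Longrightarrow> h \<in> H \<Longrightarrow> inv\<^bsub>G\<lparr>carrier := H\<rparr>\<^esub> h = inv h"
 using m_inv_consistent by blast

lemma normal_in_subgroup:
 assumes "subgroup H G" "U \<lhd> G\<lparr>carrier := H\<rparr>"
 shows "subgroup U G" "U \<subseteq> H" "\<And>h u. h \<in> H \<Longrightarrow> u \<in> U \<Longrightarrow> h \<otimes> u \<div> h \<in> U"
  "\<And>h u. h \<in> H \<Longrightarrow> u \<in> U \<Longrightarrow> inv h \<otimes> u \<otimes> h \<in> U"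
proof -
 interpret H: group "G\<lparr>carrier := H\<rparr>" using subgroup_imp_group[OF assms(1)] .
 have U: "subgroup U (G\<lparr>carrier := H\<rparr>)" using assms(2) normal_imp_subgroup by blast
 show "subgroup U G" using incl_subgroup[OF assms(1) U] .
 show UH: "U \<subseteq> H" using subgroup.subset[OF U] by simp
 show *: "h \<otimes> u \<div> h \<in> U" if "h \<in> H" "u \<in> U" for h u
  using assms(2) that inv_restrict[OF assms(1) that(1)] by (auto simp: H.normal_inv_iff)
 show "inv h \<otimes> u \<otimes> h \<in> U" if "h \<in> H" "u \<in> U" for h u
  using *[of "inv h" u] that assms(1) subgroup.m_inv_closed subgroup.mem_carrier by fastforce
qed

lemma normal_in_subgroupI:
 assumes "subgroup H G" "subgroup U G" "U \<subseteq> H" "\<And>h u. h \<in> H \<Longrightarrow> u \<in> U \<Longrightarrow> h \<otimes> u \<div> h \<in> U"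
 shows "U \<lhd> G\<lparr>carrier := H\<rparr>"
proof -
 interpret H: group "G\<lparr>carrier := H\<rparr>" using subgroup_imp_group[OF assms(1)] .
 have "subgroup U (G\<lparr>carrier := H\<rparr>)" using subgroup_incl[OF assms(2,1,3)] .
 then show ?thesis using assms(4) inv_restrict[OF assms(1)] by (simp add: H.normal_inv_iff)
qed

text \<open>Cauchy's theorem: \<open>sylow_thm\<close> supplies a subgroup of order p, and a
  nontrivial element of it has order p, which must divide k.\<close>

lemma prime_dvd_exponent:
 assumes fin: "finite (carrier G)" and p: "prime p" "p dvd order G"
  and k: "\<And>x. x \<in> carrier G \<Longrightarrow> x [^] (k::nat) = \<one>"
 shows "p dvd k"
proof (rule ccontr)
 assume nd: "\<not> p dvd k"
 obtain m where m: "order G = p ^ 1 * m" using p(2) by auto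
 obtain S where S: "subgroup S G" "card S = p ^ 1" using sylow_thm[OF p(1) is_group m fin] by blast
 interpret S: group "G\<lparr>carrier := S\<rparr>" using subgroup_imp_group[OF S(1)] .
 have "S \<noteq> {\<one>}" using S(2) prime_gt_1_nat[OF p(1)] by auto
 then obtain x where x: "x \<in> S" "x \<noteq> \<one>" using subgroup.one_closed[OF S(1)] by blast
 have xc: "x \<in> carrier G" by (rule subgroup.mem_carrier[OF S(1) x(1)])
 have "x [^]\<^bsub>G\<lparr>carrier := S\<rparr>\<^esub> order (G\<lparr>carrier := S\<rparr>) = \<one>\<^bsub>G\<lparr>carrier := S\<rparr>\<^esub>"
  by (rule S.pow_order_eq_1) (use x in simp)
 moreover have "order (G\<lparr>carrier := S\<rparr>) = p" using S(2) by (simp add: order_def)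
 ultimately have "x [^] p = \<one>" unfolding pow_restrict by simp
 then have "ord x dvd p" "ord x dvd k" using k[OF xc] pow_eq_id[OF xc] by auto
 then have "ord x = 1" using nd p(1) by (metis prime_nat_iff)
 then show False using ord_eq_1[OF xc] x by simp
qed

end

sublocale topological_group \<subseteq> plain_group G by (rule plain_group.intro) (rule is_group)

section \<open>Ramification\<close>

context pro_P_degree begin

section \<open>P-part and P'-part of a natural number\<close>

definition ppart :: "nat \<Rightarrow> nat" where
 "ppart n = (\<Prod>p \<in> prime_factors n \<inter> P. p ^ multiplicity p n)"

lemma ppart_mult: assumes "0 < n" shows "ppart n * P'_part P n = n"
proof -
 have "(\<Prod>p \<in> prime_factors n \<inter> P. p ^ multiplicity p n) * (\<Prod>p \<in> prime_factors n - P. p ^ multiplicity p n)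
   = (\<Prod>p \<in> prime_factors n. p ^ multiplicity p n)"
  by (subst prod.union_disjoint[symmetric]) (auto intro!: prod.cong)
 also have "\<dots> = n" using prime_factorization_nat[of n] assms by simp
 finally show ?thesis by (simp add: ppart_def P'_part_def)
qed

lemma prime_dvd_prod_powers:
 assumes "prime (q::nat)" "q dvd (\<Prod>p \<in> F. p ^ e p)" "finite F" "\<forall>p\<in>F. prime p"
 shows "q \<in> F"
proof -
 have "\<exists>p\<in>F. q dvd p ^ e p"
  using assms(2) prime_dvd_prod_iff[OF assms(3,1), of "\<lambda>p. p ^ e p"] by simp
 then obtain p where "p \<in> F" "q dvd p ^ e p" by blast
 then show ?thesis using assms(1,4) by (metis prime_dvd_power primes_dvd_imp_eq)
qed

lemma Pnum_ppart: "Pnum (ppart n)" unfolding Pnum_def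
proof (intro conjI allI impI)
 show "0 < ppart n" unfolding ppart_def by (rule prod_pos) (auto simp: prime_gt_0_nat in_prime_factors_iff)
 fix p assume "prime p" "p dvd ppart n"
 then show "p \<in> P" using prime_dvd_prod_powers[of p "\<lambda>q. multiplicity q n" "prime_factors n \<inter> P"] by (auto simp: ppart_def)
qed

lemma P'_part_prime: "prime p \<Longrightarrow> p dvd P'_part P n \<Longrightarrow> p \<notin> P"
 using prime_dvd_prod_powers[of p "\<lambda>q. multiplicity q n" "prime_factors n - P"] by (auto simp: P'_part_def)

lemma P'_part_pos: "0 < n \<Longrightarrow> 0 < P'_part P n"
 using ppart_mult[of n] by (metis mult_0_right not_gr_zero)

text \<open>Residue degrees and orbit lengths are P-numbers, so the exponents in
  \<open>Upsilon\<close> survive rescaling of a degree by them.\<close>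

lemma P'_part_mult:
 assumes m: "Pnum m" and n: "0 < n" shows "P'_part P (m * n) = P'_part P n" unfolding P'_part_def
proof (rule prod.cong)
 have m0: "m \<noteq> 0" using m by (simp add: Pnum_def)
 have nd: "\<not> p dvd m" if "prime p" "p \<notin> P" for p using m that by (auto simp: Pnum_def)
 show "prime_factors (m * n) - P = prime_factors n - P"
  using nd m0 n by (auto simp: prime_factors_product in_prime_factors_iff)
 fix p assume "p \<in> prime_factors n - P"
 then have "prime p" "p \<notin> P" by auto
 then show "p ^ multiplicity p (m * n) = p ^ multiplicity p n"
  using nd[of p] m0 n by (simp add: prime_elem_multiplicity_mult_distrib not_dvd_imp_multiplicity_0)
qed

lemma Om_ppart: "0 < n \<Longrightarrow> Om n = Om (ppart n)"
 using Om_coprime[OF P'_part_pos[of n], of "ppart n"] ppart_mult[of n] P'_part_prime[of _ n] by auto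

lemma ppart_Pnum: assumes "Pnum m" "0 < n" shows "ppart (m * n) = m * ppart n"
proof -
 have "ppart (m * n) * P'_part P n = m * ppart n * P'_part P n"
  using ppart_mult[of "m * n"] ppart_mult[of n] P'_part_mult[OF assms] assms by (simp add: Pnum_pos mult.assoc)
 then show ?thesis using P'_part_pos[of n] assms by simp
qed

lemma Om_representatives:
 assumes "0 < a" "0 < b" "w \<in> Om a"
 shows "\<exists>j<b. w \<cdot> inv\<^bsub>\<Omega>\<^esub> (\<omega> \<up> (a * j)) \<in> Om (a * b)"
proof -
 obtain y where y: "y \<in> carrier \<Omega>" "w = y \<up> a" using assms(3) by (auto simp: Om_def)
 obtain j z where j: "j < b" "z \<in> carrier \<Omega>" "y = \<omega> \<up> j \<cdot> z \<up> b"
  using omega_split[OF y(1) assms(2)] by blast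
 have "w = \<omega> \<up> (a * j) \<cdot> z \<up> (a * b)"
  using y j by (simp add: Og.nat_pow_distrib Og.nat_pow_pow mult.commute)
 then have "w \<cdot> inv\<^bsub>\<Omega>\<^esub> (\<omega> \<up> (a * j)) = z \<up> (a * b)"
  using j by (simp add: Og.m_comm[of "\<omega> \<up> (a * j)"] Og.m_assoc)
 then show ?thesis using j by (auto simp: Om_def)
qed

lemma Om_representatives_unique:
 assumes a: "0 < a" and b: "Pnum b" and ij: "i < b" "j < b"
  and mem: "\<omega> \<up> (a * j) \<cdot> inv\<^bsub>\<Omega>\<^esub> (\<omega> \<up> (a * i)) \<in> Om (a * b)"
 shows "i = j"
proof -
 have "\<omega> \<up> (a * j) \<cdot> inv\<^bsub>\<Omega>\<^esub> (\<omega> \<up> (a * i)) = \<omega> \<up> (int (a * j) - int (a * i))"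
  by (metis Og.int_pow_diff int_pow_int omega_carrier)
 also have "\<dots> = (\<omega> \<up> (int j - int i)) \<up> (int a)" by (simp add: Og.int_pow_pow algebra_simps)
 finally obtain z where z: "z \<in> carrier \<Omega>" "(\<omega> \<up> (int j - int i)) \<up> a = z \<up> (a * b)"
  using mem by (auto simp: Om_def int_pow_int)
 then have "(\<omega> \<up> (int j - int i)) \<up> a = (z \<up> b) \<up> a"
  by (simp add: Og.nat_pow_pow mult.commute)
 then have "\<omega> \<up> (int j - int i) = z \<up> b"
  by (rule Omega_pow_inj[OF Og.int_pow_closed[OF omega_carrier] Og.nat_pow_closed[OF z(1)] a])
 then have "\<omega> \<up> (int j - int i) \<in> Om b" using z(1) unfolding Om_def by blast
 then have "int b dvd int j - int i" by (rule omega_int_in_Om[OF b])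
 then have "int j mod int b = int i mod int b" by (simp add: mod_eq_dvd_iff)
 then show ?thesis using ij by simp
qed

lemma index_Om:
 assumes "0 < a" "Pnum b"
 shows "grp_index \<Omega> (Om a) (Om (a * b)) = b" "fin_index \<Omega> (Om a) (Om (a * b))"
proof -
 show "grp_index \<Omega> (Om a) (Om (a * b)) = b" "fin_index \<Omega> (Om a) (Om (a * b))"
  using Om_representatives[OF assms(1) Pnum_pos[OF assms(2)]] Om_representatives_unique[OF assms]
   Og.index_by_representatives[OF Om_subgroup Om_subgroup, of b "\<lambda>j. \<omega> \<up> (a * j)" a "a * b"]
   pow_in_Om[OF omega_carrier, of a] by auto
qed

text \<open>Take a minimal with \<omega>^a in D and n the index: n\<Omega> lies in D and a divides
  n, so \<open>omega_split\<close> modulo n gives D = a\<Omega>. As a and its P-part define the same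
  subgroup, minimality makes a a P-number.\<close>

lemma finite_index_subgroup_Omega:
 assumes D: "subgroup D \<Omega>" and fin: "fin_index \<Omega> (carrier \<Omega>) D"
 obtains a where "Pnum a" "D = Om a"
proof -
 interpret D: subgroup D \<Omega> by fact
 define n where "n = card (rcosets\<^bsub>\<Omega>\<^esub> D)"
 have n: "0 < n" using fin Og.fin_index_pos[OF Og.subgroup_self fin] by (simp add: n_def grp_index_def)
 have npow: "w \<up> n \<in> D" if "w \<in> carrier \<Omega>" for w
  unfolding n_def using Og.pow_normal_index[OF Og.subgroup_imp_normal[OF D] that] .
 have Dpow: "x \<up> (k::nat) \<in> D" if "x \<in> D" for x k by (induction k) (use that in auto)
 define a :: nat where "a = (LEAST a. 0 < a \<and> \<omega> \<up> a \<in> D)"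
 have a: "0 < a \<and> \<omega> \<up> a \<in> D"
  unfolding a_def by (rule LeastI[of "\<lambda>a. 0 < a \<and> \<omega> \<up> a \<in> D" n]) (use n npow in simp)
 have a_le: "a \<le> j" if "0 < (j::nat)" "\<omega> \<up> j \<in> D" for j
  unfolding a_def by (rule Least_le) (use that in simp)
 have a_dvd: "a dvd j" if "\<omega> \<up> j \<in> D" for j :: nat
 proof (rule ccontr)
  assume "\<not> a dvd j"
  then have r: "0 < j mod a" "j mod a < a" using a by (auto simp: mod_greater_zero_iff_not_dvd)
  have m: "(\<omega> \<up> a) \<up> (j div a) \<in> D" using a Dpow by blast
  have "\<omega> \<up> j = (\<omega> \<up> a) \<up> (j div a) \<cdot> \<omega> \<up> (j mod a)"
   by (simp add: Og.nat_pow_pow Og.nat_pow_mult)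
  then have "\<omega> \<up> (j mod a) = inv\<^bsub>\<Omega>\<^esub> ((\<omega> \<up> a) \<up> (j div a)) \<cdot> \<omega> \<up> j"
   by (simp add: Og.m_assoc[symmetric])
  then have "\<omega> \<up> (j mod a) \<in> D" using m that by simp
  then show False using a_le[of "j mod a"] r by simp
 qed
 have an: "a dvd n" using a_dvd npow[OF omega_carrier] by blast
 have eq: "D = Om a"
 proof (intro equalityI subsetI)
  fix w assume w: "w \<in> D"
  obtain j :: nat and z where j: "z \<in> carrier \<Omega>" "w = \<omega> \<up> j \<cdot> z \<up> n"
   using omega_split[OF D.mem_carrier[OF w] n] by blast
  have "\<omega> \<up> j = w \<cdot> inv\<^bsub>\<Omega>\<^esub> (z \<up> n)" using j by (simp add: Og.m_assoc)
  then have "\<omega> \<up> j \<in> D" using w npow[OF j(1)] by simp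
  then have "a dvd j" using a_dvd by blast
  then show "w \<in> Om a"
   using j pow_in_Om[OF omega_carrier \<open>a dvd j\<close>] pow_in_Om[OF j(1) an] subgroup.m_closed[OF Om_subgroup]
   by simp
 next
  fix w assume "w \<in> Om a"
  then obtain y where y: "y \<in> carrier \<Omega>" "w = y \<up> a" by (auto simp: Om_def)
  obtain i :: nat and z where i: "z \<in> carrier \<Omega>" "y = \<omega> \<up> i \<cdot> z \<up> n"
   using omega_split[OF y(1) n] by blast
  have "w = (\<omega> \<up> a) \<up> i \<cdot> (z \<up> a) \<up> n"
   using y i by (simp add: Og.nat_pow_distrib Og.nat_pow_pow mult.commute)
  then show "w \<in> D" using a Dpow npow i(1) by simp
 qed
 have "\<omega> \<up> ppart a \<in> D"
  unfolding eq using Om_ppart[of a] a pow_in_Om[OF omega_carrier, of "ppart a"] by simp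
 then have "a \<le> ppart a" using a_le Pnum_pos[OF Pnum_ppart] by blast
 moreover have "ppart a dvd a" using ppart_mult[of a] a by (metis dvd_triv_left)
 moreover have "0 < a" using a by blast
 ultimately have "ppart a = a" using dvd_imp_le le_antisym by blast
 then have "Pnum a" using Pnum_ppart[of a] by (rule subst)
 then show thesis using that eq by blast
qed

abbreviation inert_finite :: "'g set \<Rightarrow> bool" where "inert_finite \<equiv> inertially_finite G T \<Omega> d"
abbreviation f_of :: "'g set \<Rightarrow> nat" where "f_of \<equiv> f_abs G \<Omega> d"
abbreviation I_of :: "'g set \<Rightarrow> 'g set" where "I_of \<equiv> inertia G \<Omega> d"

lemma inert_finite_subgroup: "inert_finite H \<Longrightarrow> subgroup H G"
 and inert_finite_closed: "inert_finite H \<Longrightarrow> closedin T H"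
 by (auto simp: inertially_finite_def closed_subgroup_def)

lemma
 assumes H: "inert_finite H"
 shows d_inert_finite: "d ` H = Om (f_of H)" and Pnum_f: "Pnum (f_of H)"
proof -
 have "subgroup (d ` H) \<Omega>" using d.subgroup_img_is_subgroup[OF inert_finite_subgroup[OF H]] .
 moreover have "fin_index \<Omega> (carrier \<Omega>) (d ` H)" using H d_surj by (simp add: inertially_finite_def)
 ultimately obtain a where a: "Pnum a" "d ` H = Om a" by (rule finite_index_subgroup_Omega)
 have "f_of H = a" using a index_Om(1)[of 1 a] d_surj by (simp add: f_abs_def f_rel_def)
 then show "d ` H = Om (f_of H)" "Pnum (f_of H)" using a by auto
qed

lemma f_rel_Om:
 assumes "d ` H = Om a" "d ` K = Om (a * b)" "0 < a" "Pnum b" shows "f_rel \<Omega> d H K = b"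
 unfolding f_rel_def assms(1,2) by (rule index_Om(1)[OF assms(3,4)])

lemma norm_deg_eq:
 assumes H: "inert_finite H" and w: "w \<in> carrier \<Omega>" "w \<up> f_of H = d h"
 shows "norm_deg G \<Omega> d H h = w" unfolding norm_deg_def
proof (rule the_equality)
 show "w \<in> carrier \<Omega> \<and> w \<up> f_of H = d h" using w by blast
 fix w' assume w': "w' \<in> carrier \<Omega> \<and> w' \<up> f_of H = d h"
 then have "w' \<up> f_of H = w \<up> f_of H" using w(2) by simp
 then show "w' = w" by (rule Omega_pow_inj[OF conjunct1[OF w'] w(1) Pnum_pos[OF Pnum_f[OF H]]])
qed

lemma frobenius_exists: "inert_finite H \<Longrightarrow> 0 < a \<Longrightarrow> f_of H dvd a \<Longrightarrow> \<exists>\<phi>\<in>H. d \<phi> = \<omega> \<up> a"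
 using d_inert_finite[of H] pow_in_Om[OF omega_carrier, of "f_of H" a] by (metis imageE)

text \<open>In field terms, unramified extensions: \<open>dv X a\<close> has the inertia group of X,
  and if a is a multiple of f_X its degrees fill \<open>Om a\<close>. Comparisons between layers
  take place in such subgroups with one common a.\<close>

definition dv :: "'g set \<Rightarrow> nat \<Rightarrow> 'g set" where "dv X a = {x \<in> X. d x \<in> Om a}"

lemma mem_I_of: "x \<in> I_of X \<longleftrightarrow> x \<in> X \<and> x \<in> carrier G \<and> d x = \<one>\<^bsub>\<Omega>\<^esub>"
 by (auto simp: inertia_def kernel_def)

lemma I_of_dv: "I_of (dv X a) = I_of X"
 using subgroup.one_closed[OF Om_subgroup[of a]] by (auto simp: mem_I_of dv_def)

lemma dv_subgroup: assumes "subgroup X G" shows "subgroup (dv X a) G"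
proof -
 have "dv X a = X \<inter> {x \<in> carrier G. d x \<in> Om a}"
  using subgroup.mem_carrier[OF assms] by (auto simp: dv_def)
 then show ?thesis using G.subgroups_Inter_pair[OF assms subgroup_d_vimage[OF Om_subgroup]] by simp
qed

lemma dv_subset: "dv X a \<subseteq> X" by (auto simp: dv_def)

lemma d_dv: "inert_finite X \<Longrightarrow> f_of X dvd a \<Longrightarrow> d ` dv X a = Om a"
 using d_inert_finite[of X] Om_dvd[of "f_of X" a] by (auto simp: dv_def image_iff)

lemma d_conj: "g \<in> carrier G \<Longrightarrow> x \<in> carrier G \<Longrightarrow> d (g \<otimes> x \<div> g) = d x"
 by (simp add: Og.m_comm[of "d g"] Og.m_assoc)

lemma I_of_subgroup: "subgroup X G \<Longrightarrow> subgroup (I_of X) G"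
 unfolding inertia_def using G.subgroups_Inter_pair d.subgroup_kernel by blast

lemma openin_subgroup_mono:
 assumes "openin (subtopology T H) V" "subgroup V G" "subgroup S G" "V \<subseteq> S" "S \<subseteq> H" "subgroup H G"
 shows "openin (subtopology T H) S"
proof (subst openin_subopen, intro ballI)
 interpret H: subgroup H G by fact
 fix s assume s: "s \<in> S"
 have sc: "s \<in> carrier G" using s assms by auto
 obtain B where B: "openin T B" "V = B \<inter> H" using assms(1) by (auto simp: openin_subtopology)
 have "openin T {x \<in> carrier G. x \<div> s \<in> B}" by (rule G.openin_right_translate[OF B(1) sc])
 then have "openin (subtopology T H) ({x \<in> carrier G. x \<div> s \<in> B} \<inter> H)"
  by (auto simp: openin_subtopology)
 moreover have "s \<in> {x \<in> carrier G. x \<div> s \<in> B} \<inter> H"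
  using s sc assms(5) B(2) subgroup.one_closed[OF assms(2)] by auto
 moreover have "{x \<in> carrier G. x \<div> s \<in> B} \<inter> H \<subseteq> S"
 proof
  fix x assume x: "x \<in> {x \<in> carrier G. x \<div> s \<in> B} \<inter> H"
  then have "x \<div> s \<in> V" using s assms(5) B(2) by auto
  then have "x \<div> s \<in> S" using assms(4) by (rule subsetD[rotated])
  then have "x \<div> s \<otimes> s \<in> S" using s by (rule subgroup.m_closed[OF assms(3)])
  then show "x \<in> S" using x sc by (simp add: G.m_assoc)
 qed
 ultimately show "\<exists>W. openin (subtopology T H) W \<and> s \<in> W \<and> W \<subseteq> S" by blast
qed

text \<open>The other cosets are finitely many closed sets, and U is what they leave of H.\<close>

lemma closed_finite_index_open:
 assumes H: "subgroup H G" and U: "subgroup U G" "U \<subseteq> H" "closedin T U" and fin: "fin_index G H U"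
 shows "openin (subtopology T H) U"
proof -
 interpret H: subgroup H G by fact
 interpret U: subgroup U G by fact
 let ?R = "(\<lambda>h. U #> h) ` H - {U}"
 have "closedin T (U #> g)" if g: "g \<in> carrier G" for g
 proof -
  have "U #> g = {x \<in> carrier G. x \<div> g \<in> U}"
   using g U.rcos_module[OF G.is_group g] U.elemrcos_carrier[OF G.is_group g] by blast
  moreover have "closedin T {x \<in> topspace T. x \<div> g \<in> U}"
  proof (rule closedin_continuous_map_preimage[OF _ U(3)])
   show "continuous_map T T (\<lambda>x. x \<div> g)"
    using g by (intro G.continuous_mult G.continuous_const continuous_map_id[unfolded id_def]) auto
  qed
  ultimately show ?thesis by simp
 qed
 then have "closedin T (\<Union>?R)"
  using fin H.subset by (intro closedin_Union) (auto simp: fin_index_def rcosets_restrict)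
 then have "openin T (carrier G - \<Union>?R)" using openin_diff[OF openin_topspace, of T] by simp
 moreover have "U = (carrier G - \<Union>?R) \<inter> H"
 proof (intro equalityI subsetI)
  fix x assume x: "x \<in> U"
  have "x \<notin> U #> h" if h: "h \<in> H" "U #> h \<noteq> U" for h
  proof
   assume "x \<in> U #> h"
   then have "U #> h = U #> x" using G.repr_independence[of x U h] U(1) h(1) by simp
   then show False using h(2) G.coset_join2[of x U] x U(1) by simp
  qed
  then show "x \<in> (carrier G - \<Union>?R) \<inter> H" using x U(2) by auto
 next
  fix x assume x: "x \<in> (carrier G - \<Union>?R) \<inter> H"
  have "x \<in> U #> x" using G.rcos_self[of x U] x U(1) by simp
  then show "x \<in> U" using x by (metis DiffD2 DiffI IntE UnionI imageI singletonD)
 qed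
 ultimately show ?thesis by (auto simp: openin_subtopology)
qed

end

context plain_group begin

lemma conj_set_eq: "conj_set G g X = (\<lambda>x. g \<otimes> x \<div> g) ` X"
 by (auto simp: conj_set_def l_coset_def r_coset_def)

lemma conj_set_one: "X \<subseteq> carrier G \<Longrightarrow> conj_set G \<one> X = X"
proof -
 assume "X \<subseteq> carrier G"
 then have "\<one> \<otimes> x \<div> \<one> = x" if "x \<in> X" for x using subsetD[OF _ that, of "carrier G"] by simp
 then show ?thesis by (simp add: conj_set_eq)
qed

lemma conj_set_subset: "g \<in> carrier G \<Longrightarrow> X \<subseteq> carrier G \<Longrightarrow> conj_set G g X \<subseteq> carrier G"
 by (auto simp: conj_set_eq)

lemma conj_set_mult:
 assumes "g \<in> carrier G" "g' \<in> carrier G" "X \<subseteq> carrier G"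
 shows "conj_set G g' (conj_set G g X) = conj_set G (g' \<otimes> g) X"
proof -
 have "g' \<otimes> (g \<otimes> x \<div> g) \<div> g' = g' \<otimes> g \<otimes> x \<div> (g' \<otimes> g)" if "x \<in> X" for x
  using that assms by (simp add: inv_mult_group m_assoc subset_iff)
 then show ?thesis by (simp add: conj_set_eq image_image)
qed

lemma conj_set_inv:
 assumes "g \<in> carrier G" "X \<subseteq> carrier G"
 shows "conj_set G (inv g) (conj_set G g X) = X" "conj_set G g (conj_set G (inv g) X) = X"
 unfolding conj_set_mult[OF assms(1) inv_closed[OF assms(1)] assms(2)]
  conj_set_mult[OF inv_closed[OF assms(1)] assms] l_inv[OF assms(1)] r_inv[OF assms(1)]
 by (rule conj_set_one[OF assms(2)])+

lemma conj_set_invariant: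
 assumes "h \<in> carrier G" "X \<subseteq> carrier G" "\<And>x. x \<in> X \<Longrightarrow> h \<otimes> x \<div> h \<in> X"
  "\<And>x. x \<in> X \<Longrightarrow> inv h \<otimes> x \<otimes> h \<in> X"
 shows "conj_set G h X = X"
proof
 show "conj_set G h X \<subseteq> X" using assms(3) by (auto simp: conj_set_eq)
 show "X \<subseteq> conj_set G h X"
 proof
  fix x assume x: "x \<in> X"
  have xc: "x \<in> carrier G" using x assms(2) by (rule subsetD[rotated])
  have "h \<otimes> (inv h \<otimes> x \<otimes> h) \<div> h = (h \<div> h) \<otimes> x \<otimes> (h \<div> h)"
   using assms(1) xc by (simp only: m_assoc m_closed inv_closed)
  also have "\<dots> = x" using assms(1) xc by simp
  finally have "h \<otimes> (inv h \<otimes> x \<otimes> h) \<div> h = x" .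
  then show "x \<in> conj_set G h X" using assms(4)[OF x] unfolding conj_set_eq by (metis imageI)
 qed
qed

lemma double_coset_eq: "double_coset G I h J = {i \<otimes> h \<otimes> j | i j. i \<in> I \<and> j \<in> J}"
 by (auto simp: double_coset_def r_coset_def set_mult_def)

end

lemma open_subgroup_of_trans:
 assumes "open_subgroup_of G T I H" "open_subgroup_of G T J I"
 shows "open_subgroup_of G T J H"
proof -
 obtain A B where A: "openin T A" "I = A \<inter> H" and B: "openin T B" "J = B \<inter> I"
  using assms unfolding open_subgroup_of_def openin_subtopology by metis
 have "J = (A \<inter> B) \<inter> H" using A B by blast
 then have "openin (subtopology T H) J" using openin_Int[OF A(1) B(1)] openin_subtopology by blast
 then show ?thesis using assms unfolding open_subgroup_of_def by blast
qed

lemma open_subgroup_of_restrict: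
 assumes "open_subgroup_of G T J H" "J \<subseteq> I" "I \<subseteq> H"
 shows "open_subgroup_of G T J I"
proof -
 obtain A where A: "openin T A" "J = A \<inter> H"
  using assms unfolding open_subgroup_of_def openin_subtopology by metis
 then have "J = A \<inter> I" using assms(2,3) by blast
 then have "openin (subtopology T I) J" using A(1) openin_subtopology by blast
 then show ?thesis using assms unfolding open_subgroup_of_def by blast
qed

context pro_P_degree begin

lemma open_subgroup_of_self: "subgroup H G \<Longrightarrow> open_subgroup_of G T H H"
proof -
 assume H: "subgroup H G"
 have "openin T (carrier G)" using openin_topspace[of T] by simp
 moreover have "H = carrier G \<inter> H" using subgroup.subset[OF H] by (rule Int_absorb1[symmetric])
 ultimately have "openin (subtopology T H) H" using openin_subtopology by blast
 then show ?thesis using H by (simp add: open_subgroup_of_def)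
qed

lemma dv_open: assumes "subgroup X G" "0 < a" shows "open_subgroup_of G T (dv X a) X"
proof -
 have "dv X a = {x \<in> carrier G. d x \<in> Om a} \<inter> X"
  using subgroup.subset[OF assms(1)] unfolding dv_def by blast
 then have "openin (subtopology T X) (dv X a)" using openin_d_vimage[OF assms(2)] openin_subtopology by blast
 then show ?thesis using dv_subgroup[OF assms(1)] dv_subset by (simp add: open_subgroup_of_def)
qed

lemma dv_dv: "a dvd b \<Longrightarrow> dv (dv X a) b = dv X b" using Om_dvd[of a b] unfolding dv_def by blast

lemma dv_antimono: "a dvd b \<Longrightarrow> dv X b \<subseteq> dv X a"
 using Om_dvd[of a b] unfolding dv_def by blast

lemma dv_unram: assumes "subgroup X G" "0 < a" shows "dv X a \<in> unram G T \<Omega> d X"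
proof -
 have "dv X a \<lhd> G\<lparr>carrier := X\<rparr>"
  using d_conj subgroup.mem_carrier[OF assms(1)] subgroup.m_closed[OF assms(1)]
   subgroup.m_inv_closed[OF assms(1)]
  by (intro G.normal_in_subgroupI assms dv_subgroup dv_subset) (auto simp: dv_def)
 moreover have "I_of X \<subseteq> dv X a" using I_of_dv[of X a] by (auto simp: inertia_def)
 ultimately show ?thesis using dv_open[OF assms] by (simp add: unram_def open_normal_in_def open_subgroup_of_def)
qed

text \<open>Elements of X with normalized degree \<omega> differ by inertia, which V contains; so
  the coset chosen by \<open>THE\<close> in \<open>frob_elt\<close> is the coset of any such
  \<phi>.\<close>

lemma frob_elt_mem:
 assumes X: "inert_finite X" and \<phi>: "\<phi> \<in> X" "d \<phi> = \<omega> \<up> f_of X" and V: "V \<in> unram G T \<Omega> d X"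
 shows "\<phi> \<in> frob_elt G \<Omega> \<omega> d X V"
proof -
 note sX = inert_finite_subgroup[OF X]
 have "V \<lhd> G\<lparr>carrier := X\<rparr>" "I_of X \<subseteq> V" using V by (auto simp: unram_def open_normal_in_def)
 note VG = G.normal_in_subgroup[OF sX this(1)]
 have \<phi>c: "\<phi> \<in> carrier G" by (rule subgroup.mem_carrier[OF sX \<phi>(1)])
 have "frob_elt G \<Omega> \<omega> d X V = V #> \<phi>" unfolding frob_elt_def
 proof (rule the_equality)
  show "\<exists>h\<in>X. norm_deg G \<Omega> d X h = \<omega> \<and> V #> \<phi> = V #> h"
   using \<phi>(1) norm_deg_eq[OF X omega_carrier \<phi>(2)[symmetric]] by blast
  fix c assume "\<exists>h\<in>X. norm_deg G \<Omega> d X h = \<omega> \<and> c = V #> h"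
  then obtain h where h: "h \<in> X" "norm_deg G \<Omega> d X h = \<omega>" "c = V #> h" by blast
  have hc: "h \<in> carrier G" by (rule subgroup.mem_carrier[OF sX h(1)])
  have "d h \<in> Om (f_of X)" using h(1) d_inert_finite[OF X] by blast
  then obtain w where w: "w \<in> carrier \<Omega>" "w \<up> f_of X = d h" by (auto simp: Om_def)
  then have "d h = d \<phi>" using norm_deg_eq[OF X w] h(2) \<phi>(2) by simp
  then have "h \<div> \<phi> \<in> I_of X"
   using h(1) \<phi>(1) hc \<phi>c subgroup.m_closed[OF sX] subgroup.m_inv_closed[OF sX] by (simp add: mem_I_of)
  then have "h \<div> \<phi> \<in> V" using \<open>I_of X \<subseteq> V\<close> by blast
  then show "c = V #> \<phi>" using G.rcoset_eq_iff[OF VG(1) hc \<phi>c] h(3) by simp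
 qed
 then show ?thesis using G.rcos_self[OF \<phi>c VG(1)] by simp
qed

text \<open>Powers of an element of degree a represent the cosets, exactly as powers of \<omega> do
  in \<Omega>.\<close>

lemma index_dv:
 assumes X: "inert_finite X" and a: "0 < a" "f_of X dvd a" and b: "Pnum b"
 shows "grp_index G (dv X a) (dv X (a * b)) = b"
proof -
 note sX = inert_finite_subgroup[OF X]
 obtain \<psi> where \<psi>: "\<psi> \<in> X" "d \<psi> = \<omega> \<up> a" using frobenius_exists[OF X a] by blast
 have \<psi>c: "\<psi> \<in> carrier G" by (rule subgroup.mem_carrier[OF sX \<psi>(1)])
 have \<psi>j: "\<psi> [^] (j::nat) \<in> X" for j
  by (induction j) (use \<psi> subgroup.one_closed[OF sX] subgroup.m_closed[OF sX] in auto)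
 have d\<psi>: "d (\<psi> [^] (j::nat)) = \<omega> \<up> (a * j)" for j
  using d.hom_nat_pow[OF \<psi>c, of j] \<psi>(2) by (simp add: Og.nat_pow_pow)
 show ?thesis
 proof (rule G.index_by_representatives(1)[OF dv_subgroup[OF sX] dv_subgroup[OF sX], of b "\<lambda>j. \<psi> [^] j"])
  show "\<psi> [^] j \<in> dv X a" for j :: nat
   using \<psi>j d\<psi> pow_in_Om[OF omega_carrier, of a "a * j"] by (simp add: dv_def)
  show "\<exists>j<b. h \<div> (\<psi> [^] j) \<in> dv X (a * b)" if "h \<in> dv X a" for h
  proof -
   have h: "h \<in> X" "d h \<in> Om a" "h \<in> carrier G"
    using that subgroup.mem_carrier[OF sX] by (auto simp: dv_def)
   obtain j where j: "j < b" "d h \<cdot> inv\<^bsub>\<Omega>\<^esub> (\<omega> \<up> (a * j)) \<in> Om (a * b)"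
    using Om_representatives[OF a(1) Pnum_pos[OF b] h(2)] by blast
   then have "h \<div> (\<psi> [^] j) \<in> dv X (a * b)"
    using h \<psi>j \<psi>c subgroup.m_closed[OF sX] subgroup.m_inv_closed[OF sX] by (simp add: dv_def d\<psi>)
   then show ?thesis using j by blast
  qed
  show "i = j" if "i < b" "j < b" "\<psi> [^] j \<div> (\<psi> [^] i) \<in> dv X (a * b)" for i j :: nat
   using that \<psi>c Om_representatives_unique[OF a(1) b that(1,2)] by (simp add: dv_def d\<psi>)
 qed
qed

text \<open>\<open>dv H a\<close> is the full preimage of a\<Omega> in H and contains the inertia
  group, so a double coset is determined by degrees alone; the contribution of a\<Omega> is absorbed
  in c\<Omega>.\<close>

lemma double_coset_degree:
 assumes H: "subgroup H G" and \<Sigma>: "subgroup \<Sigma> G" "\<Sigma> \<subseteq> H" "d ` \<Sigma> = Om c" and a: "c dvd a" and h: "h \<in> H"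
 shows "double_coset G (dv H a) h \<Sigma> = {x \<in> H. d x \<cdot> inv\<^bsub>\<Omega>\<^esub> d h \<in> Om c}"
proof (intro equalityI subsetI)
 interpret H: subgroup H G by fact
 interpret Omc: subgroup "Om c" \<Omega> by (rule Om_subgroup)
 fix x
 {
  assume "x \<in> double_coset G (dv H a) h \<Sigma>"
  then obtain s j where sj: "s \<in> H" "d s \<in> Om a" "j \<in> \<Sigma>" "x = s \<otimes> h \<otimes> j"
   by (auto simp: G.double_coset_eq dv_def)
  have jH: "j \<in> H" and dj: "d j \<in> Om c" and ds: "d s \<in> Om c" using sj \<Sigma> Om_dvd[OF a] by auto
  have "d x \<cdot> inv\<^bsub>\<Omega>\<^esub> d h = d s \<cdot> d j"
   using sj jH h by (simp add: Og.m_assoc Og.m_comm[of "d h"])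
  then show "x \<in> {x \<in> H. d x \<cdot> inv\<^bsub>\<Omega>\<^esub> d h \<in> Om c}"
   using dj ds sj jH h by simp
 next
  assume "x \<in> {x \<in> H. d x \<cdot> inv\<^bsub>\<Omega>\<^esub> d h \<in> Om c}"
  then have x: "x \<in> H" "d x \<cdot> inv\<^bsub>\<Omega>\<^esub> d h \<in> Om c" by auto
  then obtain j where j: "j \<in> \<Sigma>" "d j = d x \<cdot> inv\<^bsub>\<Omega>\<^esub> d h" using \<Sigma>(3) by (metis imageE)
  have jH: "j \<in> H" using j \<Sigma> by auto
  define s where "s = x \<div> j \<div> h"
  have "d s = \<one>\<^bsub>\<Omega>\<^esub>" using x jH h j(2)
   by (simp add: s_def Og.inv_mult_group Og.m_assoc Og.m_comm[of "d h"])
  then have "s \<in> dv H a" using x jH h subgroup.one_closed[OF Om_subgroup] by (simp add: s_def dv_def)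
  moreover have "x = s \<otimes> h \<otimes> j" using x jH h by (simp add: s_def G.m_assoc)
  ultimately show "x \<in> double_coset G (dv H a) h \<Sigma>" using j(1) by (auto simp: G.double_coset_eq)
 }
qed

text \<open>Since only degrees matter, b consecutive powers of a Frobenius element represent the
  double cosets. This is what turns the Mackey formula into a product along a Frobenius
  orbit.\<close>

lemma double_coset_representatives:
 assumes H: "inert_finite H" and \<phi>: "\<phi> \<in> H" "d \<phi> = \<omega> \<up> f_of H"
  and \<Sigma>: "subgroup \<Sigma> G" "\<Sigma> \<subseteq> H" "d ` \<Sigma> = Om (f_of H * b)" and b: "Pnum b" and a: "f_of H * b dvd a"
 shows "bij_betw (\<lambda>h. double_coset G (dv H a) h \<Sigma>) ((\<lambda>j. \<phi> [^] j) ` {..<b}) (double_cosets G (dv H a) H \<Sigma>)"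
  and "inj_on (\<lambda>j. \<phi> [^] j) {..<b}" and "(\<lambda>j. \<phi> [^] j) ` {..<b} \<subseteq> H"
proof -
 note sH = inert_finite_subgroup[OF H]
 interpret H: subgroup H G by (rule sH)
 interpret Omc: subgroup "Om (f_of H * b)" \<Omega> by (rule Om_subgroup)
 have f0: "0 < f_of H" using Pnum_pos[OF Pnum_f[OF H]] .
 have \<phi>j: "\<phi> [^] (j::nat) \<in> H" for j by (induction j) (use \<phi> in auto)
 then show "(\<lambda>j. \<phi> [^] j) ` {..<b} \<subseteq> H" by auto
 have d\<phi>: "d (\<phi> [^] (j::nat)) = \<omega> \<up> (f_of H * j)" for j
  using d.hom_nat_pow[of \<phi> j] \<phi> by (simp add: Og.nat_pow_pow)
 note dc = double_coset_degree[OF sH \<Sigma> a]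
 have inj: "inj_on (\<lambda>j. double_coset G (dv H a) (\<phi> [^] j) \<Sigma>) {..<b}"
 proof (rule inj_onI)
  fix i j assume ij: "i \<in> {..<b}" "j \<in> {..<b}"
   "double_coset G (dv H a) (\<phi> [^] i) \<Sigma> = double_coset G (dv H a) (\<phi> [^] j) \<Sigma>"
  have "\<phi> [^] j \<in> double_coset G (dv H a) (\<phi> [^] j) \<Sigma>" using \<phi>j d\<phi> by (simp add: dc)
  then have "\<phi> [^] j \<in> double_coset G (dv H a) (\<phi> [^] i) \<Sigma>" using ij(3) by simp
  then have "\<omega> \<up> (f_of H * j) \<cdot> inv\<^bsub>\<Omega>\<^esub> (\<omega> \<up> (f_of H * i)) \<in> Om (f_of H * b)"
   using \<phi>j d\<phi> by (simp add: dc)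
  then show "i = j" using Om_representatives_unique[OF f0 b] ij by simp
 qed
 then show inj': "inj_on (\<lambda>j. \<phi> [^] j) {..<b}" unfolding inj_on_def by metis
 have "(\<lambda>h. double_coset G (dv H a) h \<Sigma>) ` ((\<lambda>j. \<phi> [^] j) ` {..<b}) = double_cosets G (dv H a) H \<Sigma>"
  unfolding double_cosets_def
 proof (intro equalityI subsetI)
  fix X assume "X \<in> (\<lambda>h. double_coset G (dv H a) h \<Sigma>) ` H"
  then obtain h where h: "h \<in> H" "X = double_coset G (dv H a) h \<Sigma>" by blast
  have hc: "h \<in> carrier G" using h by auto
  have "d h \<in> Om (f_of H)" using h d_inert_finite[OF H] by auto
  then obtain j where j: "j < b" "d h \<cdot> inv\<^bsub>\<Omega>\<^esub> (\<omega> \<up> (f_of H * j)) \<in> Om (f_of H * b)"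
   using Om_representatives[OF f0 Pnum_pos[OF b]] by blast
  let ?y = "\<omega> \<up> (f_of H * j)"
  have "d x \<cdot> inv\<^bsub>\<Omega>\<^esub> d h \<in> Om (f_of H * b) \<longleftrightarrow> d x \<cdot> inv\<^bsub>\<Omega>\<^esub> ?y \<in> Om (f_of H * b)" if "x \<in> H" for x
  proof -
   let ?q = "d h \<cdot> inv\<^bsub>\<Omega>\<^esub> ?y" and ?p = "d x \<cdot> inv\<^bsub>\<Omega>\<^esub> d h"
   have xc: "x \<in> carrier G" using that by auto
   have e: "?p \<cdot> ?q = d x \<cdot> inv\<^bsub>\<Omega>\<^esub> ?y"
   proof -
    have "?p \<cdot> ?q = d x \<cdot> ((inv\<^bsub>\<Omega>\<^esub> d h \<cdot> d h) \<cdot> inv\<^bsub>\<Omega>\<^esub> ?y)"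
     using xc hc by (simp only: Og.m_assoc Og.m_closed Og.inv_closed d.hom_closed omega_carrier Og.nat_pow_closed)
    then show ?thesis using hc xc by simp
   qed
   have pc: "?p \<in> carrier \<Omega>" "?q \<in> carrier \<Omega>" using xc hc by auto
   have "?p \<in> Om (f_of H * b)" if "?p \<cdot> ?q \<in> Om (f_of H * b)"
   proof -
    have "?p \<cdot> ?q \<cdot> inv\<^bsub>\<Omega>\<^esub> ?q \<in> Om (f_of H * b)"
     by (rule Omc.m_closed[OF that Omc.m_inv_closed[OF j(2)]])
    then show ?thesis using Og.m_assoc[OF pc Og.inv_closed[OF pc(2)]] Og.r_inv[OF pc(2)] Og.r_one[OF pc(1)]
     by (simp only:)
   qed
   then show ?thesis using e j(2) Omc.m_closed by metis
  qed
  then have "X = double_coset G (dv H a) (\<phi> [^] j) \<Sigma>" using h(1) \<phi>j by (auto simp: h(2) dc d\<phi>)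
  then show "X \<in> (\<lambda>h. double_coset G (dv H a) h \<Sigma>) ` ((\<lambda>j. \<phi> [^] j) ` {..<b})" using j(1) by auto
 qed (use \<phi>j in auto)
 moreover have "inj_on (\<lambda>h. double_coset G (dv H a) h \<Sigma>) ((\<lambda>j. \<phi> [^] j) ` {..<b})"
  using inj unfolding inj_on_def by auto
 ultimately show "bij_betw (\<lambda>h. double_coset G (dv H a) h \<Sigma>) ((\<lambda>j. \<phi> [^] j) ` {..<b}) (double_cosets G (dv H a) H \<Sigma>)"
  by (simp add: bij_betw_def)
qed

end

section \<open>Galois layers and the groups \<open>\<Sigma>\<^sub>h\<close>\<close>

locale galois_layer = pro_P_degree +
 fixes H U
 assumes H_inert: "inertially_finite G T \<Omega> d H" and U_inert: "inertially_finite G T \<Omega> d U"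
  and normal: "U \<lhd> G\<lparr>carrier := H\<rparr>" and fin: "fin_index G H U"
begin

lemmas H_sub = inert_finite_subgroup[OF H_inert]

sublocale H: subgroup H G by (rule H_sub)
sublocale U: subgroup U G using G.normal_in_subgroup(1)[OF H_sub normal] .

lemma UH: "U \<subseteq> H" and U_conj: "h \<in> H \<Longrightarrow> u \<in> U \<Longrightarrow> h \<otimes> u \<div> h \<in> U"
  and U_conj': "h \<in> H \<Longrightarrow> u \<in> U \<Longrightarrow> inv h \<otimes> u \<otimes> h \<in> U"
 by (fact G.normal_in_subgroup(2-4)[OF H_sub normal])+

lemma U_H: "u \<in> U \<Longrightarrow> u \<in> H" using UH by blast

lemma U_open: "open_subgroup_of G T U H"
 using closed_finite_index_open[OF H_sub U.subgroup_axioms UH inert_finite_closed[OF U_inert] fin]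
  UH U.subgroup_axioms unfolding open_subgroup_of_def by blast

lemma H_pow: "h \<in> H \<Longrightarrow> h [^] (k::nat) \<in> H" by (induction k) auto

abbreviation idx where "idx \<equiv> grp_index G H U"

lemma pow_idx: "h \<in> H \<Longrightarrow> h [^] idx \<in> U" by (rule G.normal_index_pow[OF H_sub normal])

text \<open>By \<open>open_exponent\<close> a P-number annihilates H/U, and every prime dividing the
  order of a finite group divides each of its exponents.\<close>

lemma Pnum_idx: "Pnum idx"
proof -
 let ?Q = "G\<lparr>carrier := H\<rparr> Mod U"
 interpret N: normal U "G\<lparr>carrier := H\<rparr>" by (rule normal)
 interpret Q: plain_group ?Q by (rule plain_group.intro[OF N.factorgroup_is_group])
 have ord: "order ?Q = idx" by (simp add: order_def FactGroup_def grp_index_def)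
 have finQ: "finite (carrier ?Q)" using fin by (simp add: FactGroup_def fin_index_def)
 obtain k where k: "Pnum k" "\<And>h. h \<in> H \<Longrightarrow> h [^] k \<in> U"
  using open_exponent[OF _ U.one_closed H_sub] U_open by (auto simp: open_subgroup_of_def)
 have kQ: "x [^]\<^bsub>?Q\<^esub> k = \<one>\<^bsub>?Q\<^esub>" if xQ: "x \<in> carrier ?Q" for x
 proof -
  obtain h where h: "h \<in> H" "x = U #>\<^bsub>G\<lparr>carrier := H\<rparr>\<^esub> h" using xQ by (auto simp: carrier_FactGroup)
  have "x [^]\<^bsub>?Q\<^esub> k = U #> (h [^] k)" using N.FactGroup_pow[of h k] h by (simp add: G.pow_restrict)
  also have "\<dots> = U" using k(2)[OF h(1)] G.coset_join2[of "h [^] k" U] U.subgroup_axioms by simp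
  finally show ?thesis by simp
 qed
 have "0 < idx" by (rule G.fin_index_pos[OF H_sub fin])
 moreover have "p \<in> P" if "prime p" "p dvd idx" for p
  using Q.prime_dvd_exponent[OF finQ that(1) _ kQ] that k(1) ord by (auto simp: Pnum_def)
 ultimately show ?thesis by (simp add: Pnum_def)
qed

lemma d_conj': "g \<in> carrier G \<Longrightarrow> x \<in> carrier G \<Longrightarrow> d (inv g \<otimes> x \<otimes> g) = d x"
 using d_conj[of "inv g" x] by simp

lemma IU_conj: "h \<in> H \<Longrightarrow> i \<in> I_of U \<Longrightarrow> h \<otimes> i \<div> h \<in> I_of U"
 using U_conj d_conj by (simp add: mem_I_of)

lemma IU_conj': "h \<in> H \<Longrightarrow> i \<in> I_of U \<Longrightarrow> inv h \<otimes> i \<otimes> h \<in> I_of U"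
 using U_conj' d_conj' by (simp add: mem_I_of)

lemma dvU_conj_set: "h \<in> H \<Longrightarrow> conj_set G h (dv U a) = dv U a"
 proof (rule G.conj_set_invariant)
 assume h: "h \<in> H"
 have hc: "h \<in> carrier G" by (rule H.mem_carrier[OF h])
 then show "h \<in> carrier G" .
 show "dv U a \<subseteq> carrier G" using dv_subset U.subset by (rule subset_trans)
 fix x assume x: "x \<in> dv U a"
 then have xU: "x \<in> U" and dx: "d x \<in> Om a" by (auto simp: dv_def)
 have xc: "x \<in> carrier G" by (rule U.mem_carrier[OF xU])
 show "h \<otimes> x \<div> h \<in> dv U a" "inv h \<otimes> x \<otimes> h \<in> dv U a"
  using d_conj[OF hc xc] d_conj'[OF hc xc] dx U_conj[OF h xU] U_conj'[OF h xU] unfolding dv_def by simp_all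
qed

lemma dvH_conj_set: "h \<in> H \<Longrightarrow> conj_set G h (dv H a) = dv H a"
 proof (rule G.conj_set_invariant)
 assume h: "h \<in> H"
 have hc: "h \<in> carrier G" by (rule H.mem_carrier[OF h])
 then show "h \<in> carrier G" .
 show "dv H a \<subseteq> carrier G" using dv_subset H.subset by (rule subset_trans)
 fix x assume x: "x \<in> dv H a"
 then have xH: "x \<in> H" and dx: "d x \<in> Om a" by (auto simp: dv_def)
 have xc: "x \<in> carrier G" by (rule H.mem_carrier[OF xH])
 have "h \<otimes> x \<div> h \<in> H" "inv h \<otimes> x \<otimes> h \<in> H"
  by (intro H.m_closed H.m_inv_closed h xH)+
 then show "h \<otimes> x \<div> h \<in> dv H a" "inv h \<otimes> x \<otimes> h \<in> dv H a"
  using d_conj[OF hc xc] d_conj'[OF hc xc] dx unfolding dv_def by simp_all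
qed

lemma U_conj_set: "h \<in> H \<Longrightarrow> conj_set G h U = U"
 by (rule G.conj_set_invariant) (auto intro: U_conj U_conj')

lemma dvU_open: "0 < a \<Longrightarrow> open_subgroup_of G T (dv U a) H"
 using open_subgroup_of_trans[OF U_open dv_open[OF U.subgroup_axioms]] .

lemma dvH_open: "0 < a \<Longrightarrow> open_subgroup_of G T (dv H a) H" by (rule dv_open[OF H_sub])

section \<open>The groups \<open>Sg h\<close>: degrees, inertia and intersections\<close>

abbreviation Sg where "Sg h \<equiv> Sigma_h G T \<Omega> d U h"

lemma mem_Sg: "x \<in> Sg h \<longleftrightarrow> (\<exists>s\<in>cyc h. \<exists>i\<in>I_of U. x = s \<otimes> i)"
 by (auto simp: Sigma_h_def cyc_def set_mult_def)

lemma cyc_H: "h \<in> H \<Longrightarrow> cyc h \<subseteq> H"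
 by (rule cyc_minimal[OF H_sub inert_finite_closed[OF H_inert]])

lemma IU_sub: "subgroup (I_of U) G" by (rule I_of_subgroup[OF U.subgroup_axioms])

lemma IU_H: "I_of U \<subseteq> H" using UH by (auto simp: mem_I_of)

lemma Sg_sub_H: "h \<in> H \<Longrightarrow> Sg h \<subseteq> H"
proof
 fix x assume h: "h \<in> H" and "x \<in> Sg h"
 then obtain s i where si: "s \<in> cyc h" "i \<in> I_of U" "x = s \<otimes> i" using mem_Sg by blast
 have "s \<in> H" "i \<in> H" using si cyc_H[OF h] IU_H by blast+
 then show "x \<in> H" using si by simp
qed

lemma Sg_subgroup: assumes h: "h \<in> H" shows "subgroup (Sg h) G"
proof (rule G.subgroupI)
 interpret Z: subgroup "cyc h" G using cyc_subgroup[OF H.mem_carrier[OF h]] .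
 interpret I: subgroup "I_of U" G by (rule IU_sub)
 note cH = cyc_H[OF h]
 show "Sg h \<subseteq> carrier G" using Sg_sub_H[OF h] by auto
 have "\<one> = \<one> \<otimes> \<one>" by simp
 then show "Sg h \<noteq> {}" using Z.one_closed I.one_closed mem_Sg by blast
 show "inv x \<in> Sg h" if xS: "x \<in> Sg h" for x
 proof -
  obtain s i where si: "s \<in> cyc h" "i \<in> I_of U" "x = s \<otimes> i" using xS mem_Sg by blast
  have "inv x = inv s \<otimes> (s \<div> i \<div> s)" using si by (simp add: G.inv_mult_group G.m_assoc[symmetric])
  moreover have "s \<div> i \<div> s \<in> I_of U" using si cH by (intro IU_conj) auto
  ultimately show ?thesis using si mem_Sg by (metis Z.m_inv_closed)
 qed
 show "x \<otimes> y \<in> Sg h" if xyS: "x \<in> Sg h" "y \<in> Sg h" for x y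
 proof -
  obtain s i t j where si: "s \<in> cyc h" "i \<in> I_of U" "x = s \<otimes> i" "t \<in> cyc h" "j \<in> I_of U" "y = t \<otimes> j"
   using xyS mem_Sg by metis
  have "x \<otimes> y = (s \<otimes> t) \<otimes> ((inv t \<otimes> i \<otimes> t) \<otimes> j)"
  proof -
   have "t \<otimes> (inv t \<otimes> (i \<otimes> (t \<otimes> j))) = i \<otimes> (t \<otimes> j)"
    using si by (simp add: G.m_assoc[symmetric])
   then show ?thesis using si by (simp add: G.m_assoc)
  qed
  moreover have "inv t \<otimes> i \<otimes> t \<in> I_of U" using si cH by (intro IU_conj') auto
  ultimately show ?thesis using si mem_Sg by (metis Z.m_closed I.m_closed)
 qed
qed

lemma cyc_Sg: "h \<in> H \<Longrightarrow> cyc h \<subseteq> Sg h"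
proof
 fix s assume h: "h \<in> H" and s: "s \<in> cyc h"
 have "s = s \<otimes> \<one>" using cyc_H[OF h] s by auto
 then show "s \<in> Sg h" using s subgroup.one_closed[OF IU_sub] mem_Sg by blast
qed

lemma self_Sg: "h \<in> H \<Longrightarrow> h \<in> Sg h" using cyc_Sg cyc_self[OF H.mem_carrier] by blast

lemma d_Sg: assumes h: "h \<in> H" "d h = \<omega> \<up> (c::nat)" shows "d ` Sg h = Om c"
proof -
 have "d (s \<otimes> i) = d s" if "s \<in> cyc h" "i \<in> I_of U" for s i
  using that cyc_H[OF h(1)] by (auto simp: mem_I_of subset_iff)
 then have "d ` Sg h \<subseteq> d ` cyc h" by (auto simp: mem_Sg)
 moreover have "d ` cyc h \<subseteq> d ` Sg h" using cyc_Sg[OF h(1)] by blast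
 ultimately have "d ` Sg h = d ` cyc h" by (rule equalityI)
 then show ?thesis using d_cyc[OF H.mem_carrier[OF h(1)] h(2)] by (rule trans)
qed

text \<open>A factor s in \<open>cyc h\<close> of trivial degree lies in every open normal subgroup
  by \<open>cyc_kernel\<close>, hence in U. So passing from U to \<open>Sg h\<close> adds no
  inertia.\<close>

lemma I_Sg: assumes h: "h \<in> H" "d h = \<omega> \<up> (c::nat)" "0 < c" shows "I_of (Sg h) = I_of U"
proof (intro equalityI subsetI)
 obtain N where N: "N \<lhd> G" "openin T N" "N \<inter> H \<subseteq> U"
  using open_normal_below[OF _ U.one_closed H.subset] U_open by (auto simp: open_subgroup_of_def)
 fix x assume x: "x \<in> I_of (Sg h)"
 then obtain s i where si: "s \<in> cyc h" "i \<in> I_of U" "x = s \<otimes> i" by (auto simp: mem_I_of mem_Sg)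
 have sH: "s \<in> H" using si cyc_H[OF h(1)] by blast
 have "d s = \<one>\<^bsub>\<Omega>\<^esub>" using x si sH by (auto simp: mem_I_of)
 then have "s \<in> N" using cyc_kernel[OF H.mem_carrier[OF h(1)] h(2,3) si(1) _ N(1,2)] by simp
 then have "s \<in> I_of U" using N(3) sH \<open>d s = \<one>\<^bsub>\<Omega>\<^esub>\<close> by (auto simp: mem_I_of)
 then show "x \<in> I_of U" using si subgroup.m_closed[OF IU_sub] by simp
next
 fix x assume x: "x \<in> I_of U"
 have "x = \<one> \<otimes> x" using x by (simp add: mem_I_of)
 then have "x \<in> Sg h" using x mem_Sg subgroup.one_closed[OF cyc_subgroup[OF H.mem_carrier[OF h(1)]]] by blast
 then show "x \<in> I_of (Sg h)" using x by (simp add: mem_I_of)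
qed

text \<open>As h^[H:U] lies in U, the group \<open>cyc (h [^] idx)\<close> sits in U and realizes
  all degrees in \<open>Om (c * idx)\<close>; an element of U with such a degree differs from one of
  its elements by inertia of U.\<close>

lemma dvU_Sg: assumes h: "h \<in> H" "d h = \<omega> \<up> (c::nat)" and a: "Om a \<subseteq> Om (c * idx)" shows "dv U a \<subseteq> Sg h"
proof
 fix w assume w: "w \<in> dv U a"
 have "h [^] idx \<in> U" by (rule pow_idx[OF h(1)])
 have "d (h [^] idx) = \<omega> \<up> (c * idx)" using h d.hom_nat_pow[of h idx] by (simp add: Og.nat_pow_pow)
 then have "d ` cyc (h [^] idx) = Om (c * idx)" using d_cyc[of "h [^] idx"] h(1) by simp
 moreover have "d w \<in> Om (c * idx)" using w a by (auto simp: dv_def)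
 ultimately obtain s where s: "s \<in> cyc (h [^] idx)" "d s = d w" by (metis imageE)
 have sU: "s \<in> U"
  using s(1) cyc_minimal[OF U.subgroup_axioms inert_finite_closed[OF U_inert] pow_idx[OF h(1)]] by blast
 have sc: "s \<in> cyc h" using s(1) cyc_pow_subset[OF H.mem_carrier[OF h(1)]] by blast
 have wU: "w \<in> U" using w by (simp add: dv_def)
 have "inv s \<otimes> w \<in> I_of U" using sU wU s(2) by (simp add: mem_I_of)
 moreover have "w = s \<otimes> (inv s \<otimes> w)" using sU wU by (simp add: G.m_assoc[symmetric])
 ultimately show "w \<in> Sg h" using sc mem_Sg by blast
qed

lemma Sg_open: assumes h: "h \<in> H" "d h = \<omega> \<up> (c::nat)" "0 < c" shows "open_subgroup_of G T (Sg h) H"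
proof -
 have a: "0 < c * idx" using h(3) Pnum_pos[OF Pnum_idx] by simp
 show ?thesis using openin_subgroup_mono[OF _ dv_subgroup[OF U.subgroup_axioms] Sg_subgroup[OF h(1)]
    dvU_Sg[OF h(1,2) subset_refl] Sg_sub_H[OF h(1)] H_sub] dvU_open[OF a]
   Sg_subgroup[OF h(1)] Sg_sub_H[OF h(1)] by (simp add: open_subgroup_of_def)
qed

text \<open>\<open>Sg h\<close> and U have the same inertia group, and \<open>dv U a\<close>
  realizes every degree in a\<Omega>; so an element of \<open>Sg h\<close> with degree in a\<Omega>
  is an element of \<open>dv U a\<close> times inertia of U.\<close>

lemma dvH_Int_Sg:
 assumes h: "h \<in> H" "d h = \<omega> \<up> (c::nat)" "0 < c" and a: "Om a \<subseteq> Om (c * idx)" "f_of U dvd a"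
 shows "dv H a \<inter> Sg h = dv U a"
proof (intro equalityI subsetI)
 interpret S: subgroup "Sg h" G by (rule Sg_subgroup[OF h(1)])
 fix x assume x: "x \<in> dv H a \<inter> Sg h"
 then have "d x \<in> d ` dv U a" using d_dv[OF U_inert a(2)] by (simp add: dv_def)
 then obtain w where w: "w \<in> dv U a" "d w = d x" by (metis imageE)
 have wS: "w \<in> Sg h" using w(1) dvU_Sg[OF h(1,2) a(1)] by blast
 have wU: "w \<in> U" using w(1) by (simp add: dv_def)
 have "inv w \<otimes> x \<in> I_of (Sg h)" using x wS wU w(2) by (simp add: mem_I_of)
 then have "inv w \<otimes> x \<in> U" using I_Sg[OF h] by (simp add: mem_I_of)
 then have "w \<otimes> (inv w \<otimes> x) \<in> U" using wU by simp
 then show "x \<in> dv U a" using x wU by (simp add: G.m_assoc[symmetric] dv_def)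
next
 fix x assume "x \<in> dv U a"
 then show "x \<in> dv H a \<inter> Sg h" using dvU_Sg[OF h(1,2) a(1)] UH by (auto simp: dv_def)
qed

end

section \<open>Products along orbits\<close>

text \<open>Written additively this is the operator 1 + f + ... + f^(n-1) = (f^n - 1)/(f - 1), the
  shape that both the Mackey formula and the Hilbert 90 argument take.\<close>

primrec orb :: "'a monoid \<Rightarrow> ('a \<Rightarrow> 'a) \<Rightarrow> nat \<Rightarrow> 'a \<Rightarrow> 'a" where
 "orb A f 0 a = \<one>\<^bsub>A\<^esub>"
| "orb A f (Suc n) a = orb A f n a \<otimes>\<^bsub>A\<^esub> (f ^^ n) a"

lemma funpow_closed: "f \<in> hom A A \<Longrightarrow> a \<in> carrier A \<Longrightarrow> (f ^^ n) a \<in> carrier A"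
 by (induction n) (auto simp: hom_def Pi_def)

lemma funpow_hom: "f \<in> hom A A \<Longrightarrow> (f ^^ n) \<in> hom A A"
proof (induction n)
 case 0
 then show ?case by (auto simp: hom_def)
next
 case (Suc n)
 then have f: "\<And>x. x \<in> carrier A \<Longrightarrow> f x \<in> carrier A" "\<And>x y. x \<in> carrier A \<Longrightarrow> y \<in> carrier A \<Longrightarrow> f (x \<otimes>\<^bsub>A\<^esub> y) = f x \<otimes>\<^bsub>A\<^esub> f y"
  and fn: "\<And>x. x \<in> carrier A \<Longrightarrow> (f ^^ n) x \<in> carrier A" "\<And>x y. x \<in> carrier A \<Longrightarrow> y \<in> carrier A \<Longrightarrow> (f ^^ n) (x \<otimes>\<^bsub>A\<^esub> y) = (f ^^ n) x \<otimes>\<^bsub>A\<^esub> (f ^^ n) y"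
  by (auto simp: hom_def)
 then show ?case by (auto simp: hom_def)
qed

lemma group_hom_inv: "group A \<Longrightarrow> group B \<Longrightarrow> f \<in> hom A B \<Longrightarrow> x \<in> carrier A \<Longrightarrow> f (inv\<^bsub>A\<^esub> x) = inv\<^bsub>B\<^esub> f x"
 using group_hom.hom_inv[of A B f x] by (simp add: group_hom_def group_hom_axioms_def)

lemma group_hom_pow: "group A \<Longrightarrow> group B \<Longrightarrow> f \<in> hom A B \<Longrightarrow> x \<in> carrier A \<Longrightarrow> f (x [^]\<^bsub>A\<^esub> (n::nat)) = f x [^]\<^bsub>B\<^esub> n"
 using group_hom.hom_nat_pow[of A B f x n] by (simp add: group_hom_def group_hom_axioms_def)

locale ab_endo = comm_group A for A :: "'a monoid" (structure) +
 fixes f :: "'a \<Rightarrow> 'a"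
 assumes f_hom: "f \<in> hom A A"
begin

lemma f_closed: "a \<in> carrier A \<Longrightarrow> f a \<in> carrier A"
 and f_mult: "a \<in> carrier A \<Longrightarrow> b \<in> carrier A \<Longrightarrow> f (a \<otimes> b) = f a \<otimes> f b"
 using f_hom by (auto simp: hom_def)

lemma fn_closed: "a \<in> carrier A \<Longrightarrow> (f ^^ n) a \<in> carrier A" by (rule funpow_closed[OF f_hom])

lemma fn_mult: "a \<in> carrier A \<Longrightarrow> b \<in> carrier A \<Longrightarrow> (f ^^ n) (a \<otimes> b) = (f ^^ n) a \<otimes> (f ^^ n) b"
 using funpow_hom[OF f_hom, of n] by (auto simp: hom_def)

lemma orb_closed: "a \<in> carrier A \<Longrightarrow> orb A f n a \<in> carrier A"
 by (induction n) (auto simp: fn_closed)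

lemma orb_telescope: "a \<in> carrier A \<Longrightarrow> f (orb A f n a) \<otimes> a = orb A f n a \<otimes> (f ^^ n) a"
proof (induction n)
 case 0
 then show ?case using hom_one[OF f_hom is_group is_group] by simp
next
 case (Suc n)
 have "f (orb A f (Suc n) a) \<otimes> a = (f (orb A f n a) \<otimes> a) \<otimes> (f ^^ Suc n) a"
  using Suc.prems by (simp add: f_mult orb_closed fn_closed f_closed m_ac)
 also have "\<dots> = (orb A f n a \<otimes> (f ^^ n) a) \<otimes> (f ^^ Suc n) a" using Suc by simp
 finally show ?case by simp
qed

lemma orb_telescope': "a \<in> carrier A \<Longrightarrow> f (orb A f n a) \<div> (orb A f n a) = (f ^^ n) a \<div> a"
proof -
 assume a: "a \<in> carrier A"
 let ?o = "orb A f n a"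
 have o: "?o \<in> carrier A" "f ?o \<in> carrier A" "(f ^^ n) a \<in> carrier A"
  using a orb_closed f_closed fn_closed by auto
 have "f ?o \<div> ?o = (f ?o \<otimes> a) \<otimes> (inv ?o \<div> a)"
 proof -
  have "(f ?o \<otimes> a) \<otimes> (inv ?o \<div> a) = (f ?o \<div> ?o) \<otimes> (a \<div> a)"
   using o a by (simp only: m_ac m_closed inv_closed)
  then show ?thesis using o a by simp
 qed
 also have "\<dots> = (?o \<otimes> (f ^^ n) a) \<otimes> (inv ?o \<div> a)" using orb_telescope[OF a] by simp
 also have "\<dots> = ((f ^^ n) a \<div> a) \<otimes> (?o \<div> ?o)"
  using o a by (simp only: m_ac m_closed inv_closed)
 finally show ?thesis using o a by simp
qed

lemma orb_map:
 assumes "g \<in> hom A B" "group B" "\<And>x. x \<in> carrier A \<Longrightarrow> g (f x) = f' (g x)" "a \<in> carrier A"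
 shows "g (orb A f n a) = orb B f' n (g a)"
proof -
 have fn: "g ((f ^^ n) a) = (f' ^^ n) (g a)" for n by (induction n) (simp_all add: assms fn_closed)
 show ?thesis by (induction n)
   (use assms hom_one[OF assms(1) is_group assms(2)] fn orb_closed fn_closed in \<open>simp_all add: hom_mult\<close>)
qed

lemma orb_add: "a \<in> carrier A \<Longrightarrow> orb A f (m + n) a = orb A f m a \<otimes> (f ^^ m) (orb A f n a)"
proof (induction n)
 case 0
 then show ?case using hom_one[OF funpow_hom[OF f_hom] is_group is_group] by (simp add: orb_closed)
next
 case (Suc n)
 then show ?case by (simp add: orb_closed fn_closed fn_mult m_assoc funpow_add)
qed

text \<open>The orbit is traversed c times. With b the P-part and c the P'-part of a degree this
  accounts for the exponent in \<open>Upsilon\<close>.\<close>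

lemma orb_periodic:
 assumes a: "a \<in> carrier A" and p: "(f ^^ b) a = a"
 shows "orb A f (b * c) a = orb A f b a [^] c"
proof (induction c)
 case 0
 then show ?case by simp
next
 case (Suc c)
 have pc: "(f ^^ (b * c)) a = a" by (induction c) (simp_all add: p funpow_add)
 have "(f ^^ m) (f x) = f ((f ^^ m) x)" for m x by (simp add: funpow_swap1)
 then have "(f ^^ (b * c)) (orb A f b a) = orb A f b ((f ^^ (b * c)) a)"
  by (intro orb_map funpow_hom f_hom is_group a) auto
 then have "orb A f (b * c + b) a = orb A f (b * c) a \<otimes> orb A f b a"
  using orb_add[OF a, of "b * c" b] pc by simp
 then show ?case using Suc.IH by (simp add: algebra_simps)
qed

lemma finprod_orb: "a \<in> carrier A \<Longrightarrow> finprod A (\<lambda>j. (f ^^ j) a) {..<n} = orb A f n a"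
proof (induction n)
 case (Suc n)
 have "finprod A (\<lambda>j. (f ^^ j) a) (insert n {..<n}) = (f ^^ n) a \<otimes> finprod A (\<lambda>j. (f ^^ j) a) {..<n}"
  by (rule finprod_insert) (use Suc.prems fn_closed in auto)
 then show ?case using Suc by (simp add: lessThan_Suc orb_closed fn_closed m_comm)
qed simp

end

section \<open>Cohomological Mackey functors\<close>

lemma ric_domainD:
 assumes D: "ric_domain G act D" and x: "x \<in> base D"
 shows "y \<in> rdom D x \<Longrightarrow> y \<in> base D" "y \<in> idom D x \<Longrightarrow> y \<in> base D"
  and "x \<in> rdom D x" "x \<in> idom D x"
  and "y \<in> rdom D x \<Longrightarrow> z \<in> rdom D y \<Longrightarrow> z \<in> rdom D x" "y \<in> idom D x \<Longrightarrow> z \<in> idom D y \<Longrightarrow> z \<in> idom D x"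
  and "g \<in> carrier G \<Longrightarrow> y \<in> rdom D x \<Longrightarrow> act g y \<in> rdom D (act g x)"
  and "g \<in> carrier G \<Longrightarrow> y \<in> idom D x \<Longrightarrow> act g y \<in> idom D (act g x)"
  and "g \<in> carrier G \<Longrightarrow> act g x \<in> base D"
  and "act \<one>\<^bsub>G\<^esub> x = x"
  and "g \<in> carrier G \<Longrightarrow> g' \<in> carrier G \<Longrightarrow> act g' (act g x) = act (g' \<otimes>\<^bsub>G\<^esub> g) x"
proof -
 note r = bspec[OF bspec[OF conjunct2[OF conjunct2[OF D[unfolded ric_domain_def]]] insertI1] x]
 note i = bspec[OF bspec[OF conjunct2[OF conjunct2[OF D[unfolded ric_domain_def]]] insertI2[OF singletonI]] x]
 show "y \<in> rdom D x \<Longrightarrow> y \<in> base D" "y \<in> idom D x \<Longrightarrow> y \<in> base D"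
  using conjunct1[OF r] conjunct1[OF i] by (auto dest: subsetD)
 show "x \<in> rdom D x" "x \<in> idom D x" using r i by (blast dest: conjunct1 conjunct2)+
 show "y \<in> rdom D x \<Longrightarrow> z \<in> rdom D y \<Longrightarrow> z \<in> rdom D x" "y \<in> idom D x \<Longrightarrow> z \<in> idom D y \<Longrightarrow> z \<in> idom D x"
  using conjunct1[OF conjunct2[OF conjunct2[OF r]]] conjunct1[OF conjunct2[OF conjunct2[OF i]]] by blast+
 show "g \<in> carrier G \<Longrightarrow> y \<in> rdom D x \<Longrightarrow> act g y \<in> rdom D (act g x)"
  "g \<in> carrier G \<Longrightarrow> y \<in> idom D x \<Longrightarrow> act g y \<in> idom D (act g x)"
  using conjunct2[OF conjunct2[OF conjunct2[OF r]]] conjunct2[OF conjunct2[OF conjunct2[OF i]]] by blast+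
 interpret A: group_action G "base D" "\<lambda>g. restrict (act g) (base D)"
  by (rule conjunct1[OF conjunct2[OF D[unfolded ric_domain_def]]])
 have el: "act g x \<in> base D" if "g \<in> carrier G" for g using A.element_image[OF that x refl] x by simp
 show "g \<in> carrier G \<Longrightarrow> act g x \<in> base D" by (rule el)
 show "act \<one>\<^bsub>G\<^esub> x = x" using fun_cong[OF A.id_eq_one, of x] x by simp
 show "g \<in> carrier G \<Longrightarrow> g' \<in> carrier G \<Longrightarrow> act g' (act g x) = act (g' \<otimes>\<^bsub>G\<^esub> g) x"
  using A.composition_rule[OF x, of g' g] x el[of g] by simp
qed

locale fn_datum = pro_P_degree P G T \<Omega> TO \<omega> d
 for P :: "nat set"
  and G :: "'g monoid" (structure) and T :: "'g topology"
  and \<Omega> :: "'w monoid" and TO :: "'w topology" and \<omega> :: 'w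
  and d :: "'g \<Rightarrow> 'w" +
 fixes E :: "('g set \<times> 'g set) ric_dom" and M :: "'g set ric_dom"
  and C :: "('g set, 'g, 'a) ric_fun" and v :: "'g set \<Rightarrow> 'a \<Rightarrow> 'w"
 assumes P_nonempty: "P \<noteq> {}"
  and spectrum: "spectrum G T E"
  and FN: "FN_datum G T \<Omega> \<omega> d E M C v"
  and coherent: "coherent G T E"
begin

lemma mackey_M: "mackey_system G M" and cover: "mackey_cover G E M"
 and arith_M: "arithmetic_system G T M" and inert_M: "inertially_finite_system G T \<Omega> d M"
 and coh_C: "coh_mackey_functor G M C" and val_v: "v \<in> Val G \<Omega> \<omega> d M C"
 using FN by (auto simp: FN_datum_def mackey_cover_def)

lemma ric_M: "ric_domain G (conj_set G) M" using mackey_M by (simp add: mackey_system_def subgroup_system_def)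

lemmas dom_base = ric_domainD(1,2)[OF ric_M]

lemma base_inert: "H \<in> base M \<Longrightarrow> inert_finite H"
 using inert_M by (simp add: inertially_finite_system_def)

lemma base_subgroup: "H \<in> base M \<Longrightarrow> subgroup H G" using base_inert inert_finite_subgroup by blast

lemma base_carrier: "H \<in> base M \<Longrightarrow> H \<subseteq> carrier G"
 using base_subgroup subgroup.subset by blast

lemma open_base: "H \<in> base M \<Longrightarrow> open_subgroup_of G T I H \<Longrightarrow> I \<in> base M"
 and open_rdom: "H \<in> base M \<Longrightarrow> open_subgroup_of G T I H \<Longrightarrow> I \<in> rdom M H"
 and open_idom: "H \<in> base M \<Longrightarrow> open_subgroup_of G T I H \<Longrightarrow> I \<in> idom M H"
proof -
 note a = arith_M[unfolded arithmetic_system_def, rule_format]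
 show "H \<in> base M \<Longrightarrow> open_subgroup_of G T I H \<Longrightarrow> I \<in> rdom M H" by (rule conjunct1[OF a])
 show "H \<in> base M \<Longrightarrow> open_subgroup_of G T I H \<Longrightarrow> I \<in> idom M H" by (rule conjunct2[OF a])
 show "H \<in> base M \<Longrightarrow> open_subgroup_of G T I H \<Longrightarrow> I \<in> base M"
  by (rule dom_base(1)[OF _ conjunct1[OF a]])
qed

abbreviation CC where "CC x \<equiv> carrier (obj C x)"
abbreviation res where "res \<equiv> res_map C"
abbreviation ind where "ind \<equiv> ind_map C"
abbreviation con where "con \<equiv> con_map C"

lemma ric_C: "ric_functor G (conj_set G) M C" using coh_C by (simp add: coh_mackey_functor_def ab_ric_functor_def)

lemmas C_parts = ric_C[unfolded ric_functor_def]
lemmas C_parts1 = conjunct1[OF C_parts, rule_format]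
lemmas C_parts2 = conjunct1[OF conjunct2[OF C_parts], rule_format]
lemmas C_parts3 = conjunct1[OF conjunct2[OF conjunct2[OF C_parts]], rule_format]
lemmas C_parts4 = conjunct1[OF conjunct2[OF conjunct2[OF conjunct2[OF C_parts]]], rule_format]
lemmas C_tail = conjunct2[OF conjunct2[OF conjunct2[OF conjunct2[OF C_parts]]]]
lemmas C_parts5 = conjunct1[OF C_tail, rule_format]
lemmas C_parts6 = conjunct1[OF conjunct2[OF C_tail], rule_format]
lemmas C_parts7 = conjunct1[OF conjunct2[OF conjunct2[OF C_tail]], rule_format]
lemmas C_parts8 = conjunct1[OF conjunct2[OF conjunct2[OF conjunct2[OF C_tail]]], rule_format]
lemmas C_parts9 = conjunct1[OF conjunct2[OF conjunct2[OF conjunct2[OF conjunct2[OF C_tail]]]], rule_format]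
lemmas C_parts10 = conjunct2[OF conjunct2[OF conjunct2[OF conjunct2[OF conjunct2[OF C_tail]]]], rule_format]

lemma C_comm_group: "x \<in> base M \<Longrightarrow> comm_group (obj C x)"
 using C_parts1 by (simp add: top_ab_group_def)

lemma C_group: "x \<in> base M \<Longrightarrow> group (obj C x)" using C_comm_group comm_group.axioms(2) by blast

lemma res_hom: "x \<in> base M \<Longrightarrow> y \<in> rdom M x \<Longrightarrow> res y x \<in> hom (obj C x) (obj C y)"
 and ind_hom: "x \<in> base M \<Longrightarrow> y \<in> idom M x \<Longrightarrow> ind x y \<in> hom (obj C y) (obj C x)"
 and con_hom: "x \<in> base M \<Longrightarrow> g \<in> carrier G \<Longrightarrow> con g x \<in> hom (obj C x) (obj C (conj_set G g x))"
proof -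
 have h: "\<And>f x y. f \<in> obj_hom C x C y \<Longrightarrow> f \<in> hom (obj C x) (obj C y)"
  by (simp add: obj_hom_def top_hom_def)
 show "x \<in> base M \<Longrightarrow> y \<in> rdom M x \<Longrightarrow> res y x \<in> hom (obj C x) (obj C y)"
  by (rule h[OF C_parts2])
 show "x \<in> base M \<Longrightarrow> y \<in> idom M x \<Longrightarrow> ind x y \<in> hom (obj C y) (obj C x)"
  by (rule h[OF C_parts3])
 show "x \<in> base M \<Longrightarrow> g \<in> carrier G \<Longrightarrow> con g x \<in> hom (obj C x) (obj C (conj_set G g x))"
  by (rule h[OF C_parts4])
qed

lemma res_closed: "x \<in> base M \<Longrightarrow> y \<in> rdom M x \<Longrightarrow> a \<in> CC x \<Longrightarrow> res y x a \<in> CC y"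
 and ind_closed: "x \<in> base M \<Longrightarrow> y \<in> idom M x \<Longrightarrow> a \<in> CC y \<Longrightarrow> ind x y a \<in> CC x"
 and con_closed: "x \<in> base M \<Longrightarrow> g \<in> carrier G \<Longrightarrow> a \<in> CC x \<Longrightarrow> con g x a \<in> CC (conj_set G g x)"
 by (rule hom_in_carrier[OF res_hom] hom_in_carrier[OF ind_hom] hom_in_carrier[OF con_hom]; assumption)+

lemma res_id: "x \<in> base M \<Longrightarrow> a \<in> CC x \<Longrightarrow> res x x a = a"
 and ind_id: "x \<in> base M \<Longrightarrow> a \<in> CC x \<Longrightarrow> ind x x a = a"
 and con_one: "x \<in> base M \<Longrightarrow> a \<in> CC x \<Longrightarrow> con \<one> x a = a"
 and res_res: "x \<in> base M \<Longrightarrow> y \<in> rdom M x \<Longrightarrow> z \<in> rdom M y \<Longrightarrow> a \<in> CC x \<Longrightarrow> res z y (res y x a) = res z x a"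
 and ind_ind: "x \<in> base M \<Longrightarrow> y \<in> idom M x \<Longrightarrow> z \<in> idom M y \<Longrightarrow> a \<in> CC z \<Longrightarrow> ind x y (ind y z a) = ind x z a"
 and con_con: "x \<in> base M \<Longrightarrow> g \<in> carrier G \<Longrightarrow> g' \<in> carrier G \<Longrightarrow> a \<in> CC x \<Longrightarrow>
   con g' (conj_set G g x) (con g x a) = con (g' \<otimes> g) x a"
 and con_res: "x \<in> base M \<Longrightarrow> y \<in> rdom M x \<Longrightarrow> g \<in> carrier G \<Longrightarrow> a \<in> CC x \<Longrightarrow>
   con g y (res y x a) = res (conj_set G g y) (conj_set G g x) (con g x a)"
 and con_ind: "x \<in> base M \<Longrightarrow> y \<in> idom M x \<Longrightarrow> g \<in> carrier G \<Longrightarrow> a \<in> CC y \<Longrightarrow>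
   con g x (ind x y a) = ind (conj_set G g x) (conj_set G g y) (con g y a)"
 by (rule C_parts5[THEN conjunct1] C_parts5[THEN conjunct2, THEN conjunct1]
   C_parts5[THEN conjunct2, THEN conjunct2] C_parts6 C_parts7 C_parts8 C_parts9 C_parts10; assumption)+

lemma con_inner: "x \<in> base M \<Longrightarrow> h \<in> x \<Longrightarrow> a \<in> CC x \<Longrightarrow> con h x a = a"
 and mackey: "x \<in> base M \<Longrightarrow> I \<in> rdom M x \<Longrightarrow> J \<in> idom M x \<Longrightarrow> R \<subseteq> x \<Longrightarrow>
   bij_betw (\<lambda>h. double_coset G I h J) R (double_cosets G I x J) \<Longrightarrow> a \<in> CC J \<Longrightarrow>
   res I x (ind x J a) = finprod (obj C I)
    (\<lambda>h. ind I (I \<inter> conj_set G h J) (con h (conj_set G (inv h) I \<inter> J) (res (conj_set G (inv h) I \<inter> J) J a))) R"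
 and ind_res: "x \<in> base M \<Longrightarrow> I \<in> rdom M x \<Longrightarrow> I \<in> idom M x \<Longrightarrow> a \<in> CC x \<Longrightarrow>
   ind x I (res I x a) = a [^]\<^bsub>obj C x\<^esub> grp_index G x I"
proof -
 note c = coh_C[unfolded coh_mackey_functor_def]
 show "x \<in> base M \<Longrightarrow> h \<in> x \<Longrightarrow> a \<in> CC x \<Longrightarrow> con h x a = a"
  by (rule conjunct1[OF conjunct2[OF c], rule_format])
 show "x \<in> base M \<Longrightarrow> I \<in> rdom M x \<Longrightarrow> J \<in> idom M x \<Longrightarrow> R \<subseteq> x \<Longrightarrow>
   bij_betw (\<lambda>h. double_coset G I h J) R (double_cosets G I x J) \<Longrightarrow> a \<in> CC J \<Longrightarrow>
   res I x (ind x J a) = finprod (obj C I)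
    (\<lambda>h. ind I (I \<inter> conj_set G h J) (con h (conj_set G (inv h) I \<inter> J) (res (conj_set G (inv h) I \<inter> J) J a))) R"
  by (rule conjunct1[OF conjunct2[OF conjunct2[OF c]], rule_format])
 show "x \<in> base M \<Longrightarrow> I \<in> rdom M x \<Longrightarrow> I \<in> idom M x \<Longrightarrow> a \<in> CC x \<Longrightarrow>
   ind x I (res I x a) = a [^]\<^bsub>obj C x\<^esub> grp_index G x I"
  by (rule conjunct2[OF conjunct2[OF conjunct2[OF c]], rule_format]; (assumption | rule IntI)+)
qed

lemma v_morphism: "ric_morphism G (conj_set G) M C (Omega_fun G \<Omega> d) v" using val_v by (simp add: Val_def)

lemma v_hom: "x \<in> base M \<Longrightarrow> v x \<in> hom (obj C x) \<Omega>"
 using conjunct1[OF conjunct2[OF conjunct2[OF v_morphism[unfolded ric_morphism_def]]], rule_format, of x]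
 by (simp add: obj_hom_def top_hom_def Omega_fun_def)

lemma v_closed: "x \<in> base M \<Longrightarrow> a \<in> CC x \<Longrightarrow> v x a \<in> carrier \<Omega>"
 by (rule hom_in_carrier[OF v_hom])

lemma v_res: "x \<in> base M \<Longrightarrow> y \<in> rdom M x \<Longrightarrow> a \<in> CC x \<Longrightarrow> v y (res y x a) = v x a \<up> e_rel G \<Omega> d x y"
 and v_ind: "x \<in> base M \<Longrightarrow> y \<in> idom M x \<Longrightarrow> a \<in> CC y \<Longrightarrow> v x (ind x y a) = v y a \<up> f_rel \<Omega> d x y"
 and v_con: "x \<in> base M \<Longrightarrow> g \<in> carrier G \<Longrightarrow> a \<in> CC x \<Longrightarrow> v (conj_set G g x) (con g x a) = v x a"
proof -
 note m = conjunct2[OF conjunct2[OF conjunct2[OF v_morphism[unfolded ric_morphism_def]]]]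
 show "x \<in> base M \<Longrightarrow> y \<in> rdom M x \<Longrightarrow> a \<in> CC x \<Longrightarrow> v y (res y x a) = v x a \<up> e_rel G \<Omega> d x y"
  using conjunct1[OF m, rule_format, of x y a] by (simp add: Omega_fun_def)
 show "x \<in> base M \<Longrightarrow> y \<in> idom M x \<Longrightarrow> a \<in> CC y \<Longrightarrow> v x (ind x y a) = v y a \<up> f_rel \<Omega> d x y"
  using conjunct1[OF conjunct2[OF m], rule_format, of x y a] by (simp add: Omega_fun_def)
 show "x \<in> base M \<Longrightarrow> g \<in> carrier G \<Longrightarrow> a \<in> CC x \<Longrightarrow> v (conj_set G g x) (con g x a) = v x a"
  using conjunct2[OF conjunct2[OF m], rule_format, of x g a] by (simp add: Omega_fun_def)
qed

lemma prime_exists: "x \<in> base M \<Longrightarrow> \<exists>\<pi>\<in>CC x. v x \<pi> = \<omega>"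
 using val_v unfolding Val_def by (auto simp: image_iff)

definition Eu where "Eu x = kernel (obj C x) \<Omega> (v x)"

lemma mem_Eu: "a \<in> Eu x \<longleftrightarrow> a \<in> CC x \<and> v x a = \<one>\<^bsub>\<Omega>\<^esub>"
 by (simp add: Eu_def kernel_def)

lemma Eu_subgroup: assumes "x \<in> base M" shows "subgroup (Eu x) (obj C x)"
proof -
 interpret vh: group_hom "obj C x" \<Omega> "v x"
  using C_group[OF assms] v_hom[OF assms] by (simp add: group_hom_def group_hom_axioms_def)
 show ?thesis unfolding Eu_def by (rule vh.subgroup_kernel)
qed

lemma Eu_ind: "x \<in> base M \<Longrightarrow> y \<in> idom M x \<Longrightarrow> a \<in> Eu y \<Longrightarrow> ind x y a \<in> Eu x"
 and Eu_con: "x \<in> base M \<Longrightarrow> g \<in> carrier G \<Longrightarrow> a \<in> Eu x \<Longrightarrow> con g x a \<in> Eu (conj_set G g x)"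
 by (simp_all add: mem_Eu ind_closed con_closed v_ind v_con)

lemma flat_base: "H \<in> base (flat E) \<Longrightarrow> H \<in> base M"
 using cover by (auto simp: mackey_cover_def subsystem_def)

text \<open>Read off the exact sequence of the datum, whose Frobenius coset contains every \<phi> of
  degree f_X by \<open>frob_elt_mem\<close>. The second and third statements, descent of fixed units
  and Hilbert 90 for units, carry the argument of \<open>unit_norm\<close>.\<close>

lemma unit_exact:
 assumes H: "H \<in> base (flat E)" and X: "open_subgroup_of G T X H"
  and V: "V \<in> unram G T \<Omega> d X" and \<phi>: "\<phi> \<in> X" "d \<phi> = \<omega> \<up> f_of X"
 shows "\<And>a. a \<in> Eu X \<Longrightarrow> res V X a = \<one>\<^bsub>obj C V\<^esub> \<Longrightarrow> a = \<one>\<^bsub>obj C X\<^esub>"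
  and "\<And>x. x \<in> Eu V \<Longrightarrow> con \<phi> V x = x \<Longrightarrow> \<exists>a\<in>Eu X. x = res V X a"
  and "\<And>x. x \<in> Eu V \<Longrightarrow> ind X V x = \<one>\<^bsub>obj C X\<^esub> \<Longrightarrow> \<exists>y\<in>Eu V. x = con \<phi> V y \<div>\<^bsub>obj C V\<^esub> y"
  and "\<And>a. a \<in> Eu X \<Longrightarrow> \<exists>x\<in>Eu V. a = ind X V x"
proof -
 have XM: "X \<in> base M" using open_base[OF flat_base[OF H] X] .
 have "open_subgroup_of G T V X"
 proof -
  have V': "V \<lhd> G\<lparr>carrier := X\<rparr>" "openin (subtopology T X) V"
   using V by (auto simp: unram_def open_normal_in_def)
  show ?thesis
   using G.normal_in_subgroup(1,2)[OF base_subgroup[OF XM] V'(1)] V'(2) by (simp add: open_subgroup_of_def)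
 qed
 then have VM: "V \<in> base M" using open_base[OF XM] by blast
 interpret cV: comm_group "obj C V" by (rule C_comm_group[OF VM])
 have "\<phi> \<in> frob_elt G \<Omega> \<omega> d X V" by (rule frob_elt_mem[OF base_inert[OF XM] \<phi> V])
 then have ex: "exact_seq
       ([singleton_group \<one>\<^bsub>obj C X\<^esub>, unit_group \<Omega> C v X, unit_group \<Omega> C v V,
        unit_group \<Omega> C v V, unit_group \<Omega> C v X, singleton_group \<one>\<^bsub>obj C X\<^esub>],
       [\<lambda>x. \<one>\<^bsub>obj C X\<^esub>, ind X V,
        \<lambda>x. con \<phi> V x \<div>\<^bsub>obj C V\<^esub> x, res V X,
        \<lambda>x. \<one>\<^bsub>obj C X\<^esub>])"
 proof -
  note q = FN[unfolded FN_datum_def, THEN conjunct2, THEN conjunct2, THEN conjunct2, THEN conjunct2,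
    THEN conjunct2, THEN conjunct2]
  show ?thesis
   by (rule q[rule_format, OF H X V]) (rule \<open>\<phi> \<in> frob_elt G \<Omega> \<omega> d X V\<close>)
 qed
 have u: "carrier (unit_group \<Omega> C v Y) = Eu Y" "\<one>\<^bsub>unit_group \<Omega> C v Y\<^esub> = \<one>\<^bsub>obj C Y\<^esub>" for Y
  by (simp_all add: unit_group_def Eu_def)
 have k: "kernel (unit_group \<Omega> C v X) (unit_group \<Omega> C v V) (res V X) = {\<one>\<^bsub>obj C X\<^esub>}"
  "kernel (unit_group \<Omega> C v V) (unit_group \<Omega> C v V) (\<lambda>x. con \<phi> V x \<div>\<^bsub>obj C V\<^esub> x) = res V X ` Eu X"
  "kernel (unit_group \<Omega> C v V) (unit_group \<Omega> C v X) (ind X V) = (\<lambda>x. con \<phi> V x \<div>\<^bsub>obj C V\<^esub> x) ` Eu V"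
  "kernel (unit_group \<Omega> C v X) (singleton_group \<one>\<^bsub>obj C X\<^esub>) (\<lambda>x. \<one>\<^bsub>obj C X\<^esub>) = ind X V ` Eu V"
  using ex by (auto simp: u)
 show "a = \<one>\<^bsub>obj C X\<^esub>" if "a \<in> Eu X" "res V X a = \<one>\<^bsub>obj C V\<^esub>" for a
 proof -
  have "a \<in> kernel (unit_group \<Omega> C v X) (unit_group \<Omega> C v V) (res V X)"
   using that by (simp add: kernel_def u)
  then show ?thesis unfolding k(1) by simp
 qed
 show "\<exists>a\<in>Eu X. x = res V X a" if x: "x \<in> Eu V" "con \<phi> V x = x" for x
 proof -
  have "x \<in> CC V" using x by (simp add: mem_Eu)
  then have "x \<in> kernel (unit_group \<Omega> C v V) (unit_group \<Omega> C v V) (\<lambda>x. con \<phi> V x \<div>\<^bsub>obj C V\<^esub> x)"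
   using x by (simp add: kernel_def u)
  then show ?thesis unfolding k(2) by blast
 qed
 show "\<exists>y\<in>Eu V. x = con \<phi> V y \<div>\<^bsub>obj C V\<^esub> y" if x: "x \<in> Eu V" "ind X V x = \<one>\<^bsub>obj C X\<^esub>" for x
 proof -
  have "x \<in> kernel (unit_group \<Omega> C v V) (unit_group \<Omega> C v X) (ind X V)"
   using x by (simp add: kernel_def u)
  then show ?thesis unfolding k(3) by blast
 qed
 show "\<exists>x\<in>Eu V. a = ind X V x" if "a \<in> Eu X" for a
 proof -
  have "a \<in> kernel (unit_group \<Omega> C v X) (singleton_group \<one>\<^bsub>obj C X\<^esub>) (\<lambda>x. \<one>\<^bsub>obj C X\<^esub>)"
   using that by (simp add: kernel_def u singleton_group_def)
  then show ?thesis unfolding k(4) by blast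
 qed
qed

lemma f_of_eq: "d ` X = Om a \<Longrightarrow> Pnum a \<Longrightarrow> f_of X = a"
 using index_Om(1)[of 1 a] d_surj by (simp add: f_abs_def f_rel_def)

end

lemma (in plain_group) conj_set_Int:
 assumes "g \<in> carrier G" "X \<subseteq> carrier G" "Y \<subseteq> carrier G"
 shows "conj_set G g (X \<inter> Y) = conj_set G g X \<inter> conj_set G g Y"
proof -
 have "inj_on (\<lambda>x. g \<otimes> x \<div> g) (carrier G)" using assms(1) by (auto simp: inj_on_def)
 then show ?thesis unfolding conj_set_eq by (rule inj_on_image_Int[OF _ assms(2,3)])
qed

section \<open>Elements of \<open>C\<close> attached to Frobenius lifts\<close>

locale fn_layer = fn_datum +
 fixes H U
 assumes HU: "(H, U) \<in> base E"
begin

lemma H_flat: "H \<in> base (flat E)" and U_Ext: "U \<in> Ext E H" using HU by (force simp: flat_def Ext_def)+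

lemma H_base: "H \<in> base M" by (rule flat_base[OF H_flat])

lemma U_idom: "U \<in> idom M H"
proof -
 have "\<forall>H\<in>base (flat E). Ext E H \<subseteq> idom M H" using cover by (simp add: mackey_cover_def)
 then show ?thesis using H_flat U_Ext by blast
qed

lemma U_base: "U \<in> base M" by (rule dom_base(2)[OF H_base U_idom])

sublocale galois_layer P G T \<Omega> TO \<omega> d H U
proof (rule galois_layer.intro[OF pro_P_degree_axioms], rule galois_layer_axioms.intro)
 show "inert_finite H" "inert_finite U" using base_inert H_base U_base by auto
 have "subgroup_system_2 G T E" using spectrum by (simp add: spectrum_def)
 then have "\<forall>(H, U)\<in>base E. closed_normal_in G T U H" unfolding subgroup_system_2_def by blast
 then show "U \<lhd> G\<lparr>carrier := H\<rparr>" using HU unfolding closed_normal_in_def by blast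
 have "\<forall>(H, U)\<in>base E. fin_index G H U" using coherent unfolding coherent_def by blast
 then show "fin_index G H U" using HU by blast
qed

lemma open_base': "open_subgroup_of G T I H \<Longrightarrow> I \<in> base M" by (rule open_base[OF H_base])

lemma open_open_rdom:
 assumes "open_subgroup_of G T I H" "open_subgroup_of G T J H" "J \<subseteq> I"
 shows "J \<in> rdom M I" "J \<in> idom M I"
proof -
 have "I \<subseteq> H" using assms(1) by (simp add: open_subgroup_of_def)
 then have "open_subgroup_of G T J I" by (rule open_subgroup_of_restrict[OF assms(2,3)])
 then show "J \<in> rdom M I" "J \<in> idom M I"
  using open_rdom[OF open_base'[OF assms(1)]] open_idom[OF open_base'[OF assms(1)]] by auto
qed

lemma con_endo:
 assumes "X \<in> base M" "g \<in> carrier G" "conj_set G g X = X"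
 shows "con g X \<in> hom (obj C X) (obj C X)" using con_hom[OF assms(1,2)] assms(3) by simp

lemma con_pow:
 assumes X: "X \<in> base M" "g \<in> carrier G" "conj_set G g X = X" and a: "a \<in> CC X"
 shows "(con g X ^^ n) a = con (g [^] n) X a" "conj_set G (g [^] (n::nat)) X = X"
proof -
 have "(con g X ^^ n) a = con (g [^] n) X a \<and> conj_set G (g [^] n) X = X"
 proof (induction n)
  case 0
  then show ?case using con_one[OF X(1) a] G.conj_set_one[OF base_carrier[OF X(1)]] by simp
 next
  case (Suc n)
  have "con g X (con (g [^] n) X a) = con (g \<otimes> g [^] n) X a"
   using con_con[OF X(1) G.nat_pow_closed[OF X(2), of n] X(2) a] Suc by simp
  moreover have "conj_set G (g \<otimes> g [^] n) X = X"
   using G.conj_set_mult[OF G.nat_pow_closed[OF X(2), of n] X(2) base_carrier[OF X(1)]] Suc X(3) by simp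
  moreover have "g \<otimes> g [^] n = g [^] Suc n" using G.nat_pow_Suc2[OF X(2)] by simp
  ultimately show ?case using Suc by simp
 qed
 then show "(con g X ^^ n) a = con (g [^] n) X a" "conj_set G (g [^] (n::nat)) X = X" by auto
qed

lemma con_ind_fix:
 assumes "X \<in> base M" "Y \<in> idom M X" "g \<in> carrier G" "conj_set G g X = X" "conj_set G g Y = Y" "a \<in> CC Y"
 shows "con g X (ind X Y a) = ind X Y (con g Y a)" using con_ind[OF assms(1-3,6)] assms(4,5) by simp

text \<open>\<open>dv H a\<close> and \<open>dv U a\<close> are invariant under conjugation by H, so
  every Mackey factor is the conjugate by some \<phi>^j of one and the same element.\<close>

lemma mackey_frobenius:
 assumes \<phi>: "\<phi> \<in> H" "d \<phi> = \<omega> \<up> f_of H"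
  and \<Sigma>: "open_subgroup_of G T \<Sigma> H" "d ` \<Sigma> = Om (f_of H * b)" and b: "Pnum b"
  and a: "f_of H * b dvd a" "0 < a" and int: "dv H a \<inter> \<Sigma> = dv U a" and x: "x \<in> CC \<Sigma>"
 shows "res (dv H a) H (ind H \<Sigma> x) =
  orb (obj C (dv H a)) (con \<phi> (dv H a)) b (ind (dv H a) (dv U a) (res (dv U a) \<Sigma> x))"
proof -
 let ?S = "dv H a" and ?W = "dv U a"
 have \<Sigma>': "subgroup \<Sigma> G" "\<Sigma> \<subseteq> H" using \<Sigma>(1) by (auto simp: open_subgroup_of_def)
 note R = double_coset_representatives[OF H_inert \<phi> \<Sigma>' \<Sigma>(2) b a(1)]
 have oS: "open_subgroup_of G T ?S H" and oW: "open_subgroup_of G T ?W H"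
  using dvH_open[OF a(2)] dvU_open[OF a(2)] by auto
 have WS: "?W \<subseteq> ?S" "?W \<subseteq> \<Sigma>" using int by auto
 have SM: "?S \<in> base M" and \<Sigma>M: "\<Sigma> \<in> base M" and WM: "?W \<in> base M"
  using open_base' oS oW \<Sigma>(1) by auto
 interpret cS: comm_group "obj C ?S" by (rule C_comm_group[OF SM])
 have \<phi>c: "\<phi> \<in> carrier G" by (rule H.mem_carrier[OF \<phi>(1)])
 interpret aS: ab_endo "obj C ?S" "con \<phi> ?S"
  using C_comm_group[OF SM] con_endo[OF SM \<phi>c dvH_conj_set[OF \<phi>(1)]] by (simp add: ab_endo_def ab_endo_axioms_def)
 let ?y = "res ?W \<Sigma> x"
 have y: "?y \<in> CC ?W" by (rule res_closed[OF \<Sigma>M open_open_rdom(1)[OF \<Sigma>(1) oW WS(2)] x])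
 have iy: "ind ?S ?W ?y \<in> CC ?S" by (rule ind_closed[OF SM open_open_rdom(2)[OF oS oW WS(1)] y])
 have "res ?S H (ind H \<Sigma> x) = finprod (obj C ?S)
    (\<lambda>h. ind ?S (?S \<inter> conj_set G h \<Sigma>) (con h (conj_set G (inv h) ?S \<inter> \<Sigma>) (res (conj_set G (inv h) ?S \<inter> \<Sigma>) \<Sigma> x)))
    ((\<lambda>j. \<phi> [^] j) ` {..<b})"
  by (rule mackey[OF H_base open_rdom[OF H_base oS] open_idom[OF H_base \<Sigma>(1)] R(3,1) x])
 also have "\<dots> = finprod (obj C ?S) (\<lambda>h. con h ?S (ind ?S ?W ?y)) ((\<lambda>j. \<phi> [^] j) ` {..<b})"
 proof (rule cS.finprod_cong')
  show "(\<lambda>h. con h ?S (ind ?S ?W ?y)) \<in> (\<lambda>j. \<phi> [^] j) ` {..<b} \<rightarrow> CC ?S"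
   using con_pow(1)[OF SM \<phi>c dvH_conj_set[OF \<phi>(1)] iy] aS.fn_closed[OF iy] by (auto simp flip: con_pow(1)[OF SM \<phi>c dvH_conj_set[OF \<phi>(1)] iy])
  fix h assume "h \<in> (\<lambda>j. \<phi> [^] j) ` {..<b}"
  then have h: "h \<in> H" using R(3) by blast
  have hc: "h \<in> carrier G" by (rule H.mem_carrier[OF h])
  have 1: "conj_set G (inv h) ?S \<inter> \<Sigma> = ?W" using dvH_conj_set[OF H.m_inv_closed[OF h]] int by simp
  have "?S \<inter> conj_set G h \<Sigma> = conj_set G h (?S \<inter> \<Sigma>)"
   using G.conj_set_Int[OF hc base_carrier[OF SM] base_carrier[OF \<Sigma>M]] dvH_conj_set[OF h] by simp
  then have 2: "?S \<inter> conj_set G h \<Sigma> = ?W" using int dvU_conj_set[OF h] by simp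
  show "ind ?S (?S \<inter> conj_set G h \<Sigma>) (con h (conj_set G (inv h) ?S \<inter> \<Sigma>) (res (conj_set G (inv h) ?S \<inter> \<Sigma>) \<Sigma> x))
    = con h ?S (ind ?S ?W ?y)" unfolding 1 2
   by (rule con_ind_fix[symmetric, OF SM open_open_rdom(2)[OF oS oW WS(1)] hc dvH_conj_set[OF h] dvU_conj_set[OF h] y])
 qed simp
 also have "\<dots> = finprod (obj C ?S) (\<lambda>j. con (\<phi> [^] j) ?S (ind ?S ?W ?y)) {..<b}"
  by (rule cS.finprod_reindex[OF _ R(2)])
   (use aS.fn_closed[OF iy] in \<open>auto simp flip: con_pow(1)[OF SM \<phi>c dvH_conj_set[OF \<phi>(1)] iy]\<close>)
 also have "\<dots> = finprod (obj C ?S) (\<lambda>j. (con \<phi> ?S ^^ j) (ind ?S ?W ?y)) {..<b}"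
  by (simp only: con_pow(1)[OF SM \<phi>c dvH_conj_set[OF \<phi>(1)] iy])
 also have "\<dots> = orb (obj C ?S) (con \<phi> ?S) b (ind ?S ?W ?y)" by (rule aS.finprod_orb[OF iy])
 finally show ?thesis .
qed

lemma v_res_unram:
 assumes "x \<in> base M" "y \<in> rdom M x" "a \<in> CC x" "I_of x = I_of y"
 shows "v y (res y x a) = v x a"
proof -
 have "e_rel G \<Omega> d x y = 1"
  using G.index_self[OF I_of_subgroup[OF base_subgroup[OF assms(1)]]] assms(4) by (simp add: e_rel_def)
 then show ?thesis using v_res[OF assms(1-3)] v_closed[OF assms(1,3)] by simp
qed

text \<open>An a deep enough for a lift of degree n: divisibility by f_U makes the degrees of
  \<open>dv U a\<close> fill a\<Omega>, and divisibility by f_H n_P [H:U] puts \<open>dv U a\<close>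
  into \<open>Sg h\<close>. That a is a P-number makes it the residue degree of
  \<open>dv U a\<close>, as needed for the unit sequence there.\<close>

definition good where
 "good n a \<longleftrightarrow> Pnum a \<and> f_of U dvd a \<and> f_of H * ppart n * idx dvd a"

lemma good_pos: "good n a \<Longrightarrow> 0 < a" by (simp add: good_def Pnum_pos)

lemma fH_pos: "0 < f_of H" by (rule Pnum_pos[OF Pnum_f[OF H_inert]])

lemma idx_pos: "0 < idx" by (rule Pnum_pos[OF Pnum_idx])

lemma good_exists: "\<exists>a. good n1 a \<and> good n2 a \<and> good n3 a"
proof -
 let ?a = "f_of U * f_of H * idx * (ppart n1 * ppart n2 * ppart n3)"
 have "Pnum ?a" by (intro Pnum_mult Pnum_f Pnum_idx Pnum_ppart H_inert U_inert)
 moreover have "f_of U dvd ?a" by simp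
 moreover have "f_of H * ppart n1 * idx dvd ?a" "f_of H * ppart n2 * idx dvd ?a" "f_of H * ppart n3 * idx dvd ?a"
  by (simp_all add: mult.assoc mult.left_commute[of "f_of U"] mult.commute[of "f_of U"] dvd_def)
 ultimately show ?thesis unfolding good_def by blast
qed

lemma
 assumes "good n a" "0 < n"
 shows good_Om: "Om a \<subseteq> Om (f_of H * n * idx)" and Om_fH: "Om (f_of H * n) = Om (f_of H * ppart n)"
proof -
 have p: "ppart (f_of H * idx * n) = f_of H * idx * ppart n"
  by (rule ppart_Pnum[OF Pnum_mult[OF Pnum_f[OF H_inert] Pnum_idx] assms(2)])
 have "Om (f_of H * n * idx) = Om (f_of H * idx * ppart n)"
  using Om_ppart[of "f_of H * idx * n"] fH_pos idx_pos assms(2) p by (simp add: ac_simps)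
 moreover have "f_of H * idx * ppart n dvd a" using assms(1) by (simp add: good_def ac_simps)
 ultimately show "Om a \<subseteq> Om (f_of H * n * idx)" using Om_dvd by blast
 show "Om (f_of H * n) = Om (f_of H * ppart n)"
  using Om_ppart[of "f_of H * n"] fH_pos assms(2) ppart_Pnum[OF Pnum_f[OF H_inert] assms(2)] by simp
qed

abbreviation frob_lift where
 "frob_lift h n \<equiv> h \<in> H \<and> d h = \<omega> \<up> (f_of H * n) \<and> 0 < n"

lemma
 assumes "frob_lift h n" "good n a"
 shows Sg_Int: "dv H a \<inter> Sg h = dv U a" and dvU_sub_Sg: "dv U a \<subseteq> Sg h"
  and Sg_openH: "open_subgroup_of G T (Sg h) H" and I_Sg_dv: "I_of (Sg h) = I_of (dv U a)"
proof -
 have h: "h \<in> H" "d h = \<omega> \<up> (f_of H * n)" "0 < f_of H * n" "0 < n" using assms(1) fH_pos by auto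
 show "dv H a \<inter> Sg h = dv U a"
  using dvH_Int_Sg[OF h(1-3) good_Om[OF assms(2) h(4)]] assms(2) by (simp add: good_def)
 then show "dv U a \<subseteq> Sg h" by blast
 show "open_subgroup_of G T (Sg h) H" by (rule Sg_open[OF h(1-3)])
 show "I_of (Sg h) = I_of (dv U a)" using I_Sg[OF h(1-3)] I_of_dv by simp
qed

lemma con_Sg_res:
 assumes h: "h \<in> H" and S: "open_subgroup_of G T S H" and W: "W \<subseteq> S" "open_subgroup_of G T W H" "conj_set G h W = W"
  and "h \<in> S" and \<pi>: "\<pi> \<in> CC S"
 shows "con h W (res W S \<pi>) = res W S \<pi>"
proof -
 have SM: "S \<in> base M" by (rule open_base'[OF S])
 have sS: "subgroup S G" by (rule base_subgroup[OF SM])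
 have hc: "h \<in> carrier G" by (rule H.mem_carrier[OF h])
 have "conj_set G h S = S" using \<open>h \<in> S\<close> subgroup.m_closed[OF sS] subgroup.m_inv_closed[OF sS]
  by (intro G.conj_set_invariant hc base_carrier[OF SM]) auto
 then show ?thesis
  using con_res[OF SM open_open_rdom(1)[OF S W(2,1)] hc \<pi>] con_inner[OF SM \<open>h \<in> S\<close> \<pi>] W(3) by simp
qed

text \<open>The degrees of \<open>Sg h\<close> form f_H n_P \<Omega> with n_P the P-part of n, so
  the Mackey formula gives an orbit of length n_P only. The element is fixed by \<phi>^(n_P), and
  the power P'(n) lengthens the orbit to n.\<close>

lemma res_ind_prime:
 assumes \<phi>: "\<phi> \<in> H" "d \<phi> = \<omega> \<up> f_of H" and h: "frob_lift h n" and a: "good n a" and \<pi>: "\<pi> \<in> CC (Sg h)"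
 shows "res (dv H a) H (ind H (Sg h) \<pi> [^]\<^bsub>obj C H\<^esub> P'_part P n) =
  orb (obj C (dv H a)) (con \<phi> (dv H a)) n (ind (dv H a) (dv U a) (res (dv U a) (Sg h) \<pi>))"
proof -
 let ?S = "dv H a" and ?W = "dv U a" and ?b = "ppart n"
 have n: "0 < n" and hH: "h \<in> H" using h by auto
 have a0: "0 < a" by (rule good_pos[OF a])
 note oSg = Sg_openH[OF h a] and WSg = dvU_sub_Sg[OF h a]
 have oS: "open_subgroup_of G T ?S H" and oW: "open_subgroup_of G T ?W H"
  using dvH_open[OF a0] dvU_open[OF a0] by auto
 have WS: "?W \<subseteq> ?S" using Sg_Int[OF h a] by blast
 have SM: "?S \<in> base M" and SgM: "Sg h \<in> base M" and WM: "?W \<in> base M" using open_base' oS oW oSg by auto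
 have \<phi>c: "\<phi> \<in> carrier G" by (rule H.mem_carrier[OF \<phi>(1)])
 interpret aS: ab_endo "obj C ?S" "con \<phi> ?S"
  using C_comm_group[OF SM] con_endo[OF SM \<phi>c dvH_conj_set[OF \<phi>(1)]] by (simp add: ab_endo_def ab_endo_axioms_def)
 define \<rho> where "\<rho> = res ?W (Sg h) \<pi>"
 define \<beta> where "\<beta> = ind ?S ?W \<rho>"
 have \<rho>: "\<rho> \<in> CC ?W" unfolding \<rho>_def by (rule res_closed[OF SgM open_open_rdom(1)[OF oSg oW WSg] \<pi>])
 have \<beta>: "\<beta> \<in> CC ?S" unfolding \<beta>_def by (rule ind_closed[OF SM open_open_rdom(2)[OF oS oW WS] \<rho>])
 have dSg: "d ` Sg h = Om (f_of H * ?b)" using d_Sg[of h "f_of H * n"] h Om_fH[OF a n] by simp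
 have "f_of H * ?b dvd a" using a unfolding good_def by (metis dvd_mult_left)
 note r = mackey_frobenius[OF \<phi> oSg dSg Pnum_ppart this a0 Sg_Int[OF h a] \<pi>]
 \<comment> \<open>\<phi>^(n_P) is a product s t with t in \<open>Sg h\<close> of the same degree
   and s in the inertia of H. The factor t fixes the restriction from \<open>Sg h\<close>, and s
   lies in \<open>dv H a\<close>, so it acts trivially on C(\<open>dv H a\<close>).\<close>
 have per: "(con \<phi> ?S ^^ ?b) \<beta> = \<beta>"
 proof -
  let ?p = "\<phi> [^] ?b"
  have pH: "?p \<in> H" by (rule H_pow[OF \<phi>(1)])
  have "d ?p = \<omega> \<up> (f_of H * ?b)"
   using d.hom_nat_pow[OF \<phi>c, of ?b] \<phi>(2) by (simp add: Og.nat_pow_pow)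
  then have "d ?p \<in> d ` Sg h" unfolding dSg using pow_in_Om[OF omega_carrier dvd_refl] by simp
  then obtain t where t: "t \<in> Sg h" "d t = d ?p" by (metis imageE)
  have tH: "t \<in> H" using t Sg_sub_H[OF hH] by blast
  have tc: "t \<in> carrier G" and pc: "?p \<in> carrier G" using tH pH by auto
  define s where "s = ?p \<div> t"
  have "d s = \<one>\<^bsub>\<Omega>\<^esub>" using tc pc t(2) by (simp add: s_def)
  then have sS: "s \<in> ?S" using pH tH subgroup.one_closed[OF Om_subgroup] by (simp add: s_def dv_def)
  have ps: "?p = s \<otimes> t" using pc tc by (simp add: s_def G.m_assoc)
  have "con t ?S \<beta> = ind ?S ?W (con t ?W \<rho>)"
   unfolding \<beta>_def by (rule con_ind_fix[OF SM open_open_rdom(2)[OF oS oW WS] tc dvH_conj_set[OF tH] dvU_conj_set[OF tH] \<rho>])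
  also have "con t ?W \<rho> = \<rho>"
   unfolding \<rho>_def by (rule con_Sg_res[OF tH oSg WSg oW dvU_conj_set[OF tH] t(1) \<pi>])
  finally have 1: "con t ?S \<beta> = \<beta>" by (simp add: \<beta>_def)
  have sc: "s \<in> carrier G" using sS base_carrier[OF SM] by blast
  have "con ?p ?S \<beta> = con s (conj_set G t ?S) (con t ?S \<beta>)"
   unfolding ps by (rule con_con[symmetric, OF SM tc sc \<beta>])
  also have "\<dots> = \<beta>" using 1 dvH_conj_set[OF tH] con_inner[OF SM sS \<beta>] by simp
  finally show ?thesis using con_pow(1)[OF SM \<phi>c dvH_conj_set[OF \<phi>(1)] \<beta>] by simp
 qed
 have ic: "ind H (Sg h) \<pi> \<in> CC H" by (rule ind_closed[OF H_base open_idom[OF H_base oSg] \<pi>])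
 have "res ?S H (ind H (Sg h) \<pi> [^]\<^bsub>obj C H\<^esub> P'_part P n) = res ?S H (ind H (Sg h) \<pi>) [^]\<^bsub>obj C ?S\<^esub> P'_part P n"
  by (rule group_hom_pow[OF C_group[OF H_base] C_group[OF SM] res_hom[OF H_base open_rdom[OF H_base oS]] ic])
 also have "\<dots> = orb (obj C ?S) (con \<phi> ?S) ?b \<beta> [^]\<^bsub>obj C ?S\<^esub> P'_part P n"
  using r by (simp add: \<beta>_def \<rho>_def)
 also have "\<dots> = orb (obj C ?S) (con \<phi> ?S) n \<beta>"
  using aS.orb_periodic[OF \<beta> per, of "P'_part P n"] ppart_mult[OF n] by simp
 finally show ?thesis by (simp add: \<beta>_def \<rho>_def)
qed

end

context comm_group begin

lemma quotient_swap:
 assumes "p \<in> carrier G" "q \<in> carrier G" "r \<in> carrier G" "s \<in> carrier G" "p \<div> q = r \<div> s"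
 shows "p \<div> r = q \<div> s"
proof -
 have "p \<div> r = (p \<div> q) \<otimes> (q \<div> r)"
  using assms(1-4) by (metis inv_closed l_inv l_one m_assoc m_closed)
 also have "\<dots> = (r \<div> r) \<otimes> (q \<div> s)"
  unfolding assms(5) using assms(1-4) by (simp only: m_ac m_closed inv_closed)
 finally show ?thesis using assms(1-4) by simp
qed

text \<open>Bookkeeping for \<open>xval_mult\<close>: there b_i = t_i a_i for i = 1, 2, c1 = t1 a3
  and c3 = t2 t1 a3, so that the right-hand side reads (t1 - 1)(a1 - a3) + (t2 - 1)(a2 - c1)
  additively.\<close>

lemma cocycle_identity:
 assumes "a1 \<in> carrier G" "a2 \<in> carrier G" "a3 \<in> carrier G" "b1 \<in> carrier G" "b2 \<in> carrier G"
  "c1 \<in> carrier G" "c3 \<in> carrier G"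
 shows "(b1 \<div> a1) \<otimes> (b2 \<div> a2) \<div> (c3 \<div> a3) =
  ((b1 \<div> c1) \<div> (a1 \<div> a3)) \<otimes> ((b2 \<div> c3) \<div> (a2 \<div> c1))"
proof -
 have "((b1 \<div> c1) \<div> (a1 \<div> a3)) \<otimes> ((b2 \<div> c3) \<div> (a2 \<div> c1)) =
  ((b1 \<div> a1) \<otimes> (b2 \<div> a2) \<div> (c3 \<div> a3)) \<otimes> (inv c1 \<otimes> c1)"
  using assms by (simp only: inv_mult inv_inv m_ac m_closed inv_closed)
 then show ?thesis using assms by simp
qed

end

context fn_datum begin

lemma ind_diff:
 assumes X: "X \<in> base M" and Y: "Y \<in> idom M X" and t: "t \<in> carrier G" "conj_set G t X = X" "conj_set G t Y = Y"
  and x: "x \<in> CC Y"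
 shows "ind X Y (con t Y x \<div>\<^bsub>obj C Y\<^esub> x) =
  con t X (ind X Y x) \<div>\<^bsub>obj C X\<^esub> (ind X Y x)"
proof -
 have YM: "Y \<in> base M" by (rule dom_base(2)[OF X Y])
 have cx: "con t Y x \<in> CC Y" using con_closed[OF YM t(1) x] t(3) by simp
 have ix: "inv\<^bsub>obj C Y\<^esub> x \<in> CC Y" by (rule group.inv_closed[OF C_group[OF YM] x])
 have "con t X (ind X Y x) = ind X Y (con t Y x)" using con_ind[OF X Y t(1) x] t by simp
 then show ?thesis
  using hom_mult[OF ind_hom[OF X Y] cx ix] group_hom_inv[OF C_group[OF YM] C_group[OF X] ind_hom[OF X Y] x] by simp
qed

lemma Eu_diff:
 assumes X: "X \<in> base M" and t: "t \<in> carrier G" "conj_set G t X = X" and x: "x \<in> Eu X"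
 shows "con t X x \<div>\<^bsub>obj C X\<^esub> x \<in> Eu X"
proof -
 interpret S: subgroup "Eu X" "obj C X" by (rule Eu_subgroup[OF X])
 have "con t X x \<in> Eu X" using Eu_con[OF X t(1) x] t(2) by simp
 then show ?thesis using x by simp
qed

lemma diff_inner:
 assumes X: "X \<in> base M" and t: "t \<in> X" and x: "x \<in> CC X"
 shows "con t X x \<div>\<^bsub>obj C X\<^esub> x = \<one>\<^bsub>obj C X\<^esub>"
 using con_inner[OF X t x] group.r_inv[OF C_group[OF X] x] by simp

lemma v_mult: "X \<in> base M \<Longrightarrow> a \<in> CC X \<Longrightarrow> b \<in> CC X \<Longrightarrow> v X (a \<otimes>\<^bsub>obj C X\<^esub> b) = v X a \<cdot> v X b"
 by (rule hom_mult[OF v_hom])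

lemma v_inv: "X \<in> base M \<Longrightarrow> a \<in> CC X \<Longrightarrow> v X (inv\<^bsub>obj C X\<^esub> a) = inv\<^bsub>\<Omega>\<^esub> v X a"
 by (rule group_hom_inv[OF C_group Og.is_group v_hom])

lemma norm_subgroup: "X \<in> base M \<Longrightarrow> Y \<in> idom M X \<Longrightarrow> subgroup (norm_group C X Y) (obj C X)"
 unfolding norm_group_def by (rule group_hom.img_is_subgroup)
  (simp add: group_hom_def group_hom_axioms_def C_group dom_base(2) ind_hom)

end

context fn_layer begin

section \<open>Norms of units along unramified layers\<close>

lemma v_orb:
 assumes X: "X \<in> base M" "g \<in> carrier G" "conj_set G g X = X" and a: "a \<in> CC X"
 shows "v X (orb (obj C X) (con g X) n a) = v X a \<up> n"
proof -
 interpret ab_endo "obj C X" "con g X"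
  using C_comm_group[OF X(1)] con_endo[OF X] by (simp add: ab_endo_def ab_endo_axioms_def)
 have "v X (orb (obj C X) (con g X) n a) = orb \<Omega> (\<lambda>x. x) n (v X a)"
  by (rule orb_map[OF v_hom[OF X(1)] Og.is_group _ a]) (use v_con[OF X(1,2)] X(3) in simp)
 also have "\<dots> = v X a \<up> n"
 proof (induction n)
  case (Suc n)
  have "((\<lambda>x. x) ^^ k) (v X a) = v X a" for k :: nat by (induction k) auto
  with Suc show ?case by simp
 qed simp
 finally show ?thesis .
qed

text \<open>The heart of the reciprocity law: an element of the augmentation ideal of the units which is
 divisible by \<open>\<phi> - 1\<close> has a norm coming from \<open>U\<close>; the units are lifted to a further
 unramified layer of degree \<open>[H:U]\<close>.\<close>

lemma unit_norm:
 assumes \<phi>: "\<phi> \<in> H" "d \<phi> = \<omega> \<up> f_of H"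
  and a: "Pnum a" "f_of U dvd a" "f_of H dvd a"
  and u: "u \<in> Eu (dv U a)" "u1 \<in> Eu (dv U a)" "u2 \<in> Eu (dv U a)"
  and t: "t1 \<in> I_of H" "t2 \<in> I_of H"
  and eq: "con \<phi> (dv U a) u \<div>\<^bsub>obj C (dv U a)\<^esub> u =
   (con t1 (dv U a) u1 \<div>\<^bsub>obj C (dv U a)\<^esub> u1) \<otimes>\<^bsub>obj C (dv U a)\<^esub>
   (con t2 (dv U a) u2 \<div>\<^bsub>obj C (dv U a)\<^esub> u2)"
 shows "\<exists>n\<in>norm_group C H U. n \<in> Eu H \<and> ind (dv H a) (dv U a) u = res (dv H a) H n"
proof -
 \<comment> \<open>A further unramified layer of degree [H:U]. From S' to S induction after
   restriction is the [H:U]-th power, and [H:U]-th powers in C(H) are norms from U.\<close>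
 define a' where "a' = a * idx"
 define W where "W = dv U a" define S where "S = dv H a"
 define W' where "W' = dv U a'" define S' where "S' = dv H a'"
 have a0: "0 < a" and a'0: "0 < a'" using Pnum_pos[OF a(1)] idx_pos by (auto simp: a'_def)
 have oS: "open_subgroup_of G T S H" and oW: "open_subgroup_of G T W H"
  and oS': "open_subgroup_of G T S' H" and oW': "open_subgroup_of G T W' H"
  unfolding S_def W_def S'_def W'_def by (intro dvH_open dvU_open a0 a'0)+
 have oH: "open_subgroup_of G T H H" by (rule open_subgroup_of_self[OF H_sub])
 have SM: "S \<in> base M" and WM: "W \<in> base M" and SM': "S' \<in> base M" and WM': "W' \<in> base M"
  using open_base' oS oW oS' oW' by auto
 have aa': "a dvd a'" by (simp add: a'_def)
 have sub: "W \<subseteq> S" "W' \<subseteq> W" "W' \<subseteq> S'" "S' \<subseteq> S" "S \<subseteq> H" "S' \<subseteq> H" "W \<subseteq> U"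
  unfolding S_def W_def S'_def W'_def using dv_antimono[OF aa'] dv_subset UH by (auto simp: dv_def)
 note iSW = open_open_rdom(2)[OF oS oW sub(1)] and iWW' = open_open_rdom(2)[OF oW oW' sub(2)]
  and iS'W' = open_open_rdom(2)[OF oS' oW' sub(3)] and iSS' = open_open_rdom(2)[OF oS oS' sub(4)]
  and rSS' = open_open_rdom(1)[OF oS oS' sub(4)]
 note rS = open_rdom[OF H_base oS] and rS' = open_rdom[OF H_base oS']
 have cj: "conj_set G h W = W" "conj_set G h S = S" "conj_set G h W' = W'" "conj_set G h S' = S'" if "h \<in> H" for h
  unfolding S_def W_def S'_def W'_def using dvU_conj_set dvH_conj_set that by auto
 interpret cS: comm_group "obj C S" by (rule C_comm_group[OF SM])
 interpret cW: comm_group "obj C W" by (rule C_comm_group[OF WM])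
 interpret cS': comm_group "obj C S'" by (rule C_comm_group[OF SM'])
 interpret cW': comm_group "obj C W'" by (rule C_comm_group[OF WM'])
 interpret cH: comm_group "obj C H" by (rule C_comm_group[OF H_base])
 have \<phi>c: "\<phi> \<in> carrier G" by (rule H.mem_carrier[OF \<phi>(1)])
 have tH: "t1 \<in> H" "t2 \<in> H" and tS': "t1 \<in> S'" "t2 \<in> S'"
  using t subgroup.one_closed[OF Om_subgroup] by (auto simp: mem_I_of S'_def dv_def)
 have tc: "t1 \<in> carrier G" "t2 \<in> carrier G" using tH by auto
 note eq = eq[folded W_def] and u = u[folded W_def]
 have dW: "d ` W = Om a" unfolding W_def by (rule d_dv[OF U_inert a(2)])
 have fW: "f_of W = a" by (rule f_of_eq[OF dW a(1)])
 obtain \<psi> where \<psi>: "\<psi> \<in> W" "d \<psi> = \<omega> \<up> f_of W"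
  using frobenius_exists[OF base_inert[OF WM] _ dvd_refl] fW a0 by auto
 have V1: "W' \<in> unram G T \<Omega> d W"
  using dv_unram[OF base_subgroup[OF WM] a'0] dv_dv[OF aa', of U] by (simp add: W_def W'_def)
 note ex1 = unit_exact(3,4)[OF H_flat oW V1 \<psi>]
 obtain w where w: "w \<in> Eu W'" "u = ind W W' w" using ex1(2)[OF u(1)] by blast
 obtain w1 where w1: "w1 \<in> Eu W'" "u1 = ind W W' w1" using ex1(2)[OF u(2)] by blast
 obtain w2 where w2: "w2 \<in> Eu W'" "u2 = ind W W' w2" using ex1(2)[OF u(3)] by blast
 have wc: "w \<in> CC W'" "w1 \<in> CC W'" "w2 \<in> CC W'" using w w1 w2 by (auto simp: mem_Eu)
 define D where "D t x = con t W' x \<div>\<^bsub>obj C W'\<^esub> x" for t x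
 \<comment> \<open>The relation \<open>eq\<close> lifted to W': the units are replaced by preimages
   under the norm to W, and \<delta> measures by how much the relation then fails. Its norm to W is
   trivial, so Hilbert 90 writes it as (\<psi> - 1)y.\<close>
 define \<delta> where "\<delta> = D \<phi> w \<div>\<^bsub>obj C W'\<^esub> (D t1 w1 \<otimes>\<^bsub>obj C W'\<^esub> D t2 w2)"
 have DE: "D \<phi> w \<in> Eu W'" "D t1 w1 \<in> Eu W'" "D t2 w2 \<in> Eu W'"
  unfolding D_def using Eu_diff[OF WM'] cj(3) \<phi>(1) \<phi>c tH tc w(1) w1(1) w2(1) by blast+
 have Dc: "D \<phi> w \<in> CC W'" "D t1 w1 \<in> CC W'" "D t2 w2 \<in> CC W'" using DE by (auto simp: mem_Eu)
 have \<delta>E: "\<delta> \<in> Eu W'" unfolding \<delta>_def using DE Eu_subgroup[OF WM']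
  by (intro subgroup.m_closed[OF Eu_subgroup[OF WM']] subgroup.m_inv_closed[OF Eu_subgroup[OF WM']])
 have homd: "f \<delta> = f (D \<phi> w) \<div>\<^bsub>B\<^esub> (f (D t1 w1) \<otimes>\<^bsub>B\<^esub> f (D t2 w2))"
  if f: "f \<in> hom (obj C W') B" "group B" for f B
 proof -
  have m: "D t1 w1 \<otimes>\<^bsub>obj C W'\<^esub> D t2 w2 \<in> CC W'" using Dc by simp
  have "f \<delta> = f (D \<phi> w) \<otimes>\<^bsub>B\<^esub> f (inv\<^bsub>obj C W'\<^esub> (D t1 w1 \<otimes>\<^bsub>obj C W'\<^esub> D t2 w2))"
   unfolding \<delta>_def by (rule hom_mult[OF f(1) Dc(1) cW'.inv_closed[OF m]])
  then show ?thesis using group_hom_inv[OF C_group[OF WM'] f(2) f(1) m] hom_mult[OF f(1) Dc(2,3)] by simp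
 qed
 have iD: "ind W W' (D t x) = con t W (ind W W' x) \<div>\<^bsub>obj C W\<^esub> (ind W W' x)"
  if "t \<in> H" "x \<in> CC W'" for t x
  unfolding D_def by (rule ind_diff[OF WM iWW' H.mem_carrier[OF that(1)] cj(1,3)[OF that(1)] that(2)])
 have "ind W W' \<delta> = \<one>\<^bsub>obj C W\<^esub>"
 proof -
  have Wc: "u \<in> CC W" using u by (simp add: mem_Eu)
  have "con \<phi> W u \<in> CC W" using con_closed[OF WM \<phi>c Wc] cj(1)[OF \<phi>(1)] by simp
  then have c: "con \<phi> W u \<div>\<^bsub>obj C W\<^esub> u \<in> CC W" using Wc by simp
  have "ind W W' \<delta> = (con \<phi> W u \<div>\<^bsub>obj C W\<^esub> u) \<otimes>\<^bsub>obj C W\<^esub>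
    inv\<^bsub>obj C W\<^esub> (con \<phi> W u \<div>\<^bsub>obj C W\<^esub> u)"
   using homd[OF ind_hom[OF WM iWW'] cW.is_group] iD[OF \<phi>(1) wc(1)] iD[OF tH(1) wc(2)] iD[OF tH(2) wc(3)]
    eq w(2) w1(2) w2(2) by simp
  then show ?thesis using cW.r_inv[OF c] by simp
 qed
 then obtain y where y: "y \<in> Eu W'" "\<delta> = D \<psi> y" using ex1(1)[OF \<delta>E] unfolding D_def by blast
 have yc: "y \<in> CC W'" using y by (simp add: mem_Eu)
 \<comment> \<open>Induction to S' makes the inertia terms disappear: t1 and t2 lie in S' and act
   trivially on C(S'), so only (\<phi> - 1) g(w) survives in g(\<delta>).\<close>
 define g where "g = ind S' W'"
 have gE: "g x \<in> Eu S'" if "x \<in> Eu W'" for x unfolding g_def by (rule Eu_ind[OF SM' iS'W' that])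
 have gc: "g x \<in> CC S'" if "x \<in> CC W'" for x unfolding g_def by (rule ind_closed[OF SM' iS'W' that])
 have gD: "g (D t x) = con t S' (g x) \<div>\<^bsub>obj C S'\<^esub> (g x)"
  if "t \<in> H" "x \<in> CC W'" for t x
  unfolding D_def g_def by (rule ind_diff[OF SM' iS'W' H.mem_carrier[OF that(1)] cj(4,3)[OF that(1)] that(2)])
 have gD1: "g (D t x) = \<one>\<^bsub>obj C S'\<^esub>" if "t \<in> S'" "t \<in> H" "x \<in> CC W'" for t x
  using gD[OF that(2,3)] diff_inner[OF SM' that(1) gc[OF that(3)]] by simp
 let ?F = "con \<phi> S'"
 have F_endo: "?F \<in> hom (obj C S') (obj C S')" by (rule con_endo[OF SM' \<phi>c cj(4)[OF \<phi>(1)]])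
 interpret aS': ab_endo "obj C S'" ?F using C_comm_group[OF SM'] F_endo by (simp add: ab_endo_def ab_endo_axioms_def)
 define m where "m = a div f_of H"
 have am: "a = f_of H * m" using a(3) by (simp add: m_def)
 have Pm: "Pnum m" using Pnum_dvd[OF a(1), of m] am by simp
 have \<psi>H: "\<psi> \<in> H" using \<psi>(1) sub by blast
 \<comment> \<open>\<psi> has the degree of \<phi>^m, so the two differ by inertia of H, which is
   contained in S'.\<close>
 have con\<psi>: "con \<psi> S' z = (?F ^^ m) z" if z: "z \<in> CC S'" for z
 proof -
  let ?p = "\<phi> [^] m"
  have pH: "?p \<in> H" by (rule H_pow[OF \<phi>(1)])
  define s where "s = inv ?p \<otimes> \<psi>"
  have dp: "d ?p = d \<psi>" using d.hom_nat_pow[OF \<phi>c, of m] \<phi>(2) \<psi>(2) fW am by (simp add: Og.nat_pow_pow)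
  have sH: "s \<in> H" using pH \<psi>H by (simp add: s_def)
  have "d s = \<one>\<^bsub>\<Omega>\<^esub>" using pH \<psi>H dp by (simp add: s_def)
  then have sS': "s \<in> S'" using sH subgroup.one_closed[OF Om_subgroup] by (simp add: S'_def dv_def)
  have \<psi>s: "\<psi> = ?p \<otimes> s" using pH \<psi>H by (simp add: s_def G.m_assoc[symmetric])
  have "con \<psi> S' z = con ?p (conj_set G s S') (con s S' z)"
   unfolding \<psi>s by (rule con_con[symmetric, OF SM' H.mem_carrier[OF sH] H.mem_carrier[OF pH] z])
  also have "\<dots> = con ?p S' z" using cj(4)[OF sH] con_inner[OF SM' sS' z] by simp
  also have "\<dots> = (?F ^^ m) z" by (rule con_pow(1)[symmetric, OF SM' \<phi>c cj(4)[OF \<phi>(1)] z])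
  finally show ?thesis .
 qed
 define o' where "o' = orb (obj C S') ?F m (g y)"
 have gy: "g y \<in> CC S'" and gw: "g w \<in> CC S'" using gc yc wc by auto
 have oc: "o' \<in> CC S'" unfolding o'_def by (rule aS'.orb_closed[OF gy])
 \<comment> \<open>Since (\<psi> - 1) g(y) = (\<phi>^m - 1) g(y) = (\<phi> - 1) o', the quotient z
   of g(w) by o' is fixed by \<phi> and descends to a unit of C(H).\<close>
 define z where "z = g w \<div>\<^bsub>obj C S'\<^esub> o'"
 have zc: "z \<in> CC S'" using gw oc by (simp add: z_def)
 have Fz: "?F z = z"
 proof -
  have "g \<delta> = ?F (g w) \<div>\<^bsub>obj C S'\<^esub> (g w)"
  proof -
   have "g \<delta> = (?F (g w) \<div>\<^bsub>obj C S'\<^esub> (g w)) \<otimes>\<^bsub>obj C S'\<^esub>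
     inv\<^bsub>obj C S'\<^esub> (\<one>\<^bsub>obj C S'\<^esub> \<otimes>\<^bsub>obj C S'\<^esub> \<one>\<^bsub>obj C S'\<^esub>)"
    using homd[OF ind_hom[OF SM' iS'W'] cS'.is_group, folded g_def] gD[OF \<phi>(1) wc(1)]
     gD1[OF tS'(1) tH(1) wc(2)] gD1[OF tS'(2) tH(2) wc(3)] by simp
   then show ?thesis using gw aS'.f_closed[OF gw] by simp
  qed
  moreover have "g \<delta> = (?F ^^ m) (g y) \<div>\<^bsub>obj C S'\<^esub> (g y)"
   unfolding y(2) gD[OF \<psi>H yc] con\<psi>[OF gy] ..
  moreover have "?F o' \<div>\<^bsub>obj C S'\<^esub> o' = (?F ^^ m) (g y) \<div>\<^bsub>obj C S'\<^esub> (g y)"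
   unfolding o'_def by (rule aS'.orb_telescope'[OF gy])
  ultimately have "?F (g w) \<div>\<^bsub>obj C S'\<^esub> (g w) = ?F o' \<div>\<^bsub>obj C S'\<^esub> o'" by simp
  then have "?F (g w) \<div>\<^bsub>obj C S'\<^esub> (?F o') = g w \<div>\<^bsub>obj C S'\<^esub> o'"
   by (rule cS'.quotient_swap[OF aS'.f_closed[OF gw] gw aS'.f_closed[OF oc] oc])
  then show ?thesis
   unfolding z_def using aS'.f_mult[OF gw cS'.inv_closed[OF oc]] group_hom_inv[OF cS'.is_group cS'.is_group F_endo oc] by simp
 qed
 have zE: "z \<in> Eu S'"
 proof -
  have "v S' o' = \<one>\<^bsub>\<Omega>\<^esub>"
   unfolding o'_def v_orb[OF SM' \<phi>c cj(4)[OF \<phi>(1)] gy] using gE[OF y(1)] by (simp add: mem_Eu)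
  then have "o' \<in> Eu S'" using oc by (simp add: mem_Eu)
  then show ?thesis
   unfolding z_def by (intro subgroup.m_closed[OF Eu_subgroup[OF SM']] subgroup.m_inv_closed[OF Eu_subgroup[OF SM']] gE w(1))
 qed
 have V2: "S' \<in> unram G T \<Omega> d H" unfolding S'_def by (rule dv_unram[OF H_sub a'0])
 obtain z0 where z0: "z0 \<in> Eu H" "z = res S' H z0" using unit_exact(2)[OF H_flat oH V2 \<phi> zE Fz] by blast
 have z0c: "z0 \<in> CC H" using z0 by (simp add: mem_Eu)
 define k where "k = ind S S'"
 have k_hom: "k \<in> hom (obj C S') (obj C S)" unfolding k_def by (rule ind_hom[OF SM iSS'])
 have kg: "k (g x) = ind S W (ind W W' x)" if "x \<in> CC W'" for x
  unfolding k_def g_def ind_ind[OF SM iSS' iS'W' that] ind_ind[OF SM iSW iWW' that] ..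
 define y' where "y' = ind W W' y"
 have y'c: "y' \<in> CC W" unfolding y'_def by (rule ind_closed[OF WM iWW' yc])
 \<comment> \<open>Taken down to S, the orbit product is by the Mackey formula the restriction of an
   induction from W to H; as W is contained in U, that induction is a norm from U.\<close>
 have ko: "k o' = res S H (ind H W y')"
 proof -
  have "k o' = orb (obj C S) (con \<phi> S) m (k (g y))" unfolding o'_def
  proof (rule aS'.orb_map[OF k_hom cS.is_group _ gy])
   fix x assume "x \<in> CC S'"
   then show "k (?F x) = con \<phi> S (k x)"
    unfolding k_def by (rule con_ind_fix[symmetric, OF SM iSS' \<phi>c cj(2)[OF \<phi>(1)] cj(4)[OF \<phi>(1)]])
  qed
  also have "k (g y) = ind S W (res W W y')" using kg[OF yc] res_id[OF WM y'c] by (simp add: y'_def)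
  also have "orb (obj C S) (con \<phi> S) m (ind S W (res W W y')) = res S H (ind H W y')" unfolding S_def W_def
  proof (rule mackey_frobenius[symmetric, OF \<phi> _ _ Pm])
   show "open_subgroup_of G T (dv U a) H" using oW by (simp add: W_def)
   show "d ` dv U a = Om (f_of H * m)" using dW am by (simp add: W_def)
   show "f_of H * m dvd a" using am by simp
   show "0 < a" by (rule a0)
   show "dv H a \<inter> dv U a = dv U a" using sub(1) by (auto simp: S_def W_def)
   show "y' \<in> CC (dv U a)" using y'c by (simp add: W_def)
  qed
  finally show ?thesis .
 qed
 have kz: "k z = res S H (z0 [^]\<^bsub>obj C H\<^esub> idx)"
 proof -
  have rc: "res S H z0 \<in> CC S" by (rule res_closed[OF H_base rS z0c])
  have "k z = ind S S' (res S' S (res S H z0))" unfolding k_def z0(2) res_res[OF H_base rS rSS' z0c] ..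
  also have "\<dots> = res S H z0 [^]\<^bsub>obj C S\<^esub> grp_index G S S'" by (rule ind_res[OF SM rSS' iSS' rc])
  also have "grp_index G S S' = idx" unfolding S_def S'_def a'_def by (rule index_dv[OF H_inert a0 a(3) Pnum_idx])
  finally show ?thesis using group_hom_pow[OF cH.is_group cS.is_group res_hom[OF H_base rS] z0c] by simp
 qed
 define n where "n = z0 [^]\<^bsub>obj C H\<^esub> idx \<otimes>\<^bsub>obj C H\<^esub> ind H W y'"
 have iW: "W \<in> idom M H" by (rule open_idom[OF H_base oW])
 have iyc: "ind H W y' \<in> CC H" by (rule ind_closed[OF H_base iW y'c])
 have gwz: "g w = z \<otimes>\<^bsub>obj C S'\<^esub> o'" using gw oc by (simp add: z_def cS'.m_assoc)
 have "ind S W u = k (g w)" using kg[OF wc(1)] w(2) by simp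
 also have "\<dots> = k z \<otimes>\<^bsub>obj C S\<^esub> k o'" unfolding gwz by (rule hom_mult[OF k_hom zc oc])
 also have "\<dots> = res S H n"
  unfolding kz ko n_def by (rule hom_mult[OF res_hom[OF H_base rS] _ iyc, symmetric]) (simp add: z0c)
 finally have fin: "ind S W u = res S H n" .
 have nE: "n \<in> Eu H"
 proof -
  have "z0 [^]\<^bsub>obj C H\<^esub> idx \<in> Eu H"
  proof -
   interpret EH: subgroup "Eu H" "obj C H" by (rule Eu_subgroup[OF H_base])
   have "z0 [^]\<^bsub>obj C H\<^esub> k \<in> Eu H" for k :: nat by (induction k) (use z0(1) in auto)
   then show ?thesis .
  qed
  moreover have "ind H W y' \<in> Eu H" unfolding y'_def by (intro Eu_ind H_base iW WM iWW' y(1))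
  ultimately show ?thesis unfolding n_def by (rule subgroup.m_closed[OF Eu_subgroup[OF H_base]])
 qed
 have "n \<in> norm_group C H U" unfolding n_def
 proof (rule subgroup.m_closed[OF norm_subgroup[OF H_base U_idom]])
  have "ind H U (res U H z0) = z0 [^]\<^bsub>obj C H\<^esub> idx"
   by (rule ind_res[OF H_base open_rdom[OF H_base U_open] U_idom z0c])
  moreover have "res U H z0 \<in> CC U" by (rule res_closed[OF H_base open_rdom[OF H_base U_open] z0c])
  ultimately show "z0 [^]\<^bsub>obj C H\<^esub> idx \<in> norm_group C H U" unfolding norm_group_def by (metis imageI)
  have iUW: "W \<in> idom M U" by (rule open_open_rdom(2)[OF U_open oW sub(7)])
  have "ind H W y' = ind H U (ind U W y')" by (rule ind_ind[symmetric, OF H_base U_idom iUW y'c])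
  moreover have "ind U W y' \<in> CC U" by (rule ind_closed[OF U_base iUW y'c])
  ultimately show "ind H W y' \<in> norm_group C H U" unfolding norm_group_def by blast
 qed
 then show ?thesis using nE fin unfolding S_def W_def by blast
qed

end

section \<open>Multiplicativity of the reciprocity map\<close>

context plain_group begin

section \<open>Conjugation and the groups \<Sigma>_h\<close>

lemma conj_set_subgroup:
 assumes "g \<in> carrier G" "subgroup X G" shows "subgroup (conj_set G g X) G"
proof -
 interpret X: subgroup X G by fact
 have "group_hom G G (\<lambda>x. g \<otimes> x \<div> g)"
 proof -
  have "g \<otimes> (x \<otimes> y) \<div> g = g \<otimes> x \<div> g \<otimes> (g \<otimes> y \<div> g)" if "x \<in> carrier G" "y \<in> carrier G" for x y
  proof -
   have "g \<otimes> x \<div> g \<otimes> (g \<otimes> y \<div> g) = g \<otimes> x \<otimes> ((inv g \<otimes> g) \<otimes> y) \<div> g"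
    using assms(1) that by (simp only: m_assoc m_closed inv_closed)
   then show ?thesis using assms(1) that by (simp add: m_assoc)
  qed
  then show ?thesis using assms(1) is_group by (simp add: group_hom_def group_hom_axioms_def hom_def)
 qed
 then show ?thesis unfolding conj_set_eq by (rule group_hom.subgroup_img_is_subgroup[OF _ assms(2)])
qed

lemma mem_conj_set:
 assumes "g \<in> carrier G" "X \<subseteq> carrier G"
 shows "x \<in> conj_set G g X \<longleftrightarrow> x \<in> carrier G \<and> inv g \<otimes> x \<otimes> g \<in> X"
proof
 assume "x \<in> conj_set G g X"
 then obtain y where y: "y \<in> X" "x = g \<otimes> y \<div> g" by (auto simp: conj_set_eq)
 have yc: "y \<in> carrier G" using y assms(2) by (rule_tac subsetD)
 have "inv g \<otimes> x \<otimes> g = (inv g \<otimes> g) \<otimes> y \<otimes> (inv g \<otimes> g)"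
  unfolding y(2) using assms(1) yc by (simp only: m_assoc m_closed inv_closed)
 then show "x \<in> carrier G \<and> inv g \<otimes> x \<otimes> g \<in> X" using assms(1) yc y by simp
next
 assume x: "x \<in> carrier G \<and> inv g \<otimes> x \<otimes> g \<in> X"
 have "g \<otimes> (inv g \<otimes> x \<otimes> g) \<div> g = (g \<div> g) \<otimes> x \<otimes> (g \<div> g)"
  using assms(1) x by (simp only: m_assoc m_closed inv_closed)
 then have "g \<otimes> (inv g \<otimes> x \<otimes> g) \<div> g = x" using assms(1) x by simp
 then show "x \<in> conj_set G g X" using x unfolding conj_set_eq by (metis imageI)
qed

end

context pro_P_degree begin

lemma cyc_carrier: "cyc h \<subseteq> carrier G" using closure_of_subset_topspace[of T] by (simp add: cyc_def)

lemma cyc_conj_subset: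
 assumes g: "g \<in> carrier G" and h: "h \<in> carrier G"
 shows "cyc (g \<otimes> h \<div> g) \<subseteq> conj_set G g (cyc h)"
proof (rule cyc_minimal)
 show "subgroup (conj_set G g (cyc h)) G" by (rule G.conj_set_subgroup[OF g cyc_subgroup[OF h]])
 have "continuous_map T T (\<lambda>x. inv g \<otimes> x \<otimes> g)"
  using g by (intro G.continuous_mult G.continuous_const continuous_map_id[unfolded id_def]) auto
 then have "closedin T {x \<in> topspace T. inv g \<otimes> x \<otimes> g \<in> cyc h}"
  by (rule closedin_continuous_map_preimage[OF _ cyc_closed])
 moreover have "{x \<in> topspace T. inv g \<otimes> x \<otimes> g \<in> cyc h} = conj_set G g (cyc h)"
  using G.mem_conj_set[OF g cyc_carrier] by auto
 ultimately show "closedin T (conj_set G g (cyc h))" by simp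
 show "g \<otimes> h \<div> g \<in> conj_set G g (cyc h)" unfolding G.conj_set_eq using cyc_self[OF h] by blast
qed

lemma cyc_conj:
 assumes g: "g \<in> carrier G" and h: "h \<in> carrier G"
 shows "cyc (g \<otimes> h \<div> g) = conj_set G g (cyc h)"
proof
 show "cyc (g \<otimes> h \<div> g) \<subseteq> conj_set G g (cyc h)" by (rule cyc_conj_subset[OF g h])
 let ?k = "g \<otimes> h \<div> g"
 have k: "?k \<in> carrier G" using g h by simp
 have "inv g \<otimes> ?k \<div> (inv g) = (inv g \<otimes> g) \<otimes> h \<otimes> (inv g \<otimes> g)"
  using g h by (simp only: G.m_assoc G.m_closed G.inv_closed G.inv_inv)
 then have "cyc h \<subseteq> conj_set G (inv g) (cyc ?k)" using cyc_conj_subset[OF G.inv_closed[OF g] k] g h by simp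
 then have "conj_set G g (cyc h) \<subseteq> conj_set G g (conj_set G (inv g) (cyc ?k))"
  unfolding G.conj_set_eq by (rule image_mono)
 then show "conj_set G g (cyc h) \<subseteq> cyc ?k" unfolding G.conj_set_inv(2)[OF g cyc_carrier] .
qed

lemma I_of_conj:
 assumes g: "g \<in> carrier G" and X: "X \<subseteq> carrier G"
 shows "I_of (conj_set G g X) = conj_set G g (I_of X)"
proof -
 have "conj_set G g (I_of X) = conj_set G g X \<inter> conj_set G g (kernel G \<Omega> d)"
  unfolding inertia_def by (rule G.conj_set_Int[OF g X]) (auto simp: kernel_def)
 moreover have "conj_set G g (kernel G \<Omega> d) = kernel G \<Omega> d" by (rule G.conj_set_invariant[OF g])
   (use d_conj[OF g] d_conj[OF G.inv_closed[OF g]] g in \<open>auto simp: kernel_def\<close>)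
 ultimately show ?thesis by (simp add: inertia_def)
qed

lemma Sigma_conj:
 assumes g: "g \<in> carrier G" and h: "h \<in> carrier G" and X: "X \<subseteq> carrier G"
 shows "Sigma_h G T \<Omega> d (conj_set G g X) (g \<otimes> h \<div> g) = conj_set G g (Sigma_h G T \<Omega> d X h)"
proof -
 have IX: "I_of X \<subseteq> carrier G" by (auto simp: mem_I_of)
 have e: "g \<otimes> x \<div> g \<otimes> (g \<otimes> y \<div> g) = g \<otimes> (x \<otimes> y) \<div> g" if "x \<in> carrier G" "y \<in> carrier G" for x y
 proof -
  have "g \<otimes> x \<div> g \<otimes> (g \<otimes> y \<div> g) = g \<otimes> x \<otimes> ((inv g \<otimes> g) \<otimes> y) \<div> g"
   using g that by (simp only: G.m_assoc G.m_closed G.inv_closed)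
  then show ?thesis using g that by (simp add: G.m_assoc)
 qed
 have "Sigma_h G T \<Omega> d (conj_set G g X) (g \<otimes> h \<div> g) = conj_set G g (cyc h) <#> conj_set G g (I_of X)"
  unfolding Sigma_h_def cyc_def[symmetric] I_of_conj[OF g X] cyc_conj[OF g h] ..
 also have "\<dots> = (\<lambda>x. g \<otimes> x \<div> g) ` (cyc h <#> I_of X)" unfolding G.conj_set_eq set_mult_def
 proof (intro equalityI subsetI)
  fix z assume "z \<in> (\<Union>a\<in>(\<lambda>x. g \<otimes> x \<div> g) ` cyc h. \<Union>b\<in>(\<lambda>x. g \<otimes> x \<div> g) ` I_of X. {a \<otimes> b})"
  then obtain x y where xy: "x \<in> cyc h" "y \<in> I_of X" "z = g \<otimes> x \<div> g \<otimes> (g \<otimes> y \<div> g)" by blast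
  have "z = g \<otimes> (x \<otimes> y) \<div> g" using e xy cyc_carrier IX by (simp add: subset_iff)
  then show "z \<in> (\<lambda>x. g \<otimes> x \<div> g) ` (\<Union>a\<in>cyc h. \<Union>b\<in>I_of X. {a \<otimes> b})" using xy by blast
 next
  fix z assume "z \<in> (\<lambda>x. g \<otimes> x \<div> g) ` (\<Union>a\<in>cyc h. \<Union>b\<in>I_of X. {a \<otimes> b})"
  then obtain x y where xy: "x \<in> cyc h" "y \<in> I_of X" "z = g \<otimes> (x \<otimes> y) \<div> g" by blast
  have "z = g \<otimes> x \<div> g \<otimes> (g \<otimes> y \<div> g)" using e xy cyc_carrier IX by (simp add: subset_iff)
  then show "z \<in> (\<Union>a\<in>(\<lambda>x. g \<otimes> x \<div> g) ` cyc h. \<Union>b\<in>(\<lambda>x. g \<otimes> x \<div> g) ` I_of X. {a \<otimes> b})"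
   using xy by blast
 qed
 finally show ?thesis by (simp add: Sigma_h_def cyc_def G.conj_set_eq)
qed

end

context fn_layer begin

definition is_prime where "is_prime X \<pi> \<longleftrightarrow> \<pi> \<in> CC X \<and> v X \<pi> = \<omega>"

abbreviation xval where "xval h n \<pi> \<equiv> ind H (Sg h) \<pi> [^]\<^bsub>obj C H\<^esub> P'_part P n"

lemma Sg_open': "frob_lift h n \<Longrightarrow> open_subgroup_of G T (Sg h) H"
 using Sg_open[of h "f_of H * n"] fH_pos by simp

lemma xval_closed:
 assumes "frob_lift h n" "\<pi> \<in> CC (Sg h)" shows "xval h n \<pi> \<in> CC H"
 by (rule monoid.nat_pow_closed[OF group.is_monoid[OF C_group[OF H_base]]
    ind_closed[OF H_base open_idom[OF H_base Sg_open'[OF assms(1)]] assms(2)]])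

lemma frob_lift_mult: "frob_lift h1 n1 \<Longrightarrow> frob_lift h2 n2 \<Longrightarrow> frob_lift (h1 \<otimes> h2) (n1 + n2)"
 by (simp add: Og.nat_pow_mult algebra_simps)

text \<open>Restriction to \<open>dv H a\<close> turns the three values into inductions of orbit
  products of prime elements, each fixed by its lift. The defect u is a unit because degrees add up,
  (\<phi> - 1)u telescopes to inertia terms, and \<open>unit_norm\<close> applies. The result
  returns to C(H) because restriction is injective on units.\<close>

lemma xval_mult:
 assumes h1: "frob_lift h1 n1" and h2: "frob_lift h2 n2"
  and p1: "is_prime (Sg h1) \<pi>1" and p2: "is_prime (Sg h2) \<pi>2" and p3: "is_prime (Sg (h1 \<otimes> h2)) \<pi>3"
 shows "(xval h1 n1 \<pi>1 \<otimes>\<^bsub>obj C H\<^esub> xval h2 n2 \<pi>2) \<div>\<^bsub>obj C H\<^esub> xval (h1 \<otimes> h2) (n1 + n2) \<pi>3 \<in> norm_group C H U"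
proof -
 define h3 where "h3 = h1 \<otimes> h2"
 define n3 where "n3 = n1 + n2"
 have h3: "frob_lift h3 n3" unfolding h3_def n3_def by (rule frob_lift_mult[OF h1 h2])
 note p3 = p3[folded h3_def]
 have hH: "h1 \<in> H" "h2 \<in> H" "h3 \<in> H" and hc: "h1 \<in> carrier G" "h2 \<in> carrier G" "h3 \<in> carrier G"
  using h1 h2 h3 by auto
 obtain \<phi> where \<phi>: "\<phi> \<in> H" "d \<phi> = \<omega> \<up> f_of H"
  using frobenius_exists[OF H_inert fH_pos dvd_refl] by blast
 have \<phi>c: "\<phi> \<in> carrier G" by (rule H.mem_carrier[OF \<phi>(1)])
 have d\<phi>: "d (\<phi> [^] (n::nat)) = \<omega> \<up> (f_of H * n)" for n
  using d.hom_nat_pow[OF \<phi>c, of n] \<phi>(2) by (simp add: Og.nat_pow_pow)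
 \<comment> \<open>Conjugating the second lift by \<phi>^n1 leaves its value in C(H) unchanged, as g
   lies in H, and makes the inertia elements multiply: \<phi>^n3 h3^-1 = t2 t1 below.\<close>
 define g where "g = \<phi> [^] n1"
 have gH: "g \<in> H" unfolding g_def by (rule H_pow[OF \<phi>(1)])
 have gc: "g \<in> carrier G" by (rule H.mem_carrier[OF gH])
 define h2' where "h2' = g \<otimes> h2 \<div> g"
 have h2': "frob_lift h2' n2" using h2 gH hc d_conj[OF gc hc(2)] by (simp add: h2'_def)
 have hH2': "h2' \<in> H" using h2' by simp
 have Sg2: "conj_set G g (Sg h2) = Sg h2'"
  unfolding h2'_def using Sigma_conj[OF gc hc(2) U.subset] U_conj_set[OF gH] by simp
 define \<pi>2' where "\<pi>2' = con g (Sg h2) \<pi>2"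
 have M2: "Sg h2 \<in> base M" by (rule open_base'[OF Sg_open'[OF h2]])
 have p2': "is_prime (Sg h2') \<pi>2'"
  using p2 con_closed[OF M2 gc, of \<pi>2] v_con[OF M2 gc, of \<pi>2] by (simp add: is_prime_def \<pi>2'_def Sg2)
 have x2: "xval h2' n2 \<pi>2' = xval h2 n2 \<pi>2"
 proof -
  have \<pi>2c: "\<pi>2 \<in> CC (Sg h2)" using p2 by (simp add: is_prime_def)
  have i2: "Sg h2 \<in> idom M H" by (rule open_idom[OF H_base Sg_open'[OF h2]])
  have "conj_set G g H = H" using gH by (intro G.conj_set_invariant[OF gc H.subset]) auto
  then have "ind H (Sg h2') \<pi>2' = con g H (ind H (Sg h2) \<pi>2)"
   unfolding \<pi>2'_def using con_ind[OF H_base i2 gc \<pi>2c] Sg2 by simp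
  also have "\<dots> = ind H (Sg h2) \<pi>2" by (rule con_inner[OF H_base gH ind_closed[OF H_base i2 \<pi>2c]])
  finally show ?thesis by simp
 qed
 obtain a where a: "good n1 a" "good n2 a" "good n3 a" using good_exists by blast
 have a0: "0 < a" by (rule good_pos[OF a(1)])
 define W where "W = dv U a" define S where "S = dv H a"
 have oS: "open_subgroup_of G T S H" and oW: "open_subgroup_of G T W H"
  unfolding S_def W_def by (intro dvH_open dvU_open a0)+
 have oH: "open_subgroup_of G T H H" by (rule open_subgroup_of_self[OF H_sub])
 have SM: "S \<in> base M" and WM: "W \<in> base M" using open_base' oS oW by auto
 have WS: "W \<subseteq> S" unfolding W_def S_def using UH by (auto simp: dv_def)
 note iSW = open_open_rdom(2)[OF oS oW WS] and rS = open_rdom[OF H_base oS]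
 have cj: "conj_set G h W = W" "conj_set G h S = S" if "h \<in> H" for h
  unfolding S_def W_def using dvU_conj_set dvH_conj_set that by auto
 interpret cS: comm_group "obj C S" by (rule C_comm_group[OF SM])
 interpret cW: comm_group "obj C W" by (rule C_comm_group[OF WM])
 interpret cH: comm_group "obj C H" by (rule C_comm_group[OF H_base])
 have F_endo: "con \<phi> W \<in> hom (obj C W) (obj C W)" by (rule con_endo[OF WM \<phi>c cj(1)[OF \<phi>(1)]])
 interpret aW: ab_endo "obj C W" "con \<phi> W"
  using C_comm_group[OF WM] F_endo by (simp add: ab_endo_def ab_endo_axioms_def)
 have ih: "ind S W \<in> hom (obj C W) (obj C S)" by (rule ind_hom[OF SM iSW])
 \<comment> \<open>The element \<rho> is the restriction of \<pi>. As \<open>Sg h\<close> and W have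
   the same inertia it stays prime, and h fixes it because h lies in \<open>Sg h\<close>. The orbit
   is formed in C(W) before inducing to C(S).\<close>
 have key: "\<exists>\<rho>. is_prime W \<rho> \<and> con h W \<rho> = \<rho> \<and> res S H (xval h n \<pi>) = ind S W (orb (obj C W) (con \<phi> W) n \<rho>)"
  if h: "frob_lift h n" and gd: "good n a" and p: "is_prime (Sg h) \<pi>" for h n \<pi>
 proof (intro exI conjI)
  let ?\<rho> = "res W (Sg h) \<pi>"
  have WSg: "W \<subseteq> Sg h" unfolding W_def by (rule dvU_sub_Sg[OF h gd])
  note oSg = Sg_open'[OF h]
  have SgM: "Sg h \<in> base M" by (rule open_base'[OF oSg])
  note rW = open_open_rdom(1)[OF oSg oW WSg]
  have \<pi>: "\<pi> \<in> CC (Sg h)" "v (Sg h) \<pi> = \<omega>" using p by (auto simp: is_prime_def)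
  have hh: "h \<in> H" using h by simp
  have \<rho>c: "?\<rho> \<in> CC W" by (rule res_closed[OF SgM rW \<pi>(1)])
  show "is_prime W ?\<rho>"
   using v_res_unram[OF SgM rW \<pi>(1)] I_Sg_dv[OF h gd] \<pi> \<rho>c by (simp add: is_prime_def W_def)
  show "con h W ?\<rho> = ?\<rho>" by (rule con_Sg_res[OF hh oSg WSg oW cj(1)[OF hh] self_Sg[OF hh] \<pi>(1)])
  have "res S H (xval h n \<pi>) = orb (obj C S) (con \<phi> S) n (ind S W ?\<rho>)"
   using res_ind_prime[OF \<phi> h gd \<pi>(1)] by (simp add: S_def W_def)
  also have "\<dots> = ind S W (orb (obj C W) (con \<phi> W) n ?\<rho>)"
   by (rule aW.orb_map[symmetric, OF ih cS.is_group _ \<rho>c])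
    (rule con_ind_fix[symmetric, OF SM iSW \<phi>c cj(2)[OF \<phi>(1)] cj(1)[OF \<phi>(1)]])
  finally show "res S H (xval h n \<pi>) = ind S W (orb (obj C W) (con \<phi> W) n ?\<rho>)" .
 qed
 obtain \<rho>1 where r1: "is_prime W \<rho>1" "con h1 W \<rho>1 = \<rho>1" "res S H (xval h1 n1 \<pi>1) = ind S W (orb (obj C W) (con \<phi> W) n1 \<rho>1)"
  using key[OF h1 a(1) p1] by blast
 obtain \<rho>2 where r2: "is_prime W \<rho>2" "con h2' W \<rho>2 = \<rho>2" "res S H (xval h2' n2 \<pi>2') = ind S W (orb (obj C W) (con \<phi> W) n2 \<rho>2)"
  using key[OF h2' a(2) p2'] by blast
 obtain \<rho>3 where r3: "is_prime W \<rho>3" "con h3 W \<rho>3 = \<rho>3" "res S H (xval h3 n3 \<pi>3) = ind S W (orb (obj C W) (con \<phi> W) n3 \<rho>3)"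
  using key[OF h3 a(3) p3] by blast
 have \<rho>c: "\<rho>1 \<in> CC W" "\<rho>2 \<in> CC W" "\<rho>3 \<in> CC W" and v\<rho>: "v W \<rho>1 = \<omega>" "v W \<rho>2 = \<omega>" "v W \<rho>3 = \<omega>"
  using r1 r2 r3 by (auto simp: is_prime_def)
 have cc: "con h W x \<in> CC W" if "h \<in> H" "x \<in> CC W" for h x
  using con_closed[OF WM H.mem_carrier[OF that(1)] that(2)] cj(1)[OF that(1)] by simp
 have conc: "con h W (con k W x) = con (h \<otimes> k) W x" if "h \<in> H" "k \<in> H" "x \<in> CC W" for h k x
  using con_con[OF WM H.mem_carrier[OF that(2)] H.mem_carrier[OF that(1)] that(3)] cj(1)[OF that(2)] by simp
 have vcon: "v W (con h W x) = v W x" if "h \<in> H" "x \<in> CC W" for h x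
  using v_con[OF WM H.mem_carrier[OF that(1)] that(2)] cj(1)[OF that(1)] by simp
 \<comment> \<open>since \<open>h\<close> fixes \<open>\<rho>\<close>, the Frobenius power \<open>\<phi>\<^sup>n\<close> acts on \<open>\<rho>\<close> like the inertia element \<open>\<phi>\<^sup>n h\<^sup>-\<^sup>1\<close>\<close>
 have tau: "(con \<phi> W ^^ n) \<rho> = con (\<phi> [^] n \<div> h) W \<rho>"
  if "h \<in> H" "\<rho> \<in> CC W" "con h W \<rho> = \<rho>" for h n \<rho>
 proof -
  have pH: "\<phi> [^] n \<in> H" by (rule H_pow[OF \<phi>(1)])
  have "con (\<phi> [^] n \<div> h) W \<rho> = con (\<phi> [^] n \<div> h) W (con h W \<rho>)" using that(3) by simp
  also have "\<dots> = con (\<phi> [^] n \<div> h \<otimes> h) W \<rho>" using conc that(1,2) pH by simp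
  also have "\<phi> [^] n \<div> h \<otimes> h = \<phi> [^] n" using pH that(1) by (simp add: G.m_assoc)
  finally show ?thesis using con_pow(1)[OF WM \<phi>c cj(1)[OF \<phi>(1)] that(2)] by simp
 qed
 define t1 where "t1 = \<phi> [^] n1 \<div> h1"
 define t2 where "t2 = \<phi> [^] n2 \<div> h2'"
 have t1: "t1 \<in> I_of H" "t1 \<in> H"
  using h1 H_pow[OF \<phi>(1), of n1] d\<phi>[of n1] by (auto simp: t1_def mem_I_of)
 have t2: "t2 \<in> I_of H" "t2 \<in> H"
  using h2' H_pow[OF \<phi>(1), of n2] d\<phi>[of n2] by (auto simp: t2_def mem_I_of)
 have t3: "\<phi> [^] n3 \<div> h3 = t2 \<otimes> t1"
 proof -
  have p2c: "\<phi> [^] n2 \<in> carrier G" using \<phi>c by simp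
  have "t2 \<otimes> t1 = \<phi> [^] n2 \<otimes> (g \<otimes> (inv h2 \<div> g)) \<otimes> (g \<div> h1)"
   unfolding t1_def t2_def h2'_def g_def[symmetric] using gc hc by (simp add: G.inv_mult_group G.m_assoc)
  also have "\<dots> = (\<phi> [^] n2 \<otimes> g) \<div> h2 \<otimes> (inv g \<otimes> g) \<div> h1"
   using gc hc p2c by (simp only: G.m_assoc G.m_closed G.inv_closed)
  also have "\<dots> = (\<phi> [^] n2 \<otimes> g) \<otimes> (inv h2 \<div> h1)"
   using gc hc p2c by (simp add: G.m_assoc)
  also have "\<phi> [^] n2 \<otimes> g = \<phi> [^] n3" unfolding g_def n3_def using G.nat_pow_mult[OF \<phi>c, of n2 n1] by (simp add: add.commute)
  also have "inv h2 \<div> h1 = inv h3" unfolding h3_def using hc by (simp add: G.inv_mult_group)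
  finally show ?thesis by simp
 qed
 define c1 where "c1 = con t1 W \<rho>3"
 define c3 where "c3 = con t2 W c1"
 have c: "c1 \<in> CC W" "c3 \<in> CC W" unfolding c1_def c3_def using cc t1 t2 \<rho>c by auto
 have c3': "(con \<phi> W ^^ n3) \<rho>3 = c3"
  unfolding tau[OF hH(3) \<rho>c(3) r3(2)] t3 c3_def c1_def using conc[OF t2(2) t1(2) \<rho>c(3)] by simp
 define b1 where "b1 = con t1 W \<rho>1"
 define b2 where "b2 = con t2 W \<rho>2"
 have b: "b1 \<in> CC W" "b2 \<in> CC W" unfolding b1_def b2_def using cc t1 t2 \<rho>c by auto
 have b1': "(con \<phi> W ^^ n1) \<rho>1 = b1" unfolding tau[OF hH(1) \<rho>c(1) r1(2)] t1_def b1_def ..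
 have b2': "(con \<phi> W ^^ n2) \<rho>2 = b2" unfolding tau[OF hH2' \<rho>c(2) r2(2)] t2_def b2_def ..
 let ?o = "\<lambda>n \<rho>. orb (obj C W) (con \<phi> W) n \<rho>"
 let ?o1 = "?o n1 \<rho>1" and ?o2 = "?o n2 \<rho>2" and ?o3 = "?o n3 \<rho>3"
 have oc: "?o1 \<in> CC W" "?o2 \<in> CC W" "?o3 \<in> CC W" using aW.orb_closed \<rho>c by auto
 define u where "u = (?o1 \<otimes>\<^bsub>obj C W\<^esub> ?o2) \<div>\<^bsub>obj C W\<^esub> ?o3"
 define u1 where "u1 = \<rho>1 \<div>\<^bsub>obj C W\<^esub> \<rho>3"
 define u2 where "u2 = \<rho>2 \<div>\<^bsub>obj C W\<^esub> c1"
 \<comment> \<open>The valuation of u is (n1 + n2 - n3)\<omega> = 0. This needs orbits of the full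
   lengths n1, n2, n3; their P-parts would not add up.\<close>
 have uE: "u \<in> Eu W" "u1 \<in> Eu W" "u2 \<in> Eu W"
 proof -
  have vo: "v W (?o n \<rho>) = \<omega> \<up> n" if "\<rho> \<in> CC W" "v W \<rho> = \<omega>" for n \<rho>
   using v_orb[OF WM \<phi>c cj(1)[OF \<phi>(1)] that(1)] that(2) by simp
  show "u \<in> Eu W"
   unfolding u_def using oc \<rho>c v\<rho> by (simp add: mem_Eu v_mult[OF WM] v_inv[OF WM] vo Og.nat_pow_mult n3_def)
  show "u1 \<in> Eu W" unfolding u1_def using \<rho>c v\<rho> by (simp add: mem_Eu v_mult[OF WM] v_inv[OF WM])
  have "v W c1 = \<omega>" unfolding c1_def using vcon[OF t1(2) \<rho>c(3)] v\<rho>(3) by simp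
  then show "u2 \<in> Eu W" unfolding u2_def using \<rho>c c v\<rho> by (simp add: mem_Eu v_mult[OF WM] v_inv[OF WM])
 qed
 have diff_hom: "f (x \<div>\<^bsub>obj C W\<^esub> y) = f x \<div>\<^bsub>B\<^esub> f y"
  if "f \<in> hom (obj C W) B" "group B" "x \<in> CC W" "y \<in> CC W" for f B x y
  using hom_mult[OF that(1,3) cW.inv_closed[OF that(4)]] group_hom_inv[OF cW.is_group that(2,1,4)] by simp
 have con_endo': "con h W \<in> hom (obj C W) (obj C W)" if "h \<in> H" for h
  by (rule con_endo[OF WM H.mem_carrier[OF that] cj(1)[OF that]])
 have eq: "con \<phi> W u \<div>\<^bsub>obj C W\<^esub> u =
   (con t1 W u1 \<div>\<^bsub>obj C W\<^esub> u1) \<otimes>\<^bsub>obj C W\<^esub>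
   (con t2 W u2 \<div>\<^bsub>obj C W\<^esub> u2)"
 proof -
  let ?F = "con \<phi> W"
  have Fo: "?F ?o1 \<in> CC W" "?F ?o2 \<in> CC W" "?F ?o3 \<in> CC W" using aW.f_closed oc by auto
  have "?F u = (?F ?o1 \<otimes>\<^bsub>obj C W\<^esub> ?F ?o2) \<div>\<^bsub>obj C W\<^esub> ?F ?o3"
   unfolding u_def diff_hom[OF F_endo cW.is_group cW.m_closed[OF oc(1,2)] oc(3)] aW.f_mult[OF oc(1,2)] ..
  then have "?F u \<div>\<^bsub>obj C W\<^esub> u =
    (?F ?o1 \<div>\<^bsub>obj C W\<^esub> ?o1) \<otimes>\<^bsub>obj C W\<^esub> (?F ?o2 \<div>\<^bsub>obj C W\<^esub> ?o2)
    \<div>\<^bsub>obj C W\<^esub> (?F ?o3 \<div>\<^bsub>obj C W\<^esub> ?o3)"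
   unfolding u_def using Fo oc by (simp add: cW.inv_mult cW.m_ac)
  also have "\<dots> = (b1 \<div>\<^bsub>obj C W\<^esub> \<rho>1) \<otimes>\<^bsub>obj C W\<^esub> (b2 \<div>\<^bsub>obj C W\<^esub> \<rho>2)
    \<div>\<^bsub>obj C W\<^esub> (c3 \<div>\<^bsub>obj C W\<^esub> \<rho>3)"
   using aW.orb_telescope'[OF \<rho>c(1), of n1] aW.orb_telescope'[OF \<rho>c(2), of n2] aW.orb_telescope'[OF \<rho>c(3), of n3]
    b1' b2' c3' by simp
  also have "\<dots> = ((b1 \<div>\<^bsub>obj C W\<^esub> c1) \<div>\<^bsub>obj C W\<^esub> (\<rho>1 \<div>\<^bsub>obj C W\<^esub> \<rho>3)) \<otimes>\<^bsub>obj C W\<^esub>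
    ((b2 \<div>\<^bsub>obj C W\<^esub> c3) \<div>\<^bsub>obj C W\<^esub> (\<rho>2 \<div>\<^bsub>obj C W\<^esub> c1))"
   by (rule cW.cocycle_identity[OF \<rho>c b c])
  also have "b1 \<div>\<^bsub>obj C W\<^esub> c1 = con t1 W u1"
   unfolding u1_def b1_def c1_def by (rule diff_hom[symmetric, OF con_endo'[OF t1(2)] cW.is_group \<rho>c(1,3)])
  also have "b2 \<div>\<^bsub>obj C W\<^esub> c3 = con t2 W u2"
   unfolding u2_def b2_def c3_def by (rule diff_hom[symmetric, OF con_endo'[OF t2(2)] cW.is_group \<rho>c(2) c(1)])
  finally show ?thesis unfolding u1_def u2_def .
 qed
 have ga: "Pnum a" "f_of U dvd a" "f_of H dvd a" using a(1) unfolding good_def by (auto dest: dvd_mult_left)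
 obtain n where n: "n \<in> norm_group C H U" "n \<in> Eu H" "ind S W u = res S H n"
  using unit_norm[OF \<phi> ga, of u u1 u2 t1 t2] uE t1(1) t2(1) eq unfolding S_def W_def by blast
 define y where "y = (xval h1 n1 \<pi>1 \<otimes>\<^bsub>obj C H\<^esub> xval h2 n2 \<pi>2) \<div>\<^bsub>obj C H\<^esub> xval h3 n3 \<pi>3"
 have xc: "xval h1 n1 \<pi>1 \<in> CC H" "xval h2 n2 \<pi>2 \<in> CC H" "xval h3 n3 \<pi>3 \<in> CC H"
  using xval_closed h1 h2 h3 p1 p2 p3 unfolding is_prime_def by blast+
 have yc: "y \<in> CC H" unfolding y_def using xc by simp
 have rh: "res S H \<in> hom (obj C H) (obj C S)" by (rule res_hom[OF H_base rS])
 have ry: "res S H y = ind S W u"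
 proof -
  have "res S H y = (res S H (xval h1 n1 \<pi>1) \<otimes>\<^bsub>obj C S\<^esub> res S H (xval h2 n2 \<pi>2)) \<otimes>\<^bsub>obj C S\<^esub>
    inv\<^bsub>obj C S\<^esub> res S H (xval h3 n3 \<pi>3)"
   unfolding y_def using hom_mult[OF rh cH.m_closed[OF xc(1,2)] cH.inv_closed[OF xc(3)]] hom_mult[OF rh xc(1,2)]
    group_hom_inv[OF cH.is_group cS.is_group rh xc(3)] by simp
  also have "\<dots> = (ind S W ?o1 \<otimes>\<^bsub>obj C S\<^esub> ind S W ?o2) \<div>\<^bsub>obj C S\<^esub> ind S W ?o3"
   using r1(3) r2(3) r3(3) x2 by simp
  also have "\<dots> = ind S W u"
   unfolding u_def using diff_hom[OF ih cS.is_group _ oc(3)] hom_mult[OF ih oc(1,2)] oc by simp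
  finally show ?thesis .
 qed
 have nc: "n \<in> CC H" using n(2) by (simp add: mem_Eu)
 have IS: "I_of H = I_of S" unfolding S_def I_of_dv ..
 \<comment> \<open>S over H is unramified, so the valuation of y can be read off after restriction,
   where y becomes the induction of the unit u.\<close>
 have vy: "v H y = \<one>\<^bsub>\<Omega>\<^esub>"
  using v_res_unram[OF H_base rS yc IS] ry Eu_ind[OF SM iSW uE(1)] by (simp add: mem_Eu)
 define q where "q = y \<div>\<^bsub>obj C H\<^esub> n"
 have "q \<in> Eu H" unfolding q_def
  using yc vy n(2) by (intro subgroup.m_closed[OF Eu_subgroup[OF H_base]] subgroup.m_inv_closed[OF Eu_subgroup[OF H_base]])
   (simp add: mem_Eu)
 moreover have "res S H q = \<one>\<^bsub>obj C S\<^esub>"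
 proof -
  have "res S H q = res S H y \<div>\<^bsub>obj C S\<^esub> res S H n"
   unfolding q_def using hom_mult[OF rh yc cH.inv_closed[OF nc]] group_hom_inv[OF cH.is_group cS.is_group rh nc] by simp
  then show ?thesis using ry n(3) res_closed[OF H_base rS nc] by simp
 qed
 moreover have V: "S \<in> unram G T \<Omega> d H" unfolding S_def by (rule dv_unram[OF H_sub a0])
 ultimately have "q = \<one>\<^bsub>obj C H\<^esub>" using unit_exact(1)[OF H_flat oH V \<phi>] by blast
 then have "y = n" unfolding q_def using yc nc cH.inv_equality[OF _ cH.inv_closed[OF nc] yc] by (metis cH.inv_inv)
 then show ?thesis using n(1) unfolding y_def h3_def n3_def by simp
qed

end

lemma induced_map_eq:
 assumes "x \<in> X" "\<And>x'. x' \<in> X \<Longrightarrow> p x' = p x \<Longrightarrow> q x' = q x"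
 shows "induced_map X p q (p x) = q x" unfolding induced_map_def
proof (rule the_equality)
 show "\<exists>x'\<in>X. p x' = p x \<and> q x' = q x" using assms(1) by blast
 fix y assume "\<exists>x'\<in>X. p x' = p x \<and> q x' = y"
 then obtain x' where "x' \<in> X" "p x' = p x" "q x' = y" by blast
 then show "y = q x" using assms(2)[of x'] by simp
qed

lemma image_topology_discrete: "image_topology (discrete_topology S) f = discrete_topology (f ` S)"
 unfolding topology_eq openin_image_topology by (auto simp: openin_image_topology)

lemma top_ab_group_discrete:
 assumes "comm_group A" shows "top_ab_group A (discrete_topology (carrier A))"
proof -
 interpret comm_group A by fact
 have "prod_topology (discrete_topology (carrier A)) (discrete_topology (carrier A)) = discrete_topology (carrier A \<times> carrier A)"
  by (simp add: prod_topology_discrete_topology)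
 then show ?thesis using assms is_group by (auto simp: top_ab_group_def top_group_def)
qed

context fn_layer begin

subsection \<open>The norm residue group\<close>

abbreviation Nm where "Nm \<equiv> norm_group C H U"
abbreviation QQ where "QQ \<equiv> obj C H Mod Nm"

definition cls where "cls a = Nm #>\<^bsub>obj C H\<^esub> a"

lemma cls_H0: "H0_class C (H, U) = cls" by (simp add: H0_class_def cls_def fun_eq_iff)

lemma Nm_sub: "subgroup Nm (obj C H)" by (rule norm_subgroup[OF H_base U_idom])

lemma Nm_normal: "Nm \<lhd> obj C H" by (rule comm_group.subgroup_imp_normal[OF C_comm_group[OF H_base] Nm_sub])

lemma Q_comm: "comm_group QQ" by (rule comm_group.abelian_FactGroup[OF C_comm_group[OF H_base] Nm_sub])

lemma Q_group: "group QQ" using Q_comm comm_group.axioms(2) by blast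

lemma cls_hom: "cls \<in> hom (obj C H) QQ" unfolding cls_def by (rule normal.r_coset_hom_Mod[OF Nm_normal])

lemma cls_closed: "a \<in> CC H \<Longrightarrow> cls a \<in> carrier QQ" by (rule hom_in_carrier[OF cls_hom])

lemma carrier_Q: "carrier QQ = cls ` CC H" by (simp add: carrier_FactGroup cls_def)

lemma cls_mult: "a \<in> CC H \<Longrightarrow> b \<in> CC H \<Longrightarrow> cls (a \<otimes>\<^bsub>obj C H\<^esub> b) = cls a \<otimes>\<^bsub>QQ\<^esub> cls b"
 by (rule hom_mult[OF cls_hom])

lemma cls_inv: "a \<in> CC H \<Longrightarrow> cls (inv\<^bsub>obj C H\<^esub> a) = inv\<^bsub>QQ\<^esub> cls a"
 by (rule group_hom_inv[OF C_group[OF H_base] Q_group cls_hom])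

lemma cls_one_iff: "a \<in> CC H \<Longrightarrow> cls a = \<one>\<^bsub>QQ\<^esub> \<longleftrightarrow> a \<in> Nm"
proof -
 assume a: "a \<in> CC H"
 have "Nm #>\<^bsub>obj C H\<^esub> a = Nm \<longleftrightarrow> a \<in> Nm"
  using group.coset_join2[OF C_group[OF H_base] a Nm_sub]
   group.coset_join1[OF C_group[OF H_base] _ a Nm_sub] by blast
 then show ?thesis by (simp add: cls_def)
qed

lemma group_eq_iff: "group A \<Longrightarrow> x \<in> carrier A \<Longrightarrow> y \<in> carrier A \<Longrightarrow> x \<div>\<^bsub>A\<^esub> y = \<one>\<^bsub>A\<^esub> \<longleftrightarrow> x = y"
 by (metis group.inv_equality group.inv_inv group.r_inv group.inv_closed)

lemma cls_eq_iff: "a \<in> CC H \<Longrightarrow> b \<in> CC H \<Longrightarrow> cls a = cls b \<longleftrightarrow> a \<div>\<^bsub>obj C H\<^esub> b \<in> Nm"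
proof -
 assume a: "a \<in> CC H" and b: "b \<in> CC H"
 have ib: "inv\<^bsub>obj C H\<^esub> b \<in> CC H" by (rule group.inv_closed[OF C_group[OF H_base] b])
 have "a \<div>\<^bsub>obj C H\<^esub> b \<in> Nm \<longleftrightarrow> cls (a \<div>\<^bsub>obj C H\<^esub> b) = \<one>\<^bsub>QQ\<^esub>"
  using cls_one_iff[OF monoid.m_closed[OF group.is_monoid[OF C_group[OF H_base]] a ib]] by simp
 also have "cls (a \<div>\<^bsub>obj C H\<^esub> b) = cls a \<div>\<^bsub>QQ\<^esub> cls b"
  using cls_mult[OF a ib] cls_inv[OF b] by simp
 also have "\<dots> = \<one>\<^bsub>QQ\<^esub> \<longleftrightarrow> cls a = cls b"
  by (rule group_eq_iff[OF Q_group cls_closed[OF a] cls_closed[OF b]])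
 finally show ?thesis by simp
qed

subsection \<open>The reciprocity homomorphism\<close>

definition deg where "deg h = mult_Omega \<Omega> \<omega> (norm_deg G \<Omega> d H h)"

lemma norm_deg_lift: "frob_lift h n \<Longrightarrow> norm_deg G \<Omega> d H h = \<omega> \<up> n"
 by (rule norm_deg_eq[OF H_inert]) (simp_all add: Og.nat_pow_pow mult.commute)

lemma deg_eq: assumes "frob_lift h n" shows "deg h = n" unfolding deg_def mult_Omega_def norm_deg_lift[OF assms]
proof (rule the_equality)
 show "0 < n \<and> \<omega> \<up> n = \<omega> \<up> n" using assms by simp
 fix m :: nat assume "0 < m \<and> \<omega> \<up> n = \<omega> \<up> m"
 then show "m = n" using omega_pow_inj[OF P_nonempty, of n m] by blast
qed

lemma Frob_iff: "h \<in> Frob G \<Omega> \<omega> d H \<longleftrightarrow> (\<exists>n. frob_lift h n)"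
proof
 assume "h \<in> Frob G \<Omega> \<omega> d H"
 then obtain n :: nat where h: "h \<in> H" "norm_deg G \<Omega> d H h = \<omega> \<up> n" "0 < n"
  by (auto simp: Frob_def Omega_plus_def)
 have "d h \<in> Om (f_of H)" using h(1) d_inert_finite[OF H_inert] by blast
 then obtain w where w: "w \<in> carrier \<Omega>" "w \<up> f_of H = d h" by (auto simp: Om_def)
 have "w = \<omega> \<up> n" using norm_deg_eq[OF H_inert w] h(2) by simp
 then have "d h = \<omega> \<up> (f_of H * n)" using w(2) by (simp add: Og.nat_pow_pow mult.commute)
 then show "\<exists>n. frob_lift h n" using h by blast
next
 assume "\<exists>n. frob_lift h n"
 then obtain n where n: "frob_lift h n" by blast
 then show "h \<in> Frob G \<Omega> \<omega> d H" using norm_deg_lift[OF n] by (auto simp: Frob_def Omega_plus_def)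
qed

lemma prime_Sg: "frob_lift h n \<Longrightarrow> \<exists>\<pi>. is_prime (Sg h) \<pi>"
 using prime_exists[OF open_base'[OF Sg_open']] by (auto simp: is_prime_def)

definition rec0 where "rec0 h = cls (xval h (deg h) (SOME \<pi>. is_prime (Sg h) \<pi>))"

lemma xval_prime_closed: "frob_lift h n \<Longrightarrow> is_prime (Sg h) \<pi> \<Longrightarrow> xval h n \<pi> \<in> CC H"
 by (rule xval_closed) (simp_all add: is_prime_def)

lemma xval_cls:
 assumes h: "frob_lift h1 n1" "frob_lift h2 n2"
  and p: "is_prime (Sg h1) \<pi>1" "is_prime (Sg h2) \<pi>2" "is_prime (Sg (h1 \<otimes> h2)) \<pi>3"
 shows "cls (xval (h1 \<otimes> h2) (n1 + n2) \<pi>3) = cls (xval h1 n1 \<pi>1) \<otimes>\<^bsub>QQ\<^esub> cls (xval h2 n2 \<pi>2)"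
proof -
 note c = xval_prime_closed[OF h(1) p(1)] xval_prime_closed[OF h(2) p(2)]
  xval_prime_closed[OF frob_lift_mult[OF h] p(3)]
 have c12: "xval h1 n1 \<pi>1 \<otimes>\<^bsub>obj C H\<^esub> xval h2 n2 \<pi>2 \<in> CC H"
  by (rule monoid.m_closed[OF group.is_monoid[OF C_group[OF H_base]] c(1,2)])
 show ?thesis using cls_eq_iff[OF c12 c(3)] xval_mult[OF h p] cls_mult[OF c(1,2)] by simp
qed

text \<open>Independence of the prime element falls out of multiplicativity: evaluate the product h
  h with one fixed prime for it, using once \<pi> and once \<pi>' for the first factor, and
  cancel.\<close>

lemma rec0_eq:
 assumes h: "frob_lift h n" and p: "is_prime (Sg h) \<pi>"
 shows "rec0 h = cls (xval h n \<pi>)"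
proof -
 define \<pi>' where "\<pi>' = (SOME \<pi>. is_prime (Sg h) \<pi>)"
 have p': "is_prime (Sg h) \<pi>'" unfolding \<pi>'_def by (rule someI_ex[OF prime_Sg[OF h]])
 obtain \<pi>3 where p3: "is_prime (Sg (h \<otimes> h)) \<pi>3" using prime_Sg[OF frob_lift_mult[OF h h]] by blast
 note c = cls_closed[OF xval_prime_closed[OF h p]] cls_closed[OF xval_prime_closed[OF h p']]
 have "cls (xval h n \<pi>) \<otimes>\<^bsub>QQ\<^esub> cls (xval h n \<pi>) = cls (xval h n \<pi>') \<otimes>\<^bsub>QQ\<^esub> cls (xval h n \<pi>)"
  using xval_cls[OF h h p p p3] xval_cls[OF h h p' p p3] by simp
 then have "cls (xval h n \<pi>) = cls (xval h n \<pi>')" using group.right_cancel[OF Q_group c(1) c(1) c(2)] by simp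
 then show ?thesis unfolding rec0_def deg_eq[OF h] \<pi>'_def by simp
qed

lemma rec0_closed: "frob_lift h n \<Longrightarrow> rec0 h \<in> carrier QQ"
 using rec0_eq prime_Sg cls_closed[OF xval_prime_closed] by metis

lemma rec0_mult:
 assumes h: "frob_lift h1 n1" "frob_lift h2 n2"
 shows "rec0 (h1 \<otimes> h2) = rec0 h1 \<otimes>\<^bsub>QQ\<^esub> rec0 h2"
proof -
 obtain \<pi>1 \<pi>2 \<pi>3 where p: "is_prime (Sg h1) \<pi>1" "is_prime (Sg h2) \<pi>2" "is_prime (Sg (h1 \<otimes> h2)) \<pi>3"
  using prime_Sg[OF h(1)] prime_Sg[OF h(2)] prime_Sg[OF frob_lift_mult[OF h]] by blast
 show ?thesis unfolding rec0_eq[OF h(1) p(1)] rec0_eq[OF h(2) p(2)] rec0_eq[OF frob_lift_mult[OF h] p(3)]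
  by (rule xval_cls[OF h p])
qed

lemma Sg_sub_U: assumes "h \<in> U" shows "Sg h \<subseteq> U"
proof
 fix x assume "x \<in> Sg h"
 then obtain s i where si: "s \<in> cyc h" "i \<in> I_of U" "x = s \<otimes> i" using mem_Sg by blast
 have "s \<in> U" using si(1) cyc_minimal[OF U.subgroup_axioms inert_finite_closed[OF U_inert] assms] by blast
 then show "x \<in> U" using si by (simp add: mem_I_of)
qed

text \<open>For h in U the group \<open>Sg h\<close> is contained in U, so induction to H passes
  through U.\<close>

lemma rec0_U: assumes h: "frob_lift h n" and hU: "h \<in> U" shows "rec0 h = \<one>\<^bsub>QQ\<^esub>"
proof -
 obtain \<pi> where p: "is_prime (Sg h) \<pi>" using prime_Sg[OF h] by blast
 then have \<pi>: "\<pi> \<in> CC (Sg h)" by (simp add: is_prime_def)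
 have i: "Sg h \<in> idom M U" by (rule open_open_rdom(2)[OF U_open Sg_open'[OF h] Sg_sub_U[OF hU]])
 have "ind H (Sg h) \<pi> = ind H U (ind U (Sg h) \<pi>)" by (rule ind_ind[symmetric, OF H_base U_idom i \<pi>])
 then have "ind H (Sg h) \<pi> \<in> Nm" using ind_closed[OF U_base i \<pi>] by (simp add: norm_group_def)
 then have "ind H (Sg h) \<pi> [^]\<^bsub>obj C H\<^esub> k \<in> Nm" for k :: nat
  by (induction k) (use subgroup.one_closed[OF Nm_sub] subgroup.m_closed[OF Nm_sub] in auto)
 then show ?thesis unfolding rec0_eq[OF h p] using cls_one_iff[OF xval_prime_closed[OF h p]] by simp
qed

text \<open>Modulo U the degree may be changed by f_U\<Omega>. Writing d(h) = f_H j\<omega> + f_U z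
  additively, the factor u is given degree f_U(\<omega> - z), so that u h has degree f_U\<omega> +
  f_H j\<omega>, which is positive even for j = 0.\<close>

lemma lift_exists: assumes h: "h \<in> H" shows "\<exists>h' n. frob_lift h' n \<and> h' \<div> h \<in> U"
proof -
 have "\<omega> \<up> f_of U \<in> d ` U"
  using d_inert_finite[OF U_inert] pow_in_Om[OF omega_carrier dvd_refl] by simp
 then have "\<omega> \<up> f_of U \<in> Om (f_of H)" using d_inert_finite[OF H_inert] UH by blast
 then have "f_of H dvd f_of U" by (rule omega_in_Om[OF Pnum_f[OF H_inert]])
 then obtain b where b: "f_of U = f_of H * b" by blast
 have b0: "0 < b" using Pnum_pos[OF Pnum_f[OF U_inert]] b by simp
 have "d h \<in> Om (f_of H)" using h d_inert_finite[OF H_inert] by blast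
 then obtain w where w: "w \<in> carrier \<Omega>" "d h = w \<up> f_of H" by (auto simp: Om_def)
 obtain j :: nat and z where j: "z \<in> carrier \<Omega>" "w = \<omega> \<up> j \<cdot> z \<up> b"
  using omega_split[OF w(1) b0] by metis
 have dh: "d h = \<omega> \<up> (f_of H * j) \<cdot> z \<up> f_of U"
  unfolding w(2) j(2) b using j(1) by (simp add: Og.nat_pow_distrib Og.nat_pow_pow mult.commute)
 have "(\<omega> \<cdot> inv\<^bsub>\<Omega>\<^esub> z) \<up> f_of U \<in> Om (f_of U)" using j(1) by (intro pow_in_Om) auto
 then obtain u where u: "u \<in> U" "d u = (\<omega> \<cdot> inv\<^bsub>\<Omega>\<^esub> z) \<up> f_of U"
  using d_inert_finite[OF U_inert] by (metis imageE)
 have uH: "u \<in> H" by (rule U_H[OF u(1)])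
 have "d (u \<otimes> h) = \<omega> \<up> f_of U \<cdot> \<omega> \<up> (f_of H * j) \<cdot> (inv\<^bsub>\<Omega>\<^esub> (z \<up> f_of U) \<cdot> z \<up> f_of U)"
  using uH h j(1) by (simp only: d.hom_mult H.mem_carrier u(2) dh Og.nat_pow_distrib Og.nat_pow_inv Og.m_ac
    omega_carrier Og.inv_closed Og.nat_pow_closed Og.m_closed)
 also have "\<dots> = \<omega> \<up> (f_of H * (b + j))" using j(1) by (simp add: b Og.nat_pow_mult algebra_simps)
 finally have "frob_lift (u \<otimes> h) (b + j)" using uH h b0 by simp
 moreover have "u \<otimes> h \<div> h \<in> U" using u(1) h by (simp add: G.m_assoc)
 ultimately show ?thesis by blast
qed

lemma pow_d: "h \<in> H \<Longrightarrow> d h = \<omega> \<up> (c::nat) \<Longrightarrow> d (h [^] (k::nat)) = \<omega> \<up> (c * k)"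
 using d.hom_nat_pow[of h k] by (simp add: Og.nat_pow_pow)

text \<open>The quotient h' h^-1 lies in U but need not be a Frobenius lift. It is absorbed in an
  equation a h = b h' in which a and b are Frobenius lifts in U, where \<open>rec0\<close> is
  trivial.\<close>

lemma rec0_cong:
 assumes h: "frob_lift h n" "frob_lift h' n'" and eq: "h' \<div> h \<in> U"
 shows "rec0 h' = rec0 h"
proof -
 have hH: "h \<in> H" "h' \<in> H" and hc: "h \<in> carrier G" "h' \<in> carrier G" using h by auto
 \<comment> \<open>As a multiple of [H:U] the exponent puts b = h'^k into U, and the factor n makes
   the degree n'k of b at least n, so that the degree n'k + n' - n of a is positive.\<close>
 let ?k = "idx * n"
 define b where "b = h' [^] ?k"
 define a where "a = b \<otimes> (h' \<div> h)"
 have "(h' [^] idx) [^] n \<in> U" using pow_idx[OF hH(2)] by (induction n) auto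
 then have bU: "b \<in> U" unfolding b_def using hc by (simp add: G.nat_pow_pow)
 have db: "d b = \<omega> \<up> (f_of H * (n' * ?k))"
  unfolding b_def using pow_d[OF hH(2), of "f_of H * n'" ?k] h by (simp add: mult.assoc)
 have lb: "frob_lift b (n' * ?k)" using db bU U_H h idx_pos by simp
 have aU: "a \<in> U" unfolding a_def using bU eq by simp
 have ab: "a \<otimes> h = b \<otimes> h'" unfolding a_def using bU hc by (simp add: G.m_assoc)
 let ?m = "n' * ?k + n' - n"
 have n0: "0 < n" "0 < n'" using h by auto
 have le: "n \<le> n' * ?k" using n0 idx_pos by (simp add: Suc_leI)
 have m: "?m + n = n' * ?k + n'" using le by (simp only: le_add_diff_inverse2 trans_le_add1)
 then have m0: "0 < ?m" using le n0 by arith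
 have aH: "a \<in> H" "a \<in> carrier G" using aU U_H by auto
 have "d a \<cdot> d h = \<omega> \<up> (f_of H * ?m) \<cdot> d h"
 proof -
  have "d a \<cdot> d h = d (b \<otimes> h')" using ab aH hc d.hom_mult[of a h] by simp
  also have "\<dots> = \<omega> \<up> (f_of H * (n' * ?k + n'))"
   using bU hc h by (simp add: db Og.nat_pow_mult algebra_simps)
  also have "\<dots> = \<omega> \<up> (f_of H * ?m) \<cdot> \<omega> \<up> (f_of H * n)"
   by (simp only: Og.nat_pow_mult omega_carrier distrib_left[symmetric] m)
  finally show ?thesis using h by simp
 qed
 then have "d a = \<omega> \<up> (f_of H * ?m)" using aH hc by (simp only: Og.right_cancel d.hom_closed Og.nat_pow_closed omega_carrier)
 then have la: "frob_lift a ?m" using aH m0 by simp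
 have "rec0 a \<otimes>\<^bsub>QQ\<^esub> rec0 h = rec0 b \<otimes>\<^bsub>QQ\<^esub> rec0 h'"
  using rec0_mult[OF la h(1)] rec0_mult[OF lb h(2)] ab by simp
 then show ?thesis using rec0_U[OF la aU] rec0_U[OF lb bU] rec0_closed[OF h(1)] rec0_closed[OF h(2)]
   monoid.l_one[OF group.is_monoid[OF Q_group]] by simp
qed

text \<open>The reciprocity map on all of H, before passing to classes in (H/U)^ab.\<close>

definition recX where "recX h = rec0 (SOME h'. (\<exists>n. frob_lift h' n) \<and> h' \<div> h \<in> U)"

lemma recX_eq:
 assumes h: "h \<in> H" and h': "frob_lift h' n" "h' \<div> h \<in> U"
 shows "recX h = rec0 h'"
proof -
 define k where "k = (SOME h'. (\<exists>n. frob_lift h' n) \<and> h' \<div> h \<in> U)"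
 have k: "(\<exists>n. frob_lift k n) \<and> k \<div> h \<in> U"
  unfolding k_def by (rule someI_ex) (use lift_exists[OF h] in blast)
 then obtain m where m: "frob_lift k m" by blast
 have "k \<div> h \<div> (h' \<div> h) \<in> U" using k h'(2) by simp
 moreover have "k \<div> h \<div> (h' \<div> h) = k \<div> h'"
 proof -
  have kc: "k \<in> carrier G" "h' \<in> carrier G" "h \<in> carrier G" using m h' h by auto
  have "inv (h' \<div> h) = h \<div> h'" using kc by (simp add: G.inv_mult_group)
  then have "k \<div> h \<div> (h' \<div> h) = k \<otimes> (inv h \<otimes> h) \<div> h'"
   using kc by (simp only: G.m_assoc G.m_closed G.inv_closed)
  then show ?thesis using kc by simp
 qed
 ultimately have "rec0 k = rec0 h'" using rec0_cong[OF h'(1) m] by simp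
 then show ?thesis by (simp add: recX_def k_def)
qed

lemma recX_lift: "frob_lift h n \<Longrightarrow> recX h = rec0 h" using recX_eq[of h h n] by simp

lemma recX_closed: "h \<in> H \<Longrightarrow> recX h \<in> carrier QQ"
 using lift_exists[of h] recX_eq[of h] rec0_closed by metis

lemma recX_mult: assumes h: "h1 \<in> H" "h2 \<in> H" shows "recX (h1 \<otimes> h2) = recX h1 \<otimes>\<^bsub>QQ\<^esub> recX h2"
proof -
 obtain k1 n1 where k1: "frob_lift k1 n1" "k1 \<div> h1 \<in> U" using lift_exists[OF h(1)] by blast
 obtain k2 n2 where k2: "frob_lift k2 n2" "k2 \<div> h2 \<in> U" using lift_exists[OF h(2)] by blast
 have c: "k1 \<in> carrier G" "k2 \<in> carrier G" "h1 \<in> carrier G" "h2 \<in> carrier G" using k1 k2 h by auto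
 have "(k1 \<div> h1) \<otimes> (h1 \<otimes> (k2 \<div> h2) \<div> h1) \<in> U"
  by (rule U.m_closed[OF k1(2) U_conj[OF h(1) k2(2)]])
 moreover have "(k1 \<div> h1) \<otimes> (h1 \<otimes> (k2 \<div> h2) \<div> h1) = k1 \<otimes> k2 \<div> (h1 \<otimes> h2)"
 proof -
  have "(k1 \<div> h1) \<otimes> (h1 \<otimes> (k2 \<div> h2) \<div> h1) = k1 \<otimes> ((inv h1 \<otimes> h1) \<otimes> (k2 \<div> h2)) \<div> h1"
   using c by (simp only: G.m_assoc G.m_closed G.inv_closed)
  then show ?thesis using c by (simp add: G.inv_mult_group G.m_assoc)
 qed
 ultimately have m: "k1 \<otimes> k2 \<div> (h1 \<otimes> h2) \<in> U" by simp
 have "recX (h1 \<otimes> h2) = rec0 (k1 \<otimes> k2)"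
  by (rule recX_eq[OF H.m_closed[OF h] frob_lift_mult[OF k1(1) k2(1)] m])
 also have "\<dots> = rec0 k1 \<otimes>\<^bsub>QQ\<^esub> rec0 k2" by (rule rec0_mult[OF k1(1) k2(1)])
 finally show ?thesis using recX_eq[OF h(1) k1] recX_eq[OF h(2) k2] by simp
qed

lemma recX_hom: "recX \<in> hom (G\<lparr>carrier := H\<rparr>) QQ" by (auto simp: hom_def recX_closed recX_mult)

lemma recX_U: assumes "u \<in> U" shows "recX u = \<one>\<^bsub>QQ\<^esub>"
proof -
 obtain k n where k: "frob_lift k n" "k \<div> u \<in> U" using lift_exists[OF U_H[OF assms]] by blast
 have "k \<div> u \<otimes> u \<in> U" using k(2) assms by simp
 then have "k \<in> U" using k(1) assms by (simp add: G.m_assoc)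
 then show ?thesis using recX_eq[OF U_H[OF assms] k] rec0_U[OF k(1)] by simp
qed

subsection \<open>The group \<open>(H/U)\<^sup>a\<^sup>b\<close> and the Fesenko--Neukirch morphism\<close>

abbreviation QG where "QG \<equiv> G\<lparr>carrier := H\<rparr> Mod U"

lemma QG_group: "group QG" by (rule normal.factorgroup_is_group[OF normal])

lemma QG_carrier: "carrier QG = (\<lambda>h. U #> h) ` H" by (simp add: carrier_FactGroup)

lemma QG_hom: "(\<lambda>h. U #> h) \<in> hom (G\<lparr>carrier := H\<rparr>) QG"
 using normal.r_coset_hom_Mod[OF normal] by simp

lemma H_group: "group (G\<lparr>carrier := H\<rparr>)" by (rule G.subgroup_imp_group[OF H_sub])

lemma QG_mult: "h \<in> H \<Longrightarrow> k \<in> H \<Longrightarrow> U #> (h \<otimes> k) = (U #> h) \<otimes>\<^bsub>QG\<^esub> (U #> k)"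
 using hom_mult[OF QG_hom, of h k] by simp

lemma QG_inv: "h \<in> H \<Longrightarrow> U #> (inv h) = inv\<^bsub>QG\<^esub> (U #> h)"
 using group_hom_inv[OF H_group QG_group QG_hom, of h] G.inv_restrict[OF H_sub, of h] by simp

lemma coset_open: "h \<in> H \<Longrightarrow> openin (subtopology T H) (U #> h)"
proof -
 assume h: "h \<in> H"
 obtain B where B: "openin T B" "U = B \<inter> H" using U_open by (auto simp: open_subgroup_of_def openin_subtopology)
 have "U #> h = {x \<in> carrier G. x \<div> h \<in> B} \<inter> H"
 proof (intro equalityI subsetI)
  fix x assume "x \<in> U #> h"
  then obtain u where u: "u \<in> U" "x = u \<otimes> h" by (auto simp: r_coset_def)
  have xH: "x \<in> H" using u h U_H by simp
  have "x \<div> h = u" using u h by (simp add: G.m_assoc)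
  then show "x \<in> {x \<in> carrier G. x \<div> h \<in> B} \<inter> H" using u B(2) xH by auto
 next
  fix x assume x: "x \<in> {x \<in> carrier G. x \<div> h \<in> B} \<inter> H"
  then have "x \<div> h \<in> U" using B(2) h by auto
  moreover have "x = x \<div> h \<otimes> h" using x h by (simp add: G.m_assoc)
  ultimately show "x \<in> U #> h" unfolding r_coset_def by blast
 qed
 then show ?thesis using G.openin_right_translate[OF B(1) H.mem_carrier[OF h]] openin_subtopology by blast
qed

lemma quot_group_HU: "quot_group G (H, U) = QG" by (simp add: quot_group_def)

text \<open>U is open in H, so H/U is discrete and the closure in \<open>Com_t\<close> changes
  nothing.\<close>

lemma quot_top_HU: "quot_top G T (H, U) = discrete_topology (carrier QG)"
proof -
 have ts: "topspace (subtopology T H) = H" using H.subset by (simp add: Int_absorb1)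
 have "openin (subtopology T H) {x \<in> H. U #> x \<in> V}" for V
 proof (subst openin_subopen, intro ballI)
  fix x assume x: "x \<in> {x \<in> H. U #> x \<in> V}"
  have "U #> x \<subseteq> {x \<in> H. U #> x \<in> V}"
  proof
   fix y assume y: "y \<in> U #> x"
   have yH: "y \<in> H" using y x U_H by (auto simp: r_coset_def)
   have "U #> x = U #> y" using G.repr_independence[OF y _ U.subgroup_axioms] x by simp
   then show "y \<in> {x \<in> H. U #> x \<in> V}" using yH x by simp
  qed
  moreover have "x \<in> U #> x" using G.rcos_self[OF _ U.subgroup_axioms] x by simp
  ultimately show "\<exists>W. openin (subtopology T H) W \<and> x \<in> W \<and> W \<subseteq> {x \<in> H. U #> x \<in> V}"
   using coset_open x by blast
 qed
 then show ?thesis unfolding topology_eq quot_top_def prod.case openin_image_topology ts by (simp add: QG_carrier)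
qed

abbreviation DQ where "DQ \<equiv> derived QG (carrier QG)"

lemma DQ_sub: "subgroup DQ QG" by (rule group.derived_is_subgroup[OF QG_group order_refl])

lemma DQ_normal: "DQ \<lhd> QG" by (rule group.derived_self_is_normal[OF QG_group])

lemma Com_QG: "Com_t QG (discrete_topology (carrier QG)) = DQ"
 unfolding Com_t_def by (rule closure_of_closedin) (use subgroup.subset[OF DQ_sub] in simp)

lemma pi_class_HU: "pi_class G T (H, U) h = DQ #>\<^bsub>QG\<^esub> (U #> h)"
 by (simp add: pi_class_def ab_class_def quot_group_HU quot_top_HU Com_QG)

abbreviation PI where "PI \<equiv> obj (pi_fun G T) (H, U)"

lemma PI_eq: "PI = QG Mod DQ" by (simp add: pi_fun_def ab_group_def quot_group_HU quot_top_HU Com_QG)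

lemma PI_carrier: "carrier PI = pi_class G T (H, U) ` H"
proof -
 have "carrier PI = (\<lambda>X. DQ #>\<^bsub>QG\<^esub> X) ` carrier QG" unfolding PI_eq by (rule carrier_FactGroup)
 also have "\<dots> = (\<lambda>X. DQ #>\<^bsub>QG\<^esub> X) ` ((\<lambda>h. U #> h) ` H)" using QG_carrier by (rule arg_cong)
 finally show ?thesis by (simp only: image_image pi_class_HU[abs_def])
qed

lemma pi_class_hom: "pi_class G T (H, U) \<in> hom (G\<lparr>carrier := H\<rparr>) PI"
proof -
 have "(\<lambda>X. DQ #>\<^bsub>QG\<^esub> X) \<circ> (\<lambda>h. U #> h) \<in> hom (G\<lparr>carrier := H\<rparr>) PI"
  unfolding PI_eq by (rule hom_compose[OF QG_hom normal.r_coset_hom_Mod[OF DQ_normal]])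
 then show ?thesis by (simp add: o_def pi_class_HU[abs_def])
qed

lemma PI_top: "obj_top (pi_fun G T) (H, U) = discrete_topology (carrier PI)"
proof -
 have "obj_top (pi_fun G T) (H, U) = image_topology (discrete_topology (carrier QG)) (\<lambda>X. DQ #>\<^bsub>QG\<^esub> X)"
  by (simp add: pi_fun_def ab_topology_def ab_class_def[abs_def] quot_group_HU quot_top_HU Com_QG)
 then show ?thesis unfolding image_topology_discrete PI_eq carrier_FactGroup by simp
qed

definition DH where "DH = {h \<in> H. U #> h \<in> DQ}"

lemma pi_class_eq_iff:
 assumes h: "h \<in> H" "k \<in> H"
 shows "pi_class G T (H, U) h = pi_class G T (H, U) k \<longleftrightarrow> h \<div> k \<in> DH"
proof -
 interpret QGp: plain_group QG by (rule plain_group.intro[OF QG_group])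
 have c: "U #> h \<in> carrier QG" "U #> k \<in> carrier QG" using h QG_carrier by auto
 have "pi_class G T (H, U) h = pi_class G T (H, U) k \<longleftrightarrow> (U #> h) \<div>\<^bsub>QG\<^esub> (U #> k) \<in> DQ"
  unfolding pi_class_HU by (rule QGp.rcoset_eq_iff[OF DQ_sub c])
 also have "(U #> h) \<div>\<^bsub>QG\<^esub> (U #> k) = U #> (h \<div> k)"
  using QG_mult[OF h(1) H.m_inv_closed[OF h(2)]] QG_inv[OF h(2)] by simp
 finally show ?thesis using h by (simp add: DH_def)
qed

lemma U_DH: "U \<subseteq> DH"
proof
 fix u assume u: "u \<in> U"
 have "U #> u = \<one>\<^bsub>QG\<^esub>" using G.coset_join2[of u U] u U.subgroup_axioms by simp
 then show "u \<in> DH" using subgroup.one_closed[OF DQ_sub] U_H[OF u] by (simp add: DH_def)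
qed

text \<open>\<open>recX\<close> kills U and takes values in an abelian group, so it factors through
  H/U and kills commutators there.\<close>

lemma recX_DH: assumes "h \<in> DH" shows "recX h = \<one>\<^bsub>QQ\<^esub>"
proof -
 have const: "recX x = recX y" if "x \<in> H" "y \<in> H" "U #> x = U #> y" for x y
 proof -
  have "x \<div> y \<in> U" using that G.rcoset_eq_iff[OF U.subgroup_axioms, of x y] by simp
  then have "recX (x \<div> y \<otimes> y) = \<one>\<^bsub>QQ\<^esub> \<otimes>\<^bsub>QQ\<^esub> recX y"
   using recX_mult[of "x \<div> y" y] recX_U that by simp
  then show ?thesis using that recX_closed[OF that(2)] monoid.l_one[OF group.is_monoid[OF Q_group]]
   by (simp add: G.m_assoc)
 qed
 obtain r where r: "r \<in> hom QG QQ" "\<And>x. x \<in> H \<Longrightarrow> r (U #> x) = recX x"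
 proof (rule FactGroup_universal[OF recX_hom normal])
  fix x y assume "x \<in> carrier (G\<lparr>carrier := H\<rparr>)" "y \<in> carrier (G\<lparr>carrier := H\<rparr>)"
   "U #>\<^bsub>G\<lparr>carrier := H\<rparr>\<^esub> x = U #>\<^bsub>G\<lparr>carrier := H\<rparr>\<^esub> y"
  then have "x \<in> H" "y \<in> H" "U #> x = U #> y" by simp_all
  then show "recX x = recX y" by (rule const)
 next
  fix r assume "r \<in> hom QG QQ"
   "\<And>x. x \<in> carrier (G\<lparr>carrier := H\<rparr>) \<Longrightarrow> r (U #>\<^bsub>G\<lparr>carrier := H\<rparr>\<^esub> x) = recX x"
  then show thesis using that by simp
 qed
 interpret QGg: group QG by (rule QG_group)
 interpret Q: comm_group QQ by (rule Q_comm)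
 interpret r: group_hom QG QQ r using QG_group Q_group r(1) by (simp add: group_hom_def group_hom_axioms_def)
 have "DQ \<subseteq> kernel QG QQ r" unfolding derived_def
 proof (rule group.generate_subgroup_incl[OF QG_group _ r.subgroup_kernel], rule subsetI)
  fix z assume "z \<in> derived_set QG (carrier QG)"
  then obtain x y where xy: "x \<in> carrier QG" "y \<in> carrier QG"
   "z = x \<otimes>\<^bsub>QG\<^esub> y \<div>\<^bsub>QG\<^esub> x \<div>\<^bsub>QG\<^esub> y" by blast
  have zc: "z \<in> carrier QG" unfolding xy(3) by (intro QGg.m_closed QGg.inv_closed xy(1,2))
  have rc: "r x \<in> carrier QQ" "r y \<in> carrier QQ" by (intro r.hom_closed xy)+
  have "r z = r x \<otimes>\<^bsub>QQ\<^esub> r y \<div>\<^bsub>QQ\<^esub> r x \<div>\<^bsub>QQ\<^esub> r y"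
   unfolding xy(3) by (simp only: r.hom_mult r.hom_inv QGg.m_closed QGg.inv_closed xy(1,2))
  also have "\<dots> = (r x \<div>\<^bsub>QQ\<^esub> r x) \<otimes>\<^bsub>QQ\<^esub> (r y \<div>\<^bsub>QQ\<^esub> r y)"
   using rc by (simp only: Q.m_ac Q.m_closed Q.inv_closed)
  also have "\<dots> = \<one>\<^bsub>QQ\<^esub>" using rc by (simp only: Q.r_inv Q.l_one Q.one_closed)
  finally show "z \<in> kernel QG QQ r" using zc by (simp add: kernel_def)
 qed
 then have "r (U #> h) = \<one>\<^bsub>QQ\<^esub>" using assms unfolding DH_def kernel_def by blast
 then show ?thesis using r(2)[of h] assms by (simp add: DH_def)
qed

lemma recX_cong: assumes "h \<in> H" "k \<in> H" "h \<div> k \<in> DH" shows "recX h = recX k"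
proof -
 have "recX (h \<div> k \<otimes> k) = \<one>\<^bsub>QQ\<^esub> \<otimes>\<^bsub>QQ\<^esub> recX k"
  using recX_mult[of "h \<div> k" k] recX_DH[OF assms(3)] assms(1,2) by simp
 then show ?thesis using assms(1,2) recX_closed[OF assms(2)] monoid.l_one[OF group.is_monoid[OF Q_group]]
  by (simp add: G.m_assoc)
qed

abbreviation Ups where "Ups \<equiv> Upsilon P G T \<Omega> \<omega> d C v (H, U)"

text \<open>This is the well-definedness of \<open>Upsilon\<close>: every pair of a Frobenius lift
  and a prime element over the class of h gives \<open>recX h\<close>, so the \<open>THE\<close> in
  \<open>induced_map\<close> has exactly one candidate.\<close>

lemma Upsilon_pi_class: assumes h: "h \<in> H" shows "Ups (pi_class G T (H, U) h) = recX h"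
proof -
 have rec: "cls (ind H (Sg k) \<pi> [^]\<^bsub>obj C H\<^esub> P'_part P (deg k)) = recX k" if k: "frob_lift k n" and p: "is_prime (Sg k) \<pi>" for k n \<pi>
  using recX_lift[OF k] rec0_eq[OF k p] deg_eq[OF k] by simp
 have primes: "\<pi> \<in> prime_elements \<omega> C v (Sg k) \<longleftrightarrow> is_prime (Sg k) \<pi>" for k \<pi>
  by (simp add: prime_elements_def is_prime_def)
 show ?thesis unfolding Upsilon_def prod.case induced_map_def cls_H0
 proof (rule the_equality)
  obtain k n where k: "frob_lift k n" "k \<div> h \<in> U" using lift_exists[OF h] by blast
  obtain \<pi> where p: "is_prime (Sg k) \<pi>" using prime_Sg[OF k(1)] by blast
  have kD: "k \<div> h \<in> DH" using k(2) U_DH by blast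
  have kH: "k \<in> H" using k(1) by simp
  show "\<exists>x\<in>SIGMA h:Frob G \<Omega> \<omega> d H. prime_elements \<omega> C v (Sg h).
    (case x of (h, \<pi>) \<Rightarrow> pi_class G T (H, U) h) = pi_class G T (H, U) h \<and>
    (case x of (h, \<pi>) \<Rightarrow> cls (ind H (Sg h) \<pi> [^]\<^bsub>obj C H\<^esub> P'_part P (mult_Omega \<Omega> \<omega> (norm_deg G \<Omega> d H h)))) = recX h"
  proof (rule bexI[of _ "(k, \<pi>)"])
   show "(k, \<pi>) \<in> (SIGMA h:Frob G \<Omega> \<omega> d H. prime_elements \<omega> C v (Sg h))"
    using k(1) p Frob_iff primes by blast
   show "(case (k, \<pi>) of (h, \<pi>) \<Rightarrow> pi_class G T (H, U) h) = pi_class G T (H, U) h \<and>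
    (case (k, \<pi>) of (h, \<pi>) \<Rightarrow> cls (ind H (Sg h) \<pi> [^]\<^bsub>obj C H\<^esub> P'_part P (mult_Omega \<Omega> \<omega> (norm_deg G \<Omega> d H h)))) = recX h"
    unfolding prod.case deg_def[symmetric] rec[OF k(1) p]
    using pi_class_eq_iff[OF kH h] kD recX_cong[OF kH h kD] by simp
  qed
 next
  fix y assume "\<exists>x\<in>SIGMA h:Frob G \<Omega> \<omega> d H. prime_elements \<omega> C v (Sg h).
    (case x of (h, \<pi>) \<Rightarrow> pi_class G T (H, U) h) = pi_class G T (H, U) h \<and>
    (case x of (h, \<pi>) \<Rightarrow> cls (ind H (Sg h) \<pi> [^]\<^bsub>obj C H\<^esub> P'_part P (mult_Omega \<Omega> \<omega> (norm_deg G \<Omega> d H h)))) = y"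
  then obtain k \<pi> where k: "k \<in> Frob G \<Omega> \<omega> d H" "\<pi> \<in> prime_elements \<omega> C v (Sg k)"
   "pi_class G T (H, U) k = pi_class G T (H, U) h" "cls (ind H (Sg k) \<pi> [^]\<^bsub>obj C H\<^esub> P'_part P (deg k)) = y"
   unfolding deg_def by auto
  obtain n where n: "frob_lift k n" using k(1) Frob_iff by blast
  have kH: "k \<in> H" using n by simp
  have "y = recX k" using rec[OF n] k(2,4) primes by simp
  also have "\<dots> = recX h" using recX_cong[OF kH h] pi_class_eq_iff[OF kH h] k(3) by simp
  finally show "y = recX h" .
 qed
qed

end

section \<open>Compatibility with conjugation and induction\<close>

context fn_datum begin

lemma fn_layerI: "(H, U) \<in> base E \<Longrightarrow> fn_layer P G T \<Omega> TO \<omega> d E M C v H U"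
 by (rule fn_layer.intro[OF fn_datum_axioms fn_layer_axioms.intro])

lemma ric_E: "ric_domain G (conj_pair G) E" using spectrum by (simp add: spectrum_def subgroup_system_2_def)

lemmas E_dom = ric_domainD(1,2)[OF ric_E]

lemma E_sub:
 assumes "(H, U) \<in> base E" "(I, V) \<in> rdom E (H, U) \<union> idom E (H, U)"
 shows "I \<subseteq> H" "V \<subseteq> U"
proof -
 have s2: "\<forall>x\<in>base E. case x of (H, U) \<Rightarrow> closed_subgroup G T H \<and> closed_normal_in G T U H \<and>
    (\<forall>(I, V) \<in> rdom E (H, U) \<union> idom E (H, U). I \<subseteq> H \<and> V \<subseteq> U)"
  using spectrum unfolding spectrum_def subgroup_system_2_def by (elim conjE)
 have "\<forall>y \<in> rdom E (H, U) \<union> idom E (H, U). case y of (I, V) \<Rightarrow> I \<subseteq> H \<and> V \<subseteq> U"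
  using bspec[OF s2 assms(1)] unfolding prod.case by (elim conjE)
 from bspec[OF this assms(2)] show "I \<subseteq> H" "V \<subseteq> U" by simp_all
qed

lemma E_rdom:
 assumes x: "(H, U) \<in> base E" and y: "(I, V) \<in> rdom E (H, U)"
 shows "V = U" "I \<in> rdom M H" "I \<subseteq> H" "fin_index G H I"
proof -
 have HE: "H \<in> base (flat E)" and UE: "U \<in> Ext E H" using x by (force simp: flat_def Ext_def)+
 have "\<forall>x\<in>base E. case x of (H, U) \<Rightarrow> \<forall>(I, V)\<in>rdom E (H, U). V = U"
  using spectrum unfolding spectrum_def by (elim conjE)
 from bspec[OF this x] show "V = U" using y by auto
 have Ir: "I \<in> rdom (flat E) H" using y UE by (force simp: flat_def)
 then show "I \<in> rdom M H" using cover HE unfolding mackey_cover_def subsystem_def by blast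
 show "I \<subseteq> H" using E_sub(1)[OF x] y by blast
 have "\<forall>H\<in>base (flat E). \<forall>I\<in>rdom (flat E) H. fin_index G H I"
  using spectrum unfolding spectrum_def by (elim conjE)
 then show "fin_index G H I" using HE Ir by blast
qed

lemma E_idom:
 assumes x: "(H, U) \<in> base E" and y: "(I, V) \<in> idom E (H, U)"
 shows "I \<in> idom M H" "V \<in> idom M U" "I \<subseteq> H" "V \<subseteq> U"
proof -
 have HE: "H \<in> base (flat E)" and UE: "U \<in> Ext E H" using x by (force simp: flat_def Ext_def)+
 have "I \<in> idom (flat E) H" using y UE by (force simp: flat_def)
 then show "I \<in> idom M H" using cover HE unfolding mackey_cover_def subsystem_def by blast
 have "\<forall>x\<in>base E. case x of (H, U) \<Rightarrow> \<forall>(I, V)\<in>idom E (H, U). V \<in> idom M U"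
  using cover unfolding mackey_cover_def by (elim conjE)
 from bspec[OF this x] show "V \<in> idom M U" using y by auto
 show "I \<subseteq> H" "V \<subseteq> U" using E_sub[OF x] y by blast+
qed

abbreviation h0 where "h0 \<equiv> H0_fun G C"
abbreviation h0c where "h0c \<equiv> H0_class C"
abbreviation UP where "UP \<equiv> Upsilon P G T \<Omega> \<omega> d C v"
abbreviation pc where "pc \<equiv> pi_class G T"

lemma H0_obj: "obj h0 (H, U) = obj C H Mod norm_group C H U"
 "obj_top h0 (H, U) = discrete_topology (carrier (obj C H Mod norm_group C H U))" by (simp_all add: H0_fun_def)

lemma H0_carrier: "carrier (obj h0 (H, U)) = h0c (H, U) ` CC H" by (simp add: H0_obj carrier_FactGroup H0_class_def)

lemma H0_induced:
 assumes x: "(H, U) \<in> base E" and y: "(I, V) \<in> base E"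
  and f: "f \<in> hom (obj C H) (obj C I)" and N: "\<And>a. a \<in> norm_group C H U \<Longrightarrow> f a \<in> norm_group C I V"
 shows "a \<in> CC H \<Longrightarrow> induced_map (CC H) (h0c (H, U)) (\<lambda>a. h0c (I, V) (f a)) (h0c (H, U) a) = h0c (I, V) (f a)"
  and "induced_map (CC H) (h0c (H, U)) (\<lambda>a. h0c (I, V) (f a)) \<in> hom (obj h0 (H, U)) (obj h0 (I, V))"
proof -
 interpret A: fn_layer P G T \<Omega> TO \<omega> d E M C v H U by (rule fn_layerI[OF x])
 interpret B: fn_layer P G T \<Omega> TO \<omega> d E M C v I V by (rule fn_layerI[OF y])
 let ?F = "induced_map (CC H) (h0c (H, U)) (\<lambda>a. h0c (I, V) (f a))"
 have fc: "f a \<in> CC I" if "a \<in> CC H" for a using hom_in_carrier[OF f that] .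
 have ev: "?F (h0c (H, U) a) = h0c (I, V) (f a)" if a: "a \<in> CC H" for a
 proof (rule induced_map_eq[OF a])
  fix b assume b: "b \<in> CC H" "h0c (H, U) b = h0c (H, U) a"
  then have "b \<div>\<^bsub>obj C H\<^esub> a \<in> norm_group C H U" using A.cls_eq_iff[OF b(1) a] A.cls_H0 by simp
  then have "f (b \<div>\<^bsub>obj C H\<^esub> a) \<in> norm_group C I V" by (rule N)
  also have "f (b \<div>\<^bsub>obj C H\<^esub> a) = f b \<div>\<^bsub>obj C I\<^esub> f a"
   using hom_mult[OF f b(1) group.inv_closed[OF C_group[OF A.H_base] a]]
    group_hom_inv[OF C_group[OF A.H_base] C_group[OF B.H_base] f a] by simp
  finally show "h0c (I, V) (f b) = h0c (I, V) (f a)" using B.cls_eq_iff[OF fc[OF b(1)] fc[OF a]] B.cls_H0 by simp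
 qed
 then show "a \<in> CC H \<Longrightarrow> ?F (h0c (H, U) a) = h0c (I, V) (f a)" .
 show "?F \<in> hom (obj h0 (H, U)) (obj h0 (I, V))"
 proof (rule homI)
  fix X assume "X \<in> carrier (obj h0 (H, U))"
  then obtain a where a: "a \<in> CC H" "X = h0c (H, U) a" unfolding H0_carrier by blast
  then show "?F X \<in> carrier (obj h0 (I, V))" unfolding H0_carrier a(2) ev[OF a(1)] using fc by blast
 next
  fix X Y assume "X \<in> carrier (obj h0 (H, U))" "Y \<in> carrier (obj h0 (H, U))"
  then obtain a b where a: "a \<in> CC H" "X = h0c (H, U) a" and b: "b \<in> CC H" "Y = h0c (H, U) b"
   unfolding H0_carrier by blast
  have ab: "a \<otimes>\<^bsub>obj C H\<^esub> b \<in> CC H" by (rule monoid.m_closed[OF group.is_monoid[OF C_group[OF A.H_base]] a(1) b(1)])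
  have "X \<otimes>\<^bsub>obj h0 (H, U)\<^esub> Y = h0c (H, U) (a \<otimes>\<^bsub>obj C H\<^esub> b)"
   unfolding H0_obj a(2) b(2) A.cls_H0 by (rule A.cls_mult[OF a(1) b(1), symmetric])
  then have "?F (X \<otimes>\<^bsub>obj h0 (H, U)\<^esub> Y) = h0c (I, V) (f a \<otimes>\<^bsub>obj C I\<^esub> f b)"
   using ev[OF ab] hom_mult[OF f a(1) b(1)] by simp
  also have "\<dots> = h0c (I, V) (f a) \<otimes>\<^bsub>obj h0 (I, V)\<^esub> h0c (I, V) (f b)"
   unfolding H0_obj B.cls_H0 by (rule B.cls_mult[OF fc[OF a(1)] fc[OF b(1)]])
  finally show "?F (X \<otimes>\<^bsub>obj h0 (H, U)\<^esub> Y) = ?F X \<otimes>\<^bsub>obj h0 (I, V)\<^esub> ?F Y"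
   unfolding a(2) b(2) ev[OF a(1)] ev[OF b(1)] .
 qed
qed

lemma norm_con:
 assumes x: "(H, U) \<in> base E" and g: "g \<in> carrier G" and a: "a \<in> norm_group C H U"
 shows "con g H a \<in> norm_group C (conj_set G g H) (conj_set G g U)"
proof -
 interpret A: fn_layer P G T \<Omega> TO \<omega> d E M C v H U by (rule fn_layerI[OF x])
 obtain b where b: "b \<in> CC U" "a = ind H U b" using a by (auto simp: norm_group_def)
 have "con g H a = ind (conj_set G g H) (conj_set G g U) (con g U b)"
  unfolding b(2) by (rule con_ind[OF A.H_base A.U_idom g b(1)])
 then show ?thesis using con_closed[OF A.U_base g b(1)] by (simp add: norm_group_def)
qed

lemma norm_ind:
 assumes x: "(H, U) \<in> base E" and y: "(I, V) \<in> idom E (H, U)" and a: "a \<in> norm_group C I V"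
 shows "ind H I a \<in> norm_group C H U"
proof -
 interpret A: fn_layer P G T \<Omega> TO \<omega> d E M C v H U by (rule fn_layerI[OF x])
 interpret B: fn_layer P G T \<Omega> TO \<omega> d E M C v I V by (rule fn_layerI[OF E_dom(2)[OF x y]])
 note i = E_idom[OF x y]
 obtain b where b: "b \<in> CC V" "a = ind I V b" using a by (auto simp: norm_group_def)
 have "ind H I a = ind H V b" unfolding b(2) by (rule ind_ind[OF A.H_base i(1) B.U_idom b(1)])
 also have "\<dots> = ind H U (ind U V b)" by (rule ind_ind[symmetric, OF A.H_base A.U_idom i(2) b(1)])
 finally show ?thesis using ind_closed[OF A.U_base i(2) b(1)] by (simp add: norm_group_def)
qed

lemma H0_con_map: "con_map h0 g (H, U) = induced_map (CC H) (h0c (H, U)) (\<lambda>a. h0c (conj_set G g H, conj_set G g U) (con g H a))"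
 and H0_ind_map: "ind_map h0 (H, U) (I, V) = induced_map (CC I) (h0c (I, V)) (\<lambda>a. h0c (H, U) (ind H I a))"
 and H0_res_map: "res_map h0 (I, V) (H, U) = induced_map (CC H) (h0c (H, U)) (\<lambda>a. h0c (I, V) (res I H a))"
 by (simp_all add: H0_fun_def conj_pair_def)

lemma conj_layer: "(H, U) \<in> base E \<Longrightarrow> g \<in> carrier G \<Longrightarrow> (conj_set G g H, conj_set G g U) \<in> base E"
 using ric_domainD(9)[OF ric_E, of "(H, U)" g] by (simp add: conj_pair_def)

lemma H0_con:
 assumes x: "(H, U) \<in> base E" and g: "g \<in> carrier G"
 shows "a \<in> CC H \<Longrightarrow> con_map h0 g (H, U) (h0c (H, U) a) = h0c (conj_set G g H, conj_set G g U) (con g H a)"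
  and "con_map h0 g (H, U) \<in> hom (obj h0 (H, U)) (obj h0 (conj_set G g H, conj_set G g U))"
proof -
 have HM: "H \<in> base M" using x flat_base[of H] by (force simp: flat_def)
 note l = H0_induced[OF x conj_layer[OF x g] con_hom[OF HM g] norm_con[OF x g]]
 show "a \<in> CC H \<Longrightarrow> con_map h0 g (H, U) (h0c (H, U) a) = h0c (conj_set G g H, conj_set G g U) (con g H a)"
  unfolding H0_con_map by (rule l(1))
 show "con_map h0 g (H, U) \<in> hom (obj h0 (H, U)) (obj h0 (conj_set G g H, conj_set G g U))"
  unfolding H0_con_map by (rule l(2))
qed

lemma H0_ind:
 assumes x: "(H, U) \<in> base E" and y: "(I, V) \<in> idom E (H, U)"
 shows "a \<in> CC I \<Longrightarrow> ind_map h0 (H, U) (I, V) (h0c (I, V) a) = h0c (H, U) (ind H I a)"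
  and "ind_map h0 (H, U) (I, V) \<in> hom (obj h0 (I, V)) (obj h0 (H, U))"
proof -
 have HM: "H \<in> base M" using x flat_base[of H] by (force simp: flat_def)
 note l = H0_induced[OF E_dom(2)[OF x y] x ind_hom[OF HM E_idom(1)[OF x y]] norm_ind[OF x y]]
 show "a \<in> CC I \<Longrightarrow> ind_map h0 (H, U) (I, V) (h0c (I, V) a) = h0c (H, U) (ind H I a)"
  unfolding H0_ind_map by (rule l(1))
 show "ind_map h0 (H, U) (I, V) \<in> hom (obj h0 (I, V)) (obj h0 (H, U))" unfolding H0_ind_map by (rule l(2))
qed

text \<open>Conjugation by g carries the lift, its group \<Sigma> and the prime element for (H, U)
  to such data for the conjugate layer.\<close>

lemma Upsilon_con:
 assumes x: "(H, U) \<in> base E" and g: "g \<in> carrier G" and h: "h \<in> H"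
 shows "UP (conj_set G g H, conj_set G g U) (pc (conj_set G g H, conj_set G g U) (g \<otimes> h \<div> g)) =
  con_map h0 g (H, U) (UP (H, U) (pc (H, U) h))"
proof -
 interpret A: fn_layer P G T \<Omega> TO \<omega> d E M C v H U by (rule fn_layerI[OF x])
 interpret B: fn_layer P G T \<Omega> TO \<omega> d E M C v "conj_set G g H" "conj_set G g U"
  by (rule fn_layerI[OF conj_layer[OF x g]])
 have mem: "g \<otimes> k \<div> g \<in> conj_set G g X" if "k \<in> X" for k X
  unfolding G.conj_set_eq using that by (rule imageI)
 have "d ` conj_set G g H = d ` H"
  unfolding G.conj_set_eq image_image by (rule image_cong[OF refl d_conj[OF g A.H.mem_carrier]])
 then have f: "f_of (conj_set G g H) = f_of H" by (simp add: f_abs_def f_rel_def)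
 obtain k n where k: "A.frob_lift k n" "k \<div> h \<in> U" using A.lift_exists[OF h] by blast
 have kc: "k \<in> carrier G" and hc: "h \<in> carrier G" and kH: "k \<in> H" using k h by auto
 let ?k = "g \<otimes> k \<div> g"
 have k': "B.frob_lift ?k n" using k mem[OF kH] f d_conj[OF g kc] by simp
 have "?k \<div> (g \<otimes> h \<div> g) = g \<otimes> (k \<div> h) \<div> g"
 proof -
  have "inv (g \<otimes> h \<div> g) = g \<div> h \<div> g" using g hc by (simp add: G.inv_mult_group G.m_assoc)
  then have "?k \<div> (g \<otimes> h \<div> g) = g \<otimes> k \<otimes> (inv g \<otimes> g) \<div> h \<div> g"
   using g hc kc by (simp only: G.m_assoc G.m_closed G.inv_closed)
  then show ?thesis using g hc kc by (simp add: G.m_assoc)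
 qed
 then have kU: "?k \<div> (g \<otimes> h \<div> g) \<in> conj_set G g U" using mem[OF k(2)] by simp
 obtain \<pi> where p: "A.is_prime (A.Sg k) \<pi>" using A.prime_Sg[OF k(1)] by blast
 then have \<pi>: "\<pi> \<in> CC (A.Sg k)" by (simp add: A.is_prime_def)
 note oS = A.Sg_open'[OF k(1)]
 have SM: "A.Sg k \<in> base M" by (rule A.open_base'[OF oS])
 have iS: "A.Sg k \<in> idom M H" by (rule open_idom[OF A.H_base oS])
 have Sg: "B.Sg ?k = conj_set G g (A.Sg k)" by (rule Sigma_conj[OF g kc A.U.subset])
 have p': "B.is_prime (B.Sg ?k) (con g (A.Sg k) \<pi>)"
  unfolding B.is_prime_def Sg using con_closed[OF SM g \<pi>] v_con[OF SM g \<pi>] p by (simp add: A.is_prime_def)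
 have ic: "ind H (A.Sg k) \<pi> \<in> CC H" by (rule ind_closed[OF A.H_base iS \<pi>])
 have "B.xval ?k n (con g (A.Sg k) \<pi>) = con g H (ind H (A.Sg k) \<pi>) [^]\<^bsub>obj C (conj_set G g H)\<^esub> P'_part P n"
  unfolding Sg con_ind[OF A.H_base iS g \<pi>] ..
 also have "\<dots> = con g H (A.xval k n \<pi>)"
  by (rule group_hom_pow[symmetric, OF C_group[OF A.H_base] C_group[OF B.H_base] con_hom[OF A.H_base g] ic])
 finally have xv: "B.xval ?k n (con g (A.Sg k) \<pi>) = con g H (A.xval k n \<pi>)" .
 have "UP (conj_set G g H, conj_set G g U) (pc (conj_set G g H, conj_set G g U) (g \<otimes> h \<div> g)) = B.cls (con g H (A.xval k n \<pi>))"
  using B.Upsilon_pi_class[OF mem[OF h]] B.recX_eq[OF mem[OF h] k' kU] B.rec0_eq[OF k' p'] xv by simp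
 also have "\<dots> = con_map h0 g (H, U) (A.cls (A.xval k n \<pi>))"
  using H0_con(1)[OF x g A.xval_prime_closed[OF k(1) p]] by (simp add: A.cls_H0 B.cls_H0)
 also have "A.cls (A.xval k n \<pi>) = UP (H, U) (pc (H, U) h)"
  using A.Upsilon_pi_class[OF h] A.recX_eq[OF h k] A.rec0_eq[OF k(1) p] by simp
 finally show ?thesis .
qed

lemma f_of_mult:
 assumes "inert_finite H" "inert_finite I" "I \<subseteq> H"
 obtains b where "f_of I = f_of H * b" "Pnum b"
proof -
 have "\<omega> \<up> f_of I \<in> d ` I"
  using d_inert_finite[OF assms(2)] pow_in_Om[OF omega_carrier dvd_refl] by simp
 then have "\<omega> \<up> f_of I \<in> Om (f_of H)" using d_inert_finite[OF assms(1)] assms(3) by blast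
 then have "f_of H dvd f_of I" by (rule omega_in_Om[OF Pnum_f[OF assms(1)]])
 then obtain b where b: "f_of I = f_of H * b" by blast
 then have "Pnum b" using Pnum_dvd[OF Pnum_f[OF assms(2)], of b] by simp
 then show thesis using that b by blast
qed

text \<open>One lift k serves both layers. Its two groups \<Sigma> have the same degrees, so
  induction from the smaller to the larger sends primes to primes; the degree of k changes by the
  P-number f_I/f_H, which P' ignores.\<close>

lemma Upsilon_ind:
 assumes x: "(H, U) \<in> base E" and y: "(I, V) \<in> idom E (H, U)" and h: "h \<in> I"
 shows "UP (H, U) (pc (H, U) h) = ind_map h0 (H, U) (I, V) (UP (I, V) (pc (I, V) h))"
proof -
 interpret A: fn_layer P G T \<Omega> TO \<omega> d E M C v H U by (rule fn_layerI[OF x])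
 interpret B: fn_layer P G T \<Omega> TO \<omega> d E M C v I V by (rule fn_layerI[OF E_dom(2)[OF x y]])
 note i = E_idom[OF x y]
 have hH: "h \<in> H" using h i(3) by blast
 obtain b where b: "f_of I = f_of H * b" "Pnum b" by (rule f_of_mult[OF A.H_inert B.H_inert i(3)])
 obtain k m where k: "B.frob_lift k m" "k \<div> h \<in> V" using B.lift_exists[OF h] by blast
 have kI: "k \<in> I" and kH: "k \<in> H" and kU: "k \<div> h \<in> U" using k i by auto
 have k': "A.frob_lift k (b * m)" using k(1) kH b Pnum_pos[OF b(2)] by (simp add: mult.assoc)
 obtain \<pi> where p: "B.is_prime (B.Sg k) \<pi>" using B.prime_Sg[OF k(1)] by blast
 then have \<pi>: "\<pi> \<in> CC (B.Sg k)" by (simp add: B.is_prime_def)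
 note oA = A.Sg_open'[OF k'] and oB = B.Sg_open'[OF k(1)]
 have AM: "A.Sg k \<in> base M" by (rule A.open_base'[OF oA])
 have rA: "A.Sg k \<in> rdom M H" and iA: "A.Sg k \<in> idom M H"
  using open_rdom[OF A.H_base oA] open_idom[OF A.H_base oA] by auto
 have iB: "B.Sg k \<in> idom M I" by (rule open_idom[OF B.H_base oB])
 \<comment> \<open>\<open>B.Sg k\<close> need not be open in \<open>A.Sg k\<close>, as I may have
   infinite index in H. The Mackey axiom supplies the intermediate group
   \<open>A.Sg k \<inter> I\<close>, in which \<open>B.Sg k\<close> is open.\<close>
 have int: "A.Sg k \<inter> I \<in> idom M (A.Sg k)"
  using mackey_M A.H_base rA i(1) unfolding mackey_system_def by blast
 have sub: "B.Sg k \<subseteq> A.Sg k"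
 proof
  fix z assume "z \<in> B.Sg k"
  then obtain s t where st: "s \<in> cyc k" "t \<in> I_of V" "z = s \<otimes> t" using B.mem_Sg by blast
  then have "t \<in> I_of U" using i(4) by (auto simp: mem_I_of)
  then show "z \<in> A.Sg k" using st A.mem_Sg by blast
 qed
 have "open_subgroup_of G T (B.Sg k) (A.Sg k \<inter> I)"
  by (rule open_subgroup_of_restrict[OF oB]) (use sub B.Sg_sub_H[OF kI] in auto)
 then have "B.Sg k \<in> idom M (A.Sg k \<inter> I)" using open_idom[OF dom_base(2)[OF AM int]] by blast
 moreover have "\<forall>y\<in>idom M (A.Sg k). idom M y \<subseteq> idom M (A.Sg k)"
  using ric_M AM unfolding ric_domain_def by blast
 ultimately have iBA: "B.Sg k \<in> idom M (A.Sg k)" using int by blast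
 define \<pi>' where "\<pi>' = ind (A.Sg k) (B.Sg k) \<pi>"
 have "d ` A.Sg k = d ` B.Sg k"
  using A.d_Sg[OF kH, of "f_of H * (b * m)"] B.d_Sg[OF kI, of "f_of I * m"] k k' b(1) by (simp add: mult.assoc)
 then have "f_rel \<Omega> d (A.Sg k) (B.Sg k) = 1"
  using Og.index_self[OF d.subgroup_img_is_subgroup[OF base_subgroup[OF AM]]] by (simp add: f_rel_def)
 then have "v (A.Sg k) \<pi>' = \<omega>" unfolding \<pi>'_def using v_ind[OF AM iBA \<pi>] p by (simp add: B.is_prime_def)
 moreover have \<pi>'c: "\<pi>' \<in> CC (A.Sg k)" unfolding \<pi>'_def by (rule ind_closed[OF AM iBA \<pi>])
 ultimately have p': "A.is_prime (A.Sg k) \<pi>'" by (simp add: A.is_prime_def)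
 have ic: "ind I (B.Sg k) \<pi> \<in> CC I" by (rule ind_closed[OF B.H_base iB \<pi>])
 have "A.xval k (b * m) \<pi>' = ind H (B.Sg k) \<pi> [^]\<^bsub>obj C H\<^esub> P'_part P m"
  unfolding \<pi>'_def ind_ind[OF A.H_base iA iBA \<pi>] using P'_part_mult[OF b(2), of m] k(1) by simp
 also have "ind H (B.Sg k) \<pi> = ind H I (ind I (B.Sg k) \<pi>)" by (rule ind_ind[symmetric, OF A.H_base i(1) iB \<pi>])
 also have "\<dots> [^]\<^bsub>obj C H\<^esub> P'_part P m = ind H I (B.xval k m \<pi>)"
  by (rule group_hom_pow[symmetric, OF C_group[OF B.H_base] C_group[OF A.H_base] ind_hom[OF A.H_base i(1)] ic])
 finally have xv: "A.xval k (b * m) \<pi>' = ind H I (B.xval k m \<pi>)" .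
 have "UP (H, U) (pc (H, U) h) = A.cls (ind H I (B.xval k m \<pi>))"
  using A.Upsilon_pi_class[OF hH] A.recX_eq[OF hH k' kU] A.rec0_eq[OF k' p'] xv by simp
 also have "\<dots> = ind_map h0 (H, U) (I, V) (B.cls (B.xval k m \<pi>))"
  using H0_ind(1)[OF x y B.xval_prime_closed[OF k(1) p]] by (simp add: A.cls_H0 B.cls_H0)
 also have "B.cls (B.xval k m \<pi>) = UP (I, V) (pc (I, V) h)"
  using B.Upsilon_pi_class[OF h] B.recX_eq[OF h k] B.rec0_eq[OF k(1) p] by simp
 finally show ?thesis .
qed

end

section \<open>Finite groups\<close>

lemma card_image_same_kernel:
 assumes "\<And>x y. x \<in> A \<Longrightarrow> y \<in> A \<Longrightarrow> f x = f y \<longleftrightarrow> g x = g y"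
 shows "card (f ` A) = card (g ` A)"
proof (rule bij_betw_same_card)
 show "bij_betw (\<lambda>z. g (inv_into A f z)) (f ` A) (g ` A)" unfolding bij_betw_def
 proof
  show "inj_on (\<lambda>z. g (inv_into A f z)) (f ` A)"
  proof (rule inj_onI)
   fix z w assume z: "z \<in> f ` A" "w \<in> f ` A" "g (inv_into A f z) = g (inv_into A f w)"
   then have "f (inv_into A f z) = f (inv_into A f w)"
    using assms[OF inv_into_into[OF z(1)] inv_into_into[OF z(2)]] by simp
   then show "z = w" using f_inv_into_f[OF z(1)] f_inv_into_f[OF z(2)] by simp
  qed
  have "g (inv_into A f (f x)) = g x" if "x \<in> A" for x
   using assms[OF inv_into_into[OF imageI[OF that]] that, of f] f_inv_into_f[OF imageI[OF that], of f] by simp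
  then show "(\<lambda>z. g (inv_into A f z)) ` f ` A = g ` A" by (simp add: image_image)
 qed
qed

context plain_group begin

lemma prime_order_cyclic:
 assumes "finite (carrier G)" "prime (order G)"
 shows "cyclic_group G"
proof -
 have "carrier G \<noteq> {\<one>}" using assms(2) prime_gt_1_nat[OF assms(2)] by (auto simp: order_def)
 then obtain x where x: "x \<in> carrier G" "x \<noteq> \<one>" using one_closed by blast
 have sub: "subgroup (generate G {x}) G" by (rule generate_is_subgroup) (use x in simp)
 have "card (rcosets (generate G {x})) * card (generate G {x}) = order G" by (rule lagrange[OF sub])
 then have "card (generate G {x}) dvd order G" by (metis dvd_triv_right)
 then have "card (generate G {x}) = 1 \<or> card (generate G {x}) = order G" using assms(2) by (metis prime_nat_iff)
 moreover have "card (generate G {x}) \<noteq> 1"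
 proof
  assume "card (generate G {x}) = 1"
  moreover have "x \<in> generate G {x}" by (rule generate.incl) simp
  moreover have "\<one> \<in> generate G {x}" by (rule generate.one)
  ultimately show False using x(2) by (metis card_1_singletonE singletonD)
 qed
 ultimately have "generate G {x} = carrier G"
  using card_subset_eq[OF assms(1) subgroup.subset[OF sub]] by (simp add: order_def)
 moreover have "generate G {x} = range (\<lambda>n::int. x [^] n)" using generate_pow[OF x(1)] by auto
 ultimately have "carrier G = range (\<lambda>n::int. x [^] n)" by simp
 then show ?thesis unfolding cyclic_group using x(1) by (rule bexI)
qed

text \<open>A subgroup \<open>I\<close> of index \<open>p\<close> acts on its \<open>p\<close> right cosets and fixes one of them; the other
 orbits have \<open>p\<close>-power length less than \<open>p\<close>.\<close>

lemma index_prime_normal: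
 assumes fin: "finite (carrier G)" and p: "prime p" and ord: "order G = p ^ k"
  and I: "subgroup I G" "card I * p = order G"
 shows "I \<lhd> G"
proof -
 interpret I: subgroup I G by fact
 have finI: "finite I" using fin I.subset finite_subset by blast
 have cI: "card I > 0" using finI I.one_closed card_gt_0_iff by blast
 have "card (rcosets I) * card I = card I * p" using lagrange[OF I(1)] I(2) by simp
 then have cX: "card (rcosets I) = p" using cI by simp
 have finX: "finite (rcosets I)" using rcosets_finite fin by (simp add: RCOSETS_def)
 have "g \<otimes> i \<div> g \<in> I" if g: "g \<in> carrier G" and i: "i \<in> I" for g i
 proof (cases "g \<in> I")
  case False
  \<comment> \<open>K is the stabilizer in I of the coset I g, so [I:K] is the length of its orbit:
    a power of p, and at most p - 1 because the orbit misses the coset I.\<close>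
  define K where "K = I \<inter> conj_set G (inv g) I"
  have subc: "subgroup (conj_set G (inv g) I) G" by (rule conj_set_subgroup[OF inv_closed[OF g] I(1)])
  have K: "subgroup K G" unfolding K_def by (rule subgroups_Inter_pair[OF I(1) subc])
  have memK: "x \<in> K \<longleftrightarrow> x \<in> I \<and> g \<otimes> x \<div> g \<in> I" for x
   unfolding K_def using mem_conj_set[OF inv_closed[OF g] I.subset, of x] g I.mem_carrier by auto
  let ?f = "\<lambda>i. I #> (g \<otimes> i)"
  have ker: "?f x = ?f y \<longleftrightarrow> K #> x = K #> y" if xy: "x \<in> I" "y \<in> I" for x y
  proof -
   have c: "x \<in> carrier G" "y \<in> carrier G" using xy by auto
   have "?f x = ?f y \<longleftrightarrow> (g \<otimes> x) \<div> (g \<otimes> y) \<in> I"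
    by (rule rcoset_eq_iff[OF I(1)]) (use g c in auto)
   also have "(g \<otimes> x) \<div> (g \<otimes> y) = g \<otimes> (x \<div> y) \<div> g"
    using g c by (simp add: inv_mult_group m_assoc)
   also have "\<dots> \<in> I \<longleftrightarrow> x \<div> y \<in> K" using memK xy by simp
   also have "\<dots> \<longleftrightarrow> K #> x = K #> y" using rcoset_eq_iff[OF K c] by simp
   finally show ?thesis .
  qed
  let ?n = "card (rcosets\<^bsub>G\<lparr>carrier := I\<rparr>\<^esub> K)"
  have n: "card (?f ` I) = ?n" unfolding rcosets_restrict by (rule card_image_same_kernel[OF ker])
  interpret GI: group "G\<lparr>carrier := I\<rparr>" by (rule subgroup_imp_group[OF I(1)])
  have "subgroup K (G\<lparr>carrier := I\<rparr>)" by (rule subgroup_incl[OF K I(1)]) (simp add: K_def)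
  then have "?n * card K = card I" using GI.lagrange by (simp add: order_def)
  then have "?n dvd card I" by (metis dvd_triv_left)
  then have "?n dvd p ^ k" using I(2) ord by (metis dvd_mult2)
  then obtain j where j: "?n = p ^ j" using p divides_primepow_nat by blast
  have "?f ` I \<subseteq> rcosets I - {I}"
  proof (rule image_subsetI)
   fix x assume x: "x \<in> I"
   have gx: "g \<otimes> x \<in> carrier G" using g x by simp
   have "I #> (g \<otimes> x) \<noteq> I"
   proof
    assume "I #> (g \<otimes> x) = I"
    then have "g \<otimes> x \<in> I" using coset_join1[OF _ gx I(1)] by blast
    then have "g \<otimes> x \<div> x \<in> I" using x by simp
    then show False using False g x by (simp add: m_assoc)
   qed
   then show "I #> (g \<otimes> x) \<in> rcosets I - {I}" using gx by (auto simp: RCOSETS_def)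
  qed
  then have "?n \<le> card (rcosets I - {I})" unfolding n[symmetric] using finX by (intro card_mono) auto
  moreover have "I \<in> rcosets I" by (rule I.subgroup_in_rcosets[OF is_group])
  then have "card (rcosets I - {I}) = p - 1" using cX finX by simp
  ultimately have "p ^ j < p ^ 1" using j prime_gt_0_nat[OF p] by simp
  then have "j = 0" using prime_gt_1_nat[OF p] power_strict_increasing_iff[of p j 1] by simp
  then have "?n = 1" using j by simp
  then obtain c where c: "rcosets\<^bsub>G\<lparr>carrier := I\<rparr>\<^esub> K = {c}" by (metis card_1_singletonE)
  have "K #> i = K #> \<one>" using c i I.one_closed unfolding rcosets_restrict by (metis imageI singletonD)
  then have "i \<in> K" using rcoset_eq_iff[OF K, of i \<one>] i by simp
  then show ?thesis using memK by simp
 qed (use i in auto)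
 then show ?thesis using I(1) by (simp add: normal_inv_iff)
qed

end

section \<open>Bijectivity of the Fesenko--Neukirch morphism\<close>

context fn_layer begin

section \<open>Intermediate groups of a layer and their indices\<close>

lemma QG_plain: "plain_group QG" by (rule plain_group.intro[OF QG_group])

lemma finite_QG: "finite (carrier QG)" and order_QG: "order QG = idx"
 using fin by (simp_all add: FactGroup_def fin_index_def grp_index_def order_def)

lemma coset_U_iff: "h \<in> H \<Longrightarrow> k \<in> H \<Longrightarrow> U #> h = U #> k \<longleftrightarrow> h \<div> k \<in> U"
 by (rule G.rcoset_eq_iff[OF U.subgroup_axioms]) auto

lemma intermediate_open:
 assumes "subgroup I G" "U \<subseteq> I" "I \<subseteq> H" shows "open_subgroup_of G T I H"
 unfolding open_subgroup_of_def
proof (intro conjI assms)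
 show "openin (subtopology T H) I"
  by (rule openin_subgroup_mono[OF _ U.subgroup_axioms assms H_sub]) (use U_open in \<open>simp add: open_subgroup_of_def\<close>)
qed

lemma coherent_H: "(\<forall>U\<in>Ext E H. \<forall>U1. closed_normal_in G T U1 H \<and> U \<subseteq> U1 \<longrightarrow>
      U1 \<in> Ext E H \<and> U \<in> Ext E U1 \<and> (U1, U) \<in> idom E (H, U) \<and> (H, U) \<in> idom E (H, U1))"
  "(\<forall>U\<in>Ext E H. \<forall>I. open_subgroup_of G T I H \<and> U \<subseteq> I \<longrightarrow> (I, U) \<in> idom E (H, U))"
proof -
 note c = bspec[OF conjunct2[OF coherent[unfolded coherent_def]] H_flat]
 show "(\<forall>U\<in>Ext E H. \<forall>U1. closed_normal_in G T U1 H \<and> U \<subseteq> U1 \<longrightarrow>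
      U1 \<in> Ext E H \<and> U \<in> Ext E U1 \<and> (U1, U) \<in> idom E (H, U) \<and> (H, U) \<in> idom E (H, U1))"
  by (rule conjunct1[OF conjunct2[OF c]])
 show "(\<forall>U\<in>Ext E H. \<forall>I. open_subgroup_of G T I H \<and> U \<subseteq> I \<longrightarrow> (I, U) \<in> idom E (H, U))"
  by (rule conjunct2[OF conjunct2[OF c]])
qed

lemma intermediate_idom:
 assumes "subgroup I G" "U \<subseteq> I" "I \<subseteq> H" shows "(I, U) \<in> idom E (H, U)" "(I, U) \<in> base E"
proof -
 show "(I, U) \<in> idom E (H, U)" using bspec[OF coherent_H(2) U_Ext] intermediate_open[OF assms] assms(2) by blast
 then show "(I, U) \<in> base E" by (rule E_dom(2)[OF HU])
qed

text \<open>Coherence provides the quotient layer (H, I) together with the projection from (H, U),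
  which is an induction map along the identity of H.\<close>

lemma intermediate_normal:
 assumes I: "subgroup I G" "U \<subseteq> I" "I \<subseteq> H" and n: "\<And>h i. h \<in> H \<Longrightarrow> i \<in> I \<Longrightarrow> h \<otimes> i \<div> h \<in> I"
 shows "(H, I) \<in> base E" "(H, U) \<in> idom E (H, I)"
proof -
 have "closedin T I" using inert_finite_closed[OF base_inert[OF open_base'[OF intermediate_open[OF I]]]] .
 then have "closedin (subtopology T H) I" using I(3) closedin_subtopology by (metis inf.absorb1)
 moreover have "I \<lhd> G\<lparr>carrier := H\<rparr>" by (rule G.normal_in_subgroupI[OF H_sub I(1,3) n])
 ultimately have "closed_normal_in G T I H" by (simp add: closed_normal_in_def)
 then show "(H, I) \<in> base E" "(H, U) \<in> idom E (H, I)"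
  using bspec[OF coherent_H(1) U_Ext] I(2) by (auto simp: Ext_def)
qed

lemma
 assumes I: "subgroup I G" "U \<subseteq> I" "I \<subseteq> H"
 shows index_image: "grp_index G I U = card ((\<lambda>h. U #> h) ` I)"
  and index_mult: "grp_index G H I * grp_index G I U = idx"
  and index_sub_one: "grp_index G I U = 1 \<Longrightarrow> I = U"
  and index_one: "grp_index G H I = 1 \<Longrightarrow> I = H"
proof -
 interpret I: subgroup I G by (rule I(1))
 let ?S = "(\<lambda>h. U #> h) ` I"
 interpret Q: plain_group QG by (rule QG_plain)
 have "subgroup I (G\<lparr>carrier := H\<rparr>)" by (rule G.subgroup_incl[OF I(1) H_sub I(3)])
 then have S: "subgroup ?S QG" by (rule group_hom.subgroup_img_is_subgroup[rotated])
   (use QG_hom QG_group H_group in \<open>simp add: group_hom_def group_hom_axioms_def\<close>)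
 show ind: "grp_index G I U = card ?S" by (simp add: grp_index_def rcosets_restrict)
 have memS: "U #> h \<in> ?S \<longleftrightarrow> h \<in> I" if h: "h \<in> H" for h
 proof
  assume "U #> h \<in> ?S"
  then obtain i where i: "i \<in> I" "U #> h = U #> i" by blast
  then have "h \<div> i \<in> I" using coset_U_iff[OF h, of i] I by auto
  then have "h \<div> i \<otimes> i \<in> I" using i by simp
  then show "h \<in> I" using h i by (simp add: G.m_assoc)
 qed auto
 have "card (rcosets\<^bsub>QG\<^esub> ?S) = grp_index G H I"
 proof -
  have r: "rcosets\<^bsub>QG\<^esub> ?S = (\<lambda>h. ?S #>\<^bsub>QG\<^esub> (U #> h)) ` H"
   by (auto simp: RCOSETS_def QG_carrier)
  have "?S #>\<^bsub>QG\<^esub> (U #> h) = ?S #>\<^bsub>QG\<^esub> (U #> k) \<longleftrightarrow> I #> h = I #> k" if hk: "h \<in> H" "k \<in> H" for h k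
  proof -
   have "?S #>\<^bsub>QG\<^esub> (U #> h) = ?S #>\<^bsub>QG\<^esub> (U #> k) \<longleftrightarrow> (U #> h) \<div>\<^bsub>QG\<^esub> (U #> k) \<in> ?S"
    by (rule Q.rcoset_eq_iff[OF S]) (use hk QG_carrier in auto)
   also have "(U #> h) \<div>\<^bsub>QG\<^esub> (U #> k) = U #> (h \<div> k)"
    using QG_mult[OF hk(1) H.m_inv_closed[OF hk(2)]] QG_inv[OF hk(2)] by simp
   also have "\<dots> \<in> ?S \<longleftrightarrow> h \<div> k \<in> I" using memS hk by simp
   also have "\<dots> \<longleftrightarrow> I #> h = I #> k" using G.rcoset_eq_iff[OF I(1), of h k] hk by simp
   finally show ?thesis .
  qed
  then show ?thesis unfolding grp_index_def rcosets_restrict r by (rule card_image_same_kernel)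
 qed
 then show m: "grp_index G H I * grp_index G I U = idx" using Q.lagrange[OF S] order_QG ind by simp
 show "I = U" if one: "grp_index G I U = 1"
 proof -
  obtain c where c: "?S = {c}" using card_1_singletonE[OF trans[OF ind[symmetric] one]] by blast
  have "i \<in> U" if i: "i \<in> I" for i
  proof -
   have "U #> i \<in> ?S" "U #> \<one> \<in> ?S" by (rule imageI[OF i], rule imageI[OF I.one_closed])
   then have "U #> i = U #> \<one>" using c by simp
   then show ?thesis using coset_U_iff[of i \<one>] i I(3) by auto
  qed
  then show ?thesis using I(2) by blast
 qed
 show "I = H" if one: "grp_index G H I = 1"
 proof -
  obtain c where c: "(\<lambda>h. I #> h) ` H = {c}" using card_1_singletonE[OF one[unfolded grp_index_def rcosets_restrict]] by blast
  have "h \<in> I" if h: "h \<in> H" for h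
  proof -
   have "I #> h \<in> (\<lambda>h. I #> h) ` H" "I #> \<one> \<in> (\<lambda>h. I #> h) ` H"
    by (rule imageI[OF h], rule imageI[OF H.one_closed])
   then have "I #> h = I #> \<one>" using c by simp
   then show ?thesis using G.rcoset_eq_iff[OF I(1), of h \<one>] h by simp
  qed
  then show ?thesis using I(3) by blast
 qed
qed

lemma index_less:
 assumes I: "subgroup I G" "U \<subseteq> I" "I \<subseteq> H"
 shows "I \<noteq> H \<Longrightarrow> grp_index G I U < idx" and "I \<noteq> U \<Longrightarrow> grp_index G H I < idx"
proof -
 have pos: "0 < grp_index G H I" "0 < grp_index G I U"
  using index_mult[OF I] idx_pos by (metis mult_0 mult_0_right not_gr_zero)+
 show "grp_index G I U < idx" if "I \<noteq> H"
 proof -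
  have "1 < grp_index G H I" using index_one[OF I] that pos by linarith
  then show ?thesis using index_mult[OF I] pos(2) by (metis mult_less_cancel2 nat_mult_1)
 qed
 show "grp_index G H I < idx" if "I \<noteq> U"
 proof -
  have "1 < grp_index G I U" using index_sub_one[OF I] that pos by linarith
  then show ?thesis using index_mult[OF I] pos(1) by (metis mult_less_cancel1 mult.right_neutral)
 qed
qed

lemma preimage_subgroup:
 assumes S: "subgroup S QG"
 defines "I \<equiv> {h \<in> H. U #> h \<in> S}"
 shows "subgroup I G" "U \<subseteq> I" "I \<subseteq> H" "grp_index G I U = card S"
proof -
 show sI: "subgroup I G"
 proof (rule G.subgroupI)
  have "U #> \<one> = \<one>\<^bsub>QG\<^esub>" using G.coset_join2[of \<one> U] U.subgroup_axioms by simp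
  then have "\<one> \<in> I" using subgroup.one_closed[OF S] by (simp add: I_def)
  then show "I \<noteq> {}" by blast
  show "I \<subseteq> carrier G" by (auto simp: I_def)
  show "inv h \<in> I" if "h \<in> I" for h using that QG_inv[of h] subgroup.m_inv_closed[OF S] by (simp add: I_def)
  show "h \<otimes> k \<in> I" if "h \<in> I" "k \<in> I" for h k
   using that QG_mult[of h k] subgroup.m_closed[OF S] by (simp add: I_def)
 qed
 show UI: "U \<subseteq> I"
 proof
  fix u assume u: "u \<in> U"
  have "U #> u = \<one>\<^bsub>QG\<^esub>" using G.coset_join2[of u U] u U.subgroup_axioms by simp
  then show "u \<in> I" using subgroup.one_closed[OF S] U_H[OF u] by (simp add: I_def)
 qed
 show IH: "I \<subseteq> H" by (auto simp: I_def)
 have "(\<lambda>h. U #> h) ` I = S" using subgroup.subset[OF S] unfolding I_def QG_carrier by blast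
 then show "grp_index G I U = card S" using index_image[OF sI UI IH] by simp
qed

text \<open>Stated with commutators in H, so that it passes visibly to the layers (I, U) and (H,
  I).\<close>

definition abelian_layer where "abelian_layer \<longleftrightarrow> (\<forall>h\<in>H. \<forall>k\<in>H. h \<otimes> k \<div> h \<div> k \<in> U)"

lemma abelian_DH: assumes "abelian_layer" shows "DH = U"
proof -
 interpret Q: plain_group QG by (rule QG_plain)
 have "comm_group QG"
 proof (rule Q.group_comm_groupI)
  fix X Y assume "X \<in> carrier QG" "Y \<in> carrier QG"
  then obtain h k where hk: "h \<in> H" "k \<in> H" "X = U #> h" "Y = U #> k" unfolding QG_carrier by blast
  have "h \<otimes> k \<div> (k \<otimes> h) \<in> U"
   using assms hk by (simp add: abelian_layer_def G.inv_mult_group G.m_assoc)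
  then have "U #> (h \<otimes> k) = U #> (k \<otimes> h)" using coset_U_iff[of "h \<otimes> k" "k \<otimes> h"] hk by simp
  then show "X \<otimes>\<^bsub>QG\<^esub> Y = Y \<otimes>\<^bsub>QG\<^esub> X" unfolding hk(3,4) QG_mult[OF hk(1,2)] QG_mult[OF hk(2,1)] .
 qed
 then have "DQ = {\<one>\<^bsub>QG\<^esub>}" by (rule comm_group.derived_eq_singleton) simp
 then have "DH \<subseteq> U"
 proof -
  have "h \<in> U" if "h \<in> H" "U #> h = \<one>\<^bsub>QG\<^esub>" for h
   using that G.coset_join1[OF _ H.mem_carrier[OF that(1)] U.subgroup_axioms] by simp
  then show ?thesis using \<open>DQ = {\<one>\<^bsub>QG\<^esub>}\<close> by (auto simp: DH_def)
 qed
 then show ?thesis using U_DH by blast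
qed

lemma DH_subgroup: "subgroup DH G" "DH \<subseteq> H"
 using preimage_subgroup(1,3)[OF DQ_sub] by (simp_all add: DH_def)

lemma commutator_DH: assumes hk: "h \<in> H" "k \<in> H" shows "h \<otimes> k \<div> h \<div> k \<in> DH"
proof -
 have c: "U #> h \<in> carrier QG" "U #> k \<in> carrier QG" using hk QG_carrier by auto
 have "U #> (h \<otimes> k \<div> h \<div> k) = (U #> h) \<otimes>\<^bsub>QG\<^esub> (U #> k) \<div>\<^bsub>QG\<^esub> (U #> h) \<div>\<^bsub>QG\<^esub> (U #> k)"
  using hk by (simp add: QG_mult QG_inv del: mult_FactGroup)
 moreover have "\<dots> \<in> DQ" unfolding derived_def by (rule generate.incl) (use c in blast)
 ultimately show ?thesis using hk by (simp add: DH_def)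
qed

lemma DH_conj: assumes "h \<in> H" "x \<in> DH" shows "h \<otimes> x \<div> h \<in> DH"
proof -
 have xH: "x \<in> H" using assms DH_subgroup by blast
 have "h \<otimes> x \<div> h \<div> x \<otimes> x \<in> DH"
  by (rule subgroup.m_closed[OF DH_subgroup(1) commutator_DH[OF assms(1) xH] assms(2)])
 then show ?thesis using assms(1) xH by (simp add: G.m_assoc)
qed

lemma pi_class_one_iff: "h \<in> H \<Longrightarrow> pc (H, U) h = pc (H, U) \<one> \<longleftrightarrow> h \<in> DH"
 using pi_class_eq_iff[of h \<one>] by simp

section \<open>Kernel and image of the reciprocity map; the unramified case\<close>

definition rec_inj where "rec_inj \<longleftrightarrow> (\<forall>h\<in>H. recX h = \<one>\<^bsub>QQ\<^esub> \<longrightarrow> h \<in> DH)"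
definition rec_surj where "rec_surj \<longleftrightarrow> recX ` H = carrier QQ"

lemma recX_one: "recX \<one> = \<one>\<^bsub>QQ\<^esub>" by (rule recX_U) simp

lemma recX_eq_iff:
 assumes "rec_inj" "h \<in> H" "k \<in> H" shows "recX h = recX k \<longleftrightarrow> h \<div> k \<in> DH"
proof
 assume eq: "recX h = recX k"
 have "recX (h \<div> k) \<otimes>\<^bsub>QQ\<^esub> recX k = \<one>\<^bsub>QQ\<^esub> \<otimes>\<^bsub>QQ\<^esub> recX k"
  using recX_mult[of "h \<div> k" k] assms(2,3) eq recX_closed[OF assms(3)] monoid.l_one[OF group.is_monoid[OF Q_group]]
  by (simp add: G.m_assoc)
 then have "recX (h \<div> k) = \<one>\<^bsub>QQ\<^esub>"
  using group.right_cancel[OF Q_group recX_closed[OF assms(3)] recX_closed[of "h \<div> k"] monoid.one_closed[OF group.is_monoid[OF Q_group]]]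
   assms(2,3) by simp
 then show "h \<div> k \<in> DH" using assms unfolding rec_inj_def by simp
next
 assume "h \<div> k \<in> DH"
 then show "recX h = recX k" by (rule recX_cong[OF assms(2,3)])
qed

lemma dv_fH: "dv H (f_of H) = H" using d_inert_finite[OF H_inert] by (auto simp: dv_def)

text \<open>Modulo U every h is \<phi>^j with j < b. Its image is the class of X^j with v(X) =
  \<omega>, whereas norms from U have valuation in b\<Omega>; if X^j is a norm, then b divides j and
  j = 0.\<close>

lemma unramified_inj:
 assumes b: "f_of U = f_of H * b" "Pnum b" and eq: "dv H (f_of H * b) = U"
 shows "rec_inj" unfolding rec_inj_def
proof (intro ballI impI)
 fix h assume h: "h \<in> H" "recX h = \<one>\<^bsub>QQ\<^esub>"
 have b0: "0 < b" by (rule Pnum_pos[OF b(2)])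
 obtain \<phi> where \<phi>: "\<phi> \<in> H" "d \<phi> = \<omega> \<up> f_of H"
  using frobenius_exists[OF H_inert fH_pos dvd_refl] by blast
 have "d h \<in> Om (f_of H)" using h(1) d_inert_finite[OF H_inert] by blast
 then obtain w where w: "w \<in> carrier \<Omega>" "d h = w \<up> f_of H" by (auto simp: Om_def)
 obtain j :: nat and z where j: "j < b" "z \<in> carrier \<Omega>" "w = \<omega> \<up> j \<cdot> z \<up> b"
  using omega_split[OF w(1) b0] by metis
 have pj: "\<phi> [^] j \<in> H" by (rule H_pow[OF \<phi>(1)])
 have dpj: "d (\<phi> [^] j) = \<omega> \<up> (f_of H * j)" by (rule pow_d[OF \<phi>])
 have dh: "d h = z \<up> (f_of H * b) \<cdot> \<omega> \<up> (f_of H * j)"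
  unfolding w(2) j(3) using j(2) by (simp add: Og.nat_pow_distrib Og.nat_pow_pow mult.commute Og.m_comm)
 have "d (h \<div> (\<phi> [^] j)) = z \<up> (f_of H * b)" using h(1) pj j(2) by (simp add: dpj dh Og.m_assoc)
 then have "h \<div> (\<phi> [^] j) \<in> dv H (f_of H * b)"
  using h(1) pj pow_in_Om[OF j(2), of "f_of H * b"] by (simp add: dv_def)
 then have hU: "h \<div> (\<phi> [^] j) \<in> U" using eq by simp
 have l: "frob_lift \<phi> 1" using \<phi> by simp
 obtain \<pi> where p: "is_prime (Sg \<phi>) \<pi>" using prime_Sg[OF l] by blast
 define X where "X = xval \<phi> 1 \<pi>"
 have Xc: "X \<in> CC H" unfolding X_def by (rule xval_prime_closed[OF l p])
 have rj: "recX (\<phi> [^] (k::nat)) = cls (X [^]\<^bsub>obj C H\<^esub> k)" for k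
 proof (induction k)
  case 0
  then show ?case using recX_one cls_one_iff[of "\<one>\<^bsub>obj C H\<^esub>"] subgroup.one_closed[OF Nm_sub]
    monoid.one_closed[OF group.is_monoid[OF C_group[OF H_base]]] by simp
 next
  case (Suc k)
  have "recX \<phi> = cls X" using recX_lift[OF l] rec0_eq[OF l p] by (simp add: X_def)
  then show ?case using Suc recX_mult[OF H_pow[OF \<phi>(1)] \<phi>(1), of k]
    cls_mult[OF monoid.nat_pow_closed[OF group.is_monoid[OF C_group[OF H_base]] Xc] Xc, of k] by simp
 qed
 have "recX (\<phi> [^] j) = recX h" using recX_cong[OF h(1) pj] hU U_DH by auto
 then have "X [^]\<^bsub>obj C H\<^esub> j \<in> Nm"
  using rj[of j] h(2) cls_one_iff[OF monoid.nat_pow_closed[OF group.is_monoid[OF C_group[OF H_base]] Xc]] by simp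
 then obtain c where c: "c \<in> CC U" "X [^]\<^bsub>obj C H\<^esub> j = ind H U c" by (auto simp: norm_group_def)
 have fr: "f_rel \<Omega> d H U = b"
  by (rule f_rel_Om[OF d_inert_finite[OF H_inert] _ fH_pos b(2)]) (use d_inert_finite[OF U_inert] b(1) in simp)
 have vX: "v H X = \<omega>"
 proof -
  have \<pi>: "\<pi> \<in> CC (Sg \<phi>)" "v (Sg \<phi>) \<pi> = \<omega>" using p by (auto simp: is_prime_def)
  have iS: "Sg \<phi> \<in> idom M H" by (rule open_idom[OF H_base Sg_open'[OF l]])
  have "d ` Sg \<phi> = d ` H" using d_Sg[OF \<phi>] d_inert_finite[OF H_inert] by simp
  then have "f_rel \<Omega> d H (Sg \<phi>) = 1"
   using Og.index_self[OF d.subgroup_img_is_subgroup[OF H_sub]] by (simp add: f_rel_def)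
  then have "v H (ind H (Sg \<phi>) \<pi>) = \<omega>" using v_ind[OF H_base iS \<pi>(1)] \<pi>(2) by simp
  moreover have "P'_part P 1 = 1" by (simp add: P'_part_def)
  moreover have "ind H (Sg \<phi>) \<pi> \<in> CC H" by (rule ind_closed[OF H_base iS \<pi>(1)])
  ultimately show ?thesis unfolding X_def
   using monoid.nat_pow_Suc[of "obj C H" _ 0] group.is_monoid[OF C_group[OF H_base]]
   by (simp add: monoid.nat_pow_eone)
 qed
 have "\<omega> \<up> j = v H (ind H U c)"
  using group_hom_pow[OF C_group[OF H_base] Og.is_group v_hom[OF H_base] Xc, of j] vX c(2) by simp
 also have "\<dots> = v U c \<up> b" using v_ind[OF H_base U_idom c(1)] fr by simp
 finally have "\<omega> \<up> j \<in> Om b" using v_closed[OF U_base c(1)] by (auto simp: Om_def)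
 then have "b dvd j" by (rule omega_in_Om[OF b(2)])
 then have "j = 0" using j(1) dvd_imp_le[of b j] by linarith
 then have "h \<in> U" using hU h(1) by simp
 then show "h \<in> DH" using U_DH by blast
qed

lemma trivial_layer: assumes eq: "H = U" shows "rec_inj" "rec_surj"
proof -
 show "rec_inj" unfolding rec_inj_def using U_DH eq by auto
 have "X \<in> recX ` H" if X: "X \<in> carrier QQ" for X
 proof -
  obtain a where a: "a \<in> CC H" "X = cls a" using X[unfolded carrier_Q] by blast
  have aU: "a \<in> CC U" by (rule subst[of H U "\<lambda>S. a \<in> CC S", OF eq a(1)])
  have "ind H U a = a" by (rule subst[of H U "\<lambda>S. ind H S a = a", OF eq ind_id[OF H_base a(1)]])
  then have "a \<in> Nm" unfolding norm_group_def using aU by (metis imageI)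
  then have "X = recX \<one>" using cls_one_iff[OF a(1)] a(2) recX_one by simp
  then show ?thesis using H.one_closed by (rule image_eqI)
 qed
 then show "rec_surj" unfolding rec_surj_def using recX_closed by blast
qed

end

context fn_datum begin

text \<open>Phrased through \<open>Upsilon\<close> on classes rather than through
  \<open>recX\<close>, so that layers can be quantified over without entering the locale of
  each.\<close>

definition inj_at where "inj_at x \<longleftrightarrow> (\<forall>h\<in>fst x. UP x (pc x h) = UP x (pc x \<one>) \<longrightarrow> pc x h = pc x \<one>)"
definition surj_at where "surj_at x \<longleftrightarrow> (\<lambda>h. UP x (pc x h)) ` fst x = carrier (obj h0 x)"

lemma rec_ind:
 assumes x: "(H, U) \<in> base E" and y: "(I, V) \<in> idom E (H, U)" and h: "h \<in> I" and a: "a \<in> CC I"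
  and eq: "UP (I, V) (pc (I, V) h) = h0c (I, V) a"
 shows "UP (H, U) (pc (H, U) h) = h0c (H, U) (ind H I a)"
 unfolding Upsilon_ind[OF x y h] eq by (rule H0_ind(1)[OF x y a])

end

context fn_layer begin

lemma inj_at_iff: "inj_at (H, U) \<longleftrightarrow> rec_inj"
proof -
 have "UP (H, U) (pc (H, U) h) = UP (H, U) (pc (H, U) \<one>) \<longleftrightarrow> recX h = \<one>\<^bsub>QQ\<^esub>" if "h \<in> H" for h
  using Upsilon_pi_class[OF that] Upsilon_pi_class[OF H.one_closed] recX_one by simp
 then show ?thesis unfolding inj_at_def rec_inj_def fst_conv by (simp add: pi_class_one_iff)
qed

lemma surj_at_iff: "surj_at (H, U) \<longleftrightarrow> rec_surj"
 unfolding surj_at_def rec_surj_def fst_conv H0_obj by (simp only: image_cong[OF refl Upsilon_pi_class])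

lemma recX_Upsilon: "h \<in> H \<Longrightarrow> a \<in> CC H \<Longrightarrow> recX h = cls a \<longleftrightarrow> UP (H, U) (pc (H, U) h) = h0c (H, U) a"
 using Upsilon_pi_class by (simp add: cls_H0)

lemmas recX_Upsilon_D = recX_Upsilon[THEN iffD1] and recX_Upsilon_I = recX_Upsilon[THEN iffD2]

lemma recX_obtain: assumes "h \<in> H" obtains a where "a \<in> CC H" "recX h = cls a"
 using recX_closed[OF assms] that unfolding carrier_Q by blast

lemma surj_obtain:
 assumes "surj_at (H, U)" "a \<in> CC H" obtains h where "h \<in> H" "recX h = cls a"
proof -
 have "cls a \<in> recX ` H" using assms cls_closed unfolding surj_at_iff rec_surj_def by simp
 then show thesis using that by (metis imageE)
qed

lemma comm_abelian_layer: assumes "comm_group QG" shows "abelian_layer" unfolding abelian_layer_def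
proof (intro ballI)
 fix h k assume hk: "h \<in> H" "k \<in> H"
 have c: "U #> h \<in> carrier QG" "U #> k \<in> carrier QG" using hk QG_carrier by auto
 have "U #> (h \<otimes> k) = U #> (k \<otimes> h)" unfolding QG_mult[OF hk] QG_mult[OF hk(2,1)]
  by (rule comm_monoid.m_comm[OF comm_group.axioms(1)[OF assms] c])
 then have "h \<otimes> k \<div> (k \<otimes> h) \<in> U" using coset_U_iff[of "h \<otimes> k" "k \<otimes> h"] hk by simp
 then show "h \<otimes> k \<div> h \<div> k \<in> U" using hk by (simp add: G.inv_mult_group G.m_assoc)
qed

text \<open>Induction along the identity of H is the projection from norm residues modulo C(V) to
  those modulo C(U), so the kernel for (H, V) goes into the kernel for (H, U).\<close>

lemma recX_one_of_sublayer:
 assumes x: "(H, V) \<in> base E" and y: "(H, V) \<in> idom E (H, U)" and h: "h \<in> H"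
  "fn_layer.recX P G T \<Omega> \<omega> d C v H V h = \<one>\<^bsub>obj C H Mod norm_group C H V\<^esub>"
 shows "recX h = \<one>\<^bsub>QQ\<^esub>"
proof -
 interpret A: fn_layer P G T \<Omega> TO \<omega> d E M C v H V by (rule fn_layerI[OF x])
 have o: "\<one>\<^bsub>obj C H\<^esub> \<in> CC H" by (rule monoid.one_closed[OF group.is_monoid[OF C_group[OF H_base]]])
 have Ac: "A.cls \<one>\<^bsub>obj C H\<^esub> = \<one>\<^bsub>A.QQ\<^esub>" using A.cls_one_iff[OF o] subgroup.one_closed[OF A.Nm_sub] by simp
 have c: "cls \<one>\<^bsub>obj C H\<^esub> = \<one>\<^bsub>QQ\<^esub>" using cls_one_iff[OF o] subgroup.one_closed[OF Nm_sub] by simp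
 have "UP (H, U) (pc (H, U) h) = h0c (H, U) (ind H H \<one>\<^bsub>obj C H\<^esub>)"
  by (rule rec_ind[OF HU y h(1) o]) (rule A.recX_Upsilon_D[OF h(1) o trans[OF h(2) Ac[symmetric]]])
 then have "recX h = cls \<one>\<^bsub>obj C H\<^esub>" unfolding ind_id[OF H_base o] by (rule recX_Upsilon_I[OF h(1) o])
 then show ?thesis unfolding c .
qed

end

context fn_datum begin

text \<open>By surjectivity at (H, I) the element a is corrected by the image of some h until it is
  a norm ind(c) from I; then c is a reciprocity value at (I, U).\<close>

lemma step_surj:
 assumes HU: "(H, U) \<in> base E" and I: "subgroup I G" "U \<subseteq> I" "I \<subseteq> H"
  and n: "\<And>h i. h \<in> H \<Longrightarrow> i \<in> I \<Longrightarrow> h \<otimes> i \<div> h \<in> I"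
  and s: "surj_at (I, U)" "surj_at (H, I)"
 shows "surj_at (H, U)"
proof -
 interpret A: fn_layer P G T \<Omega> TO \<omega> d E M C v H U by (rule fn_layerI[OF HU])
 note i = A.intermediate_idom[OF I]
 have j: "(H, I) \<in> base E" "(H, U) \<in> idom E (H, I)" using A.intermediate_normal[OF I n] by simp_all
 interpret B: fn_layer P G T \<Omega> TO \<omega> d E M C v I U by (rule fn_layerI[OF i(2)])
 interpret D: fn_layer P G T \<Omega> TO \<omega> d E M C v H I by (rule fn_layerI[OF j(1)])
 have "X \<in> A.recX ` H" if X: "X \<in> carrier A.QQ" for X
 proof -
  obtain a where a: "a \<in> CC H" "X = A.cls a" using X[unfolded A.carrier_Q] by blast
  obtain h where h: "h \<in> H" "D.recX h = D.cls a" by (rule D.surj_obtain[OF s(2) a(1)])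
  obtain a' where a': "a' \<in> CC H" "A.recX h = A.cls a'" by (rule A.recX_obtain[OF h(1)])
  have "UP (H, I) (pc (H, I) h) = h0c (H, I) (ind H H a')"
   by (rule rec_ind[OF j h(1) a'(1)]) (rule A.recX_Upsilon_D[OF h(1) a'])
  then have "D.recX h = D.cls a'" unfolding ind_id[OF A.H_base a'(1)] by (rule D.recX_Upsilon_I[OF h(1) a'(1)])
  then have "D.cls a = D.cls a'" using h(2) by simp
  then have "a \<div>\<^bsub>obj C H\<^esub> a' \<in> norm_group C H I" using D.cls_eq_iff[OF a(1) a'(1)] by simp
  then obtain c where c: "c \<in> CC I" "a \<div>\<^bsub>obj C H\<^esub> a' = ind H I c" by (auto simp: norm_group_def)
  obtain k where k: "k \<in> I" "B.recX k = B.cls c" by (rule B.surj_obtain[OF s(1) c(1)])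
  have kH: "k \<in> H" using k(1) I(3) by blast
  have ic: "ind H I c \<in> CC H" by (rule ind_closed[OF A.H_base D.U_idom c(1)])
  have "UP (H, U) (pc (H, U) k) = h0c (H, U) (ind H I c)"
   by (rule rec_ind[OF HU i(1) k(1) c(1)]) (rule B.recX_Upsilon_D[OF k(1) c(1) k(2)])
  then have "A.recX k = A.cls (ind H I c)" by (rule A.recX_Upsilon_I[OF kH ic])
  then have "A.recX (k \<otimes> h) = A.cls (ind H I c \<otimes>\<^bsub>obj C H\<^esub> a')"
   using A.recX_mult[OF kH h(1)] A.cls_mult[OF ic a'(1)] a'(2) by simp
  also have "ind H I c \<otimes>\<^bsub>obj C H\<^esub> a' = a"
  proof -
   interpret Cg: group "obj C H" by (rule C_group[OF A.H_base])
   show ?thesis unfolding c(2)[symmetric] using a(1) a'(1) by (simp add: Cg.m_assoc)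
  qed
  finally show ?thesis unfolding a(2) using kH h(1) by (metis A.H.m_closed imageI)
 qed
 then show ?thesis unfolding A.surj_at_iff A.rec_surj_def using A.recX_closed by blast
qed

text \<open>The point is that C(I)/ind C(U) embeds into C(H)/ind C(U). By the class field axiom the
  kernel of ind is generated by quotients of t x by x, and these are norms from U: by surjectivity
  at (I, U) their classes are reciprocity values of commutators, which lie in U.\<close>

lemma step_inj:
 assumes HU: "(H, U) \<in> base E" and I: "subgroup I G" "U \<subseteq> I" "I \<subseteq> H"
  and n: "\<And>h i. h \<in> H \<Longrightarrow> i \<in> I \<Longrightarrow> h \<otimes> i \<div> h \<in> I"
  and ab: "fn_layer.abelian_layer G H U" and cfa: "class_field_axiom G C H I"
  and s: "surj_at (I, U)" "inj_at (I, U)" "inj_at (H, I)"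
 shows "inj_at (H, U)"
proof -
 interpret A: fn_layer P G T \<Omega> TO \<omega> d E M C v H U by (rule fn_layerI[OF HU])
 note i = A.intermediate_idom[OF I]
 have j: "(H, I) \<in> base E" "(H, U) \<in> idom E (H, I)" using A.intermediate_normal[OF I n] by simp_all
 interpret B: fn_layer P G T \<Omega> TO \<omega> d E M C v I U by (rule fn_layerI[OF i(2)])
 interpret D: fn_layer P G T \<Omega> TO \<omega> d E M C v H I by (rule fn_layerI[OF j(1)])
 have com: "h \<otimes> k \<div> h \<div> k \<in> U" if "h \<in> H" "k \<in> H" for h k
  using ab that unfolding A.abelian_layer_def by blast
 have DI: "D.DH = I" by (rule D.abelian_DH) (use com I(2) in \<open>auto simp: D.abelian_layer_def\<close>)
 have BU: "B.DH = U" by (rule B.abelian_DH) (use com I(3) in \<open>auto simp: B.abelian_layer_def\<close>)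
 interpret CI: group "obj C I" by (rule C_group[OF B.H_base])
 interpret CH: group "obj C H" by (rule C_group[OF A.H_base])
 have gen: "con t I x \<div>\<^bsub>obj C I\<^esub> x \<in> norm_group C I U" if t: "t \<in> H" and x: "x \<in> CC I" for t x
 proof -
  have tc: "t \<in> carrier G" using t by simp
  have cI: "conj_set G t I = I" and cU: "conj_set G t U = U" using D.U_conj_set[OF t] A.U_conj_set[OF t] by auto
  obtain k where k: "k \<in> I" "B.recX k = B.cls x" by (rule B.surj_obtain[OF s(1) x])
  have kH: "k \<in> H" using k(1) I(3) by blast
  have tk: "t \<otimes> k \<div> t \<in> I" by (rule n[OF t k(1)])
  have cx: "con t I x \<in> CC I" using con_closed[OF B.H_base tc x] cI by simp
  have "UP (I, U) (pc (I, U) (t \<otimes> k \<div> t)) = con_map h0 t (I, U) (UP (I, U) (pc (I, U) k))"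
   using Upsilon_con[OF i(2) tc k(1)] unfolding cI cU .
  also have "UP (I, U) (pc (I, U) k) = h0c (I, U) x" by (rule B.recX_Upsilon_D[OF k(1) x k(2)])
  also have "con_map h0 t (I, U) (h0c (I, U) x) = h0c (I, U) (con t I x)"
   using H0_con(1)[OF i(2) tc x] unfolding cI cU .
  finally have "B.recX (t \<otimes> k \<div> t) = B.cls (con t I x)" by (rule B.recX_Upsilon_I[OF tk cx])
  moreover have "B.recX (t \<otimes> k \<div> t) = B.recX k"
   by (rule B.recX_cong[OF tk k(1)]) (use com[OF t kH] B.U_DH in blast)
  ultimately have "B.cls (con t I x) = B.cls x" using k(2) by simp
  then show ?thesis using B.cls_eq_iff[OF cx x] by simp
 qed
 have ker: "kernel (obj C I) (obj C H) (ind H I) \<subseteq> norm_group C I U"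
 proof -
  have "kernel (obj C I) (obj C H) (ind H I) =
   generate (obj C I) {con h I x \<div>\<^bsub>obj C I\<^esub> x | h x. h \<in> H \<and> x \<in> CC I}"
   using cfa unfolding class_field_axiom_def by (rule conjunct2)
  also have "\<dots> \<subseteq> norm_group C I U"
   by (rule CI.generate_subgroup_incl[OF _ B.Nm_sub]) (use gen in blast)
  finally show ?thesis .
 qed
 have "h \<in> A.DH" if h: "h \<in> H" "A.recX h = \<one>\<^bsub>A.QQ\<^esub>" for h
 proof -
  have "D.recX h = \<one>\<^bsub>D.QQ\<^esub>" by (rule D.recX_one_of_sublayer[OF HU j(2) h])
  then have hI: "h \<in> I" using s(3) h(1) DI unfolding D.inj_at_iff D.rec_inj_def by blast
  obtain c where c: "c \<in> CC I" "B.recX h = B.cls c" by (rule B.recX_obtain[OF hI])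
  have ic: "ind H I c \<in> CC H" by (rule ind_closed[OF A.H_base D.U_idom c(1)])
  have "UP (H, U) (pc (H, U) h) = h0c (H, U) (ind H I c)"
   by (rule rec_ind[OF HU i(1) hI c(1)]) (rule B.recX_Upsilon_D[OF hI c])
  then have "A.recX h = A.cls (ind H I c)" by (rule A.recX_Upsilon_I[OF h(1) ic])
  then have "A.cls (ind H I c) = \<one>\<^bsub>A.QQ\<^esub>" using h(2) by simp
  then have "ind H I c \<in> norm_group C H U" using A.cls_one_iff[OF ic] by simp
  then obtain e where e: "e \<in> CC U" "ind H I c = ind H U e" by (auto simp: norm_group_def)
  have ie: "ind I U e \<in> CC I" by (rule ind_closed[OF B.H_base B.U_idom e(1)])
  have eq: "ind H I (ind I U e) = ind H I c" using ind_ind[OF A.H_base D.U_idom B.U_idom e(1)] e(2) by simp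
  have iie: "inv\<^bsub>obj C I\<^esub> ind I U e \<in> CC I" using ie by simp
  have "ind H I (c \<div>\<^bsub>obj C I\<^esub> ind I U e) = ind H I c \<div>\<^bsub>obj C H\<^esub> ind H I c"
   using hom_mult[OF ind_hom[OF A.H_base D.U_idom] c(1) iie]
    group_hom_inv[OF CI.is_group CH.is_group ind_hom[OF A.H_base D.U_idom] ie] eq by simp
  then have "c \<div>\<^bsub>obj C I\<^esub> ind I U e \<in> norm_group C I U"
   using ker ic c(1) ie by (auto simp: kernel_def)
  moreover have "ind I U e \<in> norm_group C I U" using e(1) by (simp add: norm_group_def)
  ultimately have "c \<div>\<^bsub>obj C I\<^esub> ind I U e \<otimes>\<^bsub>obj C I\<^esub> ind I U e \<in> norm_group C I U"
   by (rule subgroup.m_closed[OF B.Nm_sub])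
  then have "c \<in> norm_group C I U" using c(1) ie by (simp add: CI.m_assoc)
  then have "B.recX h = \<one>\<^bsub>B.QQ\<^esub>" using B.cls_one_iff[OF c(1)] c(2) by simp
  then have "h \<in> U" using s(2) hI BU unfolding B.inj_at_iff B.rec_inj_def by blast
  then show ?thesis using A.U_DH by blast
 qed
 then show ?thesis unfolding A.inj_at_iff A.rec_inj_def by blast
qed

text \<open>The restriction of a to I is a reciprocity value modulo norms from U, and induction
  after restriction is the [H:I]-th power.\<close>

lemma power_in_image:
 assumes HU: "(H, U) \<in> base E" and I: "subgroup I G" "U \<subseteq> I" "I \<subseteq> H" and s: "surj_at (I, U)"
  and a: "a \<in> CC H"
 shows "\<exists>k\<in>H. fn_layer.recX P G T \<Omega> \<omega> d C v H U k = h0c (H, U) (a [^]\<^bsub>obj C H\<^esub> grp_index G H I)"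
proof -
 interpret A: fn_layer P G T \<Omega> TO \<omega> d E M C v H U by (rule fn_layerI[OF HU])
 note i = A.intermediate_idom[OF I]
 interpret B: fn_layer P G T \<Omega> TO \<omega> d E M C v I U by (rule fn_layerI[OF i(2)])
 note o = A.intermediate_open[OF I]
 have r: "I \<in> rdom M H" "I \<in> idom M H" using open_rdom[OF A.H_base o] open_idom[OF A.H_base o] .
 have c: "res I H a \<in> CC I" by (rule res_closed[OF A.H_base r(1) a])
 obtain k where k: "k \<in> I" "B.recX k = B.cls (res I H a)" by (rule B.surj_obtain[OF s c])
 have kH: "k \<in> H" using k(1) I(3) by blast
 have eq: "ind H I (res I H a) = a [^]\<^bsub>obj C H\<^esub> grp_index G H I" by (rule ind_res[OF A.H_base r a])
 have "UP (H, U) (pc (H, U) k) = h0c (H, U) (ind H I (res I H a))"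
  by (rule rec_ind[OF HU i(1) k(1) c]) (rule B.recX_Upsilon_D[OF k(1) c k(2)])
 then have "A.recX k = h0c (H, U) (a [^]\<^bsub>obj C H\<^esub> grp_index G H I)"
  unfolding A.Upsilon_pi_class[OF kH] eq .
 then show ?thesis using kH by blast
qed

end

locale cft_datum = fn_datum +
 assumes cfa: "\<And>l H U. prime (l::nat) \<Longrightarrow> (H, U) \<in> base E \<Longrightarrow> cyclic_group (quot_group G (H, U)) \<Longrightarrow>
   order (quot_group G (H, U)) = l \<Longrightarrow> class_field_axiom G C H U"
  and ramified_inj: "\<And>H U. (H, U) \<in> base E \<Longrightarrow> cyclic_group (quot_group G (H, U)) \<Longrightarrow>
   prime (order (quot_group G (H, U))) \<Longrightarrow> f_rel \<Omega> d H U = 1 \<Longrightarrow>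
   inj_on (Upsilon P G T \<Omega> \<omega> d C v (H, U)) (carrier (obj (pi_fun G T) (H, U)))"
begin

lemma cfa_prime_index:
 assumes HU: "(H, U) \<in> base E" and p: "prime (grp_index G H U)"
 shows "cyclic_group (quot_group G (H, U))" "class_field_axiom G C H U"
proof -
 interpret A: fn_layer P G T \<Omega> TO \<omega> d E M C v H U by (rule fn_layerI[OF HU])
 interpret Q: plain_group A.QG by (rule A.QG_plain)
 have ord: "order (quot_group G (H, U)) = A.idx" unfolding A.quot_group_HU by (rule A.order_QG)
 show c: "cyclic_group (quot_group G (H, U))" unfolding A.quot_group_HU
  by (rule Q.prime_order_cyclic[OF A.finite_QG]) (use p A.order_QG in simp)
 show "class_field_axiom G C H U" by (rule cfa[OF p HU c ord])
qed

text \<open>The elements of H with degree in f_U\<Omega> form a group J between U and H, of index b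
  = f_U/f_H in H, and primality leaves two cases. For b = 1 injectivity is a hypothesis; otherwise J
  = U and the layer is unramified. Surjectivity is a count against the order in the class field
  axiom.\<close>

lemma prime_layer:
 assumes HU: "(H, U) \<in> base E" and p: "prime (grp_index G H U)"
 shows "inj_at (H, U)" "surj_at (H, U)"
proof -
 interpret A: fn_layer P G T \<Omega> TO \<omega> d E M C v H U by (rule fn_layerI[OF HU])
 note cyc = cfa_prime_index(1)[OF HU p]
 have comm: "comm_group A.QG"
  by (rule group.cyclic_imp_abelian_group[OF A.QG_group]) (use cyc A.quot_group_HU in simp)
 have DU: "A.DH = U" by (rule A.abelian_DH[OF A.comm_abelian_layer[OF comm]])
 obtain b where b: "f_of U = f_of H * b" "Pnum b" by (rule f_of_mult[OF A.H_inert A.U_inert A.UH])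
 define J where "J = dv H (f_of H * b)"
 have J: "subgroup J G" "U \<subseteq> J" "J \<subseteq> H"
 proof -
  show "subgroup J G" unfolding J_def by (rule dv_subgroup[OF A.H_sub])
  show "J \<subseteq> H" unfolding J_def by (rule dv_subset)
  have "d u \<in> Om (f_of H * b)" if "u \<in> U" for u
   using d_inert_finite[OF A.U_inert] imageI[OF that, of d] b(1) by simp
  then show "U \<subseteq> J" unfolding J_def dv_def using A.UH by blast
 qed
 have HJ: "grp_index G H J = b" unfolding J_def using index_dv[OF A.H_inert A.fH_pos dvd_refl b(2)] A.dv_fH by simp
 have mult: "b * grp_index G J U = A.idx" using A.index_mult[OF J] HJ by simp
 show inj: "inj_at (H, U)"
 proof (cases "b = 1")
  case True
  have "f_rel \<Omega> d H U = 1"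
   by (rule f_rel_Om[OF d_inert_finite[OF A.H_inert] _ A.fH_pos]) (use d_inert_finite[OF A.U_inert] b True in simp_all)
  then have "inj_on A.Ups (carrier A.PI)"
   using ramified_inj[OF HU cyc] p A.order_QG unfolding A.quot_group_HU by simp
  then show ?thesis unfolding inj_at_def fst_conv by (intro ballI impI, elim inj_onD) (simp_all add: A.PI_carrier)
 next
  case False
  have "b dvd A.idx" using mult by (metis dvd_triv_left)
  then have "b = A.idx" using p False by (metis prime_nat_iff)
  then have "grp_index G J U = 1" using mult A.idx_pos by simp
  then have "J = U" by (rule A.index_sub_one[OF J])
  then show ?thesis unfolding A.inj_at_iff J_def by (rule A.unramified_inj[OF b])
 qed
 have eq: "A.recX h = A.recX k \<longleftrightarrow> U #> h = U #> k" if "h \<in> H" "k \<in> H" for h k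
  using A.recX_eq_iff[OF inj[unfolded A.inj_at_iff] that] A.coset_U_iff[OF that] DU by simp
 have "card (A.recX ` H) = card ((\<lambda>h. U #> h) ` H)" by (rule card_image_same_kernel[OF eq])
 also have "\<dots> = A.idx" using A.order_QG A.QG_carrier by (simp add: order_def)
 also have "\<dots> = card (carrier A.QQ)"
  using cfa_prime_index(2)[OF HU p] by (simp add: class_field_axiom_def order_def)
 finally have c: "card (A.recX ` H) = card (carrier A.QQ)" .
 have "finite (carrier A.QQ)" using cfa_prime_index(2)[OF HU p] A.idx_pos card_gt_0_iff[of "carrier A.QQ"]
  by (simp add: class_field_axiom_def order_def)
 moreover have "A.recX ` H \<subseteq> carrier A.QQ" using A.recX_closed by blast
 ultimately have "A.recX ` H = carrier A.QQ" using c by (intro card_subset_eq)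
 then show "surj_at (H, U)" unfolding A.surj_at_iff A.rec_surj_def .
qed

end

context plain_group begin

section \<open>Sylow subgroups and coprime exponents\<close>

lemma subgroup_pow_card: assumes S: "subgroup S G" and x: "x \<in> S" shows "x [^] card S = \<one>"
proof -
 interpret GS: group "G\<lparr>carrier := S\<rparr>" by (rule subgroup_imp_group[OF S])
 show ?thesis using GS.pow_order_eq_1[of x] x by (simp add: order_def pow_restrict)
qed

lemma subgroup_nat_pow: "subgroup S G \<Longrightarrow> x \<in> S \<Longrightarrow> x [^] (n::nat) \<in> S"
 by (induction n) (simp_all add: subgroup.one_closed subgroup.m_closed)

lemma exponent_dvd:
 assumes R: "subgroup R G" and x: "x \<in> carrier G" and k: "0 < k \<and> x [^] k \<in> R"
  and min: "\<And>j. 0 < j \<Longrightarrow> j < k \<Longrightarrow> x [^] j \<notin> R" and m: "x [^] (m::nat) \<in> R"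
 shows "(k::nat) dvd m"
proof (rule ccontr)
 assume nd: "\<not> k dvd m"
 have "(x [^] k) [^] (m div k) \<in> R" by (rule subgroup_nat_pow[OF R conjunct2[OF k]])
 then have q: "x [^] (k * (m div k)) \<in> R" using x by (simp add: nat_pow_pow)
 have "x [^] m = x [^] (k * (m div k)) \<otimes> x [^] (m mod k)" using x by (simp add: nat_pow_mult)
 then have "x [^] (m mod k) = inv (x [^] (k * (m div k))) \<otimes> x [^] m" using x by (simp add: m_assoc[symmetric])
 then have "x [^] (m mod k) \<in> R" using subgroup.m_closed[OF R subgroup.m_inv_closed[OF R q] m] by simp
 moreover have "0 < m mod k" using nd by (simp add: dvd_eq_mod_eq_0)
 ultimately show False using min mod_less_divisor k by blast
qed

end

context fn_layer begin

text \<open>The exponent of I/U serves injectivity for mixed indices. The final statement concerns a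
  p-group H/U, in which a subgroup of index p is normal.\<close>

lemma sylow_intermediate:
 assumes p: "prime p" and ord: "idx = p ^ a * m"
 obtains I where "subgroup I G" "U \<subseteq> I" "I \<subseteq> H" "grp_index G I U = p ^ a" "grp_index G H I = m"
  "\<And>h. h \<in> I \<Longrightarrow> h \<in> H \<and> (U #> h) [^]\<^bsub>QG\<^esub> (p ^ a) = \<one>\<^bsub>QG\<^esub>"
  "m = p \<Longrightarrow> (\<And>h i. h \<in> H \<Longrightarrow> i \<in> I \<Longrightarrow> h \<otimes> i \<div> h \<in> I)"
proof -
 interpret Q: plain_group QG by (rule QG_plain)
 obtain S where S: "subgroup S QG" "card S = p ^ a"
  using sylow_thm[OF p QG_group _ finite_QG, of a m] ord order_QG by auto
 define I where "I = {h \<in> H. U #> h \<in> S}"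
 note I = preimage_subgroup[OF S(1), folded I_def]
 have IU: "grp_index G I U = p ^ a" using I(4) S(2) by simp
 have HI: "grp_index G H I = m" using index_mult[OF I(1-3)] IU ord prime_gt_0_nat[OF p] by simp
 have pow: "h \<in> H \<and> (U #> h) [^]\<^bsub>QG\<^esub> (p ^ a) = \<one>\<^bsub>QG\<^esub>" if "h \<in> I" for h
 proof -
  have s: "U #> h \<in> S" and hH: "h \<in> H" using that by (simp_all add: I_def)
  show ?thesis using Q.subgroup_pow_card[OF S(1) s] S(2) hH by simp
 qed
 have norm: "h \<otimes> i \<div> h \<in> I" if "m = p" "h \<in> H" "i \<in> I" for h i
 proof -
  have "S \<lhd> QG"
  proof (rule Q.index_prime_normal[OF finite_QG p _ S(1)])
   show "order QG = p ^ Suc a" using order_QG ord that(1) by simp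
   show "card S * p = order QG" using order_QG ord that(1) S(2) by simp
  qed
  have iH: "i \<in> H" and iS: "U #> i \<in> S" using that(3) by (simp_all add: I_def)
  have hc: "U #> h \<in> carrier QG" using that(2) QG_carrier by auto
  have "(U #> h) \<otimes>\<^bsub>QG\<^esub> (U #> i) \<div>\<^bsub>QG\<^esub> (U #> h) \<in> S"
   by (rule normal.inv_op_closed2[OF \<open>S \<lhd> QG\<close> hc iS])
  moreover have "U #> (h \<otimes> i \<div> h) = (U #> h) \<otimes>\<^bsub>QG\<^esub> (U #> i) \<div>\<^bsub>QG\<^esub> (U #> h)"
   using QG_mult[OF H.m_closed[OF that(2) iH] H.m_inv_closed[OF that(2)]] QG_mult[OF that(2) iH] QG_inv[OF that(2)] by simp
  ultimately show ?thesis using that(2) iH by (simp add: I_def)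
 qed
 show thesis by (rule that[OF I(1-3) IU HI pow norm])
qed

end

lemma prime_part:
 fixes n :: nat
 assumes "0 < n" "prime p"
 obtains m where "n = p ^ multiplicity p n * m" "\<not> p dvd m"
proof (rule multiplicity_decompose'[of n p])
 show "n \<noteq> 0" "\<not> is_unit p" using assms not_prime_unit by auto
qed (rule that)

lemma not_prime_power_split:
 fixes n :: nat
 assumes "1 < n" "\<And>p k. prime p \<Longrightarrow> n \<noteq> p ^ k"
 obtains p q where "prime p" "prime q" "p \<noteq> q" "p dvd n" "q dvd n"
proof -
 obtain p where p: "prime p" "p dvd n" using assms(1) prime_factor_nat[of n] by auto
 obtain m where m: "n = p ^ multiplicity p n * m" "\<not> p dvd m"
  by (rule prime_part[of n p]) (use assms(1) p(1) in auto)
 have "m \<noteq> 1" using m(1) assms(2)[OF p(1)] by (metis mult.right_neutral)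
 then obtain q where q: "prime q" "q dvd m" using prime_factor_nat by blast
 show thesis by (rule that[OF p(1) q(1) _ p(2)]) (use m q in \<open>metis dvd_mult\<close>)+
qed

context fn_layer begin

lemma recX_inv: "h \<in> H \<Longrightarrow> recX (inv h) = inv\<^bsub>QQ\<^esub> recX h"
 using group_hom_inv[OF H_group Q_group recX_hom, of h] G.inv_restrict[OF H_sub, of h] by simp

lemma recX_image_subgroup: "subgroup (recX ` H) QQ"
proof (rule group.subgroupI[OF Q_group])
 show "recX ` H \<subseteq> carrier QQ" using recX_closed by blast
 show "recX ` H \<noteq> {}" using H.one_closed by blast
 show "inv\<^bsub>QQ\<^esub> X \<in> recX ` H" if "X \<in> recX ` H" for X
  using that by (elim imageE) (simp add: recX_inv[symmetric])
 show "X \<otimes>\<^bsub>QQ\<^esub> Y \<in> recX ` H" if XY: "X \<in> recX ` H" "Y \<in> recX ` H" for X Y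
 proof -
  obtain h k where hk: "h \<in> H" "k \<in> H" "X = recX h" "Y = recX k" using XY by blast
  show ?thesis unfolding hk(3,4) recX_mult[OF hk(1,2), symmetric] by (rule imageI[OF H.m_closed[OF hk(1,2)]])
 qed
qed

end

context plain_group begin

text \<open>All exponents m with x^m in R are multiples of the least positive one, k. A prime
  dividing k would divide n, and the exponent prime to it provided by \<open>pw\<close> excludes
  that.\<close>

lemma mem_subgroup_coprime_powers:
 assumes R: "subgroup R G" and x: "x \<in> carrier G" and n: "0 < n"
  and pw: "\<And>p. prime p \<Longrightarrow> p dvd n \<Longrightarrow> \<exists>m. n = p ^ multiplicity p n * m \<and> \<not> p dvd m \<and> x [^] m \<in> R"
  and xn: "x [^] (n::nat) \<in> R"
 shows "x \<in> R"
proof -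
 define k :: nat where "k = (LEAST k. 0 < k \<and> x [^] k \<in> R)"
 have k: "0 < k" "x [^] k \<in> R" unfolding k_def by (rule LeastI2[of _ n]; use n xn in blast)+
 have dvd: "k dvd m" if m: "x [^] m \<in> R" for m :: nat
 proof (rule exponent_dvd[OF R x conjI[OF k] _ m])
  show "x [^] j \<notin> R" if "0 < j" "j < k" for j
   using not_less_Least[of j "\<lambda>k. 0 < k \<and> x [^] k \<in> R"] that unfolding k_def by blast
 qed
 have "k = 1"
 proof (rule ccontr)
  assume "k \<noteq> 1"
  then obtain q where q: "prime q" "q dvd k" using prime_factor_nat by blast
  then have "q dvd n" using dvd[OF xn] dvd_trans by blast
  then obtain m where "\<not> q dvd m" "x [^] m \<in> R" using pw[OF q(1)] by blast
  then show False using dvd q(2) dvd_trans by blast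
 qed
 then show ?thesis using k(2) x by simp
qed

end

context cft_datum begin

text \<open>Injectivity is carried along for abelian layers only, since \<open>step_inj\<close>
  needs commutators in U. Abelian layers are inherited by (I, U) and (H, I), so the induction
  closes, while surjectivity is available throughout.\<close>

lemma bijective_induction:
 assumes HU: "(H, U) \<in> base E"
  and IH: "\<And>H' U'. (H', U') \<in> base E \<Longrightarrow> grp_index G H' U' < grp_index G H U \<Longrightarrow>
   surj_at (H', U') \<and> (fn_layer.abelian_layer G H' U' \<longrightarrow> inj_at (H', U'))"
 shows "surj_at (H, U) \<and> (fn_layer.abelian_layer G H U \<longrightarrow> inj_at (H, U))"
proof -
 interpret A: fn_layer P G T \<Omega> TO \<omega> d E M C v H U by (rule fn_layerI[OF HU])
 interpret Q: plain_group A.QG by (rule A.QG_plain)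
 interpret QQ: plain_group A.QQ by (rule plain_group.intro[OF A.Q_group])
 have com: "h \<otimes> k \<div> h \<div> k \<in> U" if "A.abelian_layer" "h \<in> H" "k \<in> H" for h k
  using that unfolding A.abelian_layer_def by blast
 have sub: "surj_at (I, U)" "A.abelian_layer \<Longrightarrow> inj_at (I, U)"
  if I: "subgroup I G" "U \<subseteq> I" "I \<subseteq> H" "I \<noteq> H" for I
 proof -
  note i = A.intermediate_idom(2)[OF I(1-3)]
  interpret B: fn_layer P G T \<Omega> TO \<omega> d E M C v I U by (rule fn_layerI[OF i])
  note l = IH[OF i A.index_less(1)[OF I]]
  show "surj_at (I, U)" using l by (rule conjunct1)
  assume "A.abelian_layer"
  then have "B.abelian_layer" unfolding B.abelian_layer_def using com[OF \<open>A.abelian_layer\<close>] I(3) by blast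
  with conjunct2[OF l] show "inj_at (I, U)" by (rule mp)
 qed
 have quo: "(H, I) \<in> base E" "surj_at (H, I)" "A.abelian_layer \<Longrightarrow> inj_at (H, I)"
  if I: "subgroup I G" "U \<subseteq> I" "I \<subseteq> H" "I \<noteq> U" and n: "\<And>h i. h \<in> H \<Longrightarrow> i \<in> I \<Longrightarrow> h \<otimes> i \<div> h \<in> I" for I
 proof -
  show i: "(H, I) \<in> base E" using A.intermediate_normal(1)[OF I(1-3) n] by simp
  interpret D: fn_layer P G T \<Omega> TO \<omega> d E M C v H I by (rule fn_layerI[OF i])
  note l = IH[OF i A.index_less(2)[OF I]]
  show "surj_at (H, I)" using l by (rule conjunct1)
  assume "A.abelian_layer"
  then have "D.abelian_layer" unfolding D.abelian_layer_def using com[OF \<open>A.abelian_layer\<close>] I(2) by blast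
  with conjunct2[OF l] show "inj_at (H, I)" by (rule mp)
 qed
 consider "A.idx = 1" | p where "prime p" "A.idx = p" | p k where "prime p" "A.idx = p ^ Suc (Suc k)"
  | "1 < A.idx" "\<And>p k. prime p \<Longrightarrow> A.idx \<noteq> p ^ k"
 proof (cases "\<exists>p k. prime p \<and> A.idx = p ^ k")
  case True
  then obtain p k where pk: "prime p" "A.idx = p ^ k" by blast
  show thesis
  proof (cases k)
   case 0
   then show thesis using that(1) pk by simp
  next
   case (Suc l)
   show thesis
   proof (cases l)
    case 0
    then show thesis using that(2)[OF pk(1)] pk(2) Suc by simp
   next
    case (Suc l')
    then show thesis by (intro that(3)[OF pk(1), of l']) (use pk(2) \<open>k = Suc l\<close> in simp)
   qed
  qed
 next
  case False
  then have "A.idx \<noteq> 2 ^ 0" using two_is_prime_nat by blast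
  then have "1 < A.idx" using A.idx_pos by simp
  then show thesis using that(4) False by blast
 qed
 then show ?thesis
 proof cases
  case 1
  have "H = U" by (rule A.index_sub_one[OF A.H_sub A.UH order_refl 1])
  then show ?thesis using A.trivial_layer unfolding A.inj_at_iff A.surj_at_iff by simp
 next
  case (2 p)
  then show ?thesis using prime_layer[OF HU] by simp
 next
  case (3 p k)
  have ord: "A.idx = p ^ Suc k * p" using 3(2) by simp
  obtain I where I: "subgroup I G" "U \<subseteq> I" "I \<subseteq> H" and ind: "grp_index G I U = p ^ Suc k" "grp_index G H I = p"
   and n: "\<And>h i. h \<in> H \<Longrightarrow> i \<in> I \<Longrightarrow> h \<otimes> i \<div> h \<in> I"
   by (rule A.sylow_intermediate[OF 3(1) ord]) (rule that, simp_all)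
  have p1: "1 < p" by (rule prime_gt_1_nat[OF 3(1)])
  have ne: "I \<noteq> H" "I \<noteq> U"
  proof -
   show "I \<noteq> H" using ind(2) G.index_self[OF A.H_sub] p1 by auto
   show "I \<noteq> U" using ind(1) G.index_self[OF A.U.subgroup_axioms] p1 by (auto simp: one_less_power)
  qed
  note s = sub[OF I ne(1)] and q = quo[OF I ne(2) n]
  have b: "(H, I) \<in> base E" "surj_at (H, I)" "A.abelian_layer \<Longrightarrow> inj_at (H, I)" using q by simp_all
  have "class_field_axiom G C H I" by (rule cfa_prime_index(2)[OF b(1)]) (use ind(2) 3(1) in simp)
  then show ?thesis using step_surj[OF HU I n s(1) b(2)] step_inj[OF HU I n _ _ s b(3)] by blast
 next
  case 4
  \<comment> \<open>Sylow subgroups of H/U pulled back to H. As [H:U] is not a prime power they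
    differ from H, and as p divides it they differ from U; so the induction hypothesis covers the
    layers they define.\<close>
  have pI: "\<exists>I m. subgroup I G \<and> U \<subseteq> I \<and> I \<subseteq> H \<and> I \<noteq> H \<and> I \<noteq> U \<and> grp_index G H I = m \<and>
    A.idx = p ^ multiplicity p A.idx * m \<and> \<not> p dvd m \<and>
    (\<forall>h\<in>I. h \<in> H \<and> (U #> h) [^]\<^bsub>A.QG\<^esub> (p ^ multiplicity p A.idx) = \<one>\<^bsub>A.QG\<^esub>)"
   if p: "prime p" "p dvd A.idx" for p
  proof -
   obtain m where m: "A.idx = p ^ multiplicity p A.idx * m" "\<not> p dvd m" by (rule prime_part[OF A.idx_pos p(1)])
   obtain I where I: "subgroup I G" "U \<subseteq> I" "I \<subseteq> H" and ind: "grp_index G I U = p ^ multiplicity p A.idx" "grp_index G H I = m"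
    and pw: "\<And>h. h \<in> I \<Longrightarrow> h \<in> H \<and> (U #> h) [^]\<^bsub>A.QG\<^esub> (p ^ multiplicity p A.idx) = \<one>\<^bsub>A.QG\<^esub>"
    by (rule A.sylow_intermediate[OF p(1) m(1)]) (rule that, simp_all)
   have "I \<noteq> H"
   proof
    assume "I = H"
    then have "m = 1" using ind(2) G.index_self[OF A.H_sub] by simp
    then show False using m(1) 4(2)[OF p(1)] by simp
   qed
   moreover have "I \<noteq> U"
   proof
    assume "I = U"
    then have e: "p ^ multiplicity p A.idx = 1" using ind(1) G.index_self[OF A.U.subgroup_axioms] by simp
    have "A.idx = m" using m(1) unfolding e by simp
    then show False using m(2) p(2) by simp
   qed
   ultimately show ?thesis using I ind m pw by blast
  qed
  have "surj_at (H, U)"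
  proof -
   have "X \<in> A.recX ` H" if X: "X \<in> carrier A.QQ" for X
   proof (rule QQ.mem_subgroup_coprime_powers[OF A.recX_image_subgroup X A.idx_pos])
    obtain a where a: "a \<in> CC H" "X = A.cls a" using X[unfolded A.carrier_Q] by blast
    have cp: "X [^]\<^bsub>A.QQ\<^esub> n = h0c (H, U) (a [^]\<^bsub>obj C H\<^esub> n)" for n :: nat
     unfolding a(2) A.cls_H0 by (rule group_hom_pow[symmetric, OF C_group[OF A.H_base] A.Q_group A.cls_hom a(1)])
    have pw: "X [^]\<^bsub>A.QQ\<^esub> grp_index G H I \<in> A.recX ` H" if I: "subgroup I G" "U \<subseteq> I" "I \<subseteq> H" "I \<noteq> H" for I
    proof -
     obtain k where k: "k \<in> H" "A.recX k = h0c (H, U) (a [^]\<^bsub>obj C H\<^esub> grp_index G H I)"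
      using power_in_image[OF HU I(1-3) sub(1)[OF I] a(1)] by blast
     show ?thesis unfolding cp k(2)[symmetric] by (rule imageI[OF k(1)])
    qed
    show "\<exists>m. A.idx = p ^ multiplicity p A.idx * m \<and> \<not> p dvd m \<and> X [^]\<^bsub>A.QQ\<^esub> m \<in> A.recX ` H"
     if p: "prime p" "p dvd A.idx" for p
    proof -
     obtain I m where I: "subgroup I G" "U \<subseteq> I" "I \<subseteq> H" "I \<noteq> H" and m: "grp_index G H I = m"
      "A.idx = p ^ multiplicity p A.idx * m" "\<not> p dvd m" using pI[OF p] by (elim exE conjE)
     show ?thesis using pw[OF I] m by (intro exI[of _ m]) simp
    qed
    obtain p where p: "prime p" "p dvd A.idx" using 4(1) prime_factor_nat[of A.idx] by auto
    obtain I m where I: "subgroup I G" "U \<subseteq> I" "I \<subseteq> H" "I \<noteq> H" and m: "grp_index G H I = m"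
      "A.idx = p ^ multiplicity p A.idx * m" using pI[OF p] by (elim exE conjE)
    have "(X [^]\<^bsub>A.QQ\<^esub> m) [^]\<^bsub>A.QQ\<^esub> (p ^ multiplicity p A.idx) \<in> A.recX ` H"
     by (rule QQ.subgroup_nat_pow[OF A.recX_image_subgroup]) (use pw[OF I] m(1) in simp)
    then show "X [^]\<^bsub>A.QQ\<^esub> A.idx \<in> A.recX ` H"
     unfolding QQ.nat_pow_pow[OF X] by (subst m(2)) (simp only: mult.commute)
   qed
   then show ?thesis unfolding A.surj_at_iff A.rec_surj_def using A.recX_closed by blast
  qed
  moreover have "inj_at (H, U)" if ab: "A.abelian_layer"
  proof -
   obtain p q where pq: "prime p" "prime q" "p \<noteq> q" "p dvd A.idx" "q dvd A.idx"
    by (rule not_prime_power_split[OF 4])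
   have "h \<in> A.DH" if h: "h \<in> H" "A.recX h = \<one>\<^bsub>A.QQ\<^esub>" for h
   proof -
    \<comment> \<open>Injectivity is known for the quotient layer by the Sylow p-subgroup, so h lies
      in that subgroup and has p-power order in H/U. Two different primes p and q then force the
      order 1.\<close>
    have pw: "(U #> h) [^]\<^bsub>A.QG\<^esub> (p ^ multiplicity p A.idx) = \<one>\<^bsub>A.QG\<^esub>" if p: "prime p" "p dvd A.idx" for p
    proof -
     obtain I m where I: "subgroup I G" "U \<subseteq> I" "I \<subseteq> H" "I \<noteq> H" "I \<noteq> U"
      and w: "\<forall>h\<in>I. h \<in> H \<and> (U #> h) [^]\<^bsub>A.QG\<^esub> (p ^ multiplicity p A.idx) = \<one>\<^bsub>A.QG\<^esub>"
      using pI[OF p] by (elim exE conjE)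
     have n: "h \<otimes> i \<div> h \<in> I" if hi: "h \<in> H" "i \<in> I" for h i
     proof -
      have iH: "i \<in> H" using hi(2) I(3) by blast
      have "h \<otimes> i \<div> h \<div> i \<otimes> i \<in> I"
       by (rule subgroup.m_closed[OF I(1) subsetD[OF I(2) com[OF ab hi(1) iH]] hi(2)])
      then show ?thesis using hi(1) iH by (simp add: G.m_assoc)
     qed
     have b: "(H, I) \<in> base E" "inj_at (H, I)" using quo[OF I(1-3,5) n] ab by simp_all
     interpret D: fn_layer P G T \<Omega> TO \<omega> d E M C v H I by (rule fn_layerI[OF b(1)])
     have "D.abelian_layer" unfolding D.abelian_layer_def using com[OF ab] I(2) by blast
     then have "D.DH = I" by (rule D.abelian_DH)
     moreover have "h \<in> D.DH"
     proof -
      have "(H, U) \<in> idom E (H, I)" using A.intermediate_normal(2)[OF I(1-3) n] by simp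
      then have "D.recX h = \<one>\<^bsub>D.QQ\<^esub>" by (rule D.recX_one_of_sublayer[OF HU _ h])
      then show ?thesis using b(2) h(1) unfolding D.inj_at_iff D.rec_inj_def by blast
     qed
     ultimately show ?thesis using w by blast
    qed
    have hc: "U #> h \<in> carrier A.QG" using h(1) A.QG_carrier by auto
    have "Q.ord (U #> h) dvd p ^ multiplicity p A.idx" "Q.ord (U #> h) dvd q ^ multiplicity q A.idx"
     using pw[OF pq(1,4)] pw[OF pq(2,5)] Q.pow_eq_id[OF hc] by blast+
    moreover have "coprime (p ^ multiplicity p A.idx) (q ^ multiplicity q A.idx)"
     using primes_coprime[OF pq(1-3)] by simp
    ultimately have "Q.ord (U #> h) = 1" by (metis coprime_def nat_dvd_1_iff_1)
    then have "U #> h = \<one>\<^bsub>A.QG\<^esub>" using Q.ord_eq_1[OF hc] by blast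
    then have "U #> h = U" by simp
    then have "h \<in> U" using G.coset_join1[OF _ A.H.mem_carrier[OF h(1)] A.U.subgroup_axioms] by blast
    then show ?thesis using A.U_DH by blast
   qed
   then show ?thesis unfolding A.inj_at_iff A.rec_inj_def by blast
  qed
  ultimately show ?thesis by blast
 qed
qed

lemma bijective_abelian:
 "(H, U) \<in> base E \<Longrightarrow> surj_at (H, U) \<and> (fn_layer.abelian_layer G H U \<longrightarrow> inj_at (H, U))"
proof (induction "grp_index G H U" arbitrary: H U rule: less_induct)
 case less
 show ?case by (rule bijective_induction[OF less.prems less.hyps])
qed

text \<open>An element of the kernel for (H, U) is in the kernel for (H, DH). That layer is abelian,
  so the kernel there is DH, which is exactly what injectivity on (H/U)^ab asks for.\<close>

lemma bijective:
 assumes HU: "(H, U) \<in> base E" shows "surj_at (H, U)" "inj_at (H, U)"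
proof -
 show "surj_at (H, U)" using bijective_abelian[OF HU] by (rule conjunct1)
 interpret A: fn_layer P G T \<Omega> TO \<omega> d E M C v H U by (rule fn_layerI[OF HU])
 have D: "(H, A.DH) \<in> base E" "(H, U) \<in> idom E (H, A.DH)"
  using A.intermediate_normal[OF A.DH_subgroup(1) A.U_DH A.DH_subgroup(2) A.DH_conj] by simp_all
 interpret B: fn_layer P G T \<Omega> TO \<omega> d E M C v H A.DH by (rule fn_layerI[OF D(1)])
 have ab: "B.abelian_layer" unfolding B.abelian_layer_def using A.commutator_DH by blast
 then have inj: "B.rec_inj" using bijective_abelian[OF D(1)] unfolding B.inj_at_iff by blast
 show "inj_at (H, U)" unfolding A.inj_at_iff A.rec_inj_def
 proof (intro ballI impI)
  fix h assume h: "h \<in> H" "A.recX h = \<one>\<^bsub>A.QQ\<^esub>"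
  have "B.recX h = \<one>\<^bsub>B.QQ\<^esub>" by (rule B.recX_one_of_sublayer[OF HU D(2) h])
  then have "h \<in> B.DH" using inj h(1) unfolding B.rec_inj_def by blast
  then show "h \<in> A.DH" using B.abelian_DH[OF ab] by simp
 qed
qed

end

section \<open>Compatibility with restriction\<close>

context plain_group begin

section \<open>Auxiliary facts on double cosets, finite products and procyclic groups\<close>

lemma conj_pow:
 assumes "t \<in> carrier G" "h \<in> carrier G" shows "(t \<otimes> h \<div> t) [^] (n::nat) = t \<otimes> h [^] n \<div> t"
proof (induction n)
 case (Suc n)
 have "(t \<otimes> h \<div> t) [^] Suc n = t \<otimes> h [^] n \<otimes> (inv t \<otimes> t) \<otimes> h \<div> t"
  unfolding nat_pow_Suc Suc.IH using assms by (simp only: m_assoc m_closed inv_closed nat_pow_closed)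
 then show ?case using assms by (simp add: m_assoc)
qed (use assms in simp)

lemma double_coset_cong:
 assumes I: "subgroup I G" and J: "subgroup J G" and c: "s \<in> carrier G" and t: "t \<in> double_coset G I s J"
 shows "double_coset G I t J = double_coset G I s J"
proof -
 interpret I: subgroup I G by (rule I)
 interpret J: subgroup J G by (rule J)
 obtain e \<sigma> where e: "e \<in> I" "\<sigma> \<in> J" "t = e \<otimes> s \<otimes> \<sigma>" using t unfolding double_coset_eq by blast
 have c': "e \<in> carrier G" "\<sigma> \<in> carrier G" using e by auto
 have s: "s = inv e \<otimes> t \<div> \<sigma>"
 proof -
  have "inv e \<otimes> t \<div> \<sigma> = (inv e \<otimes> e) \<otimes> s \<otimes> (\<sigma> \<div> \<sigma>)"
   unfolding e(3) using c c' by (simp only: m_assoc m_closed inv_closed)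
  then show ?thesis using c c' by simp
 qed
 have sub: "double_coset G I (a \<otimes> x \<otimes> b) J \<subseteq> double_coset G I x J" if ab: "a \<in> I" "b \<in> J" "x \<in> carrier G" for a b x
 proof
  fix y assume "y \<in> double_coset G I (a \<otimes> x \<otimes> b) J"
  then obtain i j where ij: "i \<in> I" "j \<in> J" "y = i \<otimes> (a \<otimes> x \<otimes> b) \<otimes> j" unfolding double_coset_eq by blast
  have "y = (i \<otimes> a) \<otimes> x \<otimes> (b \<otimes> j)"
   unfolding ij(3) using I.mem_carrier[OF ij(1)] I.mem_carrier[OF ab(1)] J.mem_carrier[OF ij(2)] J.mem_carrier[OF ab(2)] ab(3)
   by (simp only: m_assoc m_closed)
  then show "y \<in> double_coset G I x J"
   unfolding double_coset_eq using I.m_closed[OF ij(1) ab(1)] J.m_closed[OF ab(2) ij(2)] by blast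
 qed
 have tc: "t \<in> carrier G" unfolding e(3) using c c' by simp
 show ?thesis
 proof
  show "double_coset G I t J \<subseteq> double_coset G I s J" unfolding e(3) by (rule sub[OF e(1,2) c])
  have "double_coset G I (inv e \<otimes> t \<div> \<sigma>) J \<subseteq> double_coset G I t J"
   by (rule sub[OF I.m_inv_closed[OF e(1)] J.m_inv_closed[OF e(2)] tc])
  then show "double_coset G I s J \<subseteq> double_coset G I t J" using s by simp
 qed
qed

end

lemma hom_finprod:
 assumes "comm_group A" "comm_group B" "f \<in> hom A B" "\<And>x. x \<in> R \<Longrightarrow> g x \<in> carrier A"
 shows "f (finprod A g R) = finprod B (\<lambda>x. f (g x)) R"
proof -
 interpret A: comm_group A by fact
 interpret B: comm_group B by fact
 interpret f: group_hom A B f using assms(3) by unfold_locales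
 show ?thesis using assms(4)
 proof (induction R rule: infinite_finite_induct)
  case (insert x R)
  have "f (finprod A g (insert x R)) = f (g x \<otimes>\<^bsub>A\<^esub> finprod A g R)"
   using insert by (subst A.finprod_insert) auto
  also have "\<dots> = f (g x) \<otimes>\<^bsub>B\<^esub> f (finprod A g R)"
   by (rule f.hom_mult) (use insert in \<open>auto intro!: A.finprod_closed\<close>)
  also have "\<dots> = finprod B (\<lambda>x. f (g x)) (insert x R)" using insert by (subst B.finprod_insert) auto
  finally show ?case .
 qed simp_all
qed

lemma subgroup_finprod:
 assumes "comm_group A" "subgroup N A" "\<And>x. x \<in> R \<Longrightarrow> g x \<in> N"
 shows "finprod A g R \<in> N"
proof -
 interpret A: comm_group A by fact
 interpret N: subgroup N A by fact
 show ?thesis using assms(3)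
 proof (induction R rule: infinite_finite_induct)
  case (insert x R)
  then show ?case by (subst A.finprod_insert) auto
 qed simp_all
qed

lemma finprod_telescope:
 assumes "comm_group A" "\<And>j. q j \<in> carrier A"
 shows "finprod A (\<lambda>j. inv\<^bsub>A\<^esub> q (Suc j) \<otimes>\<^bsub>A\<^esub> q j) {..<n::nat} = q 0 \<div>\<^bsub>A\<^esub> q n"
proof -
 interpret A: comm_group A by fact
 have q: "q j \<in> carrier A" for j by (rule assms(2))
 show ?thesis
 proof (induction n)
  case 0
  show ?case using q by simp
 next
  case (Suc n)
  have "finprod A (\<lambda>j. inv\<^bsub>A\<^esub> q (Suc j) \<otimes>\<^bsub>A\<^esub> q j) (insert n {..<n}) =
    inv\<^bsub>A\<^esub> q (Suc n) \<otimes>\<^bsub>A\<^esub> q n \<otimes>\<^bsub>A\<^esub> (q 0 \<div>\<^bsub>A\<^esub> q n)"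
   by (subst A.finprod_insert) (use q Suc in auto)
  also have "\<dots> = (q n \<div>\<^bsub>A\<^esub> q n) \<otimes>\<^bsub>A\<^esub> (q 0 \<div>\<^bsub>A\<^esub> q (Suc n))"
   using q by (simp only: A.m_ac A.m_closed A.inv_closed)
  also have "\<dots> = q 0 \<div>\<^bsub>A\<^esub> q (Suc n)" using q by simp
  finally show ?case by (simp add: lessThan_Suc)
 qed
qed

context pro_P_degree begin

lemma closedin_left_translate: assumes "closedin T S" "c \<in> carrier G" shows "closedin T {x \<in> carrier G. inv c \<otimes> x \<in> S}"
proof -
 have "continuous_map T T (\<lambda>x. inv c \<otimes> x)"
  using assms by (intro G.continuous_mult G.continuous_const continuous_map_id[unfolded id_def]) auto
 then show ?thesis using closedin_continuous_map_preimage[OF _ assms(1), of T "\<lambda>x. inv c \<otimes> x"] by simp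
qed

text \<open>The m translates of \<open>cyc (h [^] m)\<close> by powers of h are closed and cover the
  powers of h, hence also their closure \<open>cyc h\<close>.\<close>

lemma cyc_pow_coset:
 assumes h: "h \<in> carrier G" and m: "0 < (m::nat)" and s: "s \<in> cyc h"
 shows "\<exists>j<m. inv (h [^] j) \<otimes> s \<in> cyc (h [^] m)"
proof -
 let ?S = "cyc (h [^] m)"
 define X where "X = (\<Union>j\<in>{..<m}. {x \<in> carrier G. inv (h [^] j) \<otimes> x \<in> ?S})"
 have hm: "h [^] m \<in> carrier G" using h by simp
 interpret S: subgroup ?S G by (rule cyc_subgroup[OF hm])
 have "closedin T X" unfolding X_def by (intro closedin_Union) (use h closedin_left_translate[OF cyc_closed] in auto)
 moreover have "generate G {h} \<subseteq> X"
 proof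
  fix x assume "x \<in> generate G {h}"
  then obtain k :: int where k: "x = h [^] k" using G.generate_pow[OF h] by blast
  define j where "j = nat (k mod int m)"
  have j: "j < m" "int j = k mod int m" using m by (simp_all add: j_def nat_less_iff)
  have "h [^] k = h [^] (int j + int m * (k div int m))" using j(2) by simp
  also have "\<dots> = h [^] (int j) \<otimes> (h [^] (int m)) [^] (k div int m)"
   using h by (simp only: G.int_pow_mult[symmetric] G.int_pow_pow)
  finally have "x = h [^] j \<otimes> (h [^] m) [^] (k div int m)" unfolding k by (simp only: int_pow_int)
  then have "inv (h [^] j) \<otimes> x = (h [^] m) [^] (k div int m)" using h hm by (simp add: G.m_assoc[symmetric])
  moreover have "(h [^] m) [^] (k div int m) \<in> ?S"
  proof -
   have "(h [^] m) [^] (k div int m) \<in> generate G {h [^] m}" unfolding G.generate_pow[OF hm] by blast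
   also have "\<dots> \<subseteq> ?S" by (rule G.generate_subgroup_incl[OF _ S.subgroup_axioms]) (use cyc_self[OF hm] in simp)
   finally show ?thesis .
  qed
  ultimately have "inv (h [^] j) \<otimes> x \<in> ?S" by simp
  moreover have "x \<in> carrier G" using k h by simp
  ultimately show "x \<in> X" unfolding X_def using j(1) by blast
 qed
 ultimately have "cyc h \<subseteq> X" unfolding cyc_def by (intro closure_of_minimal)
 then show ?thesis using s unfolding X_def by blast
qed

end

context galois_layer begin

text \<open>If s i lies in I, so does s, since I contains the inertia of U. Modulo
  \<open>cyc (h [^] m)\<close>, which lies in I, s is a power h^j with j < m, and minimality of m
  forces j = 0.\<close>

lemma Sg_inter:
 assumes I: "subgroup I G" "closedin T I" "U \<subseteq> I" and h: "h \<in> carrier G" and m: "0 < (m::nat)" "h [^] m \<in> I"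
  and min: "\<And>j. 0 < j \<Longrightarrow> j < m \<Longrightarrow> h [^] j \<notin> I"
 shows "I \<inter> Sg h = Sg (h [^] m)"
proof -
 interpret I: subgroup I G by (rule I)
 have S: "cyc (h [^] m) \<subseteq> I" by (rule cyc_minimal[OF I(1,2) m(2)])
 have IU: "I_of U \<subseteq> I" using I(3) by (auto simp: mem_I_of)
 show ?thesis
 proof (intro equalityI subsetI)
  fix x assume x: "x \<in> Sg (h [^] m)"
  then obtain s i where si: "s \<in> cyc (h [^] m)" "i \<in> I_of U" "x = s \<otimes> i" using mem_Sg by blast
  have "x \<in> I" unfolding si(3) by (rule I.m_closed[OF subsetD[OF S si(1)] subsetD[OF IU si(2)]])
  moreover have "x \<in> Sg h" using si cyc_pow_subset[OF h] mem_Sg by blast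
  ultimately show "x \<in> I \<inter> Sg h" by blast
 next
  fix x assume x: "x \<in> I \<inter> Sg h"
  then obtain s i where si: "s \<in> cyc h" "i \<in> I_of U" "x = s \<otimes> i" using mem_Sg by blast
  have iI: "i \<in> I" using IU si(2) by blast
  have sc: "s \<in> carrier G" using si(1) subgroup.subset[OF cyc_subgroup[OF h]] by blast
  have "x \<div> i \<in> I" using x iI by simp
  then have sI: "s \<in> I" using si(3) sc iI by (simp add: G.m_assoc)
  obtain j where j: "j < m" "inv (h [^] j) \<otimes> s \<in> cyc (h [^] m)" using cyc_pow_coset[OF h m(1) si(1)] by blast
  have "s \<div> (inv (h [^] j) \<otimes> s) \<in> I" using sI j(2) S by auto
  moreover have "s \<div> (inv (h [^] j) \<otimes> s) = h [^] j"
  proof -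
   have "s \<div> (inv (h [^] j) \<otimes> s) = s \<otimes> (inv s \<otimes> h [^] j)" using h sc by (simp add: G.inv_mult_group)
   then show ?thesis using h sc by (simp add: G.m_assoc[symmetric])
  qed
  ultimately have "h [^] j \<in> I" by simp
  then have "j = 0" using min j(1) by blast
  then have "s \<in> cyc (h [^] m)" using j(2) sc by simp
  then show "x \<in> Sg (h [^] m)" using si mem_Sg by blast
 qed
qed

end

locale fn_res = fn_layer +
 fixes I
 assumes IU: "(I, U) \<in> rdom E (H, U)"
begin

lemma IU_base: "(I, U) \<in> base E" by (rule E_dom(1)[OF HU IU])

sublocale B: fn_layer P G T \<Omega> TO \<omega> d E M C v I U by (rule fn_layerI[OF IU_base])

lemma I_rdom: "I \<in> rdom M H" and IH: "I \<subseteq> H" using E_rdom[OF HU IU] by auto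

lemma I_H: "i \<in> I \<Longrightarrow> i \<in> H" using IH by blast

section \<open>The Mackey formula for restriction to I\<close>

lemma representatives_exist: "\<exists>R\<subseteq>H. bij_betw (\<lambda>h. double_coset G I h J) R (double_cosets G I H J)"
proof -
 obtain R where R: "R \<subseteq> H" "inj_on (\<lambda>h. double_coset G I h J) R"
  "(\<lambda>h. double_coset G I h J) ` H = (\<lambda>h. double_coset G I h J) ` R"
  using subset_image_inj[THEN iffD1, OF order_refl[of "(\<lambda>h. double_coset G I h J) ` H"]] by blast
 show ?thesis unfolding double_cosets_def bij_betw_def by (rule exI[of _ R]) (simp only: R simp_thms)
qed

text \<open>U is normal in H and contained in I, so every Mackey factor is itself an induction from
  U to I.\<close>

lemma norm_res: assumes "a \<in> norm_group C H U" shows "res I H a \<in> norm_group C I U"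
proof -
 obtain c where c: "c \<in> CC U" "a = ind H U c" using assms by (auto simp: norm_group_def)
 obtain R where R: "R \<subseteq> H" "bij_betw (\<lambda>h. double_coset G I h U) R (double_cosets G I H U)"
  using representatives_exist by blast
 have mem: "ind I (I \<inter> conj_set G h U) (con h (conj_set G (inv h) I \<inter> U) (res (conj_set G (inv h) I \<inter> U) U c)) \<in> norm_group C I U"
  if h: "h \<in> R" for h
 proof -
  have hH: "h \<in> H" using h R(1) by blast
  have hc: "h \<in> carrier G" using hH by simp
  have 1: "I \<inter> conj_set G h U = U" using U_conj_set[OF hH] B.UH by auto
  have "conj_set G (inv h) U = U" by (rule U_conj_set[OF H.m_inv_closed[OF hH]])
  moreover have "conj_set G (inv h) U \<subseteq> conj_set G (inv h) I" unfolding G.conj_set_eq using B.UH by (rule image_mono)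
  ultimately have 2: "conj_set G (inv h) I \<inter> U = U" by blast
  have "con h U c \<in> CC U" using con_closed[OF U_base hc c(1)] U_conj_set[OF hH] by simp
  then show ?thesis unfolding 1 2 res_id[OF U_base c(1)] norm_group_def by (rule imageI)
 qed
 show ?thesis unfolding c(2) mackey[OF H_base I_rdom U_idom R c(1)]
  by (rule subgroup_finprod[OF C_comm_group[OF B.H_base] B.Nm_sub mem])
qed

lemma H0_res:
 shows "a \<in> CC H \<Longrightarrow> res_map h0 (I, U) (H, U) (h0c (H, U) a) = h0c (I, U) (res I H a)"
  and "res_map h0 (I, U) (H, U) \<in> hom (obj h0 (H, U)) (obj h0 (I, U))"
proof -
 note l = H0_induced[OF HU IU_base res_hom[OF H_base I_rdom] norm_res]
 show "a \<in> CC H \<Longrightarrow> res_map h0 (I, U) (H, U) (h0c (H, U) a) = h0c (I, U) (res I H a)"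
  unfolding H0_res_map by (rule l(1))
 show "res_map h0 (I, U) (H, U) \<in> hom (obj h0 (H, U)) (obj h0 (I, U))" unfolding H0_res_map by (rule l(2))
qed

text \<open>For g = t h t^-1 this is the length of the orbit of t^-1 I under h, acting on the left
  cosets of I in H.\<close>

definition per where "per g = (LEAST m::nat. 0 < m \<and> g [^] m \<in> I)"

lemma per: assumes "g \<in> H"
 shows "0 < per g" "g [^] per g \<in> I" "\<And>j. 0 < j \<Longrightarrow> j < per g \<Longrightarrow> g [^] j \<notin> I" "Pnum (per g)"
proof -
 have "0 < idx \<and> g [^] idx \<in> I" using pow_idx[OF assms] idx_pos B.UH by blast
 then have p: "0 < per g \<and> g [^] per g \<in> I" unfolding per_def by (rule LeastI)
 then show "0 < per g" "g [^] per g \<in> I" by simp_all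
 show min: "g [^] j \<notin> I" if "0 < j" "j < per g" for j
  using not_less_Least[of j "\<lambda>m. 0 < m \<and> g [^] m \<in> I"] that unfolding per_def by blast
 have gc: "g \<in> carrier G" using assms by simp
 have "per g dvd idx" by (rule G.exponent_dvd[OF B.H_sub gc p min]) (use pow_idx[OF assms] B.UH in auto)
 then show "Pnum (per g)" by (rule Pnum_dvd[OF Pnum_idx])
qed

text \<open>Put g = t h t^-1 and let m be its period. The factor at t is induced from
  \<open>I \<inter> Sg g\<close> = \<open>Sg (g [^] m)\<close> and applied to a conjugate of a
  restricted prime, which is again prime; so it belongs to the lift g^m over I. Period and residue
  degrees are P-numbers, hence P'(n) is the right exponent for g^m too.\<close>

lemma mackey_term:
 assumes h: "frob_lift h n" and p: "is_prime (Sg h) \<pi>" and t: "t \<in> H"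
 defines "Y \<equiv> ind I (I \<inter> conj_set G t (Sg h)) (con t (conj_set G (inv t) I \<inter> Sg h) (res (conj_set G (inv t) I \<inter> Sg h) (Sg h) \<pi>))"
 shows "Y \<in> CC I" "B.recX ((t \<otimes> h \<div> t) [^] per (t \<otimes> h \<div> t)) = B.cls (Y [^]\<^bsub>obj C I\<^esub> P'_part P n)"
proof -
 define g where "g = t \<otimes> h \<div> t"
 define m where "m = per g"
 define S where "S = conj_set G (inv t) I \<inter> Sg h"
 have tc: "t \<in> carrier G" and hH: "h \<in> H" and hc: "h \<in> carrier G" and n: "0 < n" using t h by auto
 have itc: "inv t \<in> carrier G" using tc by simp
 have gH: "g \<in> H" and gc: "g \<in> carrier G" using t hH by (auto simp: g_def)
 note per = per[OF gH, folded m_def]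
 have Scj: "conj_set G t (Sg h) = Sg g" using Sigma_conj[OF tc hc U.subset] U_conj_set[OF t] by (simp add: g_def)
 have Int: "I \<inter> Sg g = Sg (g [^] m)"
  by (rule Sg_inter[OF B.H_sub inert_finite_closed[OF B.H_inert] B.UH gc per(1,2)]) (rule per(3))
 have Sgc: "Sg h \<subseteq> carrier G" using Sg_sub_H[OF hH] H.subset by blast
 have Stc: "conj_set G t S = Sg (g [^] m)"
  unfolding S_def G.conj_set_Int[OF tc G.conj_set_subset[OF itc B.H.subset] Sgc]
   G.conj_set_inv(2)[OF tc B.H.subset] Scj Int ..
 have dg: "d g = \<omega> \<up> (f_of H * n)" using d_conj[OF tc hc] h by (simp add: g_def)
 have dgm: "d (g [^] m) = \<omega> \<up> (f_of H * n * m)" by (rule pow_d[OF gH dg])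
 obtain b where b: "f_of I = f_of H * b" "Pnum b" by (rule f_of_mult[OF H_inert B.H_inert IH])
 have "d (g [^] m) \<in> Om (f_of I)" using imageI[OF per(2), of d] d_inert_finite[OF B.H_inert] by simp
 then have "f_of I dvd f_of H * n * m" unfolding dgm by (rule omega_in_Om[OF Pnum_f[OF B.H_inert]])
 then have "b dvd n * m" using b(1) fH_pos by (simp add: mult.assoc)
 then obtain n' where n': "n * m = b * n'" by blast
 then have n'0: "0 < n'" using n per(1) by (metis mult_0_right nat_0_less_mult_iff not_gr_zero)
 have l: "B.frob_lift (g [^] m) n'" using per(2) n'0 dgm n' b(1) by (simp add: mult.assoc)
 have pp: "P'_part P n' = P'_part P n"
  using P'_part_mult[OF b(2) n'0] P'_part_mult[OF per(4) n] n' by (simp add: mult.commute)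
 note oSg = Sg_open'[OF h]
 have SgM: "Sg h \<in> base M" by (rule open_base'[OF oSg])
 have Uc: "U \<subseteq> conj_set G (inv t) I"
 proof -
  have "conj_set G (inv t) U \<subseteq> conj_set G (inv t) I" unfolding G.conj_set_eq by (rule image_mono[OF B.UH])
  then show ?thesis unfolding U_conj_set[OF H.m_inv_closed[OF t]] .
 qed
 have oC: "open_subgroup_of G T (conj_set G (inv t) I) H"
 proof (rule intermediate_open[OF G.conj_set_subgroup[OF itc B.H_sub]])
  show "U \<subseteq> conj_set G (inv t) I" by (rule Uc)
  show "conj_set G (inv t) I \<subseteq> H" unfolding G.conj_set_eq
  proof (rule image_subsetI)
   fix i assume "i \<in> I"
   then show "inv t \<otimes> i \<div> (inv t) \<in> H" by (intro H.m_closed H.m_inv_closed t I_H)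
  qed
 qed
 have oS: "open_subgroup_of G T S H"
 proof -
  note c = oC[unfolded open_subgroup_of_def] oSg[unfolded open_subgroup_of_def]
  show ?thesis unfolding S_def open_subgroup_of_def
  proof (intro conjI)
   show "subgroup (conj_set G (inv t) I \<inter> Sg h) G" by (rule G.subgroups_Inter_pair) (use c in auto)
   show "conj_set G (inv t) I \<inter> Sg h \<subseteq> H" using c by auto
   show "openin (subtopology T H) (conj_set G (inv t) I \<inter> Sg h)" by (rule openin_Int) (use c in auto)
  qed
 qed
 have SS: "S \<subseteq> Sg h" by (simp add: S_def)
 have SM: "S \<in> base M" by (rule open_base'[OF oS])
 have r: "S \<in> rdom M (Sg h)" by (rule open_open_rdom(1)[OF oSg oS SS])
 have \<pi>: "\<pi> \<in> CC (Sg h)" "v (Sg h) \<pi> = \<omega>" using p by (simp_all add: is_prime_def)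
 have Ieq: "I_of (Sg h) = I_of S"
 proof -
  have "I_of (Sg h) = I_of U" by (rule I_Sg[OF hH, of "f_of H * n"]) (use h fH_pos in auto)
  then show ?thesis unfolding S_def using Uc by (auto simp: mem_I_of set_eq_iff)
 qed
 define \<pi>' where "\<pi>' = con t S (res S (Sg h) \<pi>)"
 have rc: "res S (Sg h) \<pi> \<in> CC S" by (rule res_closed[OF SgM r \<pi>(1)])
 have pc: "\<pi>' \<in> CC (Sg (g [^] m))" unfolding \<pi>'_def using con_closed[OF SM tc rc] Stc by simp
 have "v (Sg (g [^] m)) \<pi>' = \<omega>"
  unfolding \<pi>'_def using v_con[OF SM tc rc] v_res_unram[OF SgM r \<pi>(1) Ieq] \<pi>(2) Stc by simp
 then have p': "B.is_prime (B.Sg (g [^] m)) \<pi>'" using pc by (simp add: B.is_prime_def)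
 have Y: "Y = ind I (Sg (g [^] m)) \<pi>'" unfolding Y_def \<pi>'_def S_def[symmetric] Scj Int ..
 show "Y \<in> CC I" unfolding Y by (rule ind_closed[OF B.H_base open_idom[OF B.H_base B.Sg_open'[OF l]] pc])
 show "B.recX ((t \<otimes> h \<div> t) [^] per (t \<otimes> h \<div> t)) = B.cls (Y [^]\<^bsub>obj C I\<^esub> P'_part P n)"
  unfolding g_def[symmetric] m_def[symmetric] B.recX_lift[OF l] B.rec0_eq[OF l p'] Y pp ..
qed

lemma res_reciprocity:
 assumes h: "frob_lift h n" and p: "is_prime (Sg h) \<pi>" and R: "R \<subseteq> H"
  "bij_betw (\<lambda>t. double_coset G I t (Sg h)) R (double_cosets G I H (Sg h))"
 shows "B.cls (res I H (xval h n \<pi>)) =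
  finprod B.QQ (\<lambda>t. B.recX ((t \<otimes> h \<div> t) [^] per (t \<otimes> h \<div> t))) R"
proof -
 let ?k = "P'_part P n"
 define Y where "Y t = ind I (I \<inter> conj_set G t (Sg h)) (con t (conj_set G (inv t) I \<inter> Sg h) (res (conj_set G (inv t) I \<inter> Sg h) (Sg h) \<pi>))" for t
 have Y: "Y t \<in> CC I" "B.recX ((t \<otimes> h \<div> t) [^] per (t \<otimes> h \<div> t)) = B.cls (Y t [^]\<^bsub>obj C I\<^esub> ?k)" if "t \<in> R" for t
  using mackey_term[OF h p subsetD[OF R(1) that]] unfolding Y_def by auto
 have \<pi>: "\<pi> \<in> CC (Sg h)" using p by (simp add: is_prime_def)
 note oSg = Sg_open'[OF h]
 have i: "Sg h \<in> idom M H" by (rule open_idom[OF H_base oSg])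
 have ic: "ind H (Sg h) \<pi> \<in> CC H" by (rule ind_closed[OF H_base i \<pi>])
 interpret CI: comm_group "obj C I" by (rule C_comm_group[OF B.H_base])
 have hm: "(\<lambda>y. B.cls (y [^]\<^bsub>obj C I\<^esub> ?k)) \<in> hom (obj C I) B.QQ"
 proof (rule homI)
  show "B.cls (y [^]\<^bsub>obj C I\<^esub> ?k) \<in> carrier B.QQ" if "y \<in> CC I" for y
   by (rule B.cls_closed) (use that in simp)
  show "B.cls ((x \<otimes>\<^bsub>obj C I\<^esub> y) [^]\<^bsub>obj C I\<^esub> ?k) = B.cls (x [^]\<^bsub>obj C I\<^esub> ?k) \<otimes>\<^bsub>B.QQ\<^esub> B.cls (y [^]\<^bsub>obj C I\<^esub> ?k)"
   if xy: "x \<in> CC I" "y \<in> CC I" for x y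
   unfolding CI.nat_pow_distrib[OF xy] by (rule B.cls_mult) (use xy in simp_all)
 qed
 have "res I H (ind H (Sg h) \<pi>) = finprod (obj C I) Y R" unfolding mackey[OF H_base I_rdom i R \<pi>] Y_def ..
 then have "res I H (xval h n \<pi>) = finprod (obj C I) Y R [^]\<^bsub>obj C I\<^esub> ?k"
  using group_hom_pow[OF C_group[OF H_base] C_group[OF B.H_base] res_hom[OF H_base I_rdom] ic] by simp
 also have "B.cls \<dots> = finprod B.QQ (\<lambda>t. B.cls (Y t [^]\<^bsub>obj C I\<^esub> ?k)) R"
  by (rule hom_finprod[OF CI.comm_group_axioms B.Q_comm hm Y(1)])
 also have "\<dots> = finprod B.QQ (\<lambda>t. B.recX ((t \<otimes> h \<div> t) [^] per (t \<otimes> h \<div> t))) R"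
  by (rule comm_monoid.finprod_cong'[OF comm_group.axioms(1)[OF B.Q_comm]])
   (use Y B.cls_closed in auto)
 finally show ?thesis .
qed

end

context fn_layer begin

lemma PI_comm: "comm_group PI" unfolding PI_eq by (rule group.derived_quot_is_comm_group[OF QG_group])

lemma Upsilon_hom: "Ups \<in> hom PI QQ"
proof (rule homI)
 fix X assume "X \<in> carrier PI"
 then obtain h where h: "h \<in> H" "X = pc (H, U) h" unfolding PI_carrier by blast
 show "Ups X \<in> carrier QQ" unfolding h(2) Upsilon_pi_class[OF h(1)] by (rule recX_closed[OF h(1)])
next
 fix X Y assume "X \<in> carrier PI" "Y \<in> carrier PI"
 then obtain h k where h: "h \<in> H" "X = pc (H, U) h" and k: "k \<in> H" "Y = pc (H, U) k" unfolding PI_carrier by blast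
 have "X \<otimes>\<^bsub>PI\<^esub> Y = pc (H, U) (h \<otimes> k)" unfolding h(2) k(2) using hom_mult[OF pi_class_hom, of h k] h(1) k(1) by simp
 then show "Ups (X \<otimes>\<^bsub>PI\<^esub> Y) = Ups X \<otimes>\<^bsub>QQ\<^esub> Ups Y"
  unfolding h(2) k(2) using Upsilon_pi_class[OF h(1)] Upsilon_pi_class[OF k(1)]
   Upsilon_pi_class[OF H.m_closed[OF h(1) k(1)]] recX_mult[OF h(1) k(1)] by (simp only:)
qed

lemma ab_class_HU: "ab_class QG (discrete_topology (carrier QG)) (U #> h) = pc (H, U) h"
 by (simp add: pi_class_def quot_group_HU quot_top_HU)

end

context fn_res begin

section \<open>The transfer from H/U to I/U as a product over the left cosets of I\<close>

definition kap where "kap x = (\<lambda>i. U #> (x \<otimes> i)) ` I"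

abbreviation lc where "lc X c \<equiv> X <#\<^bsub>QG\<^esub> c"

lemma lc_image: "lc X c = (\<lambda>Y. X \<otimes>\<^bsub>QG\<^esub> Y) ` c" by (auto simp: l_coset_def)

lemma kap_lcos: assumes "x \<in> H" shows "lc (U #> x) (carrier B.QG) = kap x"
 unfolding lc_image B.QG_carrier kap_def image_image
 by (rule image_cong[OF refl]) (rule QG_mult[symmetric, OF assms I_H])

lemma kap_act: assumes "h \<in> H" "x \<in> H" shows "lc (U #> h) (kap x) = kap (h \<otimes> x)"
 unfolding lc_image kap_def image_image
proof (rule image_cong[OF refl])
 fix i assume i: "i \<in> I"
 have "U #> (h \<otimes> (x \<otimes> i)) = (U #> h) \<otimes>\<^bsub>QG\<^esub> (U #> (x \<otimes> i))"
  by (rule QG_mult[OF assms(1) H.m_closed[OF assms(2) I_H[OF i]]])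
 then show "(U #> h) \<otimes>\<^bsub>QG\<^esub> (U #> (x \<otimes> i)) = U #> (h \<otimes> x \<otimes> i)"
  using assms I_H[OF i] by (simp add: G.m_assoc)
qed

lemma mem_kap:
 assumes x: "x \<in> H" and z: "z \<in> H" shows "U #> z \<in> kap x \<longleftrightarrow> inv x \<otimes> z \<in> I"
proof
 assume "U #> z \<in> kap x"
 then obtain i where i: "i \<in> I" "U #> z = U #> (x \<otimes> i)" unfolding kap_def by blast
 have c: "x \<in> carrier G" "z \<in> carrier G" "i \<in> carrier G" using x z i by auto
 have "z \<div> (x \<otimes> i) \<in> U" using coset_U_iff[OF z H.m_closed[OF x I_H[OF i(1)]]] i(2) by simp
 then have "inv x \<otimes> (z \<div> (x \<otimes> i)) \<otimes> x \<in> I" using U_conj'[OF x] B.UH by blast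
 moreover have "inv x \<otimes> (z \<div> (x \<otimes> i)) \<otimes> x = inv x \<otimes> z \<div> i"
  using c by (simp add: G.inv_mult_group G.m_assoc)
 ultimately have "inv x \<otimes> z \<div> i \<otimes> i \<in> I" using i(1) by (metis B.H.m_closed)
 then show "inv x \<otimes> z \<in> I" using c by (simp add: G.m_assoc)
next
 assume i: "inv x \<otimes> z \<in> I"
 have "x \<otimes> (inv x \<otimes> z) = z" using x z by (simp add: G.m_assoc[symmetric])
 then show "U #> z \<in> kap x" unfolding kap_def using i by (metis imageI)
qed

lemma kap_eq_iff:
 assumes x: "x \<in> H" and y: "y \<in> H" shows "kap x = kap y \<longleftrightarrow> inv x \<otimes> y \<in> I"
proof
 assume "kap x = kap y"
 moreover have "U #> y \<in> kap y" using mem_kap[OF y y] y by simp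
 ultimately show "inv x \<otimes> y \<in> I" using mem_kap[OF x y] by simp
next
 have sub: "kap y \<subseteq> kap x" if xy: "x \<in> H" "y \<in> H" "inv x \<otimes> y \<in> I" for x y
 proof
  fix Z assume "Z \<in> kap y"
  then obtain i where i: "i \<in> I" "Z = U #> (y \<otimes> i)" unfolding kap_def by blast
  have "inv x \<otimes> (y \<otimes> i) = inv x \<otimes> y \<otimes> i" using xy i I_H by (simp add: G.m_assoc)
  then have "inv x \<otimes> (y \<otimes> i) \<in> I" using B.H.m_closed[OF xy(3) i(1)] by simp
  then show "Z \<in> kap x" unfolding i(2) using mem_kap[OF xy(1) H.m_closed[OF xy(2) I_H[OF i(1)]]] by simp
 qed
 assume i: "inv x \<otimes> y \<in> I"
 have "inv (inv x \<otimes> y) = inv y \<otimes> x" using x y by (simp add: G.inv_mult_group)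
 then have "inv y \<otimes> x \<in> I" using B.H.m_inv_closed[OF i] by simp
 then show "kap x = kap y" using sub[OF x y i] sub[OF y x] by blast
qed

text \<open>The representatives in \<open>transfer\<close> are chosen by \<open>SOME\<close> inside
  H/U; \<open>rr\<close> lifts exactly this choice to H, so that the factors of the transfer can be
  computed in I.\<close>

definition rr where "rr c = (SOME z. z \<in> H \<and> U #> z = (SOME X. X \<in> c))"

lemma rr_kap:
 assumes x: "x \<in> H"
 shows "rr (kap x) \<in> H" "U #> rr (kap x) = (SOME X. X \<in> kap x)" "inv x \<otimes> rr (kap x) \<in> I"
proof -
 have "U #> x \<in> kap x" using mem_kap[OF x x] x by simp
 then have s: "(SOME X. X \<in> kap x) \<in> kap x" by (rule someI)
 then obtain i where i: "i \<in> I" "(SOME X. X \<in> kap x) = U #> (x \<otimes> i)" unfolding kap_def by blast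
 have "rr (kap x) \<in> H \<and> U #> rr (kap x) = (SOME X. X \<in> kap x)"
  unfolding rr_def by (rule someI[of _ "x \<otimes> i"]) (use i(2) H.m_closed[OF x I_H[OF i(1)]] in simp)
 then show r: "rr (kap x) \<in> H" "U #> rr (kap x) = (SOME X. X \<in> kap x)" by simp_all
 show "inv x \<otimes> rr (kap x) \<in> I" using mem_kap[OF x r(1)] s r(2) by simp
qed

definition delta where "delta h c = inv (rr (lc (U #> h) c)) \<otimes> h \<otimes> rr c"

text \<open>The factor at x is q(h x)^-1 q(x) with q(x) = x^-1 \<open>rr (kap x)\<close> in I. This
  coboundary form is the reason why products along orbits of h telescope.\<close>

lemma delta_kap:
 assumes h: "h \<in> H" and x: "x \<in> H"
 shows "delta h (kap x) = inv (inv (h \<otimes> x) \<otimes> rr (kap (h \<otimes> x))) \<otimes> (inv x \<otimes> rr (kap x))" "delta h (kap x) \<in> I"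
proof -
 have hx: "h \<otimes> x \<in> H" using h x by simp
 have c: "h \<in> carrier G" "x \<in> carrier G" "rr (kap (h \<otimes> x)) \<in> carrier G" "rr (kap x) \<in> carrier G"
  using h x rr_kap(1)[OF hx] rr_kap(1)[OF x] by auto
 have "inv (inv (h \<otimes> x) \<otimes> rr (kap (h \<otimes> x))) = inv (rr (kap (h \<otimes> x))) \<otimes> (h \<otimes> x)"
  using c by (simp add: G.inv_mult_group)
 then have "inv (inv (h \<otimes> x) \<otimes> rr (kap (h \<otimes> x))) \<otimes> (inv x \<otimes> rr (kap x)) =
   inv (rr (kap (h \<otimes> x))) \<otimes> h \<otimes> (x \<div> x) \<otimes> rr (kap x)"
  using c by (simp only: G.m_assoc G.m_closed G.inv_closed)
 then show eq: "delta h (kap x) = inv (inv (h \<otimes> x) \<otimes> rr (kap (h \<otimes> x))) \<otimes> (inv x \<otimes> rr (kap x))"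
  unfolding delta_def kap_act[OF h x] using c by simp
 show "delta h (kap x) \<in> I" unfolding eq
  by (rule B.H.m_closed[OF B.H.m_inv_closed[OF rr_kap(3)[OF hx]] rr_kap(3)[OF x]])
qed

definition trans_prod where "trans_prod a = finprod (ab_group (QG\<lparr>carrier := carrier B.QG\<rparr>) (subtopology (discrete_topology (carrier QG)) (carrier B.QG)))
    (\<lambda>c. ab_class (QG\<lparr>carrier := carrier B.QG\<rparr>) (subtopology (discrete_topology (carrier QG)) (carrier B.QG))
      (inv\<^bsub>QG\<^esub> (SOME x. x \<in> a <#\<^bsub>QG\<^esub> c) \<otimes>\<^bsub>QG\<^esub> a \<otimes>\<^bsub>QG\<^esub> (SOME x. x \<in> c)))
    ((\<lambda>x. x <#\<^bsub>QG\<^esub> carrier B.QG) ` carrier QG)"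

lemma pi_res_map: "res_map (pi_fun G T) (I, U) (H, U) =
  induced_map (carrier QG) (ab_class QG (discrete_topology (carrier QG))) trans_prod"
 by (simp add: pi_fun_def transfer_def quot_group_HU quot_top_HU B.quot_group_HU trans_prod_def[abs_def])

lemma QG_restrict: "QG\<lparr>carrier := carrier B.QG\<rparr> = B.QG"
proof -
 have "set_mult (G\<lparr>carrier := H\<rparr>) = set_mult (G\<lparr>carrier := I\<rparr>)" by (intro ext) (simp add: set_mult_def)
 then show ?thesis by (simp add: FactGroup_def)
qed

lemma QG_subset: "carrier B.QG \<subseteq> carrier QG" unfolding B.QG_carrier QG_carrier by (rule image_mono[OF IH])

lemma trans_prod_eq:
 assumes h: "h \<in> H"
 shows "trans_prod (U #> h) = finprod B.PI (\<lambda>c. pc (I, U) (delta h c)) (kap ` H)"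
proof -
 have st: "subtopology (discrete_topology (carrier QG)) (carrier B.QG) = discrete_topology (carrier B.QG)"
  using QG_subset by (simp add: Int_absorb1)
 have PI: "ab_group B.QG (discrete_topology (carrier B.QG)) = B.PI"
  by (simp add: pi_fun_def B.quot_group_HU B.quot_top_HU)
 have K: "(\<lambda>x. x <#\<^bsub>QG\<^esub> carrier B.QG) ` carrier QG = kap ` H"
  unfolding QG_carrier image_image by (rule image_cong[OF refl kap_lcos])
 have inner: "inv\<^bsub>QG\<^esub> (SOME X. X \<in> lc (U #> h) (kap x)) \<otimes>\<^bsub>QG\<^esub> (U #> h) \<otimes>\<^bsub>QG\<^esub> (SOME X. X \<in> kap x) = U #> delta h (kap x)"
  if x: "x \<in> H" for x
 proof -
  have hx: "h \<otimes> x \<in> H" using h x by simp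
  note r = rr_kap(1)[OF hx] rr_kap(1)[OF x]
  have "U #> (inv (rr (kap (h \<otimes> x))) \<otimes> h \<otimes> rr (kap x)) =
   (U #> inv (rr (kap (h \<otimes> x)))) \<otimes>\<^bsub>QG\<^esub> (U #> h) \<otimes>\<^bsub>QG\<^esub> (U #> rr (kap x))"
   by (simp only: QG_mult H.m_closed H.m_inv_closed h r)
  then show ?thesis
   unfolding kap_act[OF h x] delta_def QG_inv[OF r(1)] rr_kap(2)[OF x] rr_kap(2)[OF hx] by (rule sym)
 qed
 show ?thesis unfolding trans_prod_def QG_restrict st PI K
 proof (rule comm_monoid.finprod_cong'[OF comm_group.axioms(1)[OF B.PI_comm] refl])
  show "(\<lambda>c. pc (I, U) (delta h c)) \<in> kap ` H \<rightarrow> carrier B.PI"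
   using delta_kap(2)[OF h] by (auto simp: B.PI_carrier)
  fix c assume "c \<in> kap ` H"
  then obtain x where x: "x \<in> H" "c = kap x" by blast
  show "ab_class B.QG (discrete_topology (carrier B.QG))
    (inv\<^bsub>QG\<^esub> (SOME x. x \<in> lc (U #> h) c) \<otimes>\<^bsub>QG\<^esub> (U #> h) \<otimes>\<^bsub>QG\<^esub> (SOME x. x \<in> c)) = pc (I, U) (delta h c)"
   unfolding x(2) inner[OF x(1)] by (rule B.ab_class_HU)
 qed
qed

lemma trans_prod_closed: "h \<in> H \<Longrightarrow> trans_prod (U #> h) \<in> carrier B.PI" unfolding trans_prod_eq
 by (rule comm_monoid.finprod_closed[OF comm_group.axioms(1)[OF B.PI_comm]])
  (use delta_kap(2) in \<open>auto simp: B.PI_carrier\<close>)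

lemma Upsilon_trans_prod:
 assumes h: "h \<in> H"
 shows "B.Ups (trans_prod (U #> h)) = finprod B.QQ (\<lambda>c. B.recX (delta h c)) (kap ` H)"
proof -
 have m: "delta h c \<in> I" if "c \<in> kap ` H" for c using that delta_kap(2)[OF h] by blast
 have "B.Ups (trans_prod (U #> h)) = finprod B.QQ (\<lambda>c. B.Ups (pc (I, U) (delta h c))) (kap ` H)"
  unfolding trans_prod_eq[OF h]
  by (rule hom_finprod[OF B.PI_comm B.Q_comm B.Upsilon_hom]) (use m in \<open>auto simp: B.PI_carrier\<close>)
 also have "\<dots> = finprod B.QQ (\<lambda>c. B.recX (delta h c)) (kap ` H)"
  by (rule comm_monoid.finprod_cong'[OF comm_group.axioms(1)[OF B.Q_comm] refl])
   (use m B.recX_closed B.Upsilon_pi_class in auto)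
 finally show ?thesis .
qed

text \<open>The left cosets of \<open>I\<close> split into orbits under \<open>h\<close>; on each orbit the product telescopes.\<close>

lemma orbit_product:
 assumes h: "h \<in> H" and t: "t \<in> H"
 shows "finprod B.QQ (\<lambda>j. B.recX (delta h (kap (h [^] j \<div> t)))) {..<per (t \<otimes> h \<div> t)} =
  B.recX ((t \<otimes> h \<div> t) [^] per (t \<otimes> h \<div> t))"
proof -
 define g where "g = t \<otimes> h \<div> t"
 define m where "m = per g"
 have hc: "h \<in> carrier G" and tc: "t \<in> carrier G" using h t by auto
 have gH: "g \<in> H" using h t by (simp add: g_def)
 have y: "h [^] j \<div> t \<in> H" for j :: nat using H_pow[OF h] t by simp
 define q where "q j = inv (h [^] j \<div> t) \<otimes> rr (kap (h [^] j \<div> t))" for j :: nat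
 have q: "q j \<in> I" for j unfolding q_def by (rule rr_kap(3)[OF y])
 have suc: "h \<otimes> (h [^] j \<div> t) = h [^] Suc j \<div> t" for j :: nat
  unfolding G.nat_pow_Suc2[OF hc] using hc tc by (simp add: G.m_assoc)
 have dl: "delta h (kap (h [^] j \<div> t)) = inv (q (Suc j)) \<otimes> q j" for j :: nat
  using delta_kap(1)[OF h y, of j] unfolding suc q_def .
 have "finprod B.QQ (\<lambda>j. B.recX (delta h (kap (h [^] j \<div> t)))) {..<m} =
   finprod B.QQ (\<lambda>j. inv\<^bsub>B.QQ\<^esub> B.recX (q (Suc j)) \<otimes>\<^bsub>B.QQ\<^esub> B.recX (q j)) {..<m}"
  by (simp only: dl B.recX_mult B.recX_inv q B.H.m_inv_closed)
 also have "\<dots> = B.recX (q 0) \<div>\<^bsub>B.QQ\<^esub> B.recX (q m)"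
  by (rule finprod_telescope[OF B.Q_comm B.recX_closed[OF q]])
 also have "\<dots> = B.recX (q 0 \<div> (q m))" by (simp only: B.recX_mult B.recX_inv q B.H.m_inv_closed)
 \<comment> \<open>After a full period the coset returns, and with it the representative z, which
   cancels; only t h^m t^-1 = g^m is left.\<close>
 also have "q 0 \<div> (q m) = g [^] m"
 proof -
  have gm: "g [^] m = inv (h [^] (0::nat) \<div> t) \<otimes> (h [^] m \<div> t)"
   unfolding g_def G.conj_pow[OF tc hc] using hc tc by (simp add: G.m_assoc)
  have "kap (h [^] (0::nat) \<div> t) = kap (h [^] m \<div> t)"
   by (rule kap_eq_iff[OF y y, THEN iffD2]) (use per(2)[OF gH] gm in \<open>simp add: m_def\<close>)
  then have r: "rr (kap (h [^] (0::nat) \<div> t)) = rr (kap (h [^] m \<div> t))" by simp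
  define z where "z = rr (kap (h [^] m \<div> t))"
  have zc: "z \<in> carrier G" unfolding z_def using rr_kap(1)[OF y] by auto
  have yc: "h [^] m \<div> t \<in> carrier G" "h [^] (0::nat) \<div> t \<in> carrier G" by (rule H.mem_carrier[OF y])+
  have "q 0 \<div> (q m) = inv (h [^] (0::nat) \<div> t) \<otimes> (z \<div> z) \<otimes> (h [^] m \<div> t)"
   unfolding q_def r z_def[symmetric] G.inv_mult_group[OF G.inv_closed[OF yc(1)] zc] G.inv_inv[OF yc(1)]
   using zc yc by (simp only: G.m_assoc G.m_closed G.inv_closed)
  then show ?thesis unfolding gm using zc yc by simp
 qed
 finally show ?thesis unfolding g_def m_def .
qed

lemma orbit_mod:
 assumes h: "h \<in> H" and t: "t \<in> H"
 shows "kap (h [^] (k::nat) \<div> t) = kap (h [^] (k mod per (t \<otimes> h \<div> t)) \<div> t)"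
proof -
 define g where "g = t \<otimes> h \<div> t"
 define m where "m = per g"
 have hc: "h \<in> carrier G" and tc: "t \<in> carrier G" using h t by auto
 have gH: "g \<in> H" using h t by (simp add: g_def)
 let ?r = "k mod m" and ?s = "m * (k div m)"
 have "(g [^] m) [^] (k div m) \<in> I" unfolding m_def by (rule B.H_pow[OF per(2)[OF gH]])
 then have gs: "g [^] ?s \<in> I" using gH by (simp add: G.nat_pow_pow)
 have "h [^] k = h [^] (?r + ?s)" by simp
 also have "\<dots> = h [^] ?r \<otimes> h [^] ?s" using hc by (simp only: G.nat_pow_mult)
 finally have k: "h [^] k = h [^] ?r \<otimes> h [^] ?s" .
 have "inv (h [^] ?r \<div> t) \<otimes> (h [^] k \<div> t) = t \<otimes> (inv (h [^] ?r) \<otimes> h [^] ?r) \<otimes> h [^] ?s \<div> t"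
  unfolding k using hc tc by (simp only: G.inv_mult_group G.inv_inv G.m_assoc G.m_closed G.inv_closed G.nat_pow_closed)
 also have "\<dots> = g [^] ?s" unfolding g_def G.conj_pow[OF tc hc] using hc tc by simp
 finally have "inv (h [^] ?r \<div> t) \<otimes> (h [^] k \<div> t) \<in> I" using gs by simp
 then have "kap (h [^] ?r \<div> t) = kap (h [^] k \<div> t)"
  using kap_eq_iff[of "h [^] ?r \<div> t" "h [^] k \<div> t"] H_pow[OF h] t by simp
 then show ?thesis by (simp add: m_def g_def)
qed

text \<open>If the orbits of t^-1 I and s^-1 I meet, then t lies in I s h^i for some integer i,
  hence in the double coset of s modulo \<open>Sg h\<close>. Within one orbit the minimality of the
  period separates the points.\<close>

lemma orbit_inj:
 assumes h: "h \<in> H" and ts: "t \<in> H" "s \<in> H"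
  and dc: "double_coset G I t (Sg h) = double_coset G I s (Sg h) \<Longrightarrow> t = s"
  and jk: "j < per (t \<otimes> h \<div> t)" "k < per (s \<otimes> h \<div> s)"
  and eq: "kap (h [^] (j::nat) \<div> t) = kap (h [^] (k::nat) \<div> s)"
 shows "t = s" "j = k"
proof -
 have c: "h \<in> carrier G" "t \<in> carrier G" "s \<in> carrier G" using h ts by auto
 have y: "h [^] i \<div> x \<in> H" if "x \<in> H" for i :: nat and x using H_pow[OF h] that by simp
 define e where "e = inv (h [^] j \<div> t) \<otimes> (h [^] k \<div> s)"
 have e: "e \<in> I" unfolding e_def using kap_eq_iff[OF y[OF ts(1)] y[OF ts(2)]] eq by simp
 have "e \<otimes> s \<otimes> (inv (h [^] k) \<otimes> h [^] j) = inv (h [^] j \<div> t) \<otimes> h [^] k \<otimes> (inv s \<otimes> s) \<div> (h [^] k) \<otimes> h [^] j"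
  unfolding e_def using c by (simp only: G.m_assoc G.m_closed G.inv_closed G.nat_pow_closed)
 also have "\<dots> = t \<div> (h [^] j) \<otimes> (h [^] k \<div> (h [^] k)) \<otimes> h [^] j"
  using c by (simp add: G.inv_mult_group G.m_assoc)
 also have "\<dots> = t" using c by (simp add: G.m_assoc)
 finally have t: "t = e \<otimes> s \<otimes> (inv (h [^] k) \<otimes> h [^] j)" ..
 interpret S: subgroup "Sg h" G by (rule Sg_subgroup[OF h])
 have hS: "h [^] i \<in> Sg h" for i :: nat by (rule G.subgroup_nat_pow[OF S.subgroup_axioms self_Sg[OF h]])
 have "inv (h [^] k) \<otimes> h [^] j \<in> Sg h" by (rule S.m_closed[OF S.m_inv_closed[OF hS] hS])
 then have "t \<in> double_coset G I s (Sg h)" unfolding G.double_coset_eq using e t by blast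
 then show tseq: "t = s" by (rule dc[OF G.double_coset_cong[OF B.H_sub S.subgroup_axioms c(3)]])
 have le: "i = l" if il: "i \<le> l" "l < per (t \<otimes> h \<div> t)" "kap (h [^] i \<div> t) = kap (h [^] l \<div> t)" for i l :: nat
 proof (rule ccontr)
  assume "i \<noteq> l"
  have "(t \<otimes> h \<div> t) [^] (l - i) = inv (h [^] i \<div> t) \<otimes> (h [^] l \<div> t)"
  proof -
   have "h [^] l = h [^] (i + (l - i))" using il(1) by simp
   also have "\<dots> = h [^] i \<otimes> h [^] (l - i)" using c(1) by (simp only: G.nat_pow_mult)
   finally have l: "h [^] l = h [^] i \<otimes> h [^] (l - i)" .
   have "inv (h [^] i \<div> t) \<otimes> (h [^] l \<div> t) = t \<otimes> (inv (h [^] i) \<otimes> h [^] i) \<otimes> h [^] (l - i) \<div> t"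
    unfolding l using c by (simp only: G.inv_mult_group G.inv_inv G.m_assoc G.m_closed G.inv_closed G.nat_pow_closed)
   then show ?thesis unfolding G.conj_pow[OF c(2,1)] using c by simp
  qed
  then have "(t \<otimes> h \<div> t) [^] (l - i) \<in> I" using kap_eq_iff[OF y[OF ts(1)] y[OF ts(1)]] il(3) by simp
  moreover have "t \<otimes> h \<div> t \<in> H" using h ts by simp
  ultimately show False using per(3)[of "t \<otimes> h \<div> t" "l - i"] il \<open>i \<noteq> l\<close> by simp
 qed
 show "j = k"
 proof (cases "j \<le> k")
  case True
  then show ?thesis using le[of j k] jk(2) eq tseq by simp
 next
  case False
  then show ?thesis using le[of k j] jk(1) eq tseq by simp
 qed
qed

text \<open>Modulo U the group \<open>Sg h\<close> consists of powers of h, so double cosets modulo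
  \<open>Sg h\<close> already account for all h-orbits: the inverse of x lies in I t h^j U for some
  t in R and some j.\<close>

lemma orbit_cover:
 assumes h: "h \<in> H" and R: "R \<subseteq> H" "(\<lambda>t. double_coset G I t (Sg h)) ` R = double_cosets G I H (Sg h)" and x: "x \<in> H"
 shows "\<exists>t\<in>R. \<exists>j<per (t \<otimes> h \<div> t). kap x = kap (h [^] j \<div> t)"
proof -
 interpret S: subgroup "Sg h" G by (rule Sg_subgroup[OF h])
 have hc: "h \<in> carrier G" and xc: "x \<in> carrier G" using h x by auto
 have ix: "inv x \<in> H" using x by simp
 have "double_coset G I (inv x) (Sg h) \<in> (\<lambda>t. double_coset G I t (Sg h)) ` R"
  unfolding R(2) double_cosets_def using ix by (rule imageI)
 then obtain t where t: "t \<in> R" "double_coset G I (inv x) (Sg h) = double_coset G I t (Sg h)" by blast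
 have "\<one> \<div> x \<otimes> \<one> \<in> double_coset G I (inv x) (Sg h)"
  unfolding G.double_coset_eq using B.H.one_closed S.one_closed by blast
 then have "inv x \<in> double_coset G I t (Sg h)" using t(2) xc by simp
 then obtain e \<sigma> where e: "e \<in> I" "\<sigma> \<in> Sg h" "inv x = e \<otimes> t \<otimes> \<sigma>" unfolding G.double_coset_eq by blast
 obtain s i where si: "s \<in> cyc h" "i \<in> I_of U" "\<sigma> = s \<otimes> i" using e(2) mem_Sg by blast
 obtain j where j: "j < idx" "inv (h [^] j) \<otimes> s \<in> cyc (h [^] idx)" using cyc_pow_coset[OF hc idx_pos si(1)] by blast
 have "cyc (h [^] idx) \<subseteq> U" by (rule cyc_minimal[OF U.subgroup_axioms inert_finite_closed[OF U_inert] pow_idx[OF h]])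
 then have u: "inv (h [^] j) \<otimes> s \<otimes> i \<in> U" using j(2) si(2) by (intro U.m_closed[of "inv (h [^] j) \<otimes> s" i]) (auto simp: mem_I_of)
 define u where "u = inv (h [^] j) \<otimes> s \<otimes> i"
 have tH: "t \<in> H" using t(1) R(1) by blast
 have sc: "s \<in> carrier G" using si(1) subgroup.subset[OF cyc_subgroup[OF hc]] by blast
 have c: "t \<in> carrier G" "e \<in> carrier G" "i \<in> carrier G" "u \<in> carrier G"
  using tH e(1) si(2) u by (auto simp: mem_I_of u_def)
 have \<sigma>: "\<sigma> = h [^] j \<otimes> u"
 proof -
  have "h [^] j \<otimes> u = (h [^] j \<div> (h [^] j)) \<otimes> s \<otimes> i"
   unfolding u_def using hc sc c by (simp only: G.m_assoc G.m_closed G.inv_closed G.nat_pow_closed)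
  then show ?thesis using hc sc c si(3) by simp
 qed
 \<comment> \<open>Since h^[H:U] lies in U, the power h^k inverts h^j modulo U. A natural exponent
   is needed because orbits are indexed by natural numbers.\<close>
 define k where "k = idx - j"
 have th: "t \<otimes> h [^] j \<in> H" using tH H_pow[OF h] by simp
 have "inv x \<otimes> (h [^] k \<div> t) = e \<otimes> (t \<otimes> h [^] j \<otimes> u \<div> (t \<otimes> h [^] j)) \<otimes> (t \<otimes> h [^] idx \<div> t)"
 proof -
  have "h [^] idx = h [^] (j + k)" using j(1) by (simp add: k_def)
  also have "\<dots> = h [^] j \<otimes> h [^] k" using hc by (simp only: G.nat_pow_mult)
  finally have p: "h [^] idx = h [^] j \<otimes> h [^] k" .
  have "e \<otimes> (t \<otimes> h [^] j \<otimes> u \<div> (t \<otimes> h [^] j)) \<otimes> (t \<otimes> h [^] idx \<div> t) =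
    e \<otimes> t \<otimes> h [^] j \<otimes> u \<otimes> (inv (t \<otimes> h [^] j) \<otimes> (t \<otimes> h [^] j)) \<otimes> h [^] k \<div> t"
   unfolding p using hc c by (simp only: G.m_assoc G.m_closed G.inv_closed G.nat_pow_closed)
  also have "\<dots> = e \<otimes> t \<otimes> (h [^] j \<otimes> u) \<otimes> (h [^] k \<div> t)" using hc c by (simp add: G.m_assoc)
  finally show ?thesis unfolding e(3) \<sigma> by (rule sym)
 qed
 also have "\<dots> \<in> I"
 proof (rule B.H.m_closed[OF B.H.m_closed[OF e(1)]])
  show "t \<otimes> h [^] j \<otimes> u \<div> (t \<otimes> h [^] j) \<in> I" using U_conj[OF th] u B.UH unfolding u_def by blast
  show "t \<otimes> h [^] idx \<div> t \<in> I" using U_conj[OF tH pow_idx[OF h]] B.UH by blast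
 qed
 finally have "kap x = kap (h [^] k \<div> t)" using kap_eq_iff[OF x, of "h [^] k \<div> t"] H_pow[OF h] tH by simp
 also have "\<dots> = kap (h [^] (k mod per (t \<otimes> h \<div> t)) \<div> t)" by (rule orbit_mod[OF h tH])
 finally have "kap x = kap (h [^] (k mod per (t \<otimes> h \<div> t)) \<div> t)" .
 moreover have "k mod per (t \<otimes> h \<div> t) < per (t \<otimes> h \<div> t)"
  by (rule mod_less_divisor, rule per(1)) (use tH h in simp)
 ultimately show ?thesis using t(1) by blast
qed

lemma transfer_product:
 assumes h: "h \<in> H" and fin: "finite (double_cosets G I H (Sg h))" and R: "R \<subseteq> H"
  "bij_betw (\<lambda>t. double_coset G I t (Sg h)) R (double_cosets G I H (Sg h))"
 shows "finprod B.QQ (\<lambda>c. B.recX (delta h c)) (kap ` H) =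
  finprod B.QQ (\<lambda>t. B.recX ((t \<otimes> h \<div> t) [^] per (t \<otimes> h \<div> t))) R"
proof -
 interpret Q: comm_group B.QQ by (rule B.Q_comm)
 define K where "K t = (\<lambda>j. kap (h [^] j \<div> t)) ` {..<per (t \<otimes> h \<div> t)}" for t
 have y: "h [^] j \<div> t \<in> H" if "t \<in> R" for j :: nat and t
  by (rule H.m_closed[OF H_pow[OF h] H.m_inv_closed[OF subsetD[OF R(1) that]]])
 have finR: "finite R" using bij_betw_finite[OF R(2)] fin by simp
 have inj: "t = s \<and> j = k" if "t \<in> R" "s \<in> R" "j < per (t \<otimes> h \<div> t)" "k < per (s \<otimes> h \<div> s)"
  "kap (h [^] j \<div> t) = kap (h [^] k \<div> s)" for t s j k
 proof -
  have d: "double_coset G I t (Sg h) = double_coset G I s (Sg h) \<Longrightarrow> t = s"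
   using R(2) that(1,2) unfolding bij_betw_def inj_on_def by blast
  show ?thesis using orbit_inj[OF h subsetD[OF R(1) that(1)] subsetD[OF R(1) that(2)] d that(3-5)] by simp
 qed
 have "kap ` H = \<Union> (K ` R)"
 proof
  show "kap ` H \<subseteq> \<Union> (K ` R)"
  proof (rule image_subsetI)
   fix x assume "x \<in> H"
   then obtain t j where "t \<in> R" "j < per (t \<otimes> h \<div> t)" "kap x = kap (h [^] j \<div> t)"
    using orbit_cover[OF h R(1) _ \<open>x \<in> H\<close>] R(2) unfolding bij_betw_def by blast
   then show "kap x \<in> \<Union> (K ` R)" unfolding K_def by blast
  qed
  show "\<Union> (K ` R) \<subseteq> kap ` H" unfolding K_def using y by blast
 qed
 moreover have "finprod B.QQ (\<lambda>c. B.recX (delta h c)) (\<Union> (K ` R)) =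
   finprod B.QQ (\<lambda>t. finprod B.QQ (\<lambda>c. B.recX (delta h c)) (K t)) R"
 proof (rule Q.finprod_UN_disjoint[OF finR])
  show "finite (K t)" for t by (simp add: K_def)
  show "pairwise (\<lambda>i j. disjnt (K i) (K j)) R" unfolding pairwise_def disjnt_def K_def using inj by blast
  show "B.recX (delta h c) \<in> carrier B.QQ" if t: "t \<in> R" and cK: "c \<in> K t" for t c
  proof -
   obtain j :: nat where j: "c = kap (h [^] j \<div> t)" using cK unfolding K_def by blast
   show ?thesis unfolding j by (rule B.recX_closed[OF delta_kap(2)[OF h y[OF t]]])
  qed
 qed
 moreover have "\<dots> = finprod B.QQ (\<lambda>t. B.recX ((t \<otimes> h \<div> t) [^] per (t \<otimes> h \<div> t))) R"
 proof (rule Q.finprod_cong'[OF refl])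
  show "(\<lambda>t. B.recX ((t \<otimes> h \<div> t) [^] per (t \<otimes> h \<div> t))) \<in> R \<rightarrow> carrier B.QQ"
  proof
   fix t assume "t \<in> R"
   then have "t \<in> H" using R(1) by blast
   then show "B.recX ((t \<otimes> h \<div> t) [^] per (t \<otimes> h \<div> t)) \<in> carrier B.QQ"
    by (intro B.recX_closed per(2)) (use h in simp)
  qed
  fix t assume t: "t \<in> R"
  have "finprod B.QQ (\<lambda>c. B.recX (delta h c)) (K t) =
    finprod B.QQ (\<lambda>j. B.recX (delta h (kap (h [^] j \<div> t)))) {..<per (t \<otimes> h \<div> t)}"
   unfolding K_def
  proof (rule Q.finprod_reindex)
   show "inj_on (\<lambda>j. kap (h [^] j \<div> t)) {..<per (t \<otimes> h \<div> t)}"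
    using inj[OF t t] by (auto simp: inj_on_def)
   show "(\<lambda>c. B.recX (delta h c)) \<in> (\<lambda>j. kap (h [^] j \<div> t)) ` {..<per (t \<otimes> h \<div> t)} \<rightarrow> carrier B.QQ"
    using B.recX_closed[OF delta_kap(2)[OF h y[OF t]]] by blast
  qed
  also have "\<dots> = B.recX ((t \<otimes> h \<div> t) [^] per (t \<otimes> h \<div> t))"
   by (rule orbit_product[OF h subsetD[OF R(1) t]])
  finally show "finprod B.QQ (\<lambda>c. B.recX (delta h c)) (K t) = B.recX ((t \<otimes> h \<div> t) [^] per (t \<otimes> h \<div> t))" .
 qed
 ultimately show ?thesis by simp
qed

lemma Upsilon_trans_prod_res:
 assumes h: "h \<in> H"
 shows "B.Ups (trans_prod (U #> h)) = res_map h0 (I, U) (H, U) (Ups (pc (H, U) h))"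
proof -
 obtain k n where k: "frob_lift k n" "k \<div> h \<in> U" using lift_exists[OF h] by blast
 have kH: "k \<in> H" using k(1) by simp
 have eq: "U #> k = U #> h" using coset_U_iff[OF kH h] k(2) by simp
 then have pk: "pc (H, U) k = pc (H, U) h" unfolding pi_class_HU by simp
 obtain \<pi> where p: "is_prime (Sg k) \<pi>" using prime_Sg[OF k(1)] by blast
 obtain R where R: "R \<subseteq> H" "bij_betw (\<lambda>t. double_coset G I t (Sg k)) R (double_cosets G I H (Sg k))"
  using representatives_exist by blast
 have i: "Sg k \<in> idom M H" by (rule open_idom[OF H_base Sg_open'[OF k(1)]])
 have fin: "finite (double_cosets G I H (Sg k))" using mackey_M H_base I_rdom i unfolding mackey_system_def by blast
 have xc: "xval k n \<pi> \<in> CC H" by (rule xval_prime_closed[OF k(1) p])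
 have "B.Ups (trans_prod (U #> k)) = B.cls (res I H (xval k n \<pi>))"
  unfolding Upsilon_trans_prod[OF kH] transfer_product[OF kH fin R] res_reciprocity[OF k(1) p R] ..
 also have "\<dots> = res_map h0 (I, U) (H, U) (cls (xval k n \<pi>))"
  using H0_res(1)[OF xc] by (simp add: cls_H0 B.cls_H0)
 also have "cls (xval k n \<pi>) = Ups (pc (H, U) k)"
  unfolding Upsilon_pi_class[OF kH] recX_lift[OF k(1)] rec0_eq[OF k(1) p] ..
 finally show ?thesis unfolding eq pk .
qed

text \<open>That the transfer depends only on the class of h is not shown inside the groups: its
  values for two representatives have the same image under the injective \<open>B.Ups\<close>,
  namely a restriction in the norm residue groups.\<close>

lemma Upsilon_res:
 assumes inj: "inj_on B.Ups (carrier B.PI)" and X: "X \<in> carrier PI"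
 shows "res_map (pi_fun G T) (I, U) (H, U) X \<in> carrier B.PI"
  and "B.Ups (res_map (pi_fun G T) (I, U) (H, U) X) = res_map h0 (I, U) (H, U) (Ups X)"
proof -
 obtain h where h: "h \<in> H" "X = pc (H, U) h" using X unfolding PI_carrier by blast
 have "res_map (pi_fun G T) (I, U) (H, U) (ab_class QG (discrete_topology (carrier QG)) (U #> h)) = trans_prod (U #> h)"
  unfolding pi_res_map
 proof (rule induced_map_eq)
  show "U #> h \<in> carrier QG" using h(1) by (auto simp: QG_carrier)
  fix a assume "a \<in> carrier QG"
   and e: "ab_class QG (discrete_topology (carrier QG)) a = ab_class QG (discrete_topology (carrier QG)) (U #> h)"
  then obtain k where k: "k \<in> H" "a = U #> k" unfolding QG_carrier by blast
  have "pc (H, U) k = pc (H, U) h" using e unfolding k(2) ab_class_HU .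
  then have "B.Ups (trans_prod (U #> k)) = B.Ups (trans_prod (U #> h))"
   unfolding Upsilon_trans_prod_res[OF k(1)] Upsilon_trans_prod_res[OF h(1)] by simp
  then show "trans_prod a = trans_prod (U #> h)"
   unfolding k(2) by (rule inj_onD[OF inj _ trans_prod_closed[OF k(1)] trans_prod_closed[OF h(1)]])
 qed
 then have eq: "res_map (pi_fun G T) (I, U) (H, U) X = trans_prod (U #> h)" unfolding ab_class_HU h(2) .
 show "res_map (pi_fun G T) (I, U) (H, U) X \<in> carrier B.PI" unfolding eq by (rule trans_prod_closed[OF h(1)])
 show "B.Ups (res_map (pi_fun G T) (I, U) (H, U) X) = res_map h0 (I, U) (H, U) (Ups X)"
  by (subst eq) (simp only: h(2) Upsilon_trans_prod_res[OF h(1)])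
qed

end

section \<open>RIC-functors\<close>

lemma discrete_top_hom:
 assumes "f \<in> hom A B" "S = discrete_topology (carrier A)" "topspace T = carrier B"
 shows "f \<in> top_hom A S B T"
 using assms by (auto simp: top_hom_def continuous_map_from_discrete_topology hom_def)

text \<open>Each functor law for \<Phi> is checked after applying \<phi>, where it becomes the law
  for \<Psi>; injectivity brings it back. The structure maps of \<Phi> need not be known to be
  homomorphisms beforehand, only to be compatible with \<phi>.\<close>

lemma ric_isomorphism_transport:
 assumes D: "ric_domain G act D" and \<Psi>: "ric_functor G act D \<Psi>"
  and topD: "\<And>x. x \<in> base D \<Longrightarrow> obj_top \<Phi> x = discrete_topology (carrier (obj \<Phi> x))"
  and topS: "\<And>x. x \<in> base D \<Longrightarrow> obj_top \<Psi> x = discrete_topology (carrier (obj \<Psi> x))"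
  and grp: "\<And>x. x \<in> base D \<Longrightarrow> comm_group (obj \<Phi> x)"
  and hom: "\<And>x. x \<in> base D \<Longrightarrow> \<phi> x \<in> hom (obj \<Phi> x) (obj \<Psi> x)"
  and bij: "\<And>x. x \<in> base D \<Longrightarrow> bij_betw (\<phi> x) (carrier (obj \<Phi> x)) (carrier (obj \<Psi> x))"
  and res: "\<And>x y a. x \<in> base D \<Longrightarrow> y \<in> rdom D x \<Longrightarrow> a \<in> carrier (obj \<Phi> x) \<Longrightarrow>
   res_map \<Phi> y x a \<in> carrier (obj \<Phi> y) \<and> \<phi> y (res_map \<Phi> y x a) = res_map \<Psi> y x (\<phi> x a)"
  and ind: "\<And>x y a. x \<in> base D \<Longrightarrow> y \<in> idom D x \<Longrightarrow> a \<in> carrier (obj \<Phi> y) \<Longrightarrow>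
   ind_map \<Phi> x y a \<in> carrier (obj \<Phi> x) \<and> \<phi> x (ind_map \<Phi> x y a) = ind_map \<Psi> x y (\<phi> y a)"
  and con: "\<And>x g a. x \<in> base D \<Longrightarrow> g \<in> carrier G \<Longrightarrow> a \<in> carrier (obj \<Phi> x) \<Longrightarrow>
   con_map \<Phi> g x a \<in> carrier (obj \<Phi> (act g x)) \<and> \<phi> (act g x) (con_map \<Phi> g x a) = con_map \<Psi> g x (\<phi> x a)"
  and G: "group G"
 shows "ric_isomorphism G act D \<Phi> \<Psi> \<phi>"
proof -
 note F = \<Psi>[unfolded ric_functor_def]
 note t = conjunct2
 note F2 = F[THEN t, THEN conjunct1, rule_format]
 note F3 = F[THEN t, THEN t, THEN conjunct1, rule_format]
 note F4 = F[THEN t, THEN t, THEN t, THEN conjunct1, rule_format]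
 note F5 = F[THEN t, THEN t, THEN t, THEN t, THEN conjunct1, rule_format]
 note F6 = F[THEN t, THEN t, THEN t, THEN t, THEN t, THEN conjunct1, rule_format]
 note F7 = F[THEN t, THEN t, THEN t, THEN t, THEN t, THEN t, THEN conjunct1, rule_format]
 note F8 = F[THEN t, THEN t, THEN t, THEN t, THEN t, THEN t, THEN t, THEN conjunct1, rule_format]
 note F9 = F[THEN t, THEN t, THEN t, THEN t, THEN t, THEN t, THEN t, THEN t, THEN conjunct1, rule_format]
 note F10 = F[THEN t, THEN t, THEN t, THEN t, THEN t, THEN t, THEN t, THEN t, THEN t, rule_format]
 note dm = ric_domainD[OF D]
 interpret G: group G by (rule G)
 have res_c: "res_map \<Phi> y x a \<in> carrier (obj \<Phi> y)" and res_e: "\<phi> y (res_map \<Phi> y x a) = res_map \<Psi> y x (\<phi> x a)"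
  if "x \<in> base D" "y \<in> rdom D x" "a \<in> carrier (obj \<Phi> x)" for x y a using res[OF that] by auto
 have ind_c: "ind_map \<Phi> x y a \<in> carrier (obj \<Phi> x)" and ind_e: "\<phi> x (ind_map \<Phi> x y a) = ind_map \<Psi> x y (\<phi> y a)"
  if "x \<in> base D" "y \<in> idom D x" "a \<in> carrier (obj \<Phi> y)" for x y a using ind[OF that] by auto
 have con_c: "con_map \<Phi> g x a \<in> carrier (obj \<Phi> (act g x))" and con_e: "\<phi> (act g x) (con_map \<Phi> g x a) = con_map \<Psi> g x (\<phi> x a)"
  if "x \<in> base D" "g \<in> carrier G" "a \<in> carrier (obj \<Phi> x)" for x g a using con[OF that] by auto
 have cl: "\<phi> x a \<in> carrier (obj \<Psi> x)" if "x \<in> base D" "a \<in> carrier (obj \<Phi> x)" for x a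
  by (rule hom_in_carrier[OF hom[OF that(1)] that(2)])
 have inj: "a = b" if "x \<in> base D" "a \<in> carrier (obj \<Phi> x)" "b \<in> carrier (obj \<Phi> x)" "\<phi> x a = \<phi> x b" for x a b
  using bij[OF that(1)] that(2-) unfolding bij_betw_def inj_on_def by blast
 have top_hom: "f \<in> obj_hom \<Phi> x \<Phi> y"
  if xy: "x \<in> base D" "y \<in> base D" and F: "F \<in> obj_hom \<Psi> x \<Psi> y"
   and fc: "\<And>a. a \<in> carrier (obj \<Phi> x) \<Longrightarrow> f a \<in> carrier (obj \<Phi> y) \<and> \<phi> y (f a) = F (\<phi> x a)" for f F x y
  unfolding obj_hom_def
 proof (rule discrete_top_hom[OF _ topD[OF xy(1)]])
  have Fh: "F \<in> hom (obj \<Psi> x) (obj \<Psi> y)" using F by (simp add: obj_hom_def top_hom_def)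
  interpret X: comm_group "obj \<Phi> x" by (rule grp[OF xy(1)])
  interpret Y: comm_group "obj \<Phi> y" by (rule grp[OF xy(2)])
  show "f \<in> hom (obj \<Phi> x) (obj \<Phi> y)"
  proof (rule homI)
   fix a b assume ab: "a \<in> carrier (obj \<Phi> x)" "b \<in> carrier (obj \<Phi> x)"
   note m = hom_mult[OF hom[OF xy(1)] ab] hom_mult[OF hom[OF xy(2)] conjunct1[OF fc[OF ab(1)]] conjunct1[OF fc[OF ab(2)]]]
    hom_mult[OF Fh cl[OF xy(1) ab(1)] cl[OF xy(1) ab(2)]]
   show "f (a \<otimes>\<^bsub>obj \<Phi> x\<^esub> b) = f a \<otimes>\<^bsub>obj \<Phi> y\<^esub> f b"
   proof (rule inj[OF xy(2)])
    show "\<phi> y (f (a \<otimes>\<^bsub>obj \<Phi> x\<^esub> b)) = \<phi> y (f a \<otimes>\<^bsub>obj \<Phi> y\<^esub> f b)"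
     using fc[OF X.m_closed[OF ab]] fc[OF ab(1)] fc[OF ab(2)] m by simp
   qed (use fc[OF X.m_closed[OF ab]] fc[OF ab(1)] fc[OF ab(2)] in auto)
  qed (use fc in blast)
  show "topspace (obj_top \<Phi> y) = carrier (obj \<Phi> y)" using topD[OF xy(2)] by simp
 qed
 have \<Phi>: "ric_functor G act D \<Phi>" unfolding ric_functor_def
 proof (intro conjI ballI)
  fix x assume x: "x \<in> base D"
  show "top_ab_group (obj \<Phi> x) (obj_top \<Phi> x)" unfolding topD[OF x] by (rule top_ab_group_discrete[OF grp[OF x]])
 next
  fix x y assume xy: "x \<in> base D" "y \<in> rdom D x"
  show "res_map \<Phi> y x \<in> obj_hom \<Phi> x \<Phi> y"
   by (rule top_hom[OF xy(1) dm(1)[OF xy] F2[OF xy]]) (rule res[OF xy])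
 next
  fix x y assume xy: "x \<in> base D" "y \<in> idom D x"
  show "ind_map \<Phi> x y \<in> obj_hom \<Phi> y \<Phi> x"
   by (rule top_hom[OF dm(2)[OF xy] xy(1) F3[OF xy]]) (rule ind[OF xy])
 next
  fix x g assume xg: "x \<in> base D" "g \<in> carrier G"
  show "con_map \<Phi> g x \<in> obj_hom \<Phi> x \<Phi> (act g x)"
   by (rule top_hom[OF xg(1) dm(9)[OF xg] F4[OF xg]]) (rule con[OF xg])
 next
  fix x a assume x: "x \<in> base D" and a: "a \<in> carrier (obj \<Phi> x)"
  note f = F5[OF x cl[OF x a]]
  show "res_map \<Phi> x x a = a"
   by (rule inj[OF x res_c[OF x dm(3)[OF x] a] a]) (simp only: res_e[OF x dm(3)[OF x] a] f)
  show "ind_map \<Phi> x x a = a"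
   by (rule inj[OF x ind_c[OF x dm(4)[OF x] a] a]) (simp only: ind_e[OF x dm(4)[OF x] a] f)
  note c = con_c[OF x G.one_closed a, unfolded dm(10)[OF x]] con_e[OF x G.one_closed a, unfolded dm(10)[OF x]]
  show "con_map \<Phi> \<one>\<^bsub>G\<^esub> x a = a" by (rule inj[OF x c(1) a]) (simp only: c(2) f)
 next
  fix x y z a assume x: "x \<in> base D" and y: "y \<in> rdom D x" and z: "z \<in> rdom D y" and a: "a \<in> carrier (obj \<Phi> x)"
  note yb = dm(1)[OF x y] and zx = dm(5)[OF x y z] and ra = res_c[OF x y a]
  show "res_map \<Phi> z y (res_map \<Phi> y x a) = res_map \<Phi> z x a"
   by (rule inj[OF dm(1)[OF x zx] res_c[OF yb z ra] res_c[OF x zx a]])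
    (simp only: res_e[OF yb z ra] res_e[OF x y a] res_e[OF x zx a] F6[OF x y z cl[OF x a]])
 next
  fix x y z a assume x: "x \<in> base D" and y: "y \<in> idom D x" and z: "z \<in> idom D y" and a: "a \<in> carrier (obj \<Phi> z)"
  note yb = dm(2)[OF x y] and zx = dm(6)[OF x y z] and ra = ind_c[OF dm(2)[OF x y] z a]
  show "ind_map \<Phi> x y (ind_map \<Phi> y z a) = ind_map \<Phi> x z a"
   by (rule inj[OF x ind_c[OF x y ra] ind_c[OF x zx a]])
    (simp only: ind_e[OF yb z a] ind_e[OF x y ra] ind_e[OF x zx a] F7[OF x y z cl[OF dm(2)[OF x zx] a]])
 next
  fix x g g' a assume x: "x \<in> base D" and g: "g \<in> carrier G" "g' \<in> carrier G" and a: "a \<in> carrier (obj \<Phi> x)"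
  note gx = dm(9)[OF x g(1)] and ca = con_c[OF x g(1) a] and gg = G.m_closed[OF g(2,1)]
  note c = con_c[OF gx g(2) ca, unfolded dm(11)[OF x g]] con_e[OF gx g(2) ca, unfolded dm(11)[OF x g]]
  show "con_map \<Phi> g' (act g x) (con_map \<Phi> g x a) = con_map \<Phi> (g' \<otimes>\<^bsub>G\<^esub> g) x a"
   by (rule inj[OF dm(9)[OF x gg] c(1) con_c[OF x gg a]])
    (simp only: c(2) con_e[OF x g(1) a] con_e[OF x gg a] F8[OF x g cl[OF x a]])
 next
  fix x y g a assume x: "x \<in> base D" and y: "y \<in> rdom D x" and g: "g \<in> carrier G" and a: "a \<in> carrier (obj \<Phi> x)"
  note yb = dm(1)[OF x y] and ra = res_c[OF x y a] and gx = dm(9)[OF x g] and ca = con_c[OF x g a] and gy = dm(7)[OF x g y]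
  show "con_map \<Phi> g y (res_map \<Phi> y x a) = res_map \<Phi> (act g y) (act g x) (con_map \<Phi> g x a)"
   by (rule inj[OF dm(9)[OF yb g] con_c[OF yb g ra] res_c[OF gx gy ca]])
    (simp only: con_e[OF yb g ra] res_e[OF x y a] res_e[OF gx gy ca] con_e[OF x g a] F9[OF x y g cl[OF x a]])
 next
  fix x y g a assume x: "x \<in> base D" and y: "y \<in> idom D x" and g: "g \<in> carrier G" and a: "a \<in> carrier (obj \<Phi> y)"
  note yb = dm(2)[OF x y] and ra = ind_c[OF x y a] and gx = dm(9)[OF x g] and ca = con_c[OF dm(2)[OF x y] g a] and gy = dm(8)[OF x g y]
  show "con_map \<Phi> g x (ind_map \<Phi> x y a) = ind_map \<Phi> (act g x) (act g y) (con_map \<Phi> g y a)"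
   by (rule inj[OF gx con_c[OF x g ra] ind_c[OF gx gy ca]])
    (simp only: con_e[OF x g ra] ind_e[OF x y a] ind_e[OF gx gy ca] con_e[OF yb g a] F10[OF x y g cl[OF yb a]])
 qed
 define \<psi> where "\<psi> x = inv_into (carrier (obj \<Phi> x)) (\<phi> x)" for x
 have \<psi>: "\<psi> x b \<in> carrier (obj \<Phi> x)" "\<phi> x (\<psi> x b) = b" if "x \<in> base D" "b \<in> carrier (obj \<Psi> x)" for x b
 proof -
  have b: "b \<in> \<phi> x ` carrier (obj \<Phi> x)" using bij[OF that(1)] that(2) by (simp add: bij_betw_def)
  show "\<psi> x b \<in> carrier (obj \<Phi> x)" "\<phi> x (\<psi> x b) = b"
   unfolding \<psi>_def by (rule inv_into_into[OF b], rule f_inv_into_f[OF b])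
 qed
 have top\<Psi>: "\<And>x. x \<in> base D \<Longrightarrow> topspace (obj_top \<Psi> x) = carrier (obj \<Psi> x)" using topS by simp
 have obj_hom_hom: "f \<in> obj_hom \<Psi> x \<Psi> y \<Longrightarrow> a \<in> carrier (obj \<Psi> x) \<Longrightarrow> f a \<in> carrier (obj \<Psi> y)" for f x y a
  by (auto simp: obj_hom_def top_hom_def intro: hom_in_carrier)
 have "ric_morphism G act D \<Phi> \<Psi> \<phi>" unfolding ric_morphism_def
 proof (intro conjI ballI \<Phi> \<Psi>)
  show "\<phi> x \<in> obj_hom \<Phi> x \<Psi> x" if x: "x \<in> base D" for x
   unfolding obj_hom_def by (rule discrete_top_hom[OF hom[OF x] topD[OF x] top\<Psi>[OF x]])
 qed (rule res_e ind_e con_e; assumption)+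
 moreover have "ric_morphism G act D \<Psi> \<Phi> \<psi>" unfolding ric_morphism_def
 proof (intro conjI ballI \<Phi> \<Psi>)
  fix x assume x: "x \<in> base D"
  interpret X: comm_group "obj \<Phi> x" by (rule grp[OF x])
  have Xg: "group (obj \<Psi> x)" using F[THEN conjunct1] x by (simp add: top_ab_group_def comm_group_def)
  have "\<psi> x \<in> hom (obj \<Psi> x) (obj \<Phi> x)"
  proof (rule homI)
   fix a b assume ab: "a \<in> carrier (obj \<Psi> x)" "b \<in> carrier (obj \<Psi> x)"
   note abc = monoid.m_closed[OF group.is_monoid[OF Xg] ab] and p = \<psi>[OF x ab(1)] and q = \<psi>[OF x ab(2)]
   show "\<psi> x (a \<otimes>\<^bsub>obj \<Psi> x\<^esub> b) = \<psi> x a \<otimes>\<^bsub>obj \<Phi> x\<^esub> \<psi> x b"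
    by (rule inj[OF x \<psi>(1)[OF x abc] X.m_closed[OF p(1) q(1)]])
     (simp only: \<psi>(2)[OF x abc] hom_mult[OF hom[OF x] p(1) q(1)] p(2) q(2))
  qed (rule \<psi>(1)[OF x])
  then show "\<psi> x \<in> obj_hom \<Psi> x \<Phi> x" unfolding obj_hom_def
   by (rule discrete_top_hom[OF _ topS[OF x]]) (simp add: topD[OF x])
 next
  fix x y a assume x: "x \<in> base D" and y: "y \<in> rdom D x" and a: "a \<in> carrier (obj \<Psi> x)"
  note p = \<psi>[OF x a] and yb = dm(1)[OF x y]
  note q = \<psi>[OF yb obj_hom_hom[OF F2[OF x y] a]]
  show "\<psi> y (res_map \<Psi> y x a) = res_map \<Phi> y x (\<psi> x a)"
   by (rule inj[OF yb q(1) res_c[OF x y p(1)]]) (simp only: q(2) res_e[OF x y p(1)] p(2))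
 next
  fix x y a assume x: "x \<in> base D" and y: "y \<in> idom D x" and a: "a \<in> carrier (obj \<Psi> y)"
  note yb = dm(2)[OF x y]
  note p = \<psi>[OF yb a] and q = \<psi>[OF x obj_hom_hom[OF F3[OF x y] a]]
  show "\<psi> x (ind_map \<Psi> x y a) = ind_map \<Phi> x y (\<psi> y a)"
   by (rule inj[OF x q(1) ind_c[OF x y p(1)]]) (simp only: q(2) ind_e[OF x y p(1)] p(2))
 next
  fix x g a assume x: "x \<in> base D" and g: "g \<in> carrier G" and a: "a \<in> carrier (obj \<Psi> x)"
  note p = \<psi>[OF x a] and gx = dm(9)[OF x g]
  note q = \<psi>[OF gx obj_hom_hom[OF F4[OF x g] a]]
  show "\<psi> (act g x) (con_map \<Psi> g x a) = con_map \<Phi> g x (\<psi> x a)"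
   by (rule inj[OF gx q(1) con_c[OF x g p(1)]]) (simp only: q(2) con_e[OF x g p(1)] p(2))
 qed
 moreover have "\<psi> x (\<phi> x a) = a" if "x \<in> base D" "a \<in> carrier (obj \<Phi> x)" for x a
  by (rule inj[OF that(1) \<psi>(1)[OF that(1) cl[OF that]] that(2) \<psi>(2)[OF that(1) cl[OF that]]])
 ultimately show ?thesis unfolding ric_isomorphism_def using \<psi>(2) by blast
qed

text \<open>Joins and meets are picked by \<open>SOME\<close>, so they are identified through the
  uniqueness of least and greatest bounds. The join in the target, for subgroups the generated
  subgroup, enters only through its universal property \<open>fjoin\<close>.\<close>

lemma lattice_embedding_sets:
 fixes L :: "'p set set" and K :: "'q set set"
 defines "X \<equiv> \<lparr>carrier = L, eq = (=), le = (\<subseteq>)\<rparr>" and "Y \<equiv> \<lparr>carrier = K, eq = (=), le = (\<subseteq>)\<rparr>"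
 assumes Int: "\<And>A B. A \<in> L \<Longrightarrow> B \<in> L \<Longrightarrow> A \<inter> B \<in> L"
  and join: "\<And>A B. A \<in> L \<Longrightarrow> B \<in> L \<Longrightarrow> j A B \<in> L \<and> A \<subseteq> j A B \<and> B \<subseteq> j A B"
  and least: "\<And>A B C. A \<in> L \<Longrightarrow> B \<in> L \<Longrightarrow> C \<in> L \<Longrightarrow> A \<subseteq> C \<Longrightarrow> B \<subseteq> C \<Longrightarrow> j A B \<subseteq> C"
  and Y: "lattice Y" and f: "\<And>A. A \<in> L \<Longrightarrow> f A \<in> K"
  and order: "\<And>A B. A \<in> L \<Longrightarrow> B \<in> L \<Longrightarrow> f A \<subseteq> f B \<longleftrightarrow> A \<subseteq> B"
  and fInt: "\<And>A B. A \<in> L \<Longrightarrow> B \<in> L \<Longrightarrow> f (A \<inter> B) = f A \<inter> f B"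
  and fjoin: "\<And>A B C. A \<in> L \<Longrightarrow> B \<in> L \<Longrightarrow> C \<in> K \<Longrightarrow> f A \<subseteq> C \<Longrightarrow> f B \<subseteq> C \<Longrightarrow> f (j A B) \<subseteq> C"
 shows "lattice_embedding X Y f"
proof -
 have lub: "S = J" if "is_lub \<lparr>carrier = F, eq = (=), le = (\<subseteq>)\<rparr> S Z" "is_lub \<lparr>carrier = F, eq = (=), le = (\<subseteq>)\<rparr> J Z"
  for F :: "'z set set" and S J Z using that unfolding least_def by auto
 have glb: "S = J" if "is_glb \<lparr>carrier = F, eq = (=), le = (\<subseteq>)\<rparr> S Z" "is_glb \<lparr>carrier = F, eq = (=), le = (\<subseteq>)\<rparr> J Z"
  for F :: "'z set set" and S J Z using that unfolding greatest_def by auto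
 have jn: "A \<squnion>\<^bsub>\<lparr>carrier = F, eq = (=), le = (\<subseteq>)\<rparr>\<^esub> B = J"
  if "is_lub \<lparr>carrier = F, eq = (=), le = (\<subseteq>)\<rparr> J {A, B}" for F :: "'z set set" and A B J
  unfolding join_def sup_def by (rule some_equality[where P = "\<lambda>x. is_lub _ x _", OF that lub[OF _ that]])
 have mt: "A \<sqinter>\<^bsub>\<lparr>carrier = F, eq = (=), le = (\<subseteq>)\<rparr>\<^esub> B = J"
  if "is_glb \<lparr>carrier = F, eq = (=), le = (\<subseteq>)\<rparr> J {A, B}" for F :: "'z set set" and A B J
  unfolding meet_def inf_def by (rule some_equality[where P = "\<lambda>x. is_glb _ x _", OF that glb[OF _ that]])
 have l1: "is_lub X (j A B) {A, B}" if "A \<in> L" "B \<in> L" for A B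
  unfolding least_def Upper_def X_def using join[OF that] least[OF that] that by auto
 have g1: "is_glb X (A \<inter> B) {A, B}" if "A \<in> L" "B \<in> L" for A B
  unfolding greatest_def Lower_def X_def using Int[OF that] that by auto
 have l2: "is_lub Y (f (j A B)) {f A, f B}" if "A \<in> L" "B \<in> L" for A B
 proof -
  have "f A \<subseteq> f (j A B)" "f B \<subseteq> f (j A B)" using order that join[OF that] by auto
  then show ?thesis unfolding least_def Upper_def Y_def using f join[OF that] fjoin[OF that] that by auto
 qed
 have g2: "is_glb Y (f (A \<inter> B)) {f A, f B}" if "A \<in> L" "B \<in> L" for A B
  unfolding greatest_def Lower_def Y_def using fInt[OF that] f[OF Int[OF that]] f that by auto
 have po: "partial_order X" unfolding X_def by standard simp_all
 have "lattice X"
 proof (intro lattice.intro upper_semilattice.intro lower_semilattice.intro upper_semilattice_axioms.intro lower_semilattice_axioms.intro po)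
  show "\<exists>s. is_lub X s {x, y}" if "x \<in> carrier X" "y \<in> carrier X" for x y
   using l1[of x y] that unfolding X_def by auto
  show "\<exists>s. is_glb X s {x, y}" if "x \<in> carrier X" "y \<in> carrier X" for x y
   using g1[of x y] that unfolding X_def by auto
 qed
 moreover have "f (A \<squnion>\<^bsub>X\<^esub> B) = f A \<squnion>\<^bsub>Y\<^esub> f B" "f (A \<sqinter>\<^bsub>X\<^esub> B) = f A \<sqinter>\<^bsub>Y\<^esub> f B" if "A \<in> L" "B \<in> L" for A B
  using jn[OF l1[OF that, unfolded X_def]] jn[OF l2[OF that, unfolded Y_def]]
   mt[OF g1[OF that, unfolded X_def]] mt[OF g2[OF that, unfolded Y_def]] unfolding X_def Y_def by simp_all
 moreover have "inj_on f L"
 proof (rule inj_onI)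
  fix A B assume AB: "A \<in> L" "B \<in> L" "f A = f B"
  show "A = B" using order[OF AB(1,2)] order[OF AB(2,1)] AB(3) by simp
 qed
 ultimately show ?thesis
  unfolding lattice_embedding_def join_pres_def meet_pres_def using Y f unfolding X_def Y_def by auto
qed

lemma (in group) subgroups_lattice: "lattice \<lparr>carrier = {H. subgroup H G}, eq = (=), le = (\<subseteq>)\<rparr>" (is "lattice ?Y")
proof -
 interpret Y: complete_lattice ?Y by (rule subgroups_complete_lattice)
 show ?thesis
 proof (intro lattice.intro upper_semilattice.intro lower_semilattice.intro upper_semilattice_axioms.intro lower_semilattice_axioms.intro
   subgroups_partial_order)
  show "\<exists>s. is_lub ?Y s {x, y}" if "x \<in> carrier ?Y" "y \<in> carrier ?Y" for x y
   by (rule Y.sup_exists) (use that in simp)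
  show "\<exists>s. is_glb ?Y s {x, y}" if "x \<in> carrier ?Y" "y \<in> carrier ?Y" for x y
   by (rule Y.inf_exists) (use that in simp)
 qed
qed

context fn_datum begin

section \<open>The norm residue functor\<close>

lemma fst_base: "x \<in> base E \<Longrightarrow> fst x \<in> base M" by (rule flat_base) (simp add: flat_def)

lemma fst_rdom: "x \<in> base E \<Longrightarrow> y \<in> rdom E x \<Longrightarrow> fst y \<in> rdom M (fst x)"
 using E_rdom(2)[of "fst x" "snd x" "fst y" "snd y"] by simp

lemma fst_idom: "x \<in> base E \<Longrightarrow> y \<in> idom E x \<Longrightarrow> fst y \<in> idom M (fst x)"
 using E_idom(1)[of "fst x" "snd x" "fst y" "snd y"] by simp

lemma fst_conj: "fst (conj_pair G g x) = conj_set G g (fst x)" by (simp add: conj_pair_def)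

lemma fn_resI: "(H, U) \<in> base E \<Longrightarrow> (I, U) \<in> rdom E (H, U) \<Longrightarrow> fn_res P G T \<Omega> TO \<omega> d E M C v H U I"
 by (rule fn_res.intro[OF fn_layerI fn_res_axioms.intro])

lemma h0_elem: assumes "X \<in> carrier (obj h0 x)" obtains a where "a \<in> CC (fst x)" "X = h0c x a"
 using assms H0_carrier[of "fst x" "snd x"] by auto

lemma h0_res:
 assumes x: "x \<in> base E" and y: "y \<in> rdom E x"
 shows "a \<in> CC (fst x) \<Longrightarrow> res_map h0 y x (h0c x a) = h0c y (res (fst y) (fst x) a)"
  and "res_map h0 y x \<in> hom (obj h0 x) (obj h0 y)"
proof -
 obtain H U I V where eq: "x = (H, U)" "y = (I, V)" by (metis surj_pair)
 have V: "V = U" using E_rdom(1) x y unfolding eq by blast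
 interpret R: fn_res P G T \<Omega> TO \<omega> d E M C v H U I by (rule fn_resI) (use x y V eq in simp_all)
 show "a \<in> CC (fst x) \<Longrightarrow> res_map h0 y x (h0c x a) = h0c y (res (fst y) (fst x) a)"
  unfolding eq V fst_conv by (rule R.H0_res(1))
 show "res_map h0 y x \<in> hom (obj h0 x) (obj h0 y)" unfolding eq V by (rule R.H0_res(2))
qed

lemma h0_ind:
 assumes x: "x \<in> base E" and y: "y \<in> idom E x"
 shows "a \<in> CC (fst y) \<Longrightarrow> ind_map h0 x y (h0c y a) = h0c x (ind (fst x) (fst y) a)"
  and "ind_map h0 x y \<in> hom (obj h0 y) (obj h0 x)"
proof -
 obtain H U I V where eq: "x = (H, U)" "y = (I, V)" by (metis surj_pair)
 note i = H0_ind[OF x[unfolded eq] y[unfolded eq]]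
 show "a \<in> CC (fst y) \<Longrightarrow> ind_map h0 x y (h0c y a) = h0c x (ind (fst x) (fst y) a)"
  unfolding eq fst_conv by (rule i(1))
 show "ind_map h0 x y \<in> hom (obj h0 y) (obj h0 x)" unfolding eq by (rule i(2))
qed

lemma h0_con:
 assumes x: "x \<in> base E" and g: "g \<in> carrier G"
 shows "a \<in> CC (fst x) \<Longrightarrow> con_map h0 g x (h0c x a) = h0c (conj_pair G g x) (con g (fst x) a)"
  and "con_map h0 g x \<in> hom (obj h0 x) (obj h0 (conj_pair G g x))"
proof -
 obtain H U where eq: "x = (H, U)" by (metis surj_pair)
 have c: "conj_pair G g (H, U) = (conj_set G g H, conj_set G g U)" by (simp add: conj_pair_def)
 note i = H0_con[OF x[unfolded eq] g]
 show "a \<in> CC (fst x) \<Longrightarrow> con_map h0 g x (h0c x a) = h0c (conj_pair G g x) (con g (fst x) a)"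
  unfolding eq fst_conv c by (rule i(1))
 show "con_map h0 g x \<in> hom (obj h0 x) (obj h0 (conj_pair G g x))" unfolding eq c by (rule i(2))
qed

lemma h0_comm_group: "x \<in> base E \<Longrightarrow> comm_group (obj h0 x)"
 and h0_top: "obj_top h0 x = discrete_topology (carrier (obj h0 x))"
proof -
 show "comm_group (obj h0 x)" if "x \<in> base E"
 proof -
  interpret A: fn_layer P G T \<Omega> TO \<omega> d E M C v "fst x" "snd x" by (rule fn_layerI) (use that in simp)
  show ?thesis using A.Q_comm H0_obj(1)[of "fst x" "snd x"] by simp
 qed
 show "obj_top h0 x = discrete_topology (carrier (obj h0 x))" using H0_obj[of "fst x" "snd x"] by simp
qed

lemma h0_obj_hom: "f \<in> hom (obj h0 x) (obj h0 y) \<Longrightarrow> f \<in> obj_hom h0 x h0 y"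
 unfolding obj_hom_def by (rule discrete_top_hom[OF _ h0_top]) (simp_all add: h0_top)

lemma h0_functor: "ric_functor G (conj_pair G) E h0"
proof -
 note dm = ric_domainD[OF ric_E]
 show ?thesis unfolding ric_functor_def
 proof (intro conjI ballI)
  fix x assume x: "x \<in> base E"
  show "top_ab_group (obj h0 x) (obj_top h0 x)"
   unfolding h0_top by (rule top_ab_group_discrete[OF h0_comm_group[OF x]])
 next
  fix x a assume x: "x \<in> base E" and "a \<in> carrier (obj h0 x)"
  then obtain b where b: "b \<in> CC (fst x)" "a = h0c x b" using h0_elem by blast
  note m = fst_base[OF x]
  show "res_map h0 x x a = a" unfolding b(2) h0_res(1)[OF x dm(3)[OF x] b(1)] res_id[OF m b(1)] ..
  show "ind_map h0 x x a = a" unfolding b(2) h0_ind(1)[OF x dm(4)[OF x] b(1)] ind_id[OF m b(1)] ..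
  show "con_map h0 \<one> x a = a" unfolding b(2) h0_con(1)[OF x G.one_closed b(1)] con_one[OF m b(1)] dm(10)[OF x] ..
 next
  fix x y z a assume x: "x \<in> base E" and y: "y \<in> rdom E x" and z: "z \<in> rdom E y" and "a \<in> carrier (obj h0 x)"
  then obtain b where b: "b \<in> CC (fst x)" "a = h0c x b" using h0_elem by blast
  note m = fst_base[OF x] and yb = dm(1)[OF x y] and zx = dm(5)[OF x y z]
  note ry = fst_rdom[OF x y] and rz = fst_rdom[OF yb z]
  show "res_map h0 z y (res_map h0 y x a) = res_map h0 z x a"
   unfolding b(2) h0_res(1)[OF x y b(1)] h0_res(1)[OF yb z res_closed[OF m ry b(1)]] h0_res(1)[OF x zx b(1)]
    res_res[OF m ry rz b(1)] ..
 next
  fix x y z a assume x: "x \<in> base E" and y: "y \<in> idom E x" and z: "z \<in> idom E y" and "a \<in> carrier (obj h0 z)"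
  then obtain b where b: "b \<in> CC (fst z)" "a = h0c z b" using h0_elem by blast
  note m = fst_base[OF x] and yb = dm(2)[OF x y] and zx = dm(6)[OF x y z]
  note iy = fst_idom[OF x y] and iz = fst_idom[OF yb z]
  show "ind_map h0 x y (ind_map h0 y z a) = ind_map h0 x z a"
   unfolding b(2) h0_ind(1)[OF yb z b(1)] h0_ind(1)[OF x y ind_closed[OF fst_base[OF yb] iz b(1)]]
    h0_ind(1)[OF x zx b(1)] ind_ind[OF m iy iz b(1)] ..
 next
  fix x g g' a assume x: "x \<in> base E" and g: "g \<in> carrier G" "g' \<in> carrier G" and "a \<in> carrier (obj h0 x)"
  then obtain b where b: "b \<in> CC (fst x)" "a = h0c x b" using h0_elem by blast
  note m = fst_base[OF x] and gx = dm(9)[OF x g(1)]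
  have cb: "con g (fst x) b \<in> CC (fst (conj_pair G g x))" unfolding fst_conj by (rule con_closed[OF m g(1) b(1)])
  show "con_map h0 g' (conj_pair G g x) (con_map h0 g x a) = con_map h0 (g' \<otimes> g) x a"
   unfolding b(2) h0_con(1)[OF x g(1) b(1)] h0_con(1)[OF gx g(2) cb] h0_con(1)[OF x G.m_closed[OF g(2,1)] b(1)]
    fst_conj con_con[OF m g b(1)] dm(11)[OF x g] ..
 next
  fix x y g a assume x: "x \<in> base E" and y: "y \<in> rdom E x" and g: "g \<in> carrier G" and "a \<in> carrier (obj h0 x)"
  then obtain b where b: "b \<in> CC (fst x)" "a = h0c x b" using h0_elem by blast
  note m = fst_base[OF x] and yb = dm(1)[OF x y] and gx = dm(9)[OF x g] and gy = dm(7)[OF x g y] and ry = fst_rdom[OF x y]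
  have cb: "con g (fst x) b \<in> CC (fst (conj_pair G g x))" unfolding fst_conj by (rule con_closed[OF m g b(1)])
  show "con_map h0 g y (res_map h0 y x a) = res_map h0 (conj_pair G g y) (conj_pair G g x) (con_map h0 g x a)"
   unfolding b(2) h0_res(1)[OF x y b(1)] h0_con(1)[OF yb g res_closed[OF m ry b(1)]] h0_con(1)[OF x g b(1)]
    h0_res(1)[OF gx gy cb] fst_conj con_res[OF m ry g b(1)] ..
 next
  fix x y g a assume x: "x \<in> base E" and y: "y \<in> idom E x" and g: "g \<in> carrier G" and "a \<in> carrier (obj h0 y)"
  then obtain b where b: "b \<in> CC (fst y)" "a = h0c y b" using h0_elem by blast
  note m = fst_base[OF x] and yb = dm(2)[OF x y] and gx = dm(9)[OF x g] and gy = dm(8)[OF x g y] and iy = fst_idom[OF x y]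
  have cb: "con g (fst y) b \<in> CC (fst (conj_pair G g y))" unfolding fst_conj by (rule con_closed[OF fst_base[OF yb] g b(1)])
  show "con_map h0 g x (ind_map h0 x y a) = ind_map h0 (conj_pair G g x) (conj_pair G g y) (con_map h0 g y a)"
   unfolding b(2) h0_ind(1)[OF x y b(1)] h0_con(1)[OF x g ind_closed[OF m iy b(1)]] h0_con(1)[OF yb g b(1)]
    h0_ind(1)[OF gx gy cb] fst_conj con_ind[OF m iy g b(1)] ..
 qed (rule h0_obj_hom, rule h0_res(2) h0_ind(2) h0_con(2); assumption)+
qed

end

context cft_datum begin

section \<open>\<open>Upsilon\<close> as an isomorphism of functors\<close>

lemma recX_eq_iff_pi_class:
 assumes HU: "(H, U) \<in> base E" and hk: "h \<in> H" "k \<in> H"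
 shows "UP (H, U) (pc (H, U) h) = UP (H, U) (pc (H, U) k) \<longleftrightarrow> pc (H, U) h = pc (H, U) k"
proof -
 interpret A: fn_layer P G T \<Omega> TO \<omega> d E M C v H U by (rule fn_layerI[OF HU])
 show ?thesis unfolding A.Upsilon_pi_class[OF hk(1)] A.Upsilon_pi_class[OF hk(2)] A.pi_class_eq_iff[OF hk]
  by (rule A.recX_eq_iff[OF bijective(2)[OF HU, unfolded A.inj_at_iff] hk])
qed

lemma Upsilon_bij:
 assumes x: "x \<in> base E"
 shows "bij_betw (UP x) (carrier (obj (pi_fun G T) x)) (carrier (obj h0 x))" (is ?bij)
  and "UP x \<in> hom (obj (pi_fun G T) x) (obj h0 x)" (is ?hom)
  and "comm_group (obj (pi_fun G T) x)" (is ?comm)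
  and "obj_top (pi_fun G T) x = discrete_topology (carrier (obj (pi_fun G T) x))" (is ?top)
proof -
 obtain H U where eq: "x = (H, U)" by (metis surj_pair)
 have HU: "(H, U) \<in> base E" using x eq by simp
 interpret A: fn_layer P G T \<Omega> TO \<omega> d E M C v H U by (rule fn_layerI[OF HU])
 show ?hom unfolding eq H0_obj by (rule A.Upsilon_hom)
 show ?comm unfolding eq by (rule A.PI_comm)
 show ?top unfolding eq by (rule A.PI_top)
 have "inj_on A.Ups (carrier A.PI)" unfolding A.PI_carrier inj_on_def using recX_eq_iff_pi_class[OF HU] by blast
 moreover have "A.Ups ` carrier A.PI = carrier (obj h0 (H, U))"
  using bijective(1)[OF HU] unfolding surj_at_def A.PI_carrier image_image fst_conv .
 ultimately show ?bij unfolding eq bij_betw_def by simp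
qed

lemma pi_elem: assumes "x \<in> base E" "a \<in> carrier (obj (pi_fun G T) x)"
 obtains h where "h \<in> fst x" "a = pc x h"
proof -
 interpret A: fn_layer P G T \<Omega> TO \<omega> d E M C v "fst x" "snd x" by (rule fn_layerI) (use assms in simp)
 show thesis using assms(2) A.PI_carrier that by auto
qed

lemma pi_closed: assumes "x \<in> base E" "h \<in> fst x" shows "pc x h \<in> carrier (obj (pi_fun G T) x)"
proof -
 interpret A: fn_layer P G T \<Omega> TO \<omega> d E M C v "fst x" "snd x" by (rule fn_layerI) (use assms in simp)
 show ?thesis using assms(2) A.PI_carrier by auto
qed

lemma UP_eqD:
 assumes "x \<in> base E" "h \<in> fst x" "k \<in> fst x" "UP x (pc x h) = UP x (pc x k)" shows "pc x h = pc x k"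
proof -
 obtain H U where eq: "x = (H, U)" by (metis surj_pair)
 show ?thesis unfolding eq
  by (rule recX_eq_iff_pi_class[THEN iffD1, OF assms(1-3)[unfolded eq fst_conv] assms(4)[unfolded eq]])
qed

lemma pi_ind:
 assumes x: "x \<in> base E" and y: "y \<in> idom E x" and a: "a \<in> carrier (obj (pi_fun G T) y)"
 shows "ind_map (pi_fun G T) x y a \<in> carrier (obj (pi_fun G T) x) \<and>
  UP x (ind_map (pi_fun G T) x y a) = ind_map h0 x y (UP y a)"
proof -
 note yb = ric_domainD(2)[OF ric_E x y]
 obtain h where h: "h \<in> fst y" "a = pc y h" by (rule pi_elem[OF yb a])
 have sub: "k \<in> fst x" if "k \<in> fst y" for k
  using E_idom(3)[of "fst x" "snd x" "fst y" "snd y"] x y that by auto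
 have U: "UP x (pc x k) = ind_map h0 x y (UP y (pc y k))" if "k \<in> fst y" for k
 proof -
  obtain H U I V where eq: "x = (H, U)" "y = (I, V)" by (metis surj_pair)
  show ?thesis unfolding eq by (rule Upsilon_ind[OF x[unfolded eq] y[unfolded eq] that[unfolded eq fst_conv]])
 qed
 have "ind_map (pi_fun G T) x y (pc y h) = induced_map (fst y) (pc y) (pc x) (pc y h)" by (simp add: pi_fun_def)
 also have "\<dots> = pc x h"
 proof (rule induced_map_eq[OF h(1)])
  fix k assume k: "k \<in> fst y" "pc y k = pc y h"
  show "pc x k = pc x h" by (rule UP_eqD[OF x sub[OF k(1)] sub[OF h(1)]]) (simp only: U k h(1))
 qed
 finally have "ind_map (pi_fun G T) x y a = pc x h" unfolding h(2) .
 then show ?thesis using pi_closed[OF x sub[OF h(1)]] U[OF h(1)] h(2) by simp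
qed

lemma pi_con:
 assumes x: "x \<in> base E" and g: "g \<in> carrier G" and a: "a \<in> carrier (obj (pi_fun G T) x)"
 shows "con_map (pi_fun G T) g x a \<in> carrier (obj (pi_fun G T) (conj_pair G g x)) \<and>
  UP (conj_pair G g x) (con_map (pi_fun G T) g x a) = con_map h0 g x (UP x a)"
proof -
 note yb = ric_domainD(9)[OF ric_E x g]
 obtain h where h: "h \<in> fst x" "a = pc x h" by (rule pi_elem[OF x a])
 have sub: "g \<otimes> k \<div> g \<in> fst (conj_pair G g x)" if "k \<in> fst x" for k
  unfolding fst_conj G.conj_set_eq by (rule imageI[OF that])
 have U: "UP (conj_pair G g x) (pc (conj_pair G g x) (g \<otimes> k \<div> g)) = con_map h0 g x (UP x (pc x k))" if "k \<in> fst x" for k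
 proof -
  obtain H U where eq: "x = (H, U)" by (metis surj_pair)
  have c: "conj_pair G g (H, U) = (conj_set G g H, conj_set G g U)" by (simp add: conj_pair_def)
  show ?thesis unfolding eq c by (rule Upsilon_con[OF x[unfolded eq] g that[unfolded eq fst_conv]])
 qed
 have "con_map (pi_fun G T) g x (pc x h) =
   induced_map (fst x) (pc x) (\<lambda>h. pc (conj_pair G g x) (g \<otimes> h \<div> g)) (pc x h)" by (simp add: pi_fun_def)
 also have "\<dots> = pc (conj_pair G g x) (g \<otimes> h \<div> g)"
 proof (rule induced_map_eq[OF h(1)])
  fix k assume k: "k \<in> fst x" "pc x k = pc x h"
  show "pc (conj_pair G g x) (g \<otimes> k \<div> g) = pc (conj_pair G g x) (g \<otimes> h \<div> g)"
   by (rule UP_eqD[OF yb sub[OF k(1)] sub[OF h(1)]]) (simp only: U k h(1))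
 qed
 finally have "con_map (pi_fun G T) g x a = pc (conj_pair G g x) (g \<otimes> h \<div> g)" unfolding h(2) .
 then show ?thesis using pi_closed[OF yb sub[OF h(1)]] U[OF h(1)] h(2) by simp
qed

lemma pi_res:
 assumes x: "x \<in> base E" and y: "y \<in> rdom E x" and a: "a \<in> carrier (obj (pi_fun G T) x)"
 shows "res_map (pi_fun G T) y x a \<in> carrier (obj (pi_fun G T) y) \<and>
  UP y (res_map (pi_fun G T) y x a) = res_map h0 y x (UP x a)"
proof -
 obtain H U I V where eq: "x = (H, U)" "y = (I, V)" by (metis surj_pair)
 have V: "V = U" using E_rdom(1) x y unfolding eq by blast
 interpret R: fn_res P G T \<Omega> TO \<omega> d E M C v H U I by (rule fn_resI) (use x y V eq in simp_all)
 have inj: "inj_on (UP (I, U)) (carrier (obj (pi_fun G T) (I, U)))"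
  using Upsilon_bij(1)[OF R.IU_base] by (simp add: bij_betw_def)
 show ?thesis unfolding eq V using R.Upsilon_res[OF inj a[unfolded eq(1)]] by simp
qed

theorem Upsilon_isomorphism: "ric_isomorphism G (conj_pair G) E (pi_fun G T) h0 UP"
 by (rule ric_isomorphism_transport[OF ric_E h0_functor])
  (simp_all only: Upsilon_bij h0_top pi_res pi_ind pi_con G.is_group)

subsection \<open>The lattice of norm groups\<close>

text \<open>By compatibility with induction and surjectivity at (V, W), the norm group of V is the
  preimage in C(H) of the reciprocity image of V/W. Thus norm groups of groups over W can be
  compared through subgroups of H.\<close>

lemma norm_mem_iff:
 assumes HW: "(H, W) \<in> base E" and V: "subgroup V G" "W \<subseteq> V" "V \<subseteq> H" and a: "a \<in> CC H"
 shows "a \<in> norm_group C H V \<longleftrightarrow> (\<exists>k\<in>V. UP (H, W) (pc (H, W) k) = h0c (H, W) a)"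
proof -
 interpret A: fn_layer P G T \<Omega> TO \<omega> d E M C v H W by (rule fn_layerI[OF HW])
 note i = A.intermediate_idom[OF V]
 interpret B: fn_layer P G T \<Omega> TO \<omega> d E M C v V W by (rule fn_layerI[OF i(2)])
 have Vi: "V \<in> idom M H" by (rule open_idom[OF A.H_base A.intermediate_open[OF V]])
 show ?thesis
 proof
  assume "a \<in> norm_group C H V"
  then obtain c where c: "c \<in> CC V" "a = ind H V c" by (auto simp: norm_group_def)
  obtain k where k: "k \<in> V" "B.recX k = B.cls c" by (rule B.surj_obtain[OF bijective(1)[OF i(2)] c(1)])
  have "UP (H, W) (pc (H, W) k) = h0c (H, W) (ind H V c)"
   by (rule rec_ind[OF HW i(1) k(1) c(1)]) (rule B.recX_Upsilon_D[OF k(1) c(1) k(2)])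
  then show "\<exists>k\<in>V. UP (H, W) (pc (H, W) k) = h0c (H, W) a" using k(1) c(2) by blast
 next
  assume "\<exists>k\<in>V. UP (H, W) (pc (H, W) k) = h0c (H, W) a"
  then obtain k where k: "k \<in> V" "UP (H, W) (pc (H, W) k) = h0c (H, W) a" by blast
  obtain c where c: "c \<in> CC V" "B.recX k = B.cls c" by (rule B.recX_obtain[OF k(1)])
  have ic: "ind H V c \<in> CC H" by (rule ind_closed[OF A.H_base Vi c(1)])
  have "UP (H, W) (pc (H, W) k) = h0c (H, W) (ind H V c)"
   by (rule rec_ind[OF HW i(1) k(1) c(1)]) (rule B.recX_Upsilon_D[OF k(1) c])
  then have "A.cls a = A.cls (ind H V c)" using k(2) by (simp add: A.cls_H0)
  then have "a \<div>\<^bsub>obj C H\<^esub> ind H V c \<in> norm_group C H W" using A.cls_eq_iff[OF a ic] by simp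
  then obtain e where e: "e \<in> CC W" "a \<div>\<^bsub>obj C H\<^esub> ind H V c = ind H W e" by (auto simp: norm_group_def)
  have "ind H W e = ind H V (ind V W e)" by (rule ind_ind[symmetric, OF A.H_base Vi B.U_idom e(1)])
  then have m: "ind H W e \<in> norm_group C H V"
   using ind_closed[OF B.H_base B.U_idom e(1)] by (simp add: norm_group_def)
  have "ind H V c \<in> norm_group C H V" using c(1) by (simp add: norm_group_def)
  then have "a \<div>\<^bsub>obj C H\<^esub> ind H V c \<otimes>\<^bsub>obj C H\<^esub> ind H V c \<in> norm_group C H V"
   unfolding e(2) by (rule subgroup.m_closed[OF norm_subgroup[OF A.H_base Vi] m])
  moreover have "a \<div>\<^bsub>obj C H\<^esub> ind H V c \<otimes>\<^bsub>obj C H\<^esub> ind H V c = a"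
  proof -
   interpret Cg: group "obj C H" by (rule C_group[OF A.H_base])
   show ?thesis using a ic by (simp add: Cg.m_assoc)
  qed
  ultimately show "a \<in> norm_group C H V" by simp
 qed
qed

text \<open>Two members A and B of L are compared over W = A \<inter> B, which is again in L and,
  containing the commutators of H, gives an abelian layer. There \<open>norm_mem_iff\<close>
  translates inclusions and intersections of norm groups into those of subgroups of H/W.\<close>

lemma norm_lattice:
 assumes H: "H \<in> base (flat E)"
  and L: "L \<subseteq> {U \<in> Ext E H. Com_t (G\<lparr>carrier := H\<rparr>) (subtopology T H) \<subseteq> U}"
  and cl: "\<forall>U1\<in>L. \<forall>U2\<in>L. U1 <#> U2 \<in> L \<and> U1 \<inter> U2 \<in> L"
 shows "lattice_embedding \<lparr>carrier = L, eq = (=), le = (\<subseteq>)\<rparr>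
   \<lparr>carrier = {A. subgroup A (obj C H)}, eq = (=), le = (\<subseteq>)\<rparr> (norm_group C H)"
proof (rule lattice_embedding_sets[where j = "\<lambda>A B. A <#> B"])
 have HM: "H \<in> base M" by (rule flat_base[OF H])
 interpret Cg: comm_group "obj C H" by (rule C_comm_group[OF HM])
 interpret Hs: subgroup H G by (rule base_subgroup[OF HM])
 have base: "(H, V) \<in> base E" if "V \<in> L" for V using L that by (auto simp: Ext_def)
 have sub: "subgroup V G" "V \<subseteq> H" if "V \<in> L" for V
 proof -
  interpret A: fn_layer P G T \<Omega> TO \<omega> d E M C v H V by (rule fn_layerI[OF base[OF that]])
  show "subgroup V G" "V \<subseteq> H" using A.U.subgroup_axioms A.UH by auto
 qed
 have com: "h \<otimes> k \<div> h \<div> k \<in> V" if V: "V \<in> L" and hk: "h \<in> H" "k \<in> H" for V h k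
 proof -
  let ?K = "G\<lparr>carrier := H\<rparr>"
  have "h \<otimes>\<^bsub>?K\<^esub> k \<div>\<^bsub>?K\<^esub> h \<div>\<^bsub>?K\<^esub> k \<in> derived ?K (carrier ?K)"
   unfolding derived_def by (rule generate.incl) (use hk in auto)
  then have c: "h \<otimes> k \<div> h \<div> k \<in> derived ?K (carrier ?K)"
   using G.inv_restrict[OF Hs.subgroup_axioms] hk by simp
  have Kg: "group ?K" by (rule G.subgroup_imp_group[OF Hs.subgroup_axioms])
  have "derived ?K (carrier ?K) \<subseteq> H"
   using subgroup.subset[OF group.derived_is_subgroup[OF Kg order_refl]] by simp
  then have "derived ?K (carrier ?K) \<subseteq> subtopology T H closure_of derived ?K (carrier ?K)"
   by (intro closure_of_subset) (use Hs.subset in auto)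
  then show ?thesis using c L V unfolding Com_t_def by blast
 qed
 have Int: "A \<inter> B \<in> L" and prod: "A <#> B \<in> L" if "A \<in> L" "B \<in> L" for A B using cl that by auto
 \<comment> \<open>For an abelian layer \<open>DH\<close> is W itself, so elements with equal
   reciprocity values differ by an element of W.\<close>
 have inW: "h \<div> k \<in> W"
  if W: "W \<in> L" and hk: "h \<in> H" "k \<in> H" "UP (H, W) (pc (H, W) h) = UP (H, W) (pc (H, W) k)" for W h k
 proof -
  interpret A: fn_layer P G T \<Omega> TO \<omega> d E M C v H W by (rule fn_layerI[OF base[OF W]])
  have "A.abelian_layer" unfolding A.abelian_layer_def using com[OF W] by blast
  then have "A.DH = W" by (rule A.abelian_DH)
  then show ?thesis using recX_eq_iff_pi_class[OF base[OF W] hk(1,2)] hk(3) A.pi_class_eq_iff[OF hk(1,2)] by simp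
 qed
 have carr: "norm_group C H V \<subseteq> CC H" if V: "V \<in> L" for V
 proof -
  interpret A: fn_layer P G T \<Omega> TO \<omega> d E M C v H V by (rule fn_layerI[OF base[OF V]])
  show ?thesis by (rule subgroup.subset[OF A.Nm_sub])
 qed
 have mem: "a \<in> norm_group C H V \<longleftrightarrow> a \<in> CC H \<and> (\<exists>k\<in>V. UP (H, W) (pc (H, W) k) = h0c (H, W) a)"
  if "V \<in> L" "W \<in> L" "W \<subseteq> V" for V W a
  using norm_mem_iff[OF base[OF that(2)] sub(1)[OF that(1)] that(3) sub(2)[OF that(1)], of a] carr[OF that(1)] by blast
 show "A \<inter> B \<in> L" if "A \<in> L" "B \<in> L" for A B by (rule Int[OF that])
 show "A <#> B \<in> L \<and> A \<subseteq> A <#> B \<and> B \<subseteq> A <#> B" if AB: "A \<in> L" "B \<in> L" for A B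
 proof (intro conjI prod AB subsetI)
  show "x \<in> A <#> B" if x: "x \<in> A" for x
  proof -
   have "x = x \<otimes> \<one>" using subgroup.mem_carrier[OF sub(1)[OF AB(1)] x] by simp
   then show ?thesis unfolding set_mult_def using x subgroup.one_closed[OF sub(1)[OF AB(2)]] by blast
  qed
  show "x \<in> A <#> B" if x: "x \<in> B" for x
  proof -
   have "x = \<one> \<otimes> x" using subgroup.mem_carrier[OF sub(1)[OF AB(2)] x] by simp
   then show ?thesis unfolding set_mult_def using x subgroup.one_closed[OF sub(1)[OF AB(1)]] by blast
  qed
 qed
 show "A <#> B \<subseteq> D" if D: "A \<in> L" "B \<in> L" "D \<in> L" "A \<subseteq> D" "B \<subseteq> D" for A B D
 proof
  fix x assume "x \<in> A <#> B"
  then obtain p q where pq: "p \<in> A" "q \<in> B" "x = p \<otimes> q" unfolding set_mult_def by blast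
  show "x \<in> D" unfolding pq(3)
   by (rule subgroup.m_closed[OF sub(1)[OF D(3)] subsetD[OF D(4) pq(1)] subsetD[OF D(5) pq(2)]])
 qed
 show "lattice \<lparr>carrier = {A. subgroup A (obj C H)}, eq = (=), le = (\<subseteq>)\<rparr>" by (rule Cg.subgroups_lattice)
 show "norm_group C H A \<in> {A. subgroup A (obj C H)}" if A: "A \<in> L" for A
 proof -
  interpret A: fn_layer P G T \<Omega> TO \<omega> d E M C v H A by (rule fn_layerI[OF base[OF A]])
  show ?thesis using A.Nm_sub by simp
 qed
 have mono: "norm_group C H A \<subseteq> norm_group C H B" if "A \<in> L" "B \<in> L" "A \<subseteq> B" for A B
  using mem[OF that(1) that(1) order_refl] mem[OF that(2) that(1) that(3)] that(3) by blast
 show "norm_group C H A \<subseteq> norm_group C H B \<longleftrightarrow> A \<subseteq> B" if AB: "A \<in> L" "B \<in> L" for A B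
 proof
  let ?W = "A \<inter> B"
  assume le: "norm_group C H A \<subseteq> norm_group C H B"
  interpret W: fn_layer P G T \<Omega> TO \<omega> d E M C v H ?W by (rule fn_layerI[OF base[OF Int[OF AB]]])
  show "A \<subseteq> B"
  proof
   fix k assume k: "k \<in> A"
   have kH: "k \<in> H" using k sub(2)[OF AB(1)] by blast
   obtain a where a: "a \<in> CC H" "W.recX k = W.cls a" by (rule W.recX_obtain[OF kH])
   note u = W.recX_Upsilon_D[OF kH a]
   have "a \<in> norm_group C H A" using mem[OF AB(1) Int[OF AB], of a] a(1) u k by blast
   then have "a \<in> norm_group C H B" using le by blast
   then obtain l where l: "l \<in> B" "UP (H, ?W) (pc (H, ?W) l) = h0c (H, ?W) a"
    using mem[OF AB(2) Int[OF AB], of a] by blast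
   have lH: "l \<in> H" using l(1) sub(2)[OF AB(2)] by blast
   have "k \<div> l \<in> B" using inW[OF Int[OF AB] kH lH] u l(2) by simp
   then have "k \<div> l \<otimes> l \<in> B" by (rule subgroup.m_closed[OF sub(1)[OF AB(2)] _ l(1)])
   then show "k \<in> B" using kH lH by (simp add: G.m_assoc)
  qed
 qed (rule mono[OF AB])
 show "norm_group C H (A \<inter> B) = norm_group C H A \<inter> norm_group C H B" if AB: "A \<in> L" "B \<in> L" for A B
 proof
  show "norm_group C H (A \<inter> B) \<subseteq> norm_group C H A \<inter> norm_group C H B"
   using mono[OF Int[OF AB] AB(1)] mono[OF Int[OF AB] AB(2)] by blast
  show "norm_group C H A \<inter> norm_group C H B \<subseteq> norm_group C H (A \<inter> B)"
  proof
   let ?W = "A \<inter> B"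
   fix a assume a: "a \<in> norm_group C H A \<inter> norm_group C H B"
   then have aC: "a \<in> CC H" using carr[OF AB(1)] by blast
   obtain k l where k: "k \<in> A" "UP (H, ?W) (pc (H, ?W) k) = h0c (H, ?W) a"
    and l: "l \<in> B" "UP (H, ?W) (pc (H, ?W) l) = h0c (H, ?W) a"
    using a mem[OF AB(1) Int[OF AB], of a] mem[OF AB(2) Int[OF AB], of a] by blast
   have kH: "k \<in> H" and lH: "l \<in> H" using k(1) l(1) sub(2)[OF AB(1)] sub(2)[OF AB(2)] by auto
   have "k \<div> l \<in> B" using inW[OF Int[OF AB] kH lH] k(2) l(2) by simp
   then have "k \<div> l \<otimes> l \<in> B" by (rule subgroup.m_closed[OF sub(1)[OF AB(2)] _ l(1)])
   then have "k \<in> ?W" using kH lH k(1) by (simp add: G.m_assoc)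
   then show "a \<in> norm_group C H ?W" using mem[OF Int[OF AB] Int[OF AB] order_refl, of a] aC k(2) by blast
  qed
 qed
 show "norm_group C H (A <#> B) \<subseteq> D"
  if AB: "A \<in> L" "B \<in> L" and D: "D \<in> {A. subgroup A (obj C H)}" "norm_group C H A \<subseteq> D" "norm_group C H B \<subseteq> D" for A B D
 proof
  let ?W = "A \<inter> B"
  interpret W: fn_layer P G T \<Omega> TO \<omega> d E M C v H ?W by (rule fn_layerI[OF base[OF Int[OF AB]]])
  interpret D: subgroup D "obj C H" using D(1) by simp
  fix a assume a: "a \<in> norm_group C H (A <#> B)"
  have aC: "a \<in> CC H" using carr[OF prod[OF AB]] a by blast
  have "?W \<subseteq> A <#> B"
  proof
   fix x assume x: "x \<in> ?W"
   have xc: "x \<in> carrier G" using x sub(2)[OF AB(1)] Hs.subset by blast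
   have "x = x \<otimes> \<one>" using xc by simp
   then show "x \<in> A <#> B" unfolding set_mult_def using x subgroup.one_closed[OF sub(1)[OF AB(2)]] by blast
  qed
  then obtain k where k: "k \<in> A <#> B" "UP (H, ?W) (pc (H, ?W) k) = h0c (H, ?W) a"
   using a mem[OF prod[OF AB] Int[OF AB], of a] by blast
  \<comment> \<open>The class of a is the reciprocity value of p q with p in A and q in B; so modulo
    norms from W it is the product of a norm from A and a norm from B, all of which lie in
    D.\<close>
  obtain p q where pq: "p \<in> A" "q \<in> B" "k = p \<otimes> q" using k(1) unfolding set_mult_def by blast
  have pH: "p \<in> H" and qH: "q \<in> H" using pq sub(2)[OF AB(1)] sub(2)[OF AB(2)] by auto
  have kH: "k \<in> H" using pH qH pq(3) by simp
  obtain b where b: "b \<in> CC H" "W.recX p = W.cls b" by (rule W.recX_obtain[OF pH])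
  obtain c where c: "c \<in> CC H" "W.recX q = W.cls c" by (rule W.recX_obtain[OF qH])
  have bD: "b \<in> D" using mem[OF AB(1) Int[OF AB], of b] b(1) W.recX_Upsilon_D[OF pH b] pq(1) D(2) by blast
  have cD: "c \<in> D" using mem[OF AB(2) Int[OF AB], of c] c(1) W.recX_Upsilon_D[OF qH c] pq(2) D(3) by blast
  have bc: "b \<otimes>\<^bsub>obj C H\<^esub> c \<in> CC H" using b(1) c(1) by simp
  have "W.cls a = W.recX k" using W.recX_Upsilon_I[OF kH aC k(2)] by simp
  also have "\<dots> = W.cls (b \<otimes>\<^bsub>obj C H\<^esub> c)"
   unfolding pq(3) W.recX_mult[OF pH qH] b(2) c(2) by (rule W.cls_mult[OF b(1) c(1), symmetric])
  finally have "a \<div>\<^bsub>obj C H\<^esub> (b \<otimes>\<^bsub>obj C H\<^esub> c) \<in> norm_group C H ?W"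
   using W.cls_eq_iff[OF aC bc] by simp
  then have "a \<div>\<^bsub>obj C H\<^esub> (b \<otimes>\<^bsub>obj C H\<^esub> c) \<in> D"
   using mono[OF Int[OF AB] AB(1)] D(2) by blast
  then have "a \<div>\<^bsub>obj C H\<^esub> (b \<otimes>\<^bsub>obj C H\<^esub> c) \<otimes>\<^bsub>obj C H\<^esub> (b \<otimes>\<^bsub>obj C H\<^esub> c) \<in> D"
   by (rule D.m_closed[OF _ D.m_closed[OF bD cD]])
  then show "a \<in> D" using aC bc by (simp add: Cg.m_assoc)
 qed
qed

end

theorem proposition4p4p19:
  fixes P :: "nat set"
    and G :: "'g monoid" and T :: "'g topology"
    and \<Omega> :: "'w monoid" and T\<^sub>\<Omega> :: "'w topology" and \<omega> :: 'w
    and d :: "'g \<Rightarrow> 'w"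
    and E :: "('g set \<times> 'g set) ric_dom" and M :: "'g set ric_dom"
    and C :: "('g set, 'g, 'a) ric_fun" and v :: "'g set \<Rightarrow> 'a \<Rightarrow> 'w"
  assumes "P \<noteq> {}" and "\<forall>p\<in>P. prime p"
    and "pro_P_group P G T"
    and "top_group \<Omega> T\<^sub>\<Omega>"
    and "\<exists>\<iota>. \<iota> \<in> iso \<Omega> (ZP_group P) \<and> homeomorphic_map T\<^sub>\<Omega> (ZP_topology P) \<iota>"
    and "top_generator \<Omega> T\<^sub>\<Omega> \<omega>"
    and "d \<in> top_hom G T \<Omega> T\<^sub>\<Omega>" and "d ` carrier G = carrier \<Omega>"
    and "spectrum G T E"
    and "FN_datum G T \<Omega> \<omega> d E M C v"
    and "coherent G T E"
    and "\<And>l H U. prime (l::nat) \<Longrightarrow> (H, U) \<in> base E \<Longrightarrow>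
           cyclic_group (quot_group G (H, U)) \<Longrightarrow> order (quot_group G (H, U)) = l \<Longrightarrow>
           class_field_axiom G C H U"
    and "\<And>H U. (H, U) \<in> base E \<Longrightarrow>
           cyclic_group (quot_group G (H, U)) \<Longrightarrow> prime (order (quot_group G (H, U))) \<Longrightarrow>
           f_rel \<Omega> d H U = 1 \<Longrightarrow>
           inj_on (Upsilon P G T \<Omega> \<omega> d C v (H, U)) (carrier (obj (pi_fun G T) (H, U)))"
  shows "class_field_theory G T E C (Upsilon P G T \<Omega> \<omega> d C v)"
proof -
  interpret cft_datum P G T \<Omega> T\<^sub>\<Omega> \<omega> d E M C v
    by (intro cft_datum.intro fn_datum.intro pro_P_degree.intro fn_datum_axioms.intro cft_datum_axioms.intro)
      (fact assms)+
  show ?thesis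
    unfolding class_field_theory_def
  proof (intro conjI ballI allI impI)
    show "ric_isomorphism G (conj_pair G) E (pi_fun G T) (H0_fun G C) (Upsilon P G T \<Omega> \<omega> d C v)"
      by (rule Upsilon_isomorphism)
  qed (rule norm_lattice)
qed

end
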